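(* Let $\mathcal{O}=\mathbb{F}_q[[\pi]]$, let $r=2l$ be an even positive integer, and let $\omega\in M_n(\mathbb{F}_q)$ have additive Jordan decomposition $\omega=s+N$ with $s$ the semisimple part and $N$ the nilpotent part. Let $N_i\in M_{n_i}(\mathbb{F}_{q^{\lambda_i}})$ ($i=1,\dots,d$) be the nilpotent matrices attached to $N$, and $\nu_{N_i}$ the associated irreducible representations of $\mathrm{GL}_{n_i}(\mathcal{O}^{(\lambda_i)}/\pi^r)$, as defined in the context. Then $$\mathcal{J}_r(\omega):=J_r(s,\boxtimes_{i}\nu_{N_i})$$ is an irreducible representation of $\mathrm{GL}_n(\mathcal{O}_r)$ with $\omega\in\Omega(\mathcal{J}_r(\omega))$.
   Context: Notation. $\mathcal{O}=\mathbb{F}_q[[\pi]]$, $K=\mathbb{F}_q((\pi))$, $\mathcal{O}_m:=\mathcal{O}/\pi^m$, $p=\mathrm{char}(\mathbb{F}_q)$. $K^{\mathrm{ur}}$ is a maximal unramified extension of $K$, $\mathcal{O}^{\mathrm{ur}}$ its ring of integers, $\mathcal{O}^{\mathrm{ur}}_m:=\mathcal{O}^{\mathrm{ur}}/\pi^m$, and $F$ is the Frobenius automorphism. For $\lambda\ge1$, $K^{(\lambda)}\subset K^{\mathrm{ur}}$ is the unramified extension of degree $\lambda$, and $\mathcal{O}^{(\lambda)}=\mathbb{F}_{q^\lambda}[[\pi]]$ its ring of integers. $\rho_m$ is reduction modulo $\pi^m$. Representations are over $\overline{\mathbb{Q}}_\ell$, $\ell\ne p$ prime. Fix a group morphism $\psi:\mathcal{O}_l\to\overline{\mathbb{Q}}_\ell^\times$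 non-trivial on $\pi^{l-1}\mathcal{O}_l$. $G_r:=\mathrm{GL}_n(\mathcal{O}^{\mathrm{ur}}_r)$, $G_r^F=\mathrm{GL}_n(\mathcal{O}_r)$; for a subgroup $H\subseteq G_r$, $H^i$ is the subgroup of elements congruent to $I_n$ modulo $\pi^i$. Data attached to $s$. For every monic irreducible $f\in\mathbb{F}_q[x]$ of degree $\lambda$ fix: a root $s_f\in\mathbb{F}_{q^\lambda}$; a lift $\hat s_f\in\mathcal{O}^{(\lambda)}$; a matrix $A_f\in M_\lambda(\mathcal{O})$ conjugate under $\mathrm{GL}_\lambda(\mathcal{O}^{\mathrm{ur}})$ to $\mathrm{diag}(\hat s_f,F(\hat s_f),\dots,F^{\lambda-1}(\hat s_f))$; and a character $\phi''_f$ of $(\mathcal{O}^{(\lambda)}/\pi^r)^\times$ with $\phi''_f(1+\pi^lx)=\psi(\rho_l(\mathrm{Tr}_{K^{(\lambda)}/K}(\hat s_fx)))$ for $x\in\mathcal{O}^{(\lambda)}$. For semisimple $s\in M_n(\mathbb{F}_q)$ with characteristic polynomial $\prod_{i=1}^df_i^{n_i}$ ($f_i$ distinct monic irreducible of degree $\lambda_i$, in a fixed order), $A_s\in M_n(\mathcal{O})$ is block diagonal with $n_i$ blocks $A_{f_i}$, $i=1,\dots,d$; $\rho_1(A_s)$ is conjugate to $s$. $L_s:=C_{G_r}(\rho_r(A_s))$. The commutant of $\rho_m(A_{f_i})$ in $M_{\lambda_i}(\mathcal{O}_m)$ is identified with $\mathcal{O}^{(\lambda_i)}/\pi^m$ via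 $A_{f_i}\mapsto\hat s_{f_i}$, giving $L_s^F\cong\prod_i\mathrm{GL}_{n_i}(\mathcal{O}^{(\lambda_i)}/\pi^r)$ and $C_{M_n(\mathbb{F}_q)}(\rho_1(A_s))\cong\prod_iM_{n_i}(\mathbb{F}_{q^{\lambda_i}})$. $\phi_s(g):=\prod_i\phi''_{f_i}(\det(g)_i)$, a one-dimensional representation of $L_s^F$ ($\det(g)_i$ the determinant of the $i$-th factor). Orbits. For $B\in M_n(\mathbb{F}_q)$ let $\psi_B(I_n+\pi^{r-1}X)=\psi(\pi^{l-1}\mathrm{Tr}(BX))$, a character of $(G_r^{r-1})^F$. For $\sigma\in\mathrm{Irr}(G_r^F)$, $\Omega(\sigma)$ is the $\mathrm{GL}_n(\mathbb{F}_q)$-conjugacy class of those $B$ for which $\psi_B$ occurs in $\sigma|_{(G_r^{r-1})^F}$. For $\sigma\in\mathrm{Irr}(L_s^F)$, $\Omega(\sigma)$ is defined in the same way with $B\in C_{M_n(\mathbb{F}_q)}(\rho_1(A_s))$ and restrictions to $(L_s^{r-1})^F$; $\sigma$ is a nilpotent orbit representation if $\Omega(\sigma)$ contains a nilpotent matrix. Jordan induction. $(L_sG_r^l)^F=L_s^F(G_r^l)^F$ projects onto $L_s^F$, identically on $L_s^F$, with kernel $\{I_n+\pi^lX: X=\rho_r(A_s)Y-Y\rho_r(A_s),\ Y\in M_n(\mathcal{O}_r)\}$. For a nilpotent orbit representation $\nu\in\mathrm{Irr}(L_s^F)$, $J_r(s,\nu):=\mathrm{Ind}_{(L_sG_r^l)^F}^{G_r^F}\widetilde{\phi_s\otimes\nu}$,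 where $\widetilde{\phi_s\otimes\nu}$ is the inflation of $\phi_s\otimes\nu$ along this projection. The matrices $N_i$. Choose $h\in\mathrm{GL}_n(\mathbb{F}_q)$ with $hsh^{-1}=\rho_1(A_s)$; then $hNh^{-1}\in C_{M_n(\mathbb{F}_q)}(\rho_1(A_s))\cong\prod_iM_{n_i}(\mathbb{F}_{q^{\lambda_i}})$ corresponds to nilpotent matrices $(N_1,\dots,N_d)$. The representations $\nu_{N_i}$. Let $k=\mathbb{F}_{q^{\lambda}}$, $R=k[[\pi]]$, $R_m=R/\pi^m$, $\psi_R:=\psi\circ\mathrm{Tr}_{R_l/\mathcal{O}_l}$, and let $M\in M_m(k)$ be nilpotent. Let $\psi_M(I_m+\pi^lX):=\psi_R(\mathrm{Tr}(M\rho_l(X)))$, a character of the kernel $\Gamma^l$ of $\mathrm{GL}_m(R_r)\to\mathrm{GL}_m(R_l)$, and let $C(M)$ be the centraliser of $M$ in $\mathrm{GL}_m(R_r)$. Then $\tilde\psi_M(xg):=\psi_M(g)$ ($x\in C(M)$, $g\in\Gamma^l$) is a well-defined character of $C(M)\Gamma^l$, and $\nu_M:=\mathrm{Ind}_{C(M)\Gamma^l}^{\mathrm{GL}_m(R_r)}\tilde\psi_M$. Apply this with $\lambda=\lambda_i$, $m=n_i$, $M=N_i$; $\boxtimes_i\nu_{N_i}$ is viewed as a representation of $L_s^F\cong\prod_i\mathrm{GL}_{n_i}(\mathcal{O}^{(\lambda_i)}/\pi^r)$. *)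

theory Defs
  imports
    "HOL-Algebra.Algebraic_Closure_Type"
    "HOL-Algebra.QuotRing"
    "HOL-Computational_Algebra.Computational_Algebra"
    "Jordan_Normal_Form.Char_Poly"
    "Jordan_Normal_Form.VS_Connect"
    "Berlekamp_Zassenhaus.Finite_Field"
begin

section \<open>The coefficient field\<close>

text \<open>
  The \<open>\<ell>\<close>-adic integers, for the prime \<open>\<ell> = CARD('l)\<close>, as the inverse limit of the rings
  \<open>\<int>/\<ell>\<^sup>k\<close>: the \<open>k\<close>-th entry of a sequence is the representative in \<open>{0..<\<ell>^k}\<close>.
\<close>

typedef 'l padic_int = "{a :: nat \<Rightarrow> int. \<forall>k. a k = a (Suc k) mod int CARD('l) ^ k}"
  by (rule exI[of _ "\<lambda>_. 0"]) simp

setup_lifting type_definition_padic_int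

lemma mod_power_Suc_cancel: "(x mod (p::int) ^ Suc k) mod p ^ k = x mod p ^ k"
  by (rule mod_mod_cancel) (simp add: le_imp_power_dvd)

lemma mod_step:
  fixes u v x y p :: int
  assumes "u = x mod p ^ k"
  shows "(- u) mod p ^ k = ((- x) mod p ^ Suc k) mod p ^ k"
    and "v = y mod p ^ k \<Longrightarrow> (u + v) mod p ^ k = ((x + y) mod p ^ Suc k) mod p ^ k"
    and "v = y mod p ^ k \<Longrightarrow> (u - v) mod p ^ k = ((x - y) mod p ^ Suc k) mod p ^ k"
    and "v = y mod p ^ k \<Longrightarrow> (u * v) mod p ^ k = ((x * y) mod p ^ Suc k) mod p ^ k"
  unfolding mod_power_Suc_cancel using assms by (simp_all only: mod_simps)

lemma padic_int_entry_0:
  fixes a :: "nat \<Rightarrow> int"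
  assumes "\<forall>k. a k = a (Suc k) mod p ^ k"
  shows "a k mod p ^ k = a k"
proof -
  have "a k = a (Suc k) mod p ^ k" using assms by blast
  thus ?thesis by simp
qed

lemma padic_int_entry_mod:
  fixes a :: "nat \<Rightarrow> int"
  assumes a: "\<forall>k. a k = a (Suc k) mod p ^ k"
  shows "a k = a (k + j) mod p ^ k"
proof (induction j)
  case 0
  show ?case using padic_int_entry_0[OF a] by simp
next
  case (Suc j)
  have "a (k + j) = a (k + Suc j) mod p ^ (k + j)" using a by (metis add_Suc_right)
  hence "a (k + j) mod p ^ k = a (k + Suc j) mod p ^ (k + j) mod p ^ k" by simp
  also have "\<dots> = a (k + Suc j) mod p ^ k"
    by (rule mod_mod_cancel) (simp add: le_imp_power_dvd)
  finally show ?case using Suc by simp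
qed

instantiation padic_int :: (prime_card) comm_ring_1
begin

lift_definition zero_padic_int :: "'a padic_int" is "\<lambda>_. 0" by simp

lift_definition one_padic_int :: "'a padic_int" is "\<lambda>k. 1 mod int CARD('a) ^ k"
  by (simp only: mod_power_Suc_cancel)

lift_definition plus_padic_int :: "'a padic_int \<Rightarrow> 'a padic_int \<Rightarrow> 'a padic_int"
  is "\<lambda>a b k. (a k + b k) mod int CARD('a) ^ k"
  by (intro allI mod_step; erule meta_spec)

lift_definition minus_padic_int :: "'a padic_int \<Rightarrow> 'a padic_int \<Rightarrow> 'a padic_int"
  is "\<lambda>a b k. (a k - b k) mod int CARD('a) ^ k"
  by (intro allI mod_step; erule meta_spec)

lift_definition uminus_padic_int :: "'a padic_int \<Rightarrow> 'a padic_int"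
  is "\<lambda>a k. (- a k) mod int CARD('a) ^ k"
  by (intro allI mod_step; erule meta_spec)

lift_definition times_padic_int :: "'a padic_int \<Rightarrow> 'a padic_int \<Rightarrow> 'a padic_int"
  is "\<lambda>a b k. (a k * b k) mod int CARD('a) ^ k"
  by (intro allI mod_step; erule meta_spec)

instance
proof
  fix a b c :: "'a padic_int"
  show "a * b * c = a * (b * c)"
    by transfer (simp (no_asm) add: fun_eq_iff mod_simps mult.assoc)
  show "a * b = b * a"
    by transfer (simp (no_asm) add: fun_eq_iff mult.commute)
  show "1 * a = a"
    by transfer (intro ext, simp (no_asm) add: mod_simps, erule padic_int_entry_0)
  show "a + b + c = a + (b + c)"
    by transfer (simp (no_asm) add: fun_eq_iff mod_simps add.assoc)
  show "a + b = b + a"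
    by transfer (simp (no_asm) add: fun_eq_iff add.commute)
  show "0 + a = a"
    by transfer (intro ext, simp (no_asm) add: mod_simps, erule padic_int_entry_0)
  show "- a + a = 0"
    by transfer (simp (no_asm) add: fun_eq_iff mod_simps)
  show "a - b = a + - b"
    by transfer (simp (no_asm) add: fun_eq_iff mod_simps)
  show "(a + b) * c = a * c + b * c"
    by transfer (simp (no_asm) add: fun_eq_iff mod_simps distrib_right)
  show "(0 :: 'a padic_int) \<noteq> 1"
  proof (transfer, rule notI)
    assume "(\<lambda>_. 0) = (\<lambda>k. 1 mod int CARD('a) ^ k)"
    hence "(0::int) = 1 mod int CARD('a) ^ 1" by metis
    moreover have "1 < int CARD('a)" using prime_card_int prime_gt_1_int by blast
    ultimately show False by simp
  qed
qed

end

instance padic_int :: (prime_card) idom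
proof
  fix a b :: "'a padic_int"
  assume "a \<noteq> 0" "b \<noteq> 0"
  thus "a * b \<noteq> 0"
  proof (transfer, goal_cases)
    case (1 a b)
    define p where "p = int CARD('a)"
    have p: "prime p" unfolding p_def by (rule prime_card_int)
    have pa: "\<forall>k. a k = a (Suc k) mod p ^ k" and pb: "\<forall>k. b k = b (Suc k) mod p ^ k"
      and "a \<noteq> (\<lambda>_. 0)" "b \<noteq> (\<lambda>_. 0)"
      unfolding p_def by fact+
    then obtain i j where ij: "a i \<noteq> 0" "b j \<noteq> 0" by (metis ext)
    have a: "a i = a (i + j) mod p ^ i"
      by (rule padic_int_entry_mod[OF pa])
    have b: "b j = b (i + j) mod p ^ j"
      using padic_int_entry_mod[OF pb, of j i] by (simp only: add.commute)
    have na: "\<not> p ^ i dvd a (i + j)" and nb: "\<not> p ^ j dvd b (i + j)"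
      using a b ij by (metis dvd_eq_mod_eq_0)+
    have nz: "a (i + j) \<noteq> 0" "b (i + j) \<noteq> 0" using na nb by auto
    have "multiplicity p (a (i + j) * b (i + j)) = multiplicity p (a (i + j)) + multiplicity p (b (i + j))"
      using prime_imp_prime_elem[OF p] nz by (rule prime_elem_multiplicity_mult_distrib)
    moreover have "multiplicity p (a (i + j)) < i" "multiplicity p (b (i + j)) < j"
      using na nb multiplicity_dvd' not_le by metis+
    ultimately have "multiplicity p (a (i + j) * b (i + j)) < i + j" by simp
    hence "\<not> p ^ (i + j) dvd a (i + j) * b (i + j)"
      using p nz by (subst power_dvd_iff_le_multiplicity) auto
    hence "(a (i + j) * b (i + j)) mod p ^ (i + j) \<noteq> 0" by (simp add: dvd_eq_mod_eq_0)
    thus ?case unfolding p_def by metis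
  qed
qed

type_synonym 'l padic = "'l padic_int fract"

type_synonym 'l padic_closure = "'l padic alg_closure"

section \<open>Matrix representations of finite groups\<close>

definition representation :: "('g, 'b) monoid_scheme \<Rightarrow> nat \<Rightarrow> ('g \<Rightarrow> 'c::field mat) \<Rightarrow> bool" where
  "representation G d \<rho> \<longleftrightarrow> \<rho> \<in> hom G (units_of (ring_mat TYPE('c) d ()))"

definition rep_dim :: "('g, 'b) monoid_scheme \<Rightarrow> ('g \<Rightarrow> 'c mat) \<Rightarrow> nat" where
  "rep_dim G \<rho> = dim_row (\<rho> \<one>\<^bsub>G\<^esub>)"

definition irreducible_rep :: "('g, 'b) monoid_scheme \<Rightarrow> ('g \<Rightarrow> 'c::field mat) \<Rightarrow> bool" where
  "irreducible_rep G \<rho> \<longleftrightarrow> (let d = rep_dim G \<rho> in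
     group G \<and> representation G d \<rho> \<and> 0 < d \<and>
     (\<forall>W. VectorSpace.subspace class_ring W (module_vec TYPE('c) d) \<and>
          (\<forall>g \<in> carrier G. \<forall>w \<in> W. \<rho> g *\<^sub>v w \<in> W) \<longrightarrow>
        W = {0\<^sub>v d} \<or> W = carrier_vec d))"

definition left_transversal :: "('g, 'b) monoid_scheme \<Rightarrow> 'g set \<Rightarrow> 'g list \<Rightarrow> bool" where
  "left_transversal G H ts \<longleftrightarrow> distinct ts \<and> set ts \<subseteq> carrier G \<and>
     (\<forall>g \<in> carrier G. \<exists>!t. t \<in> set ts \<and> inv\<^bsub>G\<^esub> t \<otimes>\<^bsub>G\<^esub> g \<in> H)"

text \<open>
  For coset representatives \<open>t\<^sub>0, \<dots>, t\<^sub>k\<close> of \<open>G/H\<close>, the induced representation sends \<open>g\<close> to the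
  block matrix whose \<open>(i, j)\<close> block is \<open>\<rho>(t\<^sub>i\<^sup>-\<^sup>1 g t\<^sub>j)\<close>, read as zero when the argument is not
  in \<open>H\<close>. A different choice of representatives gives an isomorphic representation.
\<close>

definition induced_rep ::
  "('g, 'b) monoid_scheme \<Rightarrow> 'g set \<Rightarrow> ('g \<Rightarrow> 'c::field mat) \<Rightarrow> 'g \<Rightarrow> 'c mat" where
  "induced_rep G H \<rho> g =
     (let ts = (SOME ts. left_transversal G H ts); e = rep_dim G \<rho>
      in mat (length ts * e) (length ts * e) (\<lambda>(u, v).
           let y = inv\<^bsub>G\<^esub> (ts ! (u div e)) \<otimes>\<^bsub>G\<^esub> g \<otimes>\<^bsub>G\<^esub> (ts ! (v div e))
           in if y \<in> H then \<rho> y $$ (u mod e, v mod e) else 0))"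

definition kronecker :: "'c::semiring_1 mat \<Rightarrow> 'c mat \<Rightarrow> 'c mat" where
  "kronecker A B = mat (dim_row A * dim_row B) (dim_col A * dim_col B) (\<lambda>(u, v).
     A $$ (u div dim_row B, v div dim_col B) * B $$ (u mod dim_row B, v mod dim_col B))"

definition kronecker_list :: "'c::semiring_1 mat list \<Rightarrow> 'c mat" where
  "kronecker_list As = foldr kronecker As (1\<^sub>m 1)"

definition occurs_in ::
  "('g, 'b) monoid_scheme \<Rightarrow> 'g set \<Rightarrow> ('g \<Rightarrow> 'c::field) \<Rightarrow> ('g \<Rightarrow> 'c mat) \<Rightarrow> bool" where
  "occurs_in G H \<chi> \<rho> \<longleftrightarrow> (\<exists>v \<in> carrier_vec (rep_dim G \<rho>). v \<noteq> 0\<^sub>v (rep_dim G \<rho>) \<and>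
     (\<forall>g \<in> H. \<rho> g *\<^sub>v v = \<chi> g \<cdot>\<^sub>v v))"

section \<open>Truncated power series and general linear groups over them\<close>

text \<open>
  For a subring \<open>k\<close> of the coefficients, \<open>k[[\<pi>]]/\<pi>\<^sup>m\<close> is represented by the power series that
  have coefficients in \<open>k\<close> and vanish from degree \<open>m\<close> on; \<open>\<pi>\<close> is \<^const>\<open>fps_X\<close> and reduction modulo
  \<open>\<pi>\<^sup>m\<close> is \<^term>\<open>fps_cutoff m\<close>.
\<close>

lemma fps_cutoff_eq_iff_dvd:
  fixes x y :: "'a::comm_ring_1 fps"
  shows "fps_cutoff m x = fps_cutoff m y \<longleftrightarrow> fps_X ^ m dvd x - y"
proof
  assume "fps_cutoff m x = fps_cutoff m y"
  hence "x - y = fps_X ^ m * (fps_shift m x - fps_shift m y)"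
    using fps_shift_cutoff'[of m x] fps_shift_cutoff'[of m y]
    by (metis add_diff_cancel_right right_diff_distrib)
  thus "fps_X ^ m dvd x - y" by simp
next
  assume "fps_X ^ m dvd x - y"
  then obtain z where "x - y = fps_X ^ m * z" by (elim dvdE)
  hence "fps_nth x i - fps_nth y i = 0" if "i < m" for i
    using that by (metis fps_X_power_mult_nth fps_sub_nth)
  thus "fps_cutoff m x = fps_cutoff m y" by (simp add: fps_eq_iff)
qed

definition trunc_ring :: "'a::comm_ring_1 set \<Rightarrow> nat \<Rightarrow> 'a fps ring" where
  "trunc_ring k m = \<lparr>
     carrier = {x. (\<forall>i. fps_nth x i \<in> k) \<and> fps_cutoff m x = x},
     monoid.mult = (\<lambda>x y. fps_cutoff m (x * y)), one = fps_cutoff m 1, zero = 0, add = (+)\<rparr>"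

abbreviation reduce_mat :: "nat \<Rightarrow> 'a::zero fps mat \<Rightarrow> 'a fps mat" where
  "reduce_mat m \<equiv> map_mat (fps_cutoff m)"

definition trunc_mat_ring :: "'a::comm_ring_1 set \<Rightarrow> nat \<Rightarrow> nat \<Rightarrow> 'a fps mat ring" where
  "trunc_mat_ring k n m = \<lparr>
     carrier = {Z \<in> carrier_mat n n. elements_mat Z \<subseteq> carrier (trunc_ring k m)},
     monoid.mult = (\<lambda>Z Y. reduce_mat m (Z * Y)), one = reduce_mat m (1\<^sub>m n), zero = 0\<^sub>m n n, add = (+)\<rparr>"

definition GL_trunc :: "'a::comm_ring_1 set \<Rightarrow> nat \<Rightarrow> nat \<Rightarrow> 'a fps mat monoid" where
  "GL_trunc k n m = units_of (trunc_mat_ring k n m)"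

definition GL_centraliser :: "'a::comm_ring_1 set \<Rightarrow> nat \<Rightarrow> nat \<Rightarrow> 'a fps mat \<Rightarrow> 'a fps mat set" where
  "GL_centraliser k n m A = {g \<in> carrier (GL_trunc k n m). reduce_mat m (g * A) = reduce_mat m (A * g)}"

definition cong_subgroup :: "'a::comm_ring_1 set \<Rightarrow> nat \<Rightarrow> nat \<Rightarrow> nat \<Rightarrow> 'a fps mat set" where
  "cong_subgroup k n m i = {g \<in> carrier (GL_trunc k n m). reduce_mat i g = reduce_mat i (1\<^sub>m n)}"

text \<open>The \<open>X\<close> with \<open>g = 1 + \<pi>\<^sup>i X\<close>, for \<open>g\<close> congruent to \<open>1\<close> modulo \<open>\<pi>\<^sup>i\<close>.\<close>

definition cong_part :: "nat \<Rightarrow> 'a::comm_ring_1 fps mat \<Rightarrow> 'a fps mat" where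
  "cong_part i g = map_mat (fps_shift i) (g - 1\<^sub>m (dim_row g))"

definition mat_trace :: "'a::comm_monoid_add mat \<Rightarrow> 'a" where
  "mat_trace Z = (\<Sum>i < dim_row Z. Z $$ (i, i))"

abbreviation const_mat :: "'a::zero mat \<Rightarrow> 'a fps mat" where
  "const_mat \<equiv> map_mat fps_const"

abbreviation residue_mat :: "'a fps mat \<Rightarrow> 'a mat" where
  "residue_mat \<equiv> map_mat (\<lambda>x. fps_nth x 0)"

section \<open>Unramified extensions\<close>

text \<open>
  The base field \<open>\<bbbF>\<^sub>q\<close> is a type \<^typ>\<open>'q::finite_field\<close> and \<open>\<O> = \<bbbF>\<^sub>q[[\<pi>]]\<close> is \<^typ>\<open>'q fps\<close>. All
  unramified extensions of \<open>\<O>\<close> live in the power series over the algebraic closure of \<open>\<bbbF>\<^sub>q\<close>.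
\<close>

definition finite_subfield :: "nat \<Rightarrow> 'q::finite_field alg_closure set" where
  "finite_subfield d = {x. x ^ (CARD('q) ^ d) = x}"

definition O_ext :: "nat \<Rightarrow> 'q::finite_field alg_closure fps set" where
  "O_ext d = {x. \<forall>i. fps_nth x i \<in> finite_subfield d}"

definition O_ur :: "'q::finite_field alg_closure fps set" where
  "O_ur = (\<Union>d \<in> {1..}. O_ext d)"

definition O_embed :: "'q::finite_field fps \<Rightarrow> 'q alg_closure fps" where
  "O_embed x = Abs_fps (\<lambda>i. to_ac (fps_nth x i))"

definition frobenius :: "'q::finite_field alg_closure fps \<Rightarrow> 'q alg_closure fps" where
  "frobenius x = Abs_fps (\<lambda>i. fps_nth x i ^ CARD('q))"

text \<open>
  The trace of \<open>K\<^sup>(\<^sup>d\<^sup>)/K\<close> on \<open>\<O>\<^sup>(\<^sup>d\<^sup>)\<close>, as the sum of the conjugates under the cyclic Galois group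
  generated by Frobenius, read as an element of \<open>\<O>\<close>. It commutes with truncation, so the same
  function is the trace of \<open>\<O>\<^sup>(\<^sup>d\<^sup>)/\<pi>\<^sup>m\<close> over \<open>\<O>/\<pi>\<^sup>m\<close>.
\<close>

definition unram_trace :: "nat \<Rightarrow> 'q::finite_field alg_closure fps \<Rightarrow> 'q fps" where
  "unram_trace d x = Abs_fps (\<lambda>i. of_ac (fps_nth (\<Sum>j < d. (frobenius ^^ j) x) i))"

section \<open>Characters and the data attached to irreducible polynomials\<close>

definition additive_character :: "nat \<Rightarrow> ('q::finite_field fps \<Rightarrow> 'c::field) \<Rightarrow> bool" where
  "additive_character l \<psi> \<longleftrightarrow>
     \<psi> \<in> hom (add_monoid (trunc_ring UNIV l)) (units_of (class_ring :: 'c ring)) \<and>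
     (\<exists>x \<in> carrier (trunc_ring UNIV l). \<psi> (fps_cutoff l (fps_X ^ (l - 1) * x)) \<noteq> 1)"

definition jordan_datum ::
  "nat \<Rightarrow> nat \<Rightarrow> ('q::finite_field fps \<Rightarrow> 'c::field) \<Rightarrow> 'q poly \<Rightarrow> 'q alg_closure \<Rightarrow>
   'q alg_closure fps \<Rightarrow> 'q fps mat \<Rightarrow> ('q alg_closure fps \<Rightarrow> 'c) \<Rightarrow> bool" where
  "jordan_datum l r \<psi> f s\<^sub>f s_hat A \<phi> \<longleftrightarrow> (let d = Polynomial.degree f in
     s\<^sub>f \<in> finite_subfield d \<and> poly (map_poly to_ac f) s\<^sub>f = 0 \<and>
     s_hat \<in> O_ext d \<and> fps_nth s_hat 0 = s\<^sub>f \<and>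
     A \<in> carrier_mat d d \<and>
     (\<exists>P Q. elements_mat P \<subseteq> O_ur \<and> elements_mat Q \<subseteq> O_ur \<and>
        similar_mat_wit (map_mat O_embed A) (mat_diag d (\<lambda>j. (frobenius ^^ j) s_hat)) P Q) \<and>
     \<phi> \<in> hom (units_of (trunc_ring (finite_subfield d) r)) (units_of (class_ring :: 'c ring)) \<and>
     (\<forall>x \<in> O_ext d. \<phi> (fps_cutoff r (1 + fps_X ^ l * x)) =
        \<psi> (fps_cutoff l (unram_trace d (s_hat * x)))))"

section \<open>Jordan decomposition and the block matrices\<close>

definition semisimple_mat :: "'q::field mat \<Rightarrow> bool" where
  "semisimple_mat s \<longleftrightarrow> (\<exists>D. diagonal_mat D \<and> similar_mat (map_mat to_ac s) D)"

definition nilpotent_mat :: "'q::semiring_1 mat \<Rightarrow> bool" where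
  "nilpotent_mat N \<longleftrightarrow> (\<exists>k. N ^\<^sub>m k = 0\<^sub>m (dim_row N) (dim_row N))"

definition additive_jordan_decomposition :: "nat \<Rightarrow> 'q::field mat \<Rightarrow> 'q mat \<Rightarrow> 'q mat \<Rightarrow> bool" where
  "additive_jordan_decomposition n \<omega> s N \<longleftrightarrow>
     s \<in> carrier_mat n n \<and> N \<in> carrier_mat n n \<and> \<omega> = s + N \<and> s * N = N * s \<and>
     semisimple_mat s \<and> nilpotent_mat N"

text \<open>
  The factorisation \<open>\<Prod>f\<^sub>i^n\<^sub>i\<close> of a characteristic polynomial is given, in a chosen order, by the
  list of the pairs \<open>(f\<^sub>i, n\<^sub>i)\<close>.
\<close>

definition char_poly_factorisation :: "'q::field mat \<Rightarrow> ('q poly \<times> nat) list \<Rightarrow> bool" where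
  "char_poly_factorisation s fs \<longleftrightarrow> distinct (map fst fs) \<and>
     (\<forall>(f, k) \<in> set fs. monic f \<and> irreducible f \<and> 0 < k) \<and>
     char_poly s = (\<Prod>(f, k) \<leftarrow> fs. f ^ k)"

definition block_mat_A :: "('q poly \<Rightarrow> 'q::zero fps mat) \<Rightarrow> ('q poly \<times> nat) list \<Rightarrow> 'q fps mat" where
  "block_mat_A A fs = diag_block_mat (concat (map (\<lambda>(f, k). replicate k (A f)) fs))"

definition commutant :: "nat \<Rightarrow> 'q::comm_ring_1 fps mat \<Rightarrow> 'q fps mat ring" where
  "commutant m A = (let R = trunc_mat_ring UNIV (dim_row A) m in
     R\<lparr>carrier := {Z \<in> carrier R. Z \<otimes>\<^bsub>R\<^esub> reduce_mat m A = reduce_mat m A \<otimes>\<^bsub>R\<^esub> Z}\<rparr>)"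

text \<open>
  The identification of the commutant of \<open>\<rho>\<^sub>m(A\<^sub>f)\<close> with \<open>\<O>\<^sup>(\<^sup>d\<^sup>)/\<pi>\<^sup>m\<close>: the isomorphism of algebras over
  \<open>\<O>/\<pi>\<^sup>m\<close> that sends \<open>A\<^sub>f\<close> to the lifted root. The commutant is generated by \<open>A\<^sub>f\<close>, so the
  isomorphism is unique on it.
\<close>

definition commutant_iso ::
  "nat \<Rightarrow> 'q::finite_field fps mat \<Rightarrow> 'q alg_closure fps \<Rightarrow> 'q fps mat \<Rightarrow> 'q alg_closure fps" where
  "commutant_iso m A s_hat = (SOME \<iota>.
     \<iota> \<in> ring_iso (commutant m A) (trunc_ring (finite_subfield (dim_row A)) m) \<and>
     \<iota> (reduce_mat m A) = fps_cutoff m s_hat \<and>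
     (\<forall>c \<in> carrier (trunc_ring UNIV m). \<iota> (c \<cdot>\<^sub>m reduce_mat m (1\<^sub>m (dim_row A))) = O_embed c))"

text \<open>
  The \<open>i\<close>-th component (counted from \<open>0\<close>) of a matrix over \<open>\<O>/\<pi>\<^sup>m\<close> that commutes with \<open>A\<^sub>s\<close>, as an
  \<open>n\<^sub>i\<close> by \<open>n\<^sub>i\<close> matrix over \<open>\<O>\<^sup>(\<^sup>d\<^sup>)/\<pi>\<^sup>m\<close> with \<open>d = deg f\<^sub>i\<close>. Such a matrix is block diagonal, and its
  \<open>i\<close>-th diagonal block consists of \<open>n\<^sub>i\<close> by \<open>n\<^sub>i\<close> blocks of size \<open>d\<close> in the commutant of \<open>A\<^sub>f\<close>.
\<close>

definition component ::
  "nat \<Rightarrow> ('q poly \<Rightarrow> 'q::finite_field fps mat) \<Rightarrow> ('q poly \<Rightarrow> 'q alg_closure fps) \<Rightarrow>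
   ('q poly \<times> nat) list \<Rightarrow> nat \<Rightarrow> 'q fps mat \<Rightarrow> 'q alg_closure fps mat" where
  "component m A s_hat fs i Z =
     (let (f, k) = fs ! i; d = Polynomial.degree f;
          off = (\<Sum>(f', k') \<leftarrow> take i fs. k' * Polynomial.degree f')
      in mat k k (\<lambda>(a, b). commutant_iso m (A f) (s_hat f)
           (mat d d (\<lambda>(u, v). Z $$ (off + a * d + u, off + b * d + v)))))"

text \<open>The case \<open>m = 1\<close>, where the entries are constant power series, for a matrix over \<open>\<bbbF>\<^sub>q\<close>.\<close>

definition nilpotent_component ::
  "('q poly \<Rightarrow> 'q::finite_field fps mat) \<Rightarrow> ('q poly \<Rightarrow> 'q alg_closure fps) \<Rightarrow>
   ('q poly \<times> nat) list \<Rightarrow> nat \<Rightarrow> 'q mat \<Rightarrow> 'q alg_closure mat" where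
  "nilpotent_component A s_hat fs i N = residue_mat (component 1 A s_hat fs i (const_mat N))"

section \<open>The representations attached to nilpotent matrices\<close>

definition psi_nilp ::
  "nat \<Rightarrow> nat \<Rightarrow> ('q::finite_field fps \<Rightarrow> 'c) \<Rightarrow> 'q alg_closure mat \<Rightarrow> 'q alg_closure fps mat \<Rightarrow> 'c" where
  "psi_nilp l d \<psi> M g =
     \<psi> (unram_trace d (fps_cutoff l (mat_trace (const_mat M * reduce_mat l (cong_part l g)))))"

definition psi_nilp_ext ::
  "nat \<Rightarrow> nat \<Rightarrow> nat \<Rightarrow> nat \<Rightarrow> ('q::finite_field fps \<Rightarrow> 'c) \<Rightarrow> 'q alg_closure mat \<Rightarrow>
   'q alg_closure fps mat \<Rightarrow> 'c" where
  "psi_nilp_ext l r d m \<psi> M y = (let k = finite_subfield d in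
     THE c. \<exists>x \<in> GL_centraliser k m r (const_mat M). \<exists>g \<in> cong_subgroup k m r l.
       y = x \<otimes>\<^bsub>GL_trunc k m r\<^esub> g \<and> c = psi_nilp l d \<psi> M g)"

definition nu_rep ::
  "nat \<Rightarrow> nat \<Rightarrow> nat \<Rightarrow> nat \<Rightarrow> ('q::finite_field fps \<Rightarrow> 'c::field) \<Rightarrow> 'q alg_closure mat \<Rightarrow>
   'q alg_closure fps mat \<Rightarrow> 'c mat" where
  "nu_rep l r d m \<psi> M = (let k = finite_subfield d; G = GL_trunc k m r in
     induced_rep G (GL_centraliser k m r (const_mat M) <#>\<^bsub>G\<^esub> cong_subgroup k m r l)
       (\<lambda>y. mat 1 1 (\<lambda>_. psi_nilp_ext l r d m \<psi> M y)))"

text \<open>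
  The external tensor product, over the factors of the centraliser of \<open>A\<^sub>s\<close>, of the representations
  attached to a list of matrices.
\<close>

definition nu_box ::
  "nat \<Rightarrow> nat \<Rightarrow> ('q::finite_field fps \<Rightarrow> 'c::field) \<Rightarrow> ('q poly \<Rightarrow> 'q fps mat) \<Rightarrow>
   ('q poly \<Rightarrow> 'q alg_closure fps) \<Rightarrow> ('q poly \<times> nat) list \<Rightarrow> (nat \<Rightarrow> 'q alg_closure mat) \<Rightarrow>
   'q fps mat \<Rightarrow> 'c mat" where
  "nu_box l r \<psi> A s_hat fs Ns g = kronecker_list
     (map (\<lambda>i. nu_rep l r (Polynomial.degree (fst (fs ! i))) (snd (fs ! i)) \<psi> (Ns i)
                 (component r A s_hat fs i g)) [0..<length fs])"

section \<open>Jordan induction and orbits\<close>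

definition phi_s ::
  "nat \<Rightarrow> ('q poly \<Rightarrow> 'q::finite_field fps mat) \<Rightarrow> ('q poly \<Rightarrow> 'q alg_closure fps) \<Rightarrow>
   ('q poly \<Rightarrow> 'q alg_closure fps \<Rightarrow> 'c::field) \<Rightarrow> ('q poly \<times> nat) list \<Rightarrow> 'q fps mat \<Rightarrow> 'c" where
  "phi_s r A s_hat \<phi> fs g =
     (\<Prod>i < length fs. \<phi> (fst (fs ! i)) (fps_cutoff r (det (component r A s_hat fs i g))))"

definition L_group ::
  "nat \<Rightarrow> nat \<Rightarrow> ('q poly \<Rightarrow> 'q::comm_ring_1 fps mat) \<Rightarrow> ('q poly \<times> nat) list \<Rightarrow> 'q fps mat set" where
  "L_group n r A fs = GL_centraliser UNIV n r (reduce_mat r (block_mat_A A fs))"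

definition L_kernel ::
  "nat \<Rightarrow> nat \<Rightarrow> nat \<Rightarrow> ('q poly \<Rightarrow> 'q::comm_ring_1 fps mat) \<Rightarrow> ('q poly \<times> nat) list \<Rightarrow>
   'q fps mat set" where
  "L_kernel n l r A fs = (let A\<^sub>s = reduce_mat r (block_mat_A A fs) in
     {reduce_mat r (1\<^sub>m n + fps_X ^ l \<cdot>\<^sub>m (A\<^sub>s * Y - Y * A\<^sub>s)) | Y. Y \<in> carrier (trunc_mat_ring UNIV n r)})"

definition L_projection ::
  "nat \<Rightarrow> nat \<Rightarrow> nat \<Rightarrow> ('q poly \<Rightarrow> 'q::comm_ring_1 fps mat) \<Rightarrow> ('q poly \<times> nat) list \<Rightarrow>
   'q fps mat \<Rightarrow> 'q fps mat" where
  "L_projection n l r A fs g = (let G = GL_trunc UNIV n r in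
     THE x. x \<in> L_group n r A fs \<and> inv\<^bsub>G\<^esub> x \<otimes>\<^bsub>G\<^esub> g \<in> L_kernel n l r A fs)"

definition jordan_induction ::
  "nat \<Rightarrow> nat \<Rightarrow> nat \<Rightarrow> ('q poly \<Rightarrow> 'q::finite_field fps mat) \<Rightarrow> ('q poly \<Rightarrow> 'q alg_closure fps) \<Rightarrow>
   ('q poly \<Rightarrow> 'q alg_closure fps \<Rightarrow> 'c::field) \<Rightarrow> ('q poly \<times> nat) list \<Rightarrow>
   ('q fps mat \<Rightarrow> 'c mat) \<Rightarrow> 'q fps mat \<Rightarrow> 'c mat" where
  "jordan_induction n l r A s_hat \<phi> fs \<nu> = (let G = GL_trunc UNIV n r in
     induced_rep G (L_group n r A fs <#>\<^bsub>G\<^esub> cong_subgroup UNIV n r l)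
       (\<lambda>g. let x = L_projection n l r A fs g in phi_s r A s_hat \<phi> fs x \<cdot>\<^sub>m \<nu> x))"

definition psi_orbit ::
  "nat \<Rightarrow> nat \<Rightarrow> ('q::finite_field fps \<Rightarrow> 'c) \<Rightarrow> 'q mat \<Rightarrow> 'q fps mat \<Rightarrow> 'c" where
  "psi_orbit l r \<psi> B g =
     \<psi> (fps_X ^ (l - 1) * fps_const (mat_trace (B * residue_mat (cong_part (r - 1) g))))"

text \<open>For an irreducible representation this set is a single conjugacy class.\<close>

definition orbit ::
  "nat \<Rightarrow> nat \<Rightarrow> nat \<Rightarrow> ('q::finite_field fps \<Rightarrow> 'c::field) \<Rightarrow> ('q fps mat \<Rightarrow> 'c mat) \<Rightarrow> 'q mat set" where
  "orbit n l r \<psi> \<sigma> = {B \<in> carrier_mat n n.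
     occurs_in (GL_trunc UNIV n r) (cong_subgroup UNIV n r (r - 1)) (psi_orbit l r \<psi> B) \<sigma>}"

end

theory Submission
  imports Defs
begin

text \<open>
  Throughout, a representation is handled through its restriction to the congruence subgroup
  \<open>T = 1 + \<pi>\<^sup>l M\<^sub>n\<close>, on which it acts by diagonal matrices. If the diagonal characters are pairwise
  distinct and the group carries every basis vector to a multiple of every other, the representation
  is irreducible; both properties pass to external tensor products and twisted inflations, and to an
  induced representation as soon as no element outside the inducing subgroup relates two of the
  characters (Mackey's criterion). The characters of \<open>T\<close> are \<open>1 + \<pi>\<^sup>l Z \<mapsto> \<psi> (Tr (B Z))\<close>
  with \<open>B\<close> modulo \<open>\<pi>\<^sup>l\<close>, and the ones in \<open>\<phi>\<^sub>s \<otimes> \<nu>\<close> are the conjugates of \<open>B = A\<^sub>s + N'\<close>, where \<open>N'\<close>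
  is the nilpotent matrix commuting with \<open>A\<^sub>s\<close> whose components are the \<open>N\<^sub>i\<close>. The commutator with
  \<open>A\<^sub>s\<close> is diagonalisable over \<open>\<O>\<^sup>u\<^sup>r\<close> with eigenvalues zero or units, so \<open>M\<^sub>n(\<O>)\<close> splits into the commutant of
  \<open>A\<^sub>s\<close> and the image of the commutator, and an element that fixes \<open>B\<close> modulo \<open>\<pi>\<^sup>l\<close> commutes with
  \<open>A\<^sub>s\<close> modulo \<open>\<pi>\<^sup>l\<close>; hence it lies in \<open>L\<^sub>s G\<^sup>l\<close>.
\<close>

section \<open>Representations with separated weights\<close>

text \<open>The equality \<open>r = 2 * l\<close> shapes the argument: \<open>\<pi>^l\<close>
  squares to zero, so \<open>T\<close> is abelian, isomorphic to the additive group of matrices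
  modulo \<open>\<pi>^l\<close>, and a matrix congruent modulo \<open>\<pi>^l\<close> to an
  invertible one is invertible. Hence one-dimensional characters of \<open>T\<close> suffice, and
  stabilisers need to be known only modulo \<open>\<pi>^l\<close>. The obstacle is to separate
  \<open>A_s\<close> from the nilpotent part over a truncated ring, where the uniqueness of the
  Jordan decomposition over a field does not apply directly. The substitute is that the commutator
  operator and its square have the same kernel modulo every power of \<open>\<pi>\<close>, combined
  with the nilpotence of multiplication by \<open>N'\<close>. The eigenvalues are zero or units
  because the roots of the \<open>f_i\<close>, with all their conjugates, are already distinct in
  the residue field. The matrices \<open>A_f\<close> are diagonal only over \<open>\<O>^ur\<close>.
  The descent to \<open>\<O>\<close> rests on the uniqueness of interpolation: data permuted by
  Frobenius like the nodes are interpolated by a Frobenius-invariant polynomial. Elements that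
  commute with \<open>A_s\<close> up to truncation are replaced by representatives that commute
  exactly, and \<open>N'\<close> is built from constant components so that it is exactly
  nilpotent.\<close>

lemma representation_carrier:
  assumes "representation G d \<rho>" "g \<in> carrier G"
  shows "\<rho> g \<in> carrier_mat d d"
  using assms by (auto simp: representation_def hom_def units_of_def Units_def ring_mat_def)

lemma representation_mult:
  assumes "representation G d \<rho>" "g \<in> carrier G" "g' \<in> carrier G"
  shows "\<rho> (g \<otimes>\<^bsub>G\<^esub> g') = \<rho> g * \<rho> g'"
  using assms by (auto simp: representation_def hom_def units_of_def ring_mat_def)

lemma representation_one:
  fixes \<rho> :: "'g \<Rightarrow> 'c::field mat"
  assumes "representation G d \<rho>" "group G"
  shows "\<rho> \<one>\<^bsub>G\<^esub> = 1\<^sub>m d"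
proof -
  interpret R: ring "ring_mat TYPE('c) d ()" by (rule ring_mat)
  have "group_hom G (units_of (ring_mat TYPE('c) d ())) \<rho>"
    using assms R.units_group by (simp add: group_hom_def group_hom_axioms_def representation_def)
  from group_hom.hom_one[OF this] show ?thesis by (simp add: units_of_def ring_mat_def)
qed

text \<open>The matrix of \<open>inv g\<close> is a two-sided inverse of the matrix of
  \<open>g\<close>, so multiplicativity and the value at the identity already put every value among
  the units.\<close>

lemma representationI:
  fixes G (structure) and \<rho> :: "'g \<Rightarrow> 'c::field mat"
  assumes "group G" "\<And>g. g \<in> carrier G \<Longrightarrow> \<rho> g \<in> carrier_mat d d"
    and "\<And>g g'. g \<in> carrier G \<Longrightarrow> g' \<in> carrier G \<Longrightarrow> \<rho> (g \<otimes>\<^bsub>G\<^esub> g') = \<rho> g * \<rho> g'"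
    and "\<rho> \<one>\<^bsub>G\<^esub> = 1\<^sub>m d"
  shows "representation G d \<rho>"
proof -
  interpret group G by fact
  have "\<exists>y \<in> carrier_mat d d. y * \<rho> g = 1\<^sub>m d \<and> \<rho> g * y = 1\<^sub>m d" if "g \<in> carrier G" for g
    using that assms(2)[of "inv g"] assms(3)[of g "inv g"] assms(3)[of "inv g" g] assms(4)
    by (intro bexI[of _ "\<rho> (inv g)"]) auto
  thus ?thesis using assms(2,3)
    by (auto simp: representation_def hom_def units_of_def Units_def ring_mat_def)
qed

lemma rep_dim_eq:
  assumes "representation G d \<rho>" "group G"
  shows "rep_dim G \<rho> = d"
  using representation_one[OF assms] by (simp add: rep_dim_def)

text \<open>Source index first, target index second. The entrywise form, silent about all other
  columns, is what block matrices and Kronecker products preserve directly.\<close>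

definition moves_basis :: "nat \<Rightarrow> 'c::zero mat \<Rightarrow> nat \<Rightarrow> nat \<Rightarrow> bool" where
  "moves_basis d Z j i \<longleftrightarrow> (\<exists>c. c \<noteq> 0 \<and> (\<forall>a<d. Z $$ (a, j) = (if a = i then c else 0)))"

definition weight_rep :: "('g, 'b) monoid_scheme \<Rightarrow> 'g set \<Rightarrow> nat \<Rightarrow> ('g \<Rightarrow> 'c::field mat) \<Rightarrow> bool" where
  "weight_rep G T d \<rho> \<longleftrightarrow> representation G d \<rho> \<and> (\<forall>t \<in> T. diagonal_mat (\<rho> t)) \<and>
     (\<forall>i<d. \<forall>j<d. i \<noteq> j \<longrightarrow> (\<exists>t \<in> T. \<rho> t $$ (i, i) \<noteq> \<rho> t $$ (j, j))) \<and>
     (\<forall>i<d. \<forall>j<d. \<exists>g \<in> carrier G. moves_basis d (\<rho> g) j i)"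

lemma weight_repD:
  assumes "weight_rep G T d \<rho>"
  shows "representation G d \<rho>"
    and "t \<in> T \<Longrightarrow> diagonal_mat (\<rho> t)"
    and "i < d \<Longrightarrow> j < d \<Longrightarrow> i \<noteq> j \<Longrightarrow> \<exists>t \<in> T. \<rho> t $$ (i, i) \<noteq> \<rho> t $$ (j, j)"
    and "i < d \<Longrightarrow> j < d \<Longrightarrow> \<exists>g \<in> carrier G. moves_basis d (\<rho> g) j i"
  using assms by (simp_all add: weight_rep_def)

lemma diagonal_mult_vec_index:
  fixes Z :: "'c::semiring_0 mat"
  assumes "diagonal_mat Z" "Z \<in> carrier_mat d d" "w \<in> carrier_vec d" "i < d"
  shows "(Z *\<^sub>v w) $ i = Z $$ (i, i) * w $ i"
proof -
  have "(Z *\<^sub>v w) $ i = (\<Sum>k = 0..<d. Z $$ (i, k) * w $ k)"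
    using assms by (auto simp: scalar_prod_def)
  also have "\<dots> = (\<Sum>k = 0..<d. if k = i then Z $$ (i, i) * w $ i else 0)"
    by (rule sum.cong) (use assms in \<open>auto simp: diagonal_mat_def\<close>)
  finally show ?thesis using assms by simp
qed

lemma mult_unit_vec_col:
  fixes Z :: "'c::semiring_1 mat"
  assumes "Z \<in> carrier_mat d d" "j < d"
  shows "Z *\<^sub>v unit_vec d j = col Z j"
  using assms by (intro eq_vecI) (auto simp: scalar_prod_right_unit)

lemma moves_basis_unit_vec:
  fixes Z :: "'c::field mat"
  assumes "moves_basis d Z j i" "Z \<in> carrier_mat d d" "j < d" "i < d"
  shows "\<exists>c. c \<noteq> 0 \<and> Z *\<^sub>v unit_vec d j = c \<cdot>\<^sub>v unit_vec d i"
  proof -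
  obtain c where c: "c \<noteq> 0" "\<forall>a<d. Z $$ (a, j) = (if a = i then c else 0)"
    using assms unfolding moves_basis_def by blast
  have "Z *\<^sub>v unit_vec d j = c \<cdot>\<^sub>v unit_vec d i"
    using c assms by (intro eq_vecI) (auto simp: mult_unit_vec_col index_unit_vec)
  thus ?thesis using c by blast
qed

text \<open>
  A nonzero vector of minimal support in an invariant subspace is a multiple of a basis vector,
  because \<open>\<rho> t - \<chi> t\<close> kills exactly those coordinates on which the weight is \<open>\<chi>\<close>.
\<close>

lemma weight_rep_irreducible:
  fixes \<rho> :: "'g \<Rightarrow> 'c::field mat"
  assumes G: "group G" and \<rho>: "weight_rep G T d \<rho>" and d: "0 < d" and T: "T \<subseteq> carrier G"
  shows "irreducible_rep G \<rho>"
proof -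
  have rep: "representation G d \<rho>" using \<rho> by (simp add: weight_rep_def)
  note car = representation_carrier[OF rep]
  interpret V: vec_space "TYPE('c)" d .
  have "W = {0\<^sub>v d} \<or> W = carrier_vec d"
    if W: "VectorSpace.subspace class_ring W (module_vec TYPE('c) d)"
      and inv: "\<forall>g \<in> carrier G. \<forall>w \<in> W. \<rho> g *\<^sub>v w \<in> W" for W
  proof -
    have sub: "submodule class_ring W (module_vec TYPE('c) d)" using W by (simp add: subspace_def)
    have Wc: "W \<subseteq> carrier_vec d" using sub by (auto simp: submodule_def)
    have W0: "0\<^sub>v d \<in> W" using sub by (auto simp: submodule_def)
    have Wadd: "v + w \<in> W" if "v \<in> W" "w \<in> W" for v w
      using sub that by (auto simp: submodule_def)
    have Wsm: "c \<cdot>\<^sub>v v \<in> W" if "v \<in> W" for v c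
      using sub that by (auto simp: submodule_def module_vec_simps)
    show ?thesis
    proof (cases "W = {0\<^sub>v d}")
      case False
      define S where "S = (\<lambda>w::'c vec. {i. i < d \<and> w $ i \<noteq> 0})"
      have "\<exists>w. w \<in> W \<and> w \<noteq> 0\<^sub>v d" using False W0 by auto
      then obtain w where w: "w \<in> W" "w \<noteq> 0\<^sub>v d"
        and min: "\<And>v. v \<in> W \<and> v \<noteq> 0\<^sub>v d \<Longrightarrow> card (S w) \<le> card (S v)"
        using ex_has_least_nat[of "\<lambda>w. w \<in> W \<and> w \<noteq> 0\<^sub>v d" _ "\<lambda>w. card (S w)"] by metis
      have wc: "w \<in> carrier_vec d" using w Wc by auto
      then obtain i where i: "i < d" "w $ i \<noteq> 0" using w(2)
        by (metis carrier_vecD eq_vecI index_zero_vec(1) index_zero_vec(2))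
      have single: "w $ j = 0" if j: "j < d" "j \<noteq> i" for j
      proof (rule ccontr)
        assume wj: "w $ j \<noteq> 0"
        obtain t where t: "t \<in> T" "\<rho> t $$ (i, i) \<noteq> \<rho> t $$ (j, j)"
          using weight_repD(3)[OF \<rho> i(1) j(1)] j(2) by blast
        have tG: "t \<in> carrier G" using t T by auto
        have dg: "diagonal_mat (\<rho> t)" using \<rho> t by (auto simp: weight_rep_def)
        define v where "v = \<rho> t *\<^sub>v w + (- \<rho> t $$ (i, i)) \<cdot>\<^sub>v w"
        have vW: "v \<in> W" unfolding v_def using inv tG w by (intro Wadd Wsm) auto
        have vk: "v $ k = (\<rho> t $$ (k, k) - \<rho> t $$ (i, i)) * w $ k" if "k < d" for k
          using that diagonal_mult_vec_index[OF dg car[OF tG] wc that] wc car[OF tG]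
          unfolding v_def by (simp add: algebra_simps)
        have "v $ j \<noteq> 0" using vk[OF j(1)] t wj by simp
        hence "v \<noteq> 0\<^sub>v d" using j by auto
        moreover have "S v \<subset> S w" unfolding S_def using i vk by fastforce
        hence "card (S v) < card (S w)" by (rule psubset_card_mono[rotated]) (simp add: S_def)
        ultimately show False using min[of v] vW by auto
      qed
      have "inverse (w $ i) \<cdot>\<^sub>v w = unit_vec d i"
        using single i wc by (intro eq_vecI) (auto simp: unit_vec_def)
      hence ei: "unit_vec d i \<in> W" using Wsm[OF w(1)] by metis
      have e: "unit_vec d j \<in> W" if j: "j < d" for j
      proof -
        obtain g where g: "g \<in> carrier G" "moves_basis d (\<rho> g) i j"
          using weight_repD(4)[OF \<rho> j i(1)] by blast
        then obtain c where c: "c \<noteq> 0" "\<rho> g *\<^sub>v unit_vec d i = c \<cdot>\<^sub>v unit_vec d j"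
          using moves_basis_unit_vec[OF g(2) car[OF g(1)] i(1) j] by blast
        have "c \<cdot>\<^sub>v unit_vec d j \<in> W" using inv g(1) ei c by metis
        hence "inverse c \<cdot>\<^sub>v (c \<cdot>\<^sub>v unit_vec d j) \<in> W" by (rule Wsm)
        thus ?thesis using c by (simp add: smult_smult_assoc)
      qed
      have "v \<in> W" if v: "v \<in> carrier_vec d" for v
      proof -
        have "vec d (\<lambda>i. if i < k then v $ i else 0) \<in> W" if "k \<le> d" for k
          using that
        proof (induction k)
          case 0
          have "vec d (\<lambda>i. if i < 0 then v $ i else 0) = 0\<^sub>v d" by auto
          thus ?case using W0 by simp
        next
          case (Suc k)
          have "vec d (\<lambda>i. if i < Suc k then v $ i else 0) =
              vec d (\<lambda>i. if i < k then v $ i else 0) + v $ k \<cdot>\<^sub>v unit_vec d k"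
            using Suc.prems by (intro eq_vecI) (auto simp: unit_vec_def less_Suc_eq)
          thus ?case using Wadd[OF Suc.IH Wsm[OF e]] Suc.prems by simp
        qed
        from this[of d] have "vec d (\<lambda>i. if i < d then v $ i else 0) \<in> W" by simp
        moreover have "vec d (\<lambda>i. if i < d then v $ i else 0) = v" using v by auto
        ultimately show ?thesis by simp
      qed
      thus ?thesis using Wc by auto
    qed simp
  qed
  thus ?thesis using G rep d rep_dim_eq[OF rep G] by (simp add: irreducible_rep_def Let_def)
qed

subsection \<open>Induction\<close>

text \<open>The predicate \<open>inv t \<otimes> g \<in> H\<close> is the same for all
  \<open>g\<close> in one left coset, so a representative chosen from it by \<open>SOME\<close> is
  constant on cosets. The image of this choice function is the transversal.\<close>

lemma left_transversal_exists:
  fixes G (structure)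
  assumes G: "group G" and fin: "finite (carrier G)" and H: "subgroup H G"
  shows "\<exists>ts. left_transversal G H ts"
proof -
  interpret group G by fact
  interpret H: subgroup H G by fact
  define c where "c = (\<lambda>g. SOME t. t \<in> carrier G \<and> inv t \<otimes> g \<in> H)"
  have c: "c g \<in> carrier G" "inv (c g) \<otimes> g \<in> H" if "g \<in> carrier G" for g
  proof -
    have "\<exists>t. t \<in> carrier G \<and> inv t \<otimes> g \<in> H" using that by (intro exI[of _ g]) auto
    from someI_ex[OF this] show "c g \<in> carrier G" "inv (c g) \<otimes> g \<in> H" by (auto simp: c_def)
  qed
  have ceq: "c g = c g'" if g: "g \<in> carrier G" "g' \<in> carrier G" "inv g \<otimes> g' \<in> H" for g g'
  proof -
    have "inv t \<otimes> g \<in> H \<longleftrightarrow> inv t \<otimes> g' \<in> H" if t: "t \<in> carrier G" for t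
    proof -
      have 1: "inv t \<otimes> g' = (inv t \<otimes> g) \<otimes> (inv g \<otimes> g')"
        using g t by (simp add: m_assoc[symmetric]) (simp add: m_assoc)
      have 2: "inv t \<otimes> g = (inv t \<otimes> g') \<otimes> inv (inv g \<otimes> g')"
        using g t by (simp add: inv_mult_group m_assoc[symmetric]) (simp add: m_assoc)
      show ?thesis using 1 2 g by (metis H.m_closed H.m_inv_closed)
    qed
    thus ?thesis unfolding c_def by (metis (no_types, lifting))
  qed
  obtain ts where ts: "set ts = c ` carrier G" "distinct ts"
    using finite_distinct_list[of "c ` carrier G"] fin by auto
  have "left_transversal G H ts"
    unfolding left_transversal_def
  proof (intro conjI ballI)
    fix g assume g: "g \<in> carrier G"
    show "\<exists>!t. t \<in> set ts \<and> inv t \<otimes> g \<in> H"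
    proof (rule ex1I[of _ "c g"])
      show "c g \<in> set ts \<and> inv (c g) \<otimes> g \<in> H" using c[OF g] g ts by auto
      fix t assume "t \<in> set ts \<and> inv t \<otimes> g \<in> H"
      then obtain g' where g': "g' \<in> carrier G" "t = c g'" "inv t \<otimes> g \<in> H" using ts by auto
      have "inv (inv (c g') \<otimes> g') \<in> H" using c[OF g'(1)] by simp
      hence "inv g' \<otimes> t \<in> H" using c[OF g'(1)] g' by (simp add: inv_mult_group)
      hence "c g' = c t" using c[OF g'(1)] g' by (intro ceq) auto
      also have "c t = c g" using g' g c by (intro ceq) auto
      finally show "t = c g" using g' by simp
    qed
  qed (use ts c in auto)
  thus ?thesis by blast
qed

lemma sum_lessThan_mult_split:
  fixes f :: "nat \<Rightarrow> 'a::comm_monoid_add"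
  shows "sum f {0..<m * e} = (\<Sum>k<m. \<Sum>a<e. f (k * e + a))"
proof -
  have "sum f {k * e..<k * e + e} = (\<Sum>a<e. f (k * e + a))" for k
    using sum.shift_bounds_nat_ivl[of f 0 "k * e" e]
    by (simp add: lessThan_atLeast0 add.commute)
  thus ?thesis using sum.nat_group[of f e m] by (simp add: lessThan_atLeast0)
qed

lemma mult_add_less_mult:
  fixes k m a e :: nat
  assumes "k < m" "a < e"
  shows "k * e + a < m * e"
proof -
  have "k * e + a < Suc k * e" using assms by simp
  also have "\<dots> \<le> m * e" using assms by (intro mult_le_mono1) simp
  finally show ?thesis .
qed

lemma mult_add_eq_iff:
  fixes k j a b e :: nat
  assumes "a < e" "b < e"
  shows "k * e + a = j * e + b \<longleftrightarrow> k = j \<and> a = b"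
proof
  assume eq: "k * e + a = j * e + b"
  have "(k * e + a) div e = k" "(j * e + b) div e = j" using assms by simp_all
  thus "k = j \<and> a = b" using eq by simp
qed simp

lemma index_split:
  fixes u m e :: nat
  assumes "u < m * e"
  obtains k a where "k < m" "a < e" "u = k * e + a"
proof -
  have "0 < e" using assms by (cases e) auto
  thus ?thesis using assms that[of "u div e" "u mod e"]
    by (simp add: less_mult_imp_div_less)
qed

text \<open>\<open>cross\<close> is Mackey's condition read off on weights: conjugation by an
  element outside \<open>H\<close> never carries a weight of \<open>\<sigma>\<close> to a weight of
  \<open>\<sigma>\<close>. Since the whole group normalises \<open>T\<close>, conjugation makes
  sense on functions on \<open>T\<close>.\<close>

locale induction_data =
  fixes G :: "('g, 'b) monoid_scheme" (structure) and H T e and \<sigma> :: "'g \<Rightarrow> 'c::field mat"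
  assumes G: "group G" and fin: "finite (carrier G)" and H: "subgroup H G"
    and TH: "T \<subseteq> H" and Tn: "g \<in> carrier G \<Longrightarrow> t \<in> T \<Longrightarrow> inv g \<otimes> t \<otimes> g \<in> T"
    and \<sigma>: "weight_rep (G\<lparr>carrier := H\<rparr>) T e \<sigma>" and e: "0 < e"
    and cross: "g \<in> carrier G \<Longrightarrow> g \<notin> H \<Longrightarrow> a < e \<Longrightarrow> b < e \<Longrightarrow>
      \<exists>t \<in> T. \<sigma> (inv g \<otimes> t \<otimes> g) $$ (a, a) \<noteq> \<sigma> t $$ (b, b)"
begin

sublocale group G by (rule G)
sublocale H: subgroup H G by (rule H)

text \<open>The same \<open>SOME\<close> term as in \<open>induced_rep\<close>, so that unfolding
  the induced representation yields this very list.\<close>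

definition "ts = (SOME ts. left_transversal G H ts)"

lemma ts: "left_transversal G H ts"
  unfolding ts_def using left_transversal_exists[OF G fin H] by (rule someI_ex)

lemma ts_carrier [simp]: "k < length ts \<Longrightarrow> ts ! k \<in> carrier G"
  using ts by (auto simp: left_transversal_def)

lemma ts_ex: "g \<in> carrier G \<Longrightarrow> \<exists>k < length ts. inv (ts ! k) \<otimes> g \<in> H"
  using ts unfolding left_transversal_def by (metis in_set_conv_nth)

lemma ts_unique:
  assumes "g \<in> carrier G" "k < length ts" "j < length ts" "inv (ts ! k) \<otimes> g \<in> H" "inv (ts ! j) \<otimes> g \<in> H"
  shows "k = j"
  using assms ts unfolding left_transversal_def by (metis nth_eq_iff_index_eq nth_mem)

lemma rep: "representation (G\<lparr>carrier := H\<rparr>) e \<sigma>"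
  using \<sigma> by (simp add: weight_rep_def)

lemma rep_one: "\<sigma> \<one> = 1\<^sub>m e"
  using representation_one[OF rep subgroup_imp_group[OF H]] by simp

abbreviation "I \<equiv> induced_rep G H \<sigma>"

lemma I_entry:
  assumes "k < length ts" "j < length ts" "a < e" "b < e"
  shows "I g $$ (k * e + a, j * e + b) = (let y = inv (ts ! k) \<otimes> g \<otimes> (ts ! j) in
     if y \<in> H then \<sigma> y $$ (a, b) else 0)"
  using assms mult_add_less_mult rep_one
  by (simp add: induced_rep_def rep_dim_def ts_def[symmetric] Let_def)

lemma I_carrier: "I g \<in> carrier_mat (length ts * e) (length ts * e)"
  using rep_one by (simp add: induced_rep_def rep_dim_def ts_def[symmetric] Let_def)

lemma I_mult:
  assumes g: "g \<in> carrier G" "g' \<in> carrier G"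
  shows "I (g \<otimes> g') = I g * I g'"
proof (rule eq_matI)
  let ?m = "length ts"
  fix u v assume "u < dim_row (I g * I g')" "v < dim_col (I g * I g')"
  hence uv: "u < ?m * e" "v < ?m * e" using I_carrier[of g] I_carrier[of g'] by auto
  obtain k a where u: "k < ?m" "a < e" "u = k * e + a" using index_split[OF uv(1)] .
  obtain j b where v: "j < ?m" "b < e" "v = j * e + b" using index_split[OF uv(2)] .
  \<comment> \<open>In block column \<open>j\<close> of \<open>I g'\<close> only the block row
    \<open>p\<close> of the coset of \<open>g' \<otimes> ts ! j\<close> is nonzero, so the sum over
    blocks in the matrix product has a single term.\<close>
  obtain p where p: "p < ?m" "inv (ts ! p) \<otimes> (g' \<otimes> ts ! j) \<in> H"
    using ts_ex[of "g' \<otimes> ts ! j"] g v by auto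
  define y' where "y' = inv (ts ! p) \<otimes> g' \<otimes> ts ! j"
  have y': "y' \<in> H" using p g v by (simp add: y'_def m_assoc)
  define y where "y = inv (ts ! k) \<otimes> g \<otimes> ts ! p"
  have yG: "y \<in> carrier G" using g u p by (simp add: y_def)
  have yy: "inv (ts ! k) \<otimes> (g \<otimes> g') \<otimes> ts ! j = y \<otimes> y'"
  proof -
    have "y \<otimes> y' = inv (ts ! k) \<otimes> g \<otimes> (ts ! p \<otimes> inv (ts ! p)) \<otimes> g' \<otimes> ts ! j"
      using g u v p by (simp only: y_def y'_def m_assoc inv_closed m_closed ts_carrier)
    thus ?thesis using g u v p by (simp add: m_assoc)
  qed
  have "(I g * I g') $$ (u, v) = (\<Sum>w = 0..<?m * e. I g $$ (u, w) * I g' $$ (w, v))"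
    using uv I_carrier[of g] I_carrier[of g'] by (auto simp: scalar_prod_def)
  also have "\<dots> = (\<Sum>q<?m. \<Sum>c<e. I g $$ (u, q * e + c) * I g' $$ (q * e + c, v))"
    by (rule sum_lessThan_mult_split)
  also have "\<dots> = (\<Sum>q<?m. if q = p then \<Sum>c<e. I g $$ (u, q * e + c) * I g' $$ (q * e + c, v) else 0)"
  proof (intro sum.cong refl)
    fix q assume q: "q \<in> {..<?m}"
    have "I g' $$ (q * e + c, v) = 0" if "q \<noteq> p" "c < e" for c
    proof -
      have "inv (ts ! q) \<otimes> g' \<otimes> ts ! j \<notin> H"
        using ts_unique[of "g' \<otimes> ts ! j" q p] p q g v that by (auto simp: m_assoc)
      thus ?thesis using q v that by (simp add: I_entry)
    qed
    thus "(\<Sum>c<e. I g $$ (u, q * e + c) * I g' $$ (q * e + c, v)) =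
      (if q = p then \<Sum>c<e. I g $$ (u, q * e + c) * I g' $$ (q * e + c, v) else 0)" by auto
  qed
  also have "\<dots> = (\<Sum>c<e. I g $$ (u, p * e + c) * I g' $$ (p * e + c, v))" using p by simp
  also have "\<dots> = (\<Sum>c<e. (if y \<in> H then \<sigma> y $$ (a, c) else 0) * \<sigma> y' $$ (c, b))"
    using u v p y' by (intro sum.cong) (simp_all add: I_entry Let_def flip: y_def y'_def)
  also have "\<dots> = (if y \<in> H then \<sigma> (y \<otimes> y') $$ (a, b) else 0)"
  proof (cases "y \<in> H")
    case True
    have "\<sigma> (y \<otimes> y') = \<sigma> y * \<sigma> y'" using representation_mult[OF rep] True y' by simp
    thus ?thesis using True representation_carrier[OF rep, of y] representation_carrier[OF rep, of y'] y' u v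
      by (auto simp: scalar_prod_def lessThan_atLeast0)
  qed simp
  also have "\<dots> = I (g \<otimes> g') $$ (u, v)"
  proof -
    have "y \<otimes> y' \<in> H \<longleftrightarrow> y \<in> H"
    proof
      assume "y \<otimes> y' \<in> H"
      hence "(y \<otimes> y') \<otimes> inv y' \<in> H" using y' by blast
      thus "y \<in> H" using y' yG by (simp add: m_assoc)
    qed (use y' in blast)
    thus ?thesis using u v yy by (simp add: I_entry)
  qed
  finally show "I (g \<otimes> g') $$ (u, v) = (I g * I g') $$ (u, v)" by simp
qed (use I_carrier[of g] I_carrier[of g'] I_carrier[of "g \<otimes> g'"] in auto)

lemma I_one: "I \<one> = 1\<^sub>m (length ts * e)"
proof (rule eq_matI)
  fix u v assume uv: "u < dim_row (1\<^sub>m (length ts * e))" "v < dim_col (1\<^sub>m (length ts * e))"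
  obtain k a where u: "k < length ts" "a < e" "u = k * e + a" using uv index_split by (metis index_one_mat(2))
  obtain j b where v: "j < length ts" "b < e" "v = j * e + b" using uv index_split by (metis index_one_mat(3))
  have "inv (ts ! k) \<otimes> ts ! j \<in> H \<longleftrightarrow> k = j"
    using ts_unique[of "ts ! j" k j] u v by auto
  moreover have "k * e + a = j * e + b \<longleftrightarrow> k = j \<and> a = b"
    using u v by (intro mult_add_eq_iff)
  ultimately show "I \<one> $$ (u, v) = 1\<^sub>m (length ts * e) $$ (u, v)"
    using u v uv rep_one by (auto simp: I_entry)
qed (use I_carrier in auto)

lemma I_rep: "representation G (length ts * e) I"
  by (rule representationI[OF G I_carrier I_mult I_one])

text \<open>The conjugate of \<open>t\<close> by \<open>ts ! k\<close> lies in \<open>T\<close>,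
  hence in \<open>H\<close>, and can be cancelled; what remains is the coset condition between
  \<open>ts ! k\<close> and \<open>ts ! j\<close>. This is why \<open>T\<close> acts by diagonal
  blocks.\<close>

lemma conj_in_T_iff:
  assumes "t \<in> T" "k < length ts" "j < length ts"
  shows "inv (ts ! k) \<otimes> t \<otimes> ts ! j \<in> H \<longleftrightarrow> k = j"
proof
  have tG: "t \<in> carrier G" using assms TH by auto
  define s where "s = inv (ts ! k) \<otimes> t \<otimes> ts ! k"
  have s: "s \<in> H" using Tn[of "ts ! k" t] TH assms by (auto simp: s_def)
  assume *: "inv (ts ! k) \<otimes> t \<otimes> ts ! j \<in> H"
  have "inv s \<otimes> (inv (ts ! k) \<otimes> t \<otimes> ts ! j) = inv (ts ! k) \<otimes> ts ! j"
  proof -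
    have "inv (ts ! k) \<otimes> t \<otimes> ts ! j = s \<otimes> (inv (ts ! k) \<otimes> ts ! j)"
    proof -
      have "s \<otimes> (inv (ts ! k) \<otimes> ts ! j) = inv (ts ! k) \<otimes> t \<otimes> (ts ! k \<otimes> inv (ts ! k)) \<otimes> ts ! j"
        using tG assms by (simp only: s_def m_assoc inv_closed m_closed ts_carrier)
      thus ?thesis using tG assms by simp
    qed
    thus ?thesis using s assms by (simp add: m_assoc[symmetric])
  qed
  hence "inv (ts ! k) \<otimes> ts ! j \<in> H" using s * by (metis H.m_closed H.m_inv_closed)
  thus "k = j" using ts_unique[of "ts ! j" k j] assms by auto
next
  assume "k = j"
  thus "inv (ts ! k) \<otimes> t \<otimes> ts ! j \<in> H" using Tn[of "ts ! k" t] TH assms by auto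
qed

lemma I_T_entry:
  assumes "t \<in> T" "k < length ts" "a < e" "j < length ts" "b < e"
  shows "I t $$ (k * e + a, j * e + b) =
    (if k = j \<and> a = b then \<sigma> (inv (ts ! k) \<otimes> t \<otimes> ts ! k) $$ (a, a) else 0)"
proof -
  have "a \<noteq> b \<Longrightarrow> \<sigma> (inv (ts ! k) \<otimes> t \<otimes> ts ! k) $$ (a, b) = 0"
    using \<sigma> Tn[of "ts ! k" t] assms representation_carrier[OF rep, of "inv (ts ! k) \<otimes> t \<otimes> ts ! k"] TH
    by (auto simp: weight_rep_def diagonal_mat_def)
  thus ?thesis using assms conj_in_T_iff[of t k j] by (auto simp: I_entry Let_def)
qed

text \<open>The representative of the trivial coset lies in \<open>H\<close> but may differ from the
  identity, so a weight of \<open>\<sigma>\<close> reappears only up to conjugation by that element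
  \<open>c\<close>.\<close>

lemma I_weight_H:
  assumes "a < e"
  shows "\<exists>u < length ts * e. \<exists>c \<in> H. \<forall>t \<in> T. I t $$ (u, u) = \<sigma> (inv c \<otimes> t \<otimes> c) $$ (a, a)"
proof -
  obtain k where k: "k < length ts" "inv (ts ! k) \<otimes> \<one> \<in> H" using ts_ex[of \<one>] by auto
  hence "ts ! k \<in> H" using H.m_inv_closed[of "inv (ts ! k)"] by simp
  thus ?thesis using k assms mult_add_less_mult[OF k(1) assms]
    by (intro exI[of _ "k * e + a"] conjI bexI[of _ "ts ! k"]) (auto simp: I_T_entry)
qed

lemma dim_pos: "0 < length ts * e"
  using ts_ex[of \<one>] e by auto

lemma I_weight_rep: "weight_rep G T (length ts * e) I"
  unfolding weight_rep_def
proof (intro conjI allI impI ballI)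
  let ?D = "length ts * e"
  show "representation G ?D I" by (rule I_rep)
  show "diagonal_mat (I t)" if t: "t \<in> T" for t
    unfolding diagonal_mat_def
  proof (intro allI impI)
    fix u v assume uv: "u < dim_row (I t)" "v < dim_col (I t)" "u \<noteq> v"
    obtain k a where u: "k < length ts" "a < e" "u = k * e + a"
      using uv I_carrier[of t] index_split by (metis carrier_matD(1))
    obtain j b where v: "j < length ts" "b < e" "v = j * e + b"
      using uv I_carrier[of t] index_split by (metis carrier_matD(2))
    show "I t $$ (u, v) = 0" using u v uv t by (auto simp: I_T_entry)
  qed
  fix u v assume uv: "u < ?D" "v < ?D"
  obtain k a where u: "k < length ts" "a < e" "u = k * e + a" using index_split[OF uv(1)] .
  obtain j b where v: "j < length ts" "b < e" "v = j * e + b" using index_split[OF uv(2)] .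
  \<comment> \<open>With \<open>t' = ts ! j \<otimes> s \<otimes> inv (ts ! j)\<close> the block
    \<open>j\<close> sees \<open>s\<close> itself, and the block \<open>k\<close> sees the conjugate
    of \<open>s\<close> by \<open>inv (ts ! j) \<otimes> ts ! k\<close>.\<close>
  have conj: "t' \<in> T" "inv (ts ! j) \<otimes> t' \<otimes> ts ! j = s"
    "inv (ts ! k) \<otimes> t' \<otimes> ts ! k = inv (inv (ts ! j) \<otimes> ts ! k) \<otimes> s \<otimes> (inv (ts ! j) \<otimes> ts ! k)"
    if s: "s \<in> T" "t' = ts ! j \<otimes> s \<otimes> inv (ts ! j)" for s t'
  proof -
    have sG: "s \<in> carrier G" using s TH by auto
    show "t' \<in> T" using Tn[of "inv (ts ! j)" s] s v by simp
    have "inv (ts ! j) \<otimes> t' \<otimes> ts ! j = (inv (ts ! j) \<otimes> ts ! j) \<otimes> s \<otimes> (inv (ts ! j) \<otimes> ts ! j)"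
      using s sG v by (simp only: m_assoc inv_closed m_closed ts_carrier)
    thus "inv (ts ! j) \<otimes> t' \<otimes> ts ! j = s" using sG v by simp
    show "inv (ts ! k) \<otimes> t' \<otimes> ts ! k = inv (inv (ts ! j) \<otimes> ts ! k) \<otimes> s \<otimes> (inv (ts ! j) \<otimes> ts ! k)"
      using s sG v u by (simp add: inv_mult_group m_assoc)
  qed
  \<comment> \<open>Inside one block the weights are separated by \<open>\<sigma>\<close>. Between
    two blocks the quotient of the representatives lies outside \<open>H\<close>, and
    \<open>cross\<close> applies to it.\<close>
  show "\<exists>t\<in>T. I t $$ (u, u) \<noteq> I t $$ (v, v)" if "u \<noteq> v"
  proof (cases "k = j")
    case True
    hence "a \<noteq> b" using that u v by auto
    then obtain s where s: "s \<in> T" "\<sigma> s $$ (a, a) \<noteq> \<sigma> s $$ (b, b)"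
      using weight_repD(3)[OF \<sigma> u(2) v(2)] by blast
    note t' = conj[OF s(1) refl]
    have "I (ts ! j \<otimes> s \<otimes> inv (ts ! j)) $$ (u, u) = \<sigma> s $$ (a, a)"
      "I (ts ! j \<otimes> s \<otimes> inv (ts ! j)) $$ (v, v) = \<sigma> s $$ (b, b)"
      using I_T_entry[OF t'(1) u(1,2) u(1,2)] I_T_entry[OF t'(1) v(1,2) v(1,2)]
      unfolding u(3) v(3) True t'(2) by simp_all
    thus ?thesis using t'(1) s(2) by metis
  next
    case False
    have gG: "inv (ts ! j) \<otimes> ts ! k \<in> carrier G" using u v by simp
    have "inv (ts ! j) \<otimes> ts ! k \<notin> H"
      using False ts_unique[of "ts ! k" j k] u v by auto
    from cross[OF gG this u(2) v(2)] obtain s where s: "s \<in> T"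
      "\<sigma> (inv (inv (ts ! j) \<otimes> ts ! k) \<otimes> s \<otimes> (inv (ts ! j) \<otimes> ts ! k)) $$ (a, a) \<noteq> \<sigma> s $$ (b, b)"
      by blast
    note t' = conj[OF s(1) refl]
    have "I (ts ! j \<otimes> s \<otimes> inv (ts ! j)) $$ (u, u) =
        \<sigma> (inv (inv (ts ! j) \<otimes> ts ! k) \<otimes> s \<otimes> (inv (ts ! j) \<otimes> ts ! k)) $$ (a, a)"
      "I (ts ! j \<otimes> s \<otimes> inv (ts ! j)) $$ (v, v) = \<sigma> s $$ (b, b)"
      using I_T_entry[OF t'(1) u(1,2) u(1,2)] I_T_entry[OF t'(1) v(1,2) v(1,2)]
      unfolding u(3) v(3) t'(2,3) by (simp_all only: simp_thms if_True)
    thus ?thesis using t'(1) s(2) by metis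
  qed
  have "\<exists>h \<in> carrier (G\<lparr>carrier := H\<rparr>). moves_basis e (\<sigma> h) b a"
    by (rule weight_repD(4)[OF \<sigma> u(2) v(2)])
  then obtain h where h: "h \<in> H" "moves_basis e (\<sigma> h) b a" by auto
  then obtain c where c: "c \<noteq> 0" "\<And>x. x < e \<Longrightarrow> \<sigma> h $$ (x, b) = (if x = a then c else 0)"
    unfolding moves_basis_def by blast
  \<comment> \<open>This element carries block \<open>j\<close> to block \<open>k\<close> and acts
    there by \<open>\<sigma> h\<close>, which links the positions \<open>b\<close> and
    \<open>a\<close>.\<close>
  define g where "g = ts ! k \<otimes> h \<otimes> inv (ts ! j)"
  have hG: "h \<in> carrier G" using h by auto
  have gj: "inv (ts ! p) \<otimes> g \<otimes> ts ! j = inv (ts ! p) \<otimes> ts ! k \<otimes> h" if "p < length ts" for p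
  proof -
    have "inv (ts ! p) \<otimes> g \<otimes> ts ! j = inv (ts ! p) \<otimes> ts ! k \<otimes> h \<otimes> (inv (ts ! j) \<otimes> ts ! j)"
      using that u v hG by (simp only: g_def m_assoc inv_closed m_closed ts_carrier)
    thus ?thesis using that u v hG by simp
  qed
  have ph: "inv (ts ! p) \<otimes> ts ! k \<otimes> h \<in> H \<longleftrightarrow> p = k" if p: "p < length ts" for p
  proof
    assume "inv (ts ! p) \<otimes> ts ! k \<otimes> h \<in> H"
    hence "inv (ts ! p) \<otimes> ts ! k \<otimes> h \<otimes> inv h \<in> H" using h by blast
    hence "inv (ts ! p) \<otimes> ts ! k \<in> H" using p u hG by (simp add: m_assoc)
    thus "p = k" using ts_unique[of "ts ! k" p k] u p by auto
  qed (use u h in auto)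
  show "\<exists>g\<in>carrier G. moves_basis ?D (I g) v u"
  proof (rule bexI[of _ g], unfold moves_basis_def, intro exI[of _ c] conjI allI impI)
    show "c \<noteq> 0" by fact
    fix w assume "w < ?D"
    then obtain p x where w: "p < length ts" "x < e" "w = p * e + x" by (rule index_split)
    have "p * e + x = k * e + a \<longleftrightarrow> p = k \<and> x = a"
      using u w by (intro mult_add_eq_iff)
    thus "I g $$ (w, v) = (if w = u then c else 0)"
      using ph[OF w(1)] c(2)[OF w(2)] hG u(1)
      unfolding w(3) u(3) v(3) I_entry[OF w(1) v(1) w(2) v(2)] Let_def gj[OF w(1)]
      by (cases "p = k") simp_all
  qed (use hG u v in \<open>simp add: g_def\<close>)
qed

end

subsection \<open>Kronecker products\<close>

text \<open>Mixed-radix digits, most significant first. This order matches the right-nested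
  \<open>kronecker_list\<close>, so an index of the tensor product becomes the tuple of indices of
  its factors.\<close>

fun digits :: "nat list \<Rightarrow> nat \<Rightarrow> nat list" where
  "digits [] u = []"
| "digits (d # ds) u = u div prod_list ds # digits ds (u mod prod_list ds)"

lemma digits_less:
  "u < prod_list ds \<Longrightarrow> list_all2 (<) (digits ds u) ds"
proof (induction ds arbitrary: u)
  case (Cons d ds)
  hence "0 < prod_list ds" by (cases "prod_list ds") auto
  thus ?case using Cons by (auto simp: less_mult_imp_div_less)
qed simp

lemma length_digits [simp]: "length (digits ds u) = length ds"
  by (induction ds arbitrary: u) auto

lemma digits_inj:
  "u < prod_list ds \<Longrightarrow> v < prod_list ds \<Longrightarrow> digits ds u = digits ds v \<Longrightarrow> u = v"
proof (induction ds arbitrary: u v)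
  case (Cons d ds)
  hence "0 < prod_list ds" by (cases "prod_list ds") auto
  hence "u mod prod_list ds = v mod prod_list ds" using Cons by auto
  moreover have "u div prod_list ds = v div prod_list ds" using Cons by auto
  ultimately show ?case by (metis div_mult_mod_eq)
qed simp

lemma digits_surj:
  "list_all2 (<) us ds \<Longrightarrow> \<exists>u < prod_list ds. digits ds u = us"
proof (induction rule: list_all2_induct)
  case (Cons x xs d ds)
  then obtain u where u: "u < prod_list ds" "digits ds u = xs" by blast
  have "x * prod_list ds + u < d * prod_list ds" by (rule mult_add_less_mult) (use Cons u in auto)
  moreover have "prod_list ds \<noteq> 0" using u(1) by linarith
  ultimately show ?case using u by (intro exI[of _ "x * prod_list ds + u"]) auto
qed simp

lemma kronecker_carrier:
  "A \<in> carrier_mat a b \<Longrightarrow> B \<in> carrier_mat c d \<Longrightarrow> kronecker A B \<in> carrier_mat (a * c) (b * d)"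
  by (auto simp: kronecker_def)

lemma kronecker_mult:
  fixes A B C D :: "'a::comm_semiring_1 mat"
  assumes A: "A \<in> carrier_mat a a" "C \<in> carrier_mat a a" and B: "B \<in> carrier_mat b b" "D \<in> carrier_mat b b"
  shows "kronecker (A * C) (B * D) = kronecker A B * kronecker C D"
proof (rule eq_matI)
  fix u v assume "u < dim_row (kronecker A B * kronecker C D)" "v < dim_col (kronecker A B * kronecker C D)"
  hence uv: "u < a * b" "v < a * b" using assms by (auto simp: kronecker_def)
  hence b: "0 < b" by (cases b) auto
  have uv': "u div b < a" "v div b < a" using uv by (auto simp: less_mult_imp_div_less)
  have "(kronecker A B * kronecker C D) $$ (u, v) =
      (\<Sum>w = 0..<a * b. kronecker A B $$ (u, w) * kronecker C D $$ (w, v))"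
    using assms uv by (auto simp: kronecker_def scalar_prod_def)
  also have "\<dots> = (\<Sum>k<a. \<Sum>j<b. kronecker A B $$ (u, k * b + j) * kronecker C D $$ (k * b + j, v))"
    by (rule sum_lessThan_mult_split)
  also have "\<dots> = (\<Sum>k<a. \<Sum>j<b. (A $$ (u div b, k) * C $$ (k, v div b)) * (B $$ (u mod b, j) * D $$ (j, v mod b)))"
    using assms uv b mult_add_less_mult[of _ a _ b]
    by (intro sum.cong refl) (auto simp: kronecker_def mult_ac)
  also have "\<dots> = (\<Sum>k<a. A $$ (u div b, k) * C $$ (k, v div b)) * (\<Sum>j<b. B $$ (u mod b, j) * D $$ (j, v mod b))"
    by (simp add: sum_product)
  also have "\<dots> = kronecker (A * C) (B * D) $$ (u, v)"
    using assms uv uv' b by (auto simp: kronecker_def scalar_prod_def lessThan_atLeast0)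
  finally show "kronecker (A * C) (B * D) $$ (u, v) = (kronecker A B * kronecker C D) $$ (u, v)" by simp
qed (use assms in \<open>auto simp: kronecker_def\<close>)

lemma kronecker_one: "kronecker (1\<^sub>m a) (1\<^sub>m b) = (1\<^sub>m (a * b) :: 'a::semiring_1 mat)"
proof (rule eq_matI)
  fix u v assume "u < dim_row (1\<^sub>m (a * b) :: 'a mat)" "v < dim_col (1\<^sub>m (a * b) :: 'a mat)"
  hence uv: "u < a * b" "v < a * b" by auto
  hence b: "0 < b" by (cases b) auto
  have uv': "u div b < a" "v div b < a" using uv by (auto simp: less_mult_imp_div_less)
  have "u = v" if "u div b = v div b" "u mod b = v mod b" using that by (metis div_mult_mod_eq)
  thus "kronecker (1\<^sub>m a) (1\<^sub>m b) $$ (u, v) = (1\<^sub>m (a * b) :: 'a mat) $$ (u, v)"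
    using uv uv' b by (auto simp: kronecker_def)
qed (auto simp: kronecker_def)

lemma kronecker_list_Cons: "kronecker_list (A # As) = kronecker A (kronecker_list As)"
  by (simp add: kronecker_list_def)

lemma kronecker_list_carrier:
  "list_all2 (\<lambda>Z d. Z \<in> carrier_mat d d) As ds \<Longrightarrow>
    kronecker_list As \<in> carrier_mat (prod_list ds) (prod_list ds)"
proof (induction rule: list_all2_induct)
  case Nil
  show ?case by (simp add: kronecker_list_def)
next
  case (Cons A As d ds)
  thus ?case by (simp add: kronecker_list_Cons kronecker_carrier)
qed

lemma kronecker_list_index:
  "list_all2 (\<lambda>Z d. Z \<in> carrier_mat d d) As ds \<Longrightarrow> u < prod_list ds \<Longrightarrow> v < prod_list ds \<Longrightarrow>
    kronecker_list As $$ (u, v) = (\<Prod>k<length ds. (As ! k) $$ (digits ds u ! k, digits ds v ! k))"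
proof (induction arbitrary: u v rule: list_all2_induct)
  case Nil
  thus ?case by (simp add: kronecker_list_def)
next
  case (Cons A As d ds)
  hence pos: "0 < prod_list ds" by (cases "prod_list ds") auto
  have "kronecker_list As \<in> carrier_mat (prod_list ds) (prod_list ds)"
    using Cons by (intro kronecker_list_carrier)
  thus ?case using Cons.prems Cons.hyps(1) Cons.IH[of "u mod prod_list ds" "v mod prod_list ds"] pos
    by (simp add: kronecker_list_Cons kronecker_def prod.lessThan_Suc_shift del: prod.lessThan_Suc)
qed

lemma kronecker_list_mult:
  fixes As Bs :: "'a::comm_semiring_1 mat list"
  assumes "list_all2 (\<lambda>Z d. Z \<in> carrier_mat d d) As ds" "list_all2 (\<lambda>Z d. Z \<in> carrier_mat d d) Bs ds"
  shows "kronecker_list (map2 (*) As Bs) = kronecker_list As * kronecker_list Bs"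
  using assms
proof (induction As ds arbitrary: Bs rule: list_all2_induct)
  case Nil
  thus ?case by (simp add: kronecker_list_def)
next
  case (Cons A As d ds)
  then obtain B Bs' where B: "Bs = B # Bs'" "B \<in> carrier_mat d d"
    "list_all2 (\<lambda>Z d. Z \<in> carrier_mat d d) Bs' ds" by (auto simp: list_all2_Cons2)
  have "kronecker_list As \<in> carrier_mat (prod_list ds) (prod_list ds)"
    "kronecker_list Bs' \<in> carrier_mat (prod_list ds) (prod_list ds)"
    using Cons B by (auto intro: kronecker_list_carrier)
  thus ?case using B Cons.IH[OF B(3)] Cons.hyps by (simp add: kronecker_list_Cons kronecker_mult)
qed

lemma kronecker_list_one: "kronecker_list (map (1\<^sub>m) ds) = 1\<^sub>m (prod_list ds)"
  by (induction ds) (simp_all add: kronecker_list_Cons kronecker_one, simp add: kronecker_list_def)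

text \<open>Separation is required factor by factor, by elements acting as the identity in all other
  factors: otherwise a difference in one factor could be compensated in the product. Transitivity
  has to be simultaneous, since one group element acts on all factors at once.\<close>

lemma kronecker_weight_rep:
  fixes \<rho>s :: "('g \<Rightarrow> 'c::field mat) list"
  assumes G: "group G" and len: "length \<rho>s = length ds" and T: "T \<subseteq> carrier G"
    and rep: "\<And>k. k < length ds \<Longrightarrow> representation G (ds ! k) (\<rho>s ! k)"
    and diag: "\<And>k t. k < length ds \<Longrightarrow> t \<in> T \<Longrightarrow> diagonal_mat ((\<rho>s ! k) t)"
    and sep: "\<And>k i j. k < length ds \<Longrightarrow> i < ds ! k \<Longrightarrow> j < ds ! k \<Longrightarrow> i \<noteq> j \<Longrightarrow>
      \<exists>t \<in> T. (\<rho>s ! k) t $$ (i, i) \<noteq> (\<rho>s ! k) t $$ (j, j) \<and>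
        (\<forall>k' < length ds. k' \<noteq> k \<longrightarrow> (\<rho>s ! k') t = 1\<^sub>m (ds ! k'))"
    and tra: "\<And>us vs. list_all2 (<) us ds \<Longrightarrow> list_all2 (<) vs ds \<Longrightarrow>
      \<exists>g \<in> carrier G. \<forall>k < length ds. moves_basis (ds ! k) ((\<rho>s ! k) g) (vs ! k) (us ! k)"
  shows "weight_rep G T (prod_list ds) (\<lambda>g. kronecker_list (map (\<lambda>\<rho>. \<rho> g) \<rho>s))"
proof -
  define D where "D = prod_list ds"
  define K where "K = (\<lambda>g. kronecker_list (map (\<lambda>\<rho>. \<rho> g) \<rho>s))"
  have car: "list_all2 (\<lambda>Z d. Z \<in> carrier_mat d d) (map (\<lambda>\<rho>. \<rho> g) \<rho>s) ds" if "g \<in> carrier G" for g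
    using len representation_carrier[OF rep that] by (auto simp: list_all2_conv_all_nth)
  have Kcar: "K g \<in> carrier_mat D D" if "g \<in> carrier G" for g
    unfolding K_def D_def using car[OF that] by (rule kronecker_list_carrier)
  have entry: "K g $$ (u, v) = (\<Prod>k<length ds. (\<rho>s ! k) g $$ (digits ds u ! k, digits ds v ! k))"
    if "g \<in> carrier G" "u < D" "v < D" for g u v
    using kronecker_list_index[OF car[OF that(1)]] that len by (auto simp: K_def D_def intro!: prod.cong)
  have dig: "digits ds u ! k < ds ! k" if "u < D" "k < length ds" for u k
    using digits_less[of u ds] that by (auto simp: D_def list_all2_conv_all_nth)
  have digneq: "\<exists>k < length ds. digits ds u ! k \<noteq> digits ds v ! k" if "u < D" "v < D" "u \<noteq> v" for u v
    using digits_inj[of u ds v] that nth_equalityI[of "digits ds u" "digits ds v"] by (auto simp: D_def)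
  have "weight_rep G T D K"
    unfolding weight_rep_def
  proof (intro conjI allI impI ballI)
    show "representation G D K"
    proof (rule representationI[OF G Kcar])
      fix g g' assume g: "g \<in> carrier G" "g' \<in> carrier G"
      have "map (\<lambda>\<rho>. \<rho> (g \<otimes>\<^bsub>G\<^esub> g')) \<rho>s = map2 (*) (map (\<lambda>\<rho>. \<rho> g) \<rho>s) (map (\<lambda>\<rho>. \<rho> g') \<rho>s)"
        using representation_mult[OF rep g] len by (auto intro: nth_equalityI)
      thus "K (g \<otimes>\<^bsub>G\<^esub> g') = K g * K g'"
        unfolding K_def using kronecker_list_mult[OF car car] g by simp
    next
      have "map (\<lambda>\<rho>. \<rho> \<one>\<^bsub>G\<^esub>) \<rho>s = map (1\<^sub>m) ds"
        using representation_one[OF rep G] len by (auto intro: nth_equalityI)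
      thus "K \<one>\<^bsub>G\<^esub> = 1\<^sub>m D" unfolding K_def D_def by (simp add: kronecker_list_one)
    qed
    show "diagonal_mat (K t)" if t: "t \<in> T" for t
      unfolding diagonal_mat_def
    proof (intro allI impI)
      have tG: "t \<in> carrier G" using t T by auto
      fix u v assume "u < dim_row (K t)" "v < dim_col (K t)" and neq: "u \<noteq> v"
      hence uv: "u < D" "v < D" using Kcar[OF tG] by auto
      obtain k where k: "k < length ds" "digits ds u ! k \<noteq> digits ds v ! k" using digneq[OF uv neq] by blast
      have "(\<rho>s ! k) t $$ (digits ds u ! k, digits ds v ! k) = 0"
        using diag[OF k(1) t] k dig[OF uv(1) k(1)] dig[OF uv(2) k(1)] representation_carrier[OF rep[OF k(1)] tG]
        by (auto simp: diagonal_mat_def)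
      thus "K t $$ (u, v) = 0" using entry[OF tG uv] k by (auto intro!: prod_zero)
    qed
    fix u v assume uv: "u < D" "v < D"
    show "\<exists>t\<in>T. K t $$ (u, u) \<noteq> K t $$ (v, v)" if neq: "u \<noteq> v"
    proof -
      obtain k where k: "k < length ds" "digits ds u ! k \<noteq> digits ds v ! k" using digneq[OF uv neq] by blast
      from sep[OF k(1) dig[OF uv(1) k(1)] dig[OF uv(2) k(1)] k(2)] obtain t where t: "t \<in> T"
        "(\<rho>s ! k) t $$ (digits ds u ! k, digits ds u ! k) \<noteq> (\<rho>s ! k) t $$ (digits ds v ! k, digits ds v ! k)"
        "\<forall>k' < length ds. k' \<noteq> k \<longrightarrow> (\<rho>s ! k') t = 1\<^sub>m (ds ! k')" by blast
      have tG: "t \<in> carrier G" using t T by auto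
      have "K t $$ (w, w) = (\<rho>s ! k) t $$ (digits ds w ! k, digits ds w ! k)" if w: "w < D" for w
      proof -
        have "K t $$ (w, w) = (\<rho>s ! k) t $$ (digits ds w ! k, digits ds w ! k) *
            (\<Prod>j \<in> {..<length ds} - {k}. (\<rho>s ! j) t $$ (digits ds w ! j, digits ds w ! j))"
          unfolding entry[OF tG w w] using k by (subst prod.remove[of _ k]) auto
        also have "(\<Prod>j \<in> {..<length ds} - {k}. (\<rho>s ! j) t $$ (digits ds w ! j, digits ds w ! j)) = 1"
          using t(3) dig[OF w] by (intro prod.neutral) auto
        finally show ?thesis by simp
      qed
      thus ?thesis using t(1,2) uv by metis
    qed
    obtain g where g: "g \<in> carrier G"
      "\<forall>k < length ds. moves_basis (ds ! k) ((\<rho>s ! k) g) (digits ds v ! k) (digits ds u ! k)"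
      using tra[OF digits_less digits_less] uv by (metis D_def)
    then obtain c where c: "\<And>k. k < length ds \<Longrightarrow> c k \<noteq> 0"
      "\<And>k a. k < length ds \<Longrightarrow> a < ds ! k \<Longrightarrow>
        (\<rho>s ! k) g $$ (a, digits ds v ! k) = (if a = digits ds u ! k then c k else 0)"
      unfolding moves_basis_def by metis
    have "K g $$ (w, v) = (if w = u then prod c {..<length ds} else 0)" if w: "w < D" for w
    proof (cases "w = u")
      case True
      thus ?thesis using entry[OF g(1) w uv(2)] c(2) dig[OF w] by simp
    next
      case False
      obtain k where "k < length ds" "digits ds w ! k \<noteq> digits ds u ! k" using digneq[OF w uv(1) False] by blast
      hence "\<exists>k \<in> {..<length ds}. (\<rho>s ! k) g $$ (digits ds w ! k, digits ds v ! k) = 0"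
        using c(2) dig[OF w] by (intro bexI[of _ k]) auto
      thus ?thesis using False entry[OF g(1) w uv(2)] by (auto intro!: prod_zero)
    qed
    thus "\<exists>g \<in> carrier G. moves_basis D (K g) v u"
      using g(1) c(1) by (intro bexI[of _ g]) (auto simp: moves_basis_def intro!: exI[of _ "prod c {..<length ds}"])
  qed
  thus ?thesis by (simp add: K_def D_def)
qed

subsection \<open>Twisting and inflation\<close>

lemma class_ring_character:
  fixes \<phi> :: "'g \<Rightarrow> 'c::field"
  shows "\<phi> \<in> hom G (units_of class_ring) \<longleftrightarrow> (\<forall>x \<in> carrier G. \<phi> x \<noteq> 0) \<and>
    (\<forall>x \<in> carrier G. \<forall>y \<in> carrier G. \<phi> (x \<otimes>\<^bsub>G\<^esub> y) = \<phi> x * \<phi> y)"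
proof -
  have "carrier (units_of (class_ring :: 'c ring)) = {x. x \<noteq> 0}"
    by (auto simp: units_of_def Units_def) (metis left_inverse right_inverse)
  moreover have "x \<otimes>\<^bsub>units_of class_ring\<^esub> y = x * y" for x y :: 'c
    by (simp add: units_of_def)
  ultimately show ?thesis by (auto simp: hom_def)
qed

lemma smult_mat_mult_smult_mat:
  fixes A B :: "'a::comm_semiring_1 mat"
  assumes "A \<in> carrier_mat n k" "B \<in> carrier_mat k m"
  shows "(a \<cdot>\<^sub>m A) * (b \<cdot>\<^sub>m B) = (a * b) \<cdot>\<^sub>m (A * B)"
  using assms by (intro eq_matI) (auto simp: scalar_prod_def sum_distrib_left mult_ac)

text \<open>The twist multiplies all diagonal entries at one element by the same nonzero scalar, so
  weights that differ at some element still differ there. The two surjectivity assumptions pull the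
  witnesses in \<open>TL\<close> and \<open>L\<close> back along \<open>p\<close>.\<close>

lemma weight_rep_inflate:
  fixes \<nu> :: "'g \<Rightarrow> 'c::field mat"
  assumes H: "group H" and L: "group L" and T: "T \<subseteq> carrier H" and \<nu>: "weight_rep L TL e \<nu>"
    and p: "p \<in> hom H L" and surj: "\<And>x. x \<in> carrier L \<Longrightarrow> \<exists>h \<in> carrier H. p h = x"
    and pT: "\<And>t. t \<in> T \<Longrightarrow> p t \<in> TL" and surjT: "\<And>t. t \<in> TL \<Longrightarrow> \<exists>s \<in> T. p s = t"
    and \<phi>: "\<phi> \<in> hom L (units_of (class_ring :: 'c ring))"
  shows "weight_rep H T e (\<lambda>g. \<phi> (p g) \<cdot>\<^sub>m \<nu> (p g))"
proof -
  have rep: "representation L e \<nu>" using \<nu> by (simp add: weight_rep_def)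
  note car = representation_carrier[OF rep]
  have pL: "p h \<in> carrier L" if "h \<in> carrier H" for h using p that by (auto simp: hom_def)
  have pm: "p (h \<otimes>\<^bsub>H\<^esub> h') = p h \<otimes>\<^bsub>L\<^esub> p h'" if "h \<in> carrier H" "h' \<in> carrier H" for h h'
    using p that by (auto simp: hom_def)
  have p1: "p \<one>\<^bsub>H\<^esub> = \<one>\<^bsub>L\<^esub>" using hom_one[OF p H L] .
  have phi0: "\<phi> x \<noteq> 0" and phim: "y \<in> carrier L \<Longrightarrow> \<phi> (x \<otimes>\<^bsub>L\<^esub> y) = \<phi> x * \<phi> y"
    if "x \<in> carrier L" for x y using \<phi> that by (auto simp: class_ring_character)
  have phi1: "\<phi> \<one>\<^bsub>L\<^esub> = 1"
  proof -
    interpret L: group L by fact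
    have "\<phi> \<one>\<^bsub>L\<^esub> * \<phi> \<one>\<^bsub>L\<^esub> = \<phi> \<one>\<^bsub>L\<^esub>" using phim[of "\<one>\<^bsub>L\<^esub>" "\<one>\<^bsub>L\<^esub>", symmetric] by simp
    thus ?thesis using phi0[of "\<one>\<^bsub>L\<^esub>"] by simp
  qed
  show ?thesis unfolding weight_rep_def
  proof (intro conjI allI impI ballI)
    show "representation H e (\<lambda>g. \<phi> (p g) \<cdot>\<^sub>m \<nu> (p g))"
    proof (rule representationI[OF H])
      fix g g' assume g: "g \<in> carrier H" "g' \<in> carrier H"
      show "\<phi> (p (g \<otimes>\<^bsub>H\<^esub> g')) \<cdot>\<^sub>m \<nu> (p (g \<otimes>\<^bsub>H\<^esub> g')) = \<phi> (p g) \<cdot>\<^sub>m \<nu> (p g) * (\<phi> (p g') \<cdot>\<^sub>m \<nu> (p g'))"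
        unfolding pm[OF g] phim[OF pL[OF g(1)] pL[OF g(2)]] representation_mult[OF rep pL[OF g(1)] pL[OF g(2)]]
        by (rule smult_mat_mult_smult_mat[OF car[OF pL[OF g(1)]] car[OF pL[OF g(2)]], symmetric])
    qed (use car pL representation_one[OF rep L] in \<open>auto simp: p1 phi1\<close>)
    show "diagonal_mat (\<phi> (p t) \<cdot>\<^sub>m \<nu> (p t))" if "t \<in> T" for t
    proof -
      have "diagonal_mat (\<nu> (p t))" by (rule weight_repD(2)[OF \<nu> pT[OF that]])
      thus ?thesis by (auto simp: diagonal_mat_def)
    qed
    fix i j assume ij: "i < e" "j < e"
    show "\<exists>t\<in>T. (\<phi> (p t) \<cdot>\<^sub>m \<nu> (p t)) $$ (i, i) \<noteq> (\<phi> (p t) \<cdot>\<^sub>m \<nu> (p t)) $$ (j, j)" if neq: "i \<noteq> j"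
    proof -
      obtain t where t: "t \<in> TL" "\<nu> t $$ (i, i) \<noteq> \<nu> t $$ (j, j)"
        using weight_repD(3)[OF \<nu> ij neq] by blast
      obtain s where s: "s \<in> T" "p s = t" using surjT[OF t(1)] by blast
      have "t \<in> carrier L" using s T pL by auto
      thus ?thesis using s t ij car[of t] phi0[of t] by (intro bexI[of _ s]) auto
    qed
    obtain x where x: "x \<in> carrier L" "moves_basis e (\<nu> x) j i"
      using weight_repD(4)[OF \<nu> ij] by blast
    obtain h where h: "h \<in> carrier H" "p h = x" using surj[OF x(1)] by blast
    obtain c where c: "c \<noteq> 0" "\<forall>a<e. \<nu> x $$ (a, j) = (if a = i then c else 0)"
      using x(2) unfolding moves_basis_def by blast
    have "moves_basis e (\<phi> x \<cdot>\<^sub>m \<nu> x) j i"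
      unfolding moves_basis_def
    proof (intro exI[of _ "\<phi> x * c"] conjI allI impI)
      show "\<phi> x * c \<noteq> 0" using c(1) phi0[OF x(1)] by simp
      show "(\<phi> x \<cdot>\<^sub>m \<nu> x) $$ (a, j) = (if a = i then \<phi> x * c else 0)" if "a < e" for a
        using that c(2) car[OF x(1)] ij by simp
    qed
    thus "\<exists>g\<in>carrier H. moves_basis e (\<phi> (p g) \<cdot>\<^sub>m \<nu> (p g)) j i"
      using h by (intro bexI[of _ h]) simp_all
  qed
qed

section \<open>Matrices over truncated power series\<close>

text \<open>A subring given as a set, so that one body of lemmas serves both the full type of the
  base field and the finite subfields of its algebraic closure.\<close>

definition coeff_ring :: "'a::comm_ring_1 set \<Rightarrow> bool" where
  "coeff_ring k \<longleftrightarrow> 1 \<in> k \<and> (\<forall>x\<in>k. \<forall>y\<in>k. x - y \<in> k \<and> x * y \<in> k)"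

lemma coeff_ring_closed:
  assumes "coeff_ring k"
  shows "0 \<in> k" "1 \<in> k" "x \<in> k \<Longrightarrow> y \<in> k \<Longrightarrow> x - y \<in> k" "x \<in> k \<Longrightarrow> y \<in> k \<Longrightarrow> x * y \<in> k"
    "x \<in> k \<Longrightarrow> - x \<in> k" "x \<in> k \<Longrightarrow> y \<in> k \<Longrightarrow> x + y \<in> k"
proof -
  show 0: "0 \<in> k" using assms unfolding coeff_ring_def by (metis diff_self)
  show neg: "- x \<in> k" if "x \<in> k" for x using assms 0 that unfolding coeff_ring_def by (metis diff_0)
  show "x \<in> k \<Longrightarrow> y \<in> k \<Longrightarrow> x + y \<in> k"
    using assms neg[of y] unfolding coeff_ring_def by (metis diff_minus_eq_add)
qed (use assms in \<open>auto simp: coeff_ring_def\<close>)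

lemma coeff_ring_sum:
  assumes "coeff_ring k" "\<And>i. i \<in> I \<Longrightarrow> f i \<in> k"
  shows "sum f I \<in> k"
  using assms(2) by (induction I rule: infinite_finite_induct) (auto simp: coeff_ring_closed[OF assms(1)])

lemma coeff_ring_prod:
  assumes "coeff_ring k" "\<And>i. i \<in> I \<Longrightarrow> f i \<in> k"
  shows "prod f I \<in> k"
  using assms(2) by (induction I rule: infinite_finite_induct) (auto simp: coeff_ring_closed[OF assms(1)])

definition fps_over :: "'a::comm_ring_1 set \<Rightarrow> 'a fps set" where
  "fps_over k = {x. \<forall>i. fps_nth x i \<in> k}"

lemma fps_overD: "x \<in> fps_over k \<Longrightarrow> fps_nth x i \<in> k"
  by (simp add: fps_over_def)

lemma fps_over_UNIV [simp]: "fps_over UNIV = UNIV"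
  by (simp add: fps_over_def)

lemma coeff_ring_fps_over:
  assumes "coeff_ring k"
  shows "coeff_ring (fps_over k)"
  using assms by (auto simp: coeff_ring_def fps_over_def fps_mult_nth coeff_ring_closed[OF assms] intro!: coeff_ring_sum)

lemma fps_over_closed:
  assumes "coeff_ring k"
  shows "c \<in> k \<Longrightarrow> fps_const c \<in> fps_over k" "x \<in> fps_over k \<Longrightarrow> fps_cutoff m x \<in> fps_over k"
    "x \<in> fps_over k \<Longrightarrow> fps_shift m x \<in> fps_over k" "fps_X ^ m \<in> fps_over k"
  using coeff_ring_closed[OF assms] by (auto simp: fps_over_def)

lemma fps_cutoff_sum: "fps_cutoff m (sum f I) = (\<Sum>i\<in>I. fps_cutoff m (f i))"
  by (auto simp: fps_eq_iff fps_sum_nth)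

lemma fps_cutoff_mult_cong:
  fixes x y :: "'a::comm_ring_1 fps"
  assumes "fps_cutoff m x = fps_cutoff m x'" "fps_cutoff m y = fps_cutoff m y'"
  shows "fps_cutoff m (x * y) = fps_cutoff m (x' * y')"
proof -
  have "x * y - x' * y' = (x - x') * y + x' * (y - y')" by (simp add: algebra_simps)
  thus ?thesis using assms unfolding fps_cutoff_eq_iff_dvd by (metis dvd_add dvd_mult dvd_mult2)
qed

lemma fps_cutoff_cutoff_le [simp]: "i \<le> m \<Longrightarrow> fps_cutoff i (fps_cutoff m x) = fps_cutoff i x"
  by (auto simp: fps_eq_iff)

lemma fps_cutoff_mult_cutoff:
  fixes x y :: "'a::comm_ring_1 fps"
  shows "fps_cutoff m (fps_cutoff m x * y) = fps_cutoff m (x * y)"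
    "fps_cutoff m (x * fps_cutoff m y) = fps_cutoff m (x * y)"
  by (rule fps_cutoff_mult_cong; simp)+

lemma fps_cutoff_X_power_mult:
  fixes x y :: "'a::comm_ring_1 fps"
  assumes "m \<le> i + j" "fps_cutoff j x = fps_cutoff j y"
  shows "fps_cutoff m (fps_X ^ i * x) = fps_cutoff m (fps_X ^ i * y)"
proof -
  have "fps_nth x b = fps_nth y b" if "b < j" for b
    using arg_cong[OF assms(2), of "\<lambda>z. fps_nth z b"] that by simp
  thus ?thesis using assms(1) by (auto simp: fps_eq_iff fps_X_power_mult_nth)
qed

text \<open>Cancelling \<open>fps_X ^ i\<close> costs \<open>i\<close> digits of precision. This
  loss is what turns commutation modulo \<open>\<pi>^r\<close> into commutation modulo
  \<open>\<pi>^l\<close> for elements of the form \<open>1 + \<pi>^l V\<close>.\<close>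

lemma fps_cutoff_X_power_mult_cancel:
  fixes x y :: "'a::comm_ring_1 fps"
  assumes "fps_cutoff (i + j) (fps_X ^ i * x) = fps_cutoff (i + j) (fps_X ^ i * y)"
  shows "fps_cutoff j x = fps_cutoff j y"
proof (rule fps_ext)
  fix a
  have "fps_nth (fps_cutoff (i + j) (fps_X ^ i * x)) (i + a) = fps_nth (fps_cutoff (i + j) (fps_X ^ i * y)) (i + a)"
    using assms by simp
  thus "fps_nth (fps_cutoff j x) a = fps_nth (fps_cutoff j y) a" by (auto simp: fps_X_power_mult_nth split: if_splits)
qed

text \<open>Untruncated representatives: sums and products stay in this set, and truncation is
  applied only when group elements are compared.\<close>

definition mats :: "'a::comm_ring_1 set \<Rightarrow> nat \<Rightarrow> 'a fps mat set" where
  "mats k n = {Z \<in> carrier_mat n n. \<forall>i<n. \<forall>j<n. Z $$ (i, j) \<in> fps_over k}"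

lemma matsD: "Z \<in> mats k n \<Longrightarrow> Z \<in> carrier_mat n n"
  "Z \<in> mats k n \<Longrightarrow> i < n \<Longrightarrow> j < n \<Longrightarrow> Z $$ (i, j) \<in> fps_over k"
  by (auto simp: mats_def)

lemma mats_UNIV [simp]: "mats UNIV n = carrier_mat n n"
  by (auto simp: mats_def)

lemma mats_closed:
  assumes k: "coeff_ring k"
  shows "1\<^sub>m n \<in> mats k n" "0\<^sub>m n n \<in> mats k n"
    "Z \<in> mats k n \<Longrightarrow> Y \<in> mats k n \<Longrightarrow> Z + Y \<in> mats k n"
    "Z \<in> mats k n \<Longrightarrow> Y \<in> mats k n \<Longrightarrow> Z - Y \<in> mats k n"
    "Z \<in> mats k n \<Longrightarrow> Y \<in> mats k n \<Longrightarrow> Z * Y \<in> mats k n"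
    "c \<in> fps_over k \<Longrightarrow> Z \<in> mats k n \<Longrightarrow> c \<cdot>\<^sub>m Z \<in> mats k n"
    "Z \<in> mats k n \<Longrightarrow> map_mat (fps_cutoff m) Z \<in> mats k n"
    "Z \<in> mats k n \<Longrightarrow> map_mat (fps_shift m) Z \<in> mats k n"
  by (auto simp: mats_def scalar_prod_def fps_over_closed[OF k] coeff_ring_closed[OF coeff_ring_fps_over[OF k]]
      intro!: coeff_ring_sum[OF coeff_ring_fps_over[OF k]])

lemma carrier_trunc_mat_ring:
  "carrier (trunc_mat_ring k n m) = {Z \<in> mats k n. map_mat (fps_cutoff m) Z = Z}"
proof (rule equalityI; rule subsetI)
  fix Z assume "Z \<in> carrier (trunc_mat_ring k n m)"
  hence Z: "Z \<in> carrier_mat n n" "elements_mat Z \<subseteq> carrier (trunc_ring k m)" by (simp_all add: trunc_mat_ring_def)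
  have "Z $$ (i, j) \<in> carrier (trunc_ring k m)" if "i < n" "j < n" for i j
    using Z elements_matI[OF Z(1) that refl] by blast
  hence *: "Z $$ (i, j) \<in> fps_over k" "fps_cutoff m (Z $$ (i, j)) = Z $$ (i, j)" if "i < n" "j < n" for i j
    using that by (auto simp: trunc_ring_def fps_over_def)
  show "Z \<in> {Z \<in> mats k n. map_mat (fps_cutoff m) Z = Z}"
    using Z(1) * by (auto simp: mats_def intro!: eq_matI)
next
  fix Z assume "Z \<in> {Z \<in> mats k n. map_mat (fps_cutoff m) Z = Z}"
  hence Z: "Z \<in> carrier_mat n n" "\<And>i j. i < n \<Longrightarrow> j < n \<Longrightarrow> Z $$ (i, j) \<in> fps_over k" "map_mat (fps_cutoff m) Z = Z"
    by (auto simp: mats_def)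
  have "fps_cutoff m (Z $$ (i, j)) = Z $$ (i, j)" if "i < n" "j < n" for i j
    using arg_cong[OF Z(3), of "\<lambda>Y. Y $$ (i, j)"] that Z(1) by simp
  hence "elements_mat Z \<subseteq> carrier (trunc_ring k m)"
    using Z(1,2) by (auto simp: trunc_ring_def fps_over_def dest!: elements_matD)
  thus "Z \<in> carrier (trunc_mat_ring k n m)" using Z(1) by (simp add: trunc_mat_ring_def)
qed

lemma reduce_eq_iff:
  "Z \<in> carrier_mat a b \<Longrightarrow> Y \<in> carrier_mat a b \<Longrightarrow> reduce_mat m Z = reduce_mat m Y \<longleftrightarrow>
    (\<forall>i<a. \<forall>j<b. fps_cutoff m (Z $$ (i, j)) = fps_cutoff m (Y $$ (i, j)))"
  by (auto simp: mat_eq_iff)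

lemma reduce_add_cong:
  fixes A :: "'a::comm_ring_1 fps mat"
  assumes "reduce_mat m A = reduce_mat m A'" "reduce_mat m B = reduce_mat m B'"
    "A \<in> carrier_mat a b" "A' \<in> carrier_mat a b" "B \<in> carrier_mat a b" "B' \<in> carrier_mat a b"
  shows "reduce_mat m (A + B) = reduce_mat m (A' + B')" "reduce_mat m (A - B) = reduce_mat m (A' - B')"
  using assms by (auto simp: mat_eq_iff fps_cutoff_add fps_cutoff_diff)

lemma reduce_mult_cong:
  fixes A :: "'a::comm_ring_1 fps mat"
  assumes "reduce_mat m A = reduce_mat m A'" "reduce_mat m B = reduce_mat m B'"
    and car: "A \<in> carrier_mat a b" "A' \<in> carrier_mat a b" "B \<in> carrier_mat b c" "B' \<in> carrier_mat b c"
  shows "reduce_mat m (A * B) = reduce_mat m (A' * B')"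
proof -
  have "fps_cutoff m (\<Sum>k = 0..<b. A $$ (i, k) * B $$ (k, j)) = fps_cutoff m (\<Sum>k = 0..<b. A' $$ (i, k) * B' $$ (k, j))"
    if "i < a" "j < c" for i j
    using assms(1,2) that car by (auto simp: fps_cutoff_sum reduce_eq_iff intro!: sum.cong fps_cutoff_mult_cong)
  thus ?thesis using car by (auto simp: mat_eq_iff scalar_prod_def)
qed

lemma reduce_smult_cong:
  fixes A :: "'a::comm_ring_1 fps mat"
  assumes "reduce_mat m A = reduce_mat m A'"
  shows "reduce_mat m (c \<cdot>\<^sub>m A) = reduce_mat m (c \<cdot>\<^sub>m A')"
proof -
  have d: "dim_row A = dim_row A'" "dim_col A = dim_col A'"
    using assms by (metis index_map_mat(2), metis index_map_mat(3))
  have "fps_cutoff m (A $$ (i, j)) = fps_cutoff m (A' $$ (i, j))" if "i < dim_row A'" "j < dim_col A'" for i j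
    using arg_cong[OF assms, of "\<lambda>Z. Z $$ (i, j)"] that d by simp
  thus ?thesis using d by (auto simp: mat_eq_iff intro!: fps_cutoff_mult_cong)
qed

lemma reduce_reduce [simp]: "i \<le> m \<Longrightarrow> reduce_mat i (reduce_mat m A) = reduce_mat i A"
  by (auto simp: mat_eq_iff)

lemma reduce_mult_reduce:
  fixes A :: "'a::comm_ring_1 fps mat"
  assumes "A \<in> carrier_mat a b" "B \<in> carrier_mat b c"
  shows "reduce_mat m (reduce_mat m A * B) = reduce_mat m (A * B)" "reduce_mat m (A * reduce_mat m B) = reduce_mat m (A * B)"
  by (rule reduce_mult_cong[of _ _ _ _ _ a b c]; use assms in simp)+

lemma reduce_mono:
  assumes "reduce_mat m A = reduce_mat m B" "i \<le> m"
  shows "reduce_mat i A = reduce_mat i B"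
  using assms by (metis reduce_reduce)

lemma reduce_X_power_smult:
  fixes A :: "'a::comm_ring_1 fps mat"
  assumes "m \<le> i + j" "reduce_mat j A = reduce_mat j B" "A \<in> carrier_mat a b" "B \<in> carrier_mat a b"
  shows "reduce_mat m (fps_X ^ i \<cdot>\<^sub>m A) = reduce_mat m (fps_X ^ i \<cdot>\<^sub>m B)"
  using assms by (auto simp: mat_eq_iff intro!: fps_cutoff_X_power_mult)

lemma reduce_X_power_smult_cancel:
  fixes A :: "'a::comm_ring_1 fps mat"
  assumes "reduce_mat (i + j) (fps_X ^ i \<cdot>\<^sub>m A) = reduce_mat (i + j) (fps_X ^ i \<cdot>\<^sub>m B)"
    "A \<in> carrier_mat a b" "B \<in> carrier_mat a b"
  shows "reduce_mat j A = reduce_mat j B"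
  using assms by (auto simp: mat_eq_iff intro: fps_cutoff_X_power_mult_cancel)

subsection \<open>The general linear groups\<close>

lemma trunc_mat_monoid:
  assumes k: "coeff_ring k"
  shows "monoid (trunc_mat_ring k n m)"
proof (rule monoidI)
  have mult: "A \<otimes>\<^bsub>trunc_mat_ring k n m\<^esub> B = reduce_mat m (A * B)" for A B
    by (simp add: trunc_mat_ring_def)
  have one: "\<one>\<^bsub>trunc_mat_ring k n m\<^esub> = reduce_mat m (1\<^sub>m n)" by (simp add: trunc_mat_ring_def)
  show "\<one>\<^bsub>trunc_mat_ring k n m\<^esub> \<in> carrier (trunc_mat_ring k n m)"
    unfolding one carrier_trunc_mat_ring by (simp add: mats_closed[OF k])
  fix A B C assume A: "A \<in> carrier (trunc_mat_ring k n m)" and B: "B \<in> carrier (trunc_mat_ring k n m)"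
  have A': "A \<in> mats k n" "A \<in> carrier_mat n n" "reduce_mat m A = A" and B': "B \<in> mats k n" "B \<in> carrier_mat n n"
    using A B by (auto simp: carrier_trunc_mat_ring matsD)
  show "A \<otimes>\<^bsub>trunc_mat_ring k n m\<^esub> B \<in> carrier (trunc_mat_ring k n m)"
    unfolding mult carrier_trunc_mat_ring using A' B' by (simp add: mats_closed[OF k])
  show "\<one>\<^bsub>trunc_mat_ring k n m\<^esub> \<otimes>\<^bsub>trunc_mat_ring k n m\<^esub> A = A"
    "A \<otimes>\<^bsub>trunc_mat_ring k n m\<^esub> \<one>\<^bsub>trunc_mat_ring k n m\<^esub> = A"
    unfolding mult one using A' by (simp_all add: reduce_mult_reduce[of _ n n _ n])
  assume C: "C \<in> carrier (trunc_mat_ring k n m)"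
  have C': "C \<in> carrier_mat n n" using C by (auto simp: carrier_trunc_mat_ring matsD)
  show "A \<otimes>\<^bsub>trunc_mat_ring k n m\<^esub> B \<otimes>\<^bsub>trunc_mat_ring k n m\<^esub> C =
      A \<otimes>\<^bsub>trunc_mat_ring k n m\<^esub> (B \<otimes>\<^bsub>trunc_mat_ring k n m\<^esub> C)"
    unfolding mult using A' B' C' by (simp add: reduce_mult_reduce[of _ n n _ n])
qed

lemma GL_trunc_mult [simp]: "A \<otimes>\<^bsub>GL_trunc k n m\<^esub> B = reduce_mat m (A * B)"
  and GL_trunc_one [simp]: "\<one>\<^bsub>GL_trunc k n m\<^esub> = reduce_mat m (1\<^sub>m n)"
  by (simp_all add: GL_trunc_def units_of_def trunc_mat_ring_def)

text \<open>An inverse may be given by any untruncated representative; truncating it yields the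
  inverse inside the ring.\<close>

lemma GL_trunc_carrier_iff:
  assumes k: "coeff_ring k"
  shows "g \<in> carrier (GL_trunc k n m) \<longleftrightarrow> g \<in> mats k n \<and> reduce_mat m g = g \<and>
    (\<exists>y \<in> mats k n. reduce_mat m (g * y) = reduce_mat m (1\<^sub>m n) \<and> reduce_mat m (y * g) = reduce_mat m (1\<^sub>m n))"
    (is "?l \<longleftrightarrow> ?r")
proof
  assume ?l
  thus ?r by (auto simp: GL_trunc_def units_of_def Units_def carrier_trunc_mat_ring) (auto simp: trunc_mat_ring_def)
next
  assume r: ?r
  then obtain y where y: "y \<in> mats k n" "reduce_mat m (g * y) = reduce_mat m (1\<^sub>m n)" "reduce_mat m (y * g) = reduce_mat m (1\<^sub>m n)"
    by blast
  have c: "g \<in> carrier_mat n n" "y \<in> carrier_mat n n" using r y by (auto simp: matsD)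
  have "reduce_mat m y \<in> {Z \<in> mats k n. reduce_mat m Z = Z}" using y by (simp add: mats_closed[OF k])
  moreover have "reduce_mat m (g * reduce_mat m y) = reduce_mat m (1\<^sub>m n)" "reduce_mat m (reduce_mat m y * g) = reduce_mat m (1\<^sub>m n)"
    using y c by (simp_all add: reduce_mult_reduce[of _ n n _ n])
  ultimately show ?l using r
    by (auto simp: GL_trunc_def units_of_def Units_def carrier_trunc_mat_ring)
      (auto simp: trunc_mat_ring_def)
qed

lemma GL_trunc_group:
  assumes "coeff_ring k"
  shows "group (GL_trunc k n m)"
  unfolding GL_trunc_def using monoid.units_group[OF trunc_mat_monoid[OF assms]] .

lemma finite_mats:
  fixes S :: "'a set"
  assumes "finite S"
  shows "finite {Z \<in> carrier_mat n n. elements_mat Z \<subseteq> S}"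
proof -
  have "{Z \<in> carrier_mat n n. elements_mat Z \<subseteq> S} \<subseteq> mat n n ` (({..<n} \<times> {..<n}) \<rightarrow>\<^sub>E S)"
  proof
    fix Z assume "Z \<in> {Z \<in> carrier_mat n n. elements_mat Z \<subseteq> S}"
    hence Z: "Z \<in> carrier_mat n n" "elements_mat Z \<subseteq> S" by auto
    define f where "f = restrict (\<lambda>p. Z $$ p) ({..<n} \<times> {..<n})"
    have "f \<in> ({..<n} \<times> {..<n}) \<rightarrow>\<^sub>E S"
      using Z(2) elements_matI[OF Z(1)] by (auto simp: f_def)
    moreover have "Z = mat n n f" using Z by (intro eq_matI) (auto simp: f_def)
    ultimately show "Z \<in> mat n n ` (({..<n} \<times> {..<n}) \<rightarrow>\<^sub>E S)" by blast
  qed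
  thus ?thesis
    by (rule finite_subset) (intro finite_imageI finite_PiE finite_cartesian_product assms finite_lessThan)
qed

lemma finite_trunc_ring:
  fixes k :: "'a::comm_ring_1 set"
  assumes "finite k"
  shows "finite (carrier (trunc_ring k m))"
proof -
  have "carrier (trunc_ring k m) \<subseteq> (\<lambda>f. Abs_fps (\<lambda>i. if i < m then f i else 0)) ` ({..<m} \<rightarrow>\<^sub>E k)"
  proof
    fix x assume "x \<in> carrier (trunc_ring k m)"
    hence x: "\<And>i. fps_nth x i \<in> k" "fps_cutoff m x = x" by (simp_all add: trunc_ring_def)
    have "fps_nth x i = 0" if "\<not> i < m" for i
      using arg_cong[OF x(2), of "\<lambda>z. fps_nth z i"] that by simp
    hence "x = Abs_fps (\<lambda>i. if i < m then restrict (fps_nth x) {..<m} i else 0)"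
      by (intro fps_ext) simp
    moreover have "restrict (fps_nth x) {..<m} \<in> {..<m} \<rightarrow>\<^sub>E k"
      by (rule restrict_PiE_iff[THEN iffD2]) (rule ballI, rule x(1))
    ultimately show "x \<in> (\<lambda>f. Abs_fps (\<lambda>i. if i < m then f i else 0)) ` ({..<m} \<rightarrow>\<^sub>E k)"
      by (rule image_eqI)
  qed
  thus ?thesis by (rule finite_subset) (intro finite_imageI finite_PiE assms finite_lessThan)
qed

lemma GL_trunc_finite:
  assumes "finite k"
  shows "finite (carrier (GL_trunc k n m))"
proof -
  have "carrier (GL_trunc k n m) \<subseteq> carrier (trunc_mat_ring k n m)"
    unfolding GL_trunc_def units_of_carrier by (rule subsetI) (simp only: Units_def mem_Collect_eq)
  moreover have "carrier (trunc_mat_ring k n m) = {Z \<in> carrier_mat n n. elements_mat Z \<subseteq> carrier (trunc_ring k m)}"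
    unfolding trunc_mat_ring_def by simp
  moreover have "finite {Z \<in> carrier_mat n n. elements_mat Z \<subseteq> carrier (trunc_ring k m)}"
    by (rule finite_mats[OF finite_trunc_ring[OF assms]])
  ultimately show ?thesis by (simp only: finite_subset)
qed

subsection \<open>Traces\<close>

lemma square_carrier_closed [simp]:
  fixes A B :: "'a::ring mat"
  assumes "A \<in> carrier_mat n n" "B \<in> carrier_mat n n"
  shows "A * B \<in> carrier_mat n n" "A - B \<in> carrier_mat n n"
  using assms by auto

lemma mat_trace_mult_comm:
  fixes A :: "'a::comm_semiring_0 mat"
  assumes "A \<in> carrier_mat n m" "B \<in> carrier_mat m n"
  shows "mat_trace (A * B) = mat_trace (B * A)"
proof -
  have "mat_trace (A * B) = (\<Sum>i<n. \<Sum>j<m. A $$ (i, j) * B $$ (j, i))"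
    using assms by (auto simp: mat_trace_def scalar_prod_def lessThan_atLeast0)
  also have "\<dots> = (\<Sum>j<m. \<Sum>i<n. B $$ (j, i) * A $$ (i, j))"
    by (subst sum.swap) (simp add: mult.commute)
  also have "\<dots> = mat_trace (B * A)"
    using assms by (auto simp: mat_trace_def scalar_prod_def lessThan_atLeast0)
  finally show ?thesis .
qed

lemma mat_trace_add:
  assumes "A \<in> carrier_mat n n" "B \<in> carrier_mat n n"
  shows "mat_trace (A + B) = mat_trace A + mat_trace B"
  using assms by (auto simp: mat_trace_def sum.distrib)

lemma mat_trace_diff:
  fixes A :: "'a::ab_group_add mat"
  assumes "A \<in> carrier_mat n n" "B \<in> carrier_mat n n"
  shows "mat_trace (A - B) = mat_trace A - mat_trace B"
  using assms by (auto simp: mat_trace_def sum_subtractf)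

lemma mat_trace_smult:
  fixes A :: "'a::semiring_0 mat"
  assumes "A \<in> carrier_mat n n"
  shows "mat_trace (c \<cdot>\<^sub>m A) = c * mat_trace A"
  using assms by (auto simp: mat_trace_def sum_distrib_left)

lemma cutoff_mat_trace_cong:
  assumes "reduce_mat m A = reduce_mat m B" "A \<in> carrier_mat n n" "B \<in> carrier_mat n n"
  shows "fps_cutoff m (mat_trace A) = fps_cutoff m (mat_trace B)"
  using assms by (auto simp: mat_trace_def fps_cutoff_sum reduce_eq_iff intro!: sum.cong)

lemma mat_trace_similar:
  fixes A :: "'a::comm_semiring_1 mat"
  assumes "A \<in> carrier_mat n n" "P \<in> carrier_mat n n" "Q \<in> carrier_mat n n" "Q * P = 1\<^sub>m n"
  shows "mat_trace (P * A * Q) = mat_trace A"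
proof -
  have "mat_trace (P * A * Q) = mat_trace (Q * (P * A))"
    using assms by (intro mat_trace_mult_comm[of _ n n]) auto
  also have "Q * (P * A) = A" using assms by (simp add: assoc_mult_mat[of Q n n P n A n, symmetric])
  finally show ?thesis .
qed

lemma pow_mat_mult_commute:
  fixes A B :: "'a::semiring_1 mat"
  assumes A: "A \<in> carrier_mat n n" and B: "B \<in> carrier_mat n n" and "A * B = B * A"
  shows "A ^\<^sub>m k * B = B * A ^\<^sub>m k" "(A * B) ^\<^sub>m k = A ^\<^sub>m k * B ^\<^sub>m k"
proof -
  note assoc = assoc_mult_mat[of _ n n _ n _ n]
  have comm: "C ^\<^sub>m k * D = D * C ^\<^sub>m k"
    if C: "C \<in> carrier_mat n n" "D \<in> carrier_mat n n" "C * D = D * C" for C D :: "'a mat" and k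
  proof (induction k)
    case (Suc k)
    have Ck: "C ^\<^sub>m k \<in> carrier_mat n n" using C by simp
    have "C ^\<^sub>m Suc k * D = C ^\<^sub>m k * (C * D)" unfolding pow_mat.simps by (rule assoc[OF Ck C(1,2)])
    also have "\<dots> = C ^\<^sub>m k * D * C" unfolding C(3) by (rule assoc[OF Ck C(2,1), symmetric])
    also have "\<dots> = D * C ^\<^sub>m Suc k" unfolding Suc pow_mat.simps by (rule assoc[OF C(2) Ck C(1)])
    finally show ?case .
  qed (use C in simp)
  show "A ^\<^sub>m k * B = B * A ^\<^sub>m k" by (rule comm) fact+
  show "(A * B) ^\<^sub>m k = A ^\<^sub>m k * B ^\<^sub>m k"
  proof (induction k)
    case (Suc k)
    have c: "A ^\<^sub>m k \<in> carrier_mat n n" "B ^\<^sub>m k \<in> carrier_mat n n" using A B by simp_all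
    have BA: "B ^\<^sub>m k * A = A * B ^\<^sub>m k" using assms by (intro comm) auto
    have "(A * B) ^\<^sub>m Suc k = A ^\<^sub>m k * B ^\<^sub>m k * (A * B)" by (simp only: pow_mat.simps Suc)
    also have "\<dots> = A ^\<^sub>m k * (B ^\<^sub>m k * A * B)"
      using c A B mult_carrier_mat[OF A B] by (simp only: assoc)
    also have "\<dots> = A ^\<^sub>m k * A * (B ^\<^sub>m k * B)"
      unfolding BA using c A B mult_carrier_mat[OF c(2) B] by (simp only: assoc)
    finally show ?case by (simp only: pow_mat.simps)
  qed (use assms in simp)
qed

lemma prod_one_plus_mult:
  fixes f :: "nat \<Rightarrow> 'a::comm_ring_1"
  shows "c * c dvd (\<Prod>i<n. 1 + c * f i) - 1 - c * (\<Sum>i<n. f i)"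
proof (induction n)
  case (Suc n)
  define P where "P = (\<Prod>i<n. 1 + c * f i)"
  define S where "S = (\<Sum>i<n. f i)"
  have "(\<Prod>i<Suc n. 1 + c * f i) - 1 - c * (\<Sum>i<Suc n. f i) = P * (1 + c * f n) - 1 - c * (S + f n)"
    by (simp add: P_def S_def)
  also have "\<dots> = (P - 1 - c * S) + c * f n * (P - 1 - c * S) + c * c * (f n * S)"
    by (simp add: algebra_simps)
  finally show ?case using Suc[folded P_def S_def] by (simp only: dvd_add dvd_mult dvd_triv_left)
qed simp

text \<open>A permutation other than the identity moves some \<open>i\<close> and then also
  \<open>p i\<close>, which produces two off-diagonal factors, each divisible by \<open>c\<close>.
  Only the identity contributes to first order. The choice \<open>c = fps_X ^ l\<close> computes
  determinants on the congruence subgroup; the polynomial variable as \<open>c\<close> gives the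
  trace of a nilpotent matrix.\<close>

lemma det_one_plus_smult:
  fixes Z :: "'a::comm_ring_1 mat"
  assumes Z: "Z \<in> carrier_mat n n"
  shows "c * c dvd det (1\<^sub>m n + c \<cdot>\<^sub>m Z) - 1 - c * mat_trace Z"
proof -
  let ?P = "{p. p permutes {0..<n}}"
  define t where "t = (\<lambda>p. signof p * (\<Prod>i = 0..<n. (1\<^sub>m n + c \<cdot>\<^sub>m Z) $$ (i, p i)))"
  have D: "1\<^sub>m n + c \<cdot>\<^sub>m Z \<in> carrier_mat n n" using Z by simp
  have "det (1\<^sub>m n + c \<cdot>\<^sub>m Z) = sum t ?P" unfolding det_def'[OF D] t_def by simp
  also have "\<dots> = t id + sum t (?P - {id})"
    by (rule sum.remove) (auto simp: finite_permutations permutes_id)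
  finally have 1: "det (1\<^sub>m n + c \<cdot>\<^sub>m Z) = t id + sum t (?P - {id})" .
  have "t id = (\<Prod>i<n. 1 + c * Z $$ (i, i))"
    using Z by (auto simp: t_def lessThan_atLeast0 intro!: prod.cong)
  hence 2: "c * c dvd t id - 1 - c * mat_trace Z"
    using prod_one_plus_mult[where c = c and n = n and f = "\<lambda>i. Z $$ (i, i)"] Z by (simp add: mat_trace_def)
  have "c * c dvd t p" if p: "p \<in> ?P - {id}" for p
  proof -
    have perm: "p permutes {0..<n}" using p by simp
    obtain i where i: "p i \<noteq> i" using p by (auto simp: fun_eq_iff)
    have iN: "i < n" using i perm by (metis atLeastLessThan_iff permutes_not_in zero_le)
    have piN: "p i < n" using perm iN by (metis atLeastLessThan_iff permutes_in_image zero_le)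
    have ppi: "p (p i) \<noteq> p i" using i perm by (metis permutes_inj injD)
    have ppiN: "p (p i) < n" using perm piN by (metis atLeastLessThan_iff permutes_in_image zero_le)
    let ?f = "\<lambda>i. (1\<^sub>m n + c \<cdot>\<^sub>m Z) $$ (i, p i)"
    have "prod ?f {0..<n} = ?f i * (?f (p i) * prod ?f ({0..<n} - {i} - {p i}))"
      using i iN piN by (subst prod.remove[of _ i]; (subst prod.remove[of _ "p i"])?) auto
    also have "?f i = c * Z $$ (i, p i)" using i iN piN Z by simp
    also have "?f (p i) = c * Z $$ (p i, p (p i))" using ppi ppiN piN Z by simp
    finally have "prod ?f {0..<n} = c * c * (Z $$ (i, p i) * Z $$ (p i, p (p i)) * prod ?f ({0..<n} - {i} - {p i}))"
      by (simp only: mult_ac)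
    thus ?thesis unfolding t_def by (simp only: dvd_mult dvd_triv_left)
  qed
  hence "c * c dvd sum t (?P - {id})" by (rule dvd_sum)
  hence "c * c dvd (t id - 1 - c * mat_trace Z) + sum t (?P - {id})" using 2 by (rule dvd_add[rotated])
  thus ?thesis unfolding 1 by (simp add: algebra_simps)
qed

text \<open>
  Over \<open>F[x]\<close> the matrix \<open>1 - xA\<close> of a nilpotent \<open>A\<close> is invertible, so its determinant is constant,
  while its linear coefficient is the trace up to sign.
\<close>

lemma mat_trace_nilpotent:
  fixes A :: "'a::field mat"
  assumes A: "A \<in> carrier_mat n n" and nil: "A ^\<^sub>m k = 0\<^sub>m n n"
  shows "mat_trace A = 0"
proof -
  define B where "B = [:0, 1:] \<cdot>\<^sub>m map_mat (\<lambda>a. [:a:]) A"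
  have B: "B \<in> carrier_mat n n" using A by (simp add: B_def)
  interpret c: semiring_hom "\<lambda>a::'a. [:a:]" by standard (auto simp: one_pCons)
  have pow: "B ^\<^sub>m j = monom 1 j \<cdot>\<^sub>m map_mat (\<lambda>a. [:a:]) (A ^\<^sub>m j)" for j
  proof (induction j)
    case 0
    show ?case using A by (intro eq_matI) (simp_all add: B_def monom_0)
  next
    case (Suc j)
    have "[:0, 1:] = monom (1::'a) 1" by (simp add: monom_altdef)
    thus ?case using A Suc unfolding pow_mat.simps Suc.IH
      by (simp add: B_def smult_mat_mult_smult_mat[of _ n n _ n] c.mat_hom_mult[of _ n n _ n] mult_monom)
  qed
  \<comment> \<open>The witness built by the induction is the geometric sum of the powers of
    \<open>B\<close> below \<open>j\<close>.\<close>
  have ex: "\<exists>S \<in> carrier_mat n n. (1\<^sub>m n - B) * S = 1\<^sub>m n - B ^\<^sub>m j" for j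
  proof (induction j)
    case 0
    show ?case using B by (intro bexI[of _ "0\<^sub>m n n"]) auto
  next
    case (Suc j)
    then obtain S where S: "S \<in> carrier_mat n n" "(1\<^sub>m n - B) * S = 1\<^sub>m n - B ^\<^sub>m j" by blast
    have "(1\<^sub>m n - B) * (S + B ^\<^sub>m j) = (1\<^sub>m n - B ^\<^sub>m j) + (B ^\<^sub>m j - B * B ^\<^sub>m j)"
      using B S pow_carrier_mat[OF B, of j]
      by (simp add: mult_add_distrib_mat[of "1\<^sub>m n - B" n n S n] minus_mult_distrib_mat[of "1\<^sub>m n" n n B "B ^\<^sub>m j" n])
    also have "B * B ^\<^sub>m j = B ^\<^sub>m Suc j"
      using pow_mat_mult_commute(1)[OF B B refl, of j] by simp
    also have "(1\<^sub>m n - B ^\<^sub>m j) + (B ^\<^sub>m j - B ^\<^sub>m Suc j) = 1\<^sub>m n - B ^\<^sub>m Suc j"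
      using B by (intro eq_matI) auto
    finally show ?case using S B by (intro bexI[of _ "S + B ^\<^sub>m j"]) auto
  qed
  obtain S where S: "S \<in> carrier_mat n n" "(1\<^sub>m n - B) * S = 1\<^sub>m n - B ^\<^sub>m k" using ex[of k] by blast
  have "B ^\<^sub>m k = 0\<^sub>m n n" unfolding pow nil by (auto simp: mat_eq_iff)
  hence "(1\<^sub>m n - B) * S = 1\<^sub>m n" using S by (auto simp: mat_eq_iff)
  hence "det (1\<^sub>m n - B) * det S = 1" using S B by (metis det_mult det_one minus_carrier_mat)
  hence "det (1\<^sub>m n - B) dvd 1" by (metis dvd_triv_left)
  hence "Polynomial.degree (det (1\<^sub>m n - B)) = 0" by (simp add: poly_dvd_1)
  hence d: "Polynomial.coeff (det (1\<^sub>m n - B)) 1 = 0" by (simp add: coeff_eq_0)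
  have "1\<^sub>m n - B = 1\<^sub>m n + [:0, 1:] \<cdot>\<^sub>m map_mat (\<lambda>a. [:- a:]) A"
    using A by (auto simp: B_def mat_eq_iff)
  moreover have "mat_trace (map_mat (\<lambda>a. [:- a:]) A) = [:- mat_trace A:]"
  proof -
    have "(\<Sum>i<j. [:- A $$ (i, i):]) = [:- (\<Sum>i<j. A $$ (i, i)):]" for j by (induction j) auto
    thus ?thesis using A by (simp add: mat_trace_def)
  qed
  ultimately have "[:0, 1:] * [:0, 1:] dvd det (1\<^sub>m n - B) - 1 - [:0, 1:] * [:- mat_trace A:]"
    using det_one_plus_smult[of "map_mat (\<lambda>a. [:- a:]) A" n "[:0, 1:]"] A by simp
  then obtain q where "det (1\<^sub>m n - B) - 1 - [:0, 1:] * [:- mat_trace A:] = [:0, 1:] * [:0, 1:] * q" by (elim dvdE)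
  from arg_cong[OF this, of "\<lambda>p. Polynomial.coeff p 1"]
  have "Polynomial.coeff (det (1\<^sub>m n - B)) 1 + mat_trace A = 0" by (simp add: coeff_pCons)
  thus ?thesis using d by simp
qed

section \<open>Characters of the congruence subgroups\<close>

lemma subgroup_set_mult:
  fixes G (structure)
  assumes G: "group G" and C: "subgroup C G" and T: "subgroup T G"
    and n: "\<And>g t. g \<in> carrier G \<Longrightarrow> t \<in> T \<Longrightarrow> inv g \<otimes> t \<otimes> g \<in> T"
  shows "subgroup (C <#> T) G"
proof -
  interpret group G by fact
  interpret C: subgroup C G by fact
  interpret T: subgroup T G by fact
  show ?thesis
  proof (rule subgroupI)
    show "C <#> T \<subseteq> carrier G" by (auto simp: set_mult_def)
    show "C <#> T \<noteq> {}" using C.one_closed T.one_closed unfolding set_mult_def by blast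
    fix a assume "a \<in> C <#> T"
    then obtain x t where a: "a = x \<otimes> t" "x \<in> C" "t \<in> T" by (auto simp: set_mult_def)
    have "inv a = inv x \<otimes> (inv (inv x) \<otimes> inv t \<otimes> inv x)"
      using a by (simp add: inv_mult_group m_assoc[symmetric])
    moreover have "inv (inv x) \<otimes> inv t \<otimes> inv x \<in> T" using a by (intro n) auto
    ultimately show "inv a \<in> C <#> T" using a C.m_inv_closed unfolding set_mult_def by blast
    fix b assume "b \<in> C <#> T"
    then obtain y s where b: "b = y \<otimes> s" "y \<in> C" "s \<in> T" by (auto simp: set_mult_def)
    have "a \<otimes> b = (x \<otimes> y) \<otimes> ((inv y \<otimes> t \<otimes> y) \<otimes> s)"
    proof -
      have "(x \<otimes> y) \<otimes> ((inv y \<otimes> t \<otimes> y) \<otimes> s) = x \<otimes> (y \<otimes> inv y) \<otimes> t \<otimes> y \<otimes> s"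
        using a b by (simp only: m_assoc C.mem_carrier T.mem_carrier inv_closed m_closed)
      thus ?thesis using a b by (simp add: m_assoc)
    qed
    moreover have "(inv y \<otimes> t \<otimes> y) \<otimes> s \<in> T" using n[of y t] a b by auto
    ultimately show "a \<otimes> b \<in> C <#> T" using C.m_closed[OF a(2) b(2)] unfolding set_mult_def by blast
  qed
qed

text \<open>\<open>\<chi>\<close> is an additive character of untruncated series that factors
  through truncation at \<open>l\<close> and is nontrivial on the socle in degree
  \<open>l - 1\<close>. The locale is used for the base field with \<open>\<psi>\<close>, and for
  each residue field of degree \<open>\<lambda>_i\<close> with \<open>\<psi>\<close> composed with
  the trace.\<close>

locale truncated_gl =
  fixes k :: "'a::field set" and n l r :: nat and \<chi> :: "'a fps \<Rightarrow> 'c::field"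
  assumes k: "coeff_ring k" and kinv: "x \<in> k \<Longrightarrow> inverse x \<in> k" and kfin: "finite k"
    and l: "0 < l" and r: "r = 2 * l"
    and \<chi>_add: "y \<in> fps_over k \<Longrightarrow> z \<in> fps_over k \<Longrightarrow> \<chi> (y + z) = \<chi> y * \<chi> z"
    and \<chi>_cut: "y \<in> fps_over k \<Longrightarrow> \<chi> (fps_cutoff l y) = \<chi> y"
    and \<chi>_nz: "y \<in> fps_over k \<Longrightarrow> \<chi> y \<noteq> 0"
    and \<chi>_nt: "\<exists>e\<in>k. \<chi> (fps_X ^ (l - 1) * fps_const e) \<noteq> 1"
begin

abbreviation "G \<equiv> GL_trunc k n r"
abbreviation "T \<equiv> cong_subgroup k n r l"

definition "cong_elt V = reduce_mat r (1\<^sub>m n + fps_X ^ l \<cdot>\<^sub>m V)"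
definition "wt B g = \<chi> (mat_trace (B * cong_part l g))"

sublocale G: group G by (rule GL_trunc_group[OF k])

lemma lr: "l \<le> r" using r by simp

lemmas fk = coeff_ring_closed[OF coeff_ring_fps_over[OF k]] fps_over_closed[OF k]
lemmas mk = mats_closed[OF k]
lemmas dims = matsD(1)[of _ k n]

lemma G_iff: "g \<in> carrier G \<longleftrightarrow> g \<in> mats k n \<and> reduce_mat r g = g \<and>
    (\<exists>y \<in> mats k n. reduce_mat r (g * y) = reduce_mat r (1\<^sub>m n) \<and> reduce_mat r (y * g) = reduce_mat r (1\<^sub>m n))"
  by (rule GL_trunc_carrier_iff[OF k])

lemma G_mats: "g \<in> carrier G \<Longrightarrow> g \<in> mats k n" "g \<in> carrier G \<Longrightarrow> g \<in> carrier_mat n n"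
  "g \<in> carrier G \<Longrightarrow> reduce_mat r g = g"
  using G_iff matsD by blast+

lemma G_inv: "g \<in> carrier G \<Longrightarrow> reduce_mat r (g * inv\<^bsub>G\<^esub> g) = reduce_mat r (1\<^sub>m n)"
  "g \<in> carrier G \<Longrightarrow> reduce_mat r (inv\<^bsub>G\<^esub> g * g) = reduce_mat r (1\<^sub>m n)"
  using G.r_inv[of g] G.l_inv[of g] by simp_all

lemma \<chi>_0: "\<chi> 0 = 1"
proof -
  have "\<chi> 0 * \<chi> 0 = \<chi> 0" using \<chi>_add[of 0 0, symmetric] fk by simp
  thus ?thesis using \<chi>_nz[of 0] fk by simp
qed

lemma \<chi>_cong:
  assumes "fps_cutoff l x = fps_cutoff l y" "x \<in> fps_over k" "y \<in> fps_over k"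
  shows "\<chi> x = \<chi> y"
  using \<chi>_cut[OF assms(2)] \<chi>_cut[OF assms(3)] assms(1) by simp

text \<open>If the lowest term of \<open>w\<close> has degree \<open>a < l\<close> and coefficient
  \<open>c\<close>, multiplication by a monomial of degree \<open>l - 1 - a\<close> pushes it into
  the socle. The factor \<open>inverse c * e\<close> turns its coefficient into the element
  \<open>e\<close> on which \<open>\<chi>\<close> is nontrivial.\<close>

lemma \<chi>_nondegenerate:
  assumes w: "w \<in> fps_over k" and triv: "\<And>x. x \<in> fps_over k \<Longrightarrow> \<chi> (w * x) = 1"
  shows "fps_cutoff l w = 0"
proof (rule ccontr)
  assume nz: "fps_cutoff l w \<noteq> 0"
  define a where "a = subdegree w"
  have w0: "w \<noteq> 0" and a: "a < l" using nz by (auto simp: fps_cutoff_zero_iff a_def)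
  define c where "c = fps_nth w a"
  have c: "c \<noteq> 0" "c \<in> k" using w0 w by (auto simp: c_def a_def fps_overD)
  obtain e where e: "e \<in> k" "\<chi> (fps_X ^ (l - 1) * fps_const e) \<noteq> 1" using \<chi>_nt by blast
  define x where "x = fps_X ^ (l - 1 - a) * fps_const (inverse c * e)"
  have x: "x \<in> fps_over k" unfolding x_def by (intro fk coeff_ring_closed[OF k] c kinv e)
  have "fps_cutoff l (w * x) = fps_cutoff l (fps_X ^ (l - 1) * fps_const e)"
  proof (rule fps_ext)
    fix i
    have "fps_nth (w * x) i = fps_nth (fps_X ^ (l - 1) * fps_const e) i" if "i < l"
    proof -
      have wx': "w * x = fps_X ^ (l - 1 - a) * (w * fps_const (inverse c * e))" by (simp add: x_def mult_ac)
      hence wx: "fps_nth (w * x) i = (if i < l - 1 - a then 0 else fps_nth w (i - (l - 1 - a)) * (inverse c * e))"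
        unfolding wx' by (simp add: fps_X_power_mult_nth)
      show ?thesis
      proof (cases "i = l - 1")
        case True
        thus ?thesis using wx a c by (simp add: fps_X_power_mult_nth c_def)
      next
        case False
        hence rhs: "fps_nth (fps_X ^ (l - 1) * fps_const e) i = 0"
          using \<open>i < l\<close> by (simp add: fps_X_power_mult_nth)
        have "fps_nth w (i - (l - 1 - a)) = 0" if "\<not> i < l - 1 - a"
          by (rule nth_less_subdegree_zero) (use that False \<open>i < l\<close> a in \<open>simp add: a_def\<close>)
        thus ?thesis unfolding wx rhs by simp
      qed
    qed
    thus "fps_nth (fps_cutoff l (w * x)) i = fps_nth (fps_cutoff l (fps_X ^ (l - 1) * fps_const e)) i" by simp
  qed
  hence "\<chi> (w * x) = \<chi> (fps_X ^ (l - 1) * fps_const e)"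
    using w x e by (intro \<chi>_cong fk) auto
  thus False using triv[OF x] e by simp
qed

lemma trace_over: "Z \<in> mats k n \<Longrightarrow> mat_trace Z \<in> fps_over k"
  unfolding mat_trace_def by (intro coeff_ring_sum[OF coeff_ring_fps_over[OF k]]) (auto simp: mats_def)

text \<open>Testing against \<open>x\<close> times the elementary matrix in position
  \<open>(j, i)\<close> isolates the single entry \<open>W $$ (i, j)\<close>, which reduces the
  trace pairing to the scalar case.\<close>

lemma \<chi>_trace_nondegenerate:
  assumes W: "W \<in> mats k n" and triv: "\<And>V. V \<in> mats k n \<Longrightarrow> \<chi> (mat_trace (W * V)) = 1"
  shows "reduce_mat l W = 0\<^sub>m n n"
proof -
  have "fps_cutoff l (W $$ (i, j)) = 0" if ij: "i < n" "j < n" for i j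
  proof (rule \<chi>_nondegenerate)
    show "W $$ (i, j) \<in> fps_over k" using W ij by (rule matsD)
    fix x assume x: "x \<in> fps_over k"
    define V where "V = mat n n (\<lambda>(a, b). if a = j \<and> b = i then x else 0)"
    have V: "V \<in> mats k n" using x fk(1) by (auto simp: V_def mats_def)
    have "mat_trace (W * V) = (\<Sum>a<n. \<Sum>b<n. W $$ (a, b) * V $$ (b, a))"
      using dims[OF W] dims[OF V] by (auto simp: mat_trace_def scalar_prod_def lessThan_atLeast0)
    also have "\<dots> = (\<Sum>a<n. \<Sum>b<n. if a = i then (if b = j then W $$ (i, j) * x else 0) else 0)"
      by (intro sum.cong refl) (auto simp: V_def)
    also have "\<dots> = (\<Sum>a<n. if a = i then W $$ (i, j) * x else 0)"
      using ij by (intro sum.cong refl) auto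
    also have "\<dots> = W $$ (i, j) * x" using ij by simp
    finally show "\<chi> (W $$ (i, j) * x) = 1" using triv[OF V] by simp
  qed
  thus ?thesis using dims[OF W] by (auto simp: mat_eq_iff)
qed

text \<open>Write \<open>x = g + \<pi>^l Z\<close>. Because \<open>\<pi>^l\<close> squares to zero
  modulo \<open>\<pi>^r\<close>, the inverse is the inverse of \<open>g\<close> corrected by one
  first-order term. The second conclusion exhibits \<open>g\<close> as \<open>x\<close> times an
  element of \<open>T\<close>, the form in which membership in the inducing subgroups is
  proved.\<close>

lemma unit_lift:
  assumes g: "g \<in> carrier G" and x: "x \<in> mats k n" and eq: "reduce_mat l x = reduce_mat l g"
  shows "reduce_mat r x \<in> carrier G" "inv\<^bsub>G\<^esub> (reduce_mat r x) \<otimes>\<^bsub>G\<^esub> g \<in> T"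
proof -
  note gm = G_mats[OF g] and gi = G_mats[OF G.inv_closed[OF g]] and xc = dims[OF x]
  let ?gi = "inv\<^bsub>G\<^esub> g"
  define Z where "Z = map_mat (fps_shift l) (x - g)"
  have Z: "Z \<in> mats k n" "Z \<in> carrier_mat n n" using x gm mk dims by (auto simp: Z_def)
  have xg: "x = g + fps_X ^ l \<cdot>\<^sub>m Z"
  proof (rule eq_matI)
    fix i j assume "i < dim_row (g + fps_X ^ l \<cdot>\<^sub>m Z)" "j < dim_col (g + fps_X ^ l \<cdot>\<^sub>m Z)"
    hence ij: "i < n" "j < n" using Z by auto
    have "fps_cutoff l (x $$ (i, j) - g $$ (i, j)) = 0"
      using eq ij xc gm by (simp add: reduce_eq_iff[OF xc gm(2)] fps_cutoff_diff)
    hence "fps_X ^ l * fps_shift l (x $$ (i, j) - g $$ (i, j)) = x $$ (i, j) - g $$ (i, j)"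
      using fps_shift_cutoff'[of l "x $$ (i, j) - g $$ (i, j)"] by simp
    thus "x $$ (i, j) = (g + fps_X ^ l \<cdot>\<^sub>m Z) $$ (i, j)" using ij xc gm Z by (simp add: Z_def)
  qed (use xc Z in auto)
  define y where "y = ?gi - fps_X ^ l \<cdot>\<^sub>m (?gi * Z * ?gi)"
  have y: "y \<in> mats k n" "y \<in> carrier_mat n n"
    unfolding y_def using gi Z by (auto intro!: mk fk simp: dims)
  have smult_swap: "A * (fps_X ^ l \<cdot>\<^sub>m B) = fps_X ^ l \<cdot>\<^sub>m (A * B)" "(fps_X ^ l \<cdot>\<^sub>m A) * B = fps_X ^ l \<cdot>\<^sub>m (A * B)"
    if "A \<in> carrier_mat n n" "B \<in> carrier_mat n n" for A B :: "'a fps mat"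
    using that by (auto simp: mult_smult_distrib mult_smult_assoc_mat)
  have sq: "reduce_mat r (fps_X ^ l \<cdot>\<^sub>m (fps_X ^ l \<cdot>\<^sub>m A)) = reduce_mat r (0\<^sub>m n n)" if "A \<in> carrier_mat n n" for A :: "'a fps mat"
    using that by (auto simp: mat_eq_iff fps_eq_iff r mult.assoc[symmetric] power_add[symmetric] fps_X_power_mult_nth simp flip: mult_2)
  have small: "reduce_mat r (fps_X ^ l \<cdot>\<^sub>m A) = reduce_mat r (fps_X ^ l \<cdot>\<^sub>m B)"
    if "reduce_mat r A = reduce_mat r B" for A B :: "'a fps mat"
    using that by (rule reduce_smult_cong)
  have "reduce_mat r (x * y) = reduce_mat r (1\<^sub>m n)"
  proof -
    have "x * y = g * ?gi - fps_X ^ l \<cdot>\<^sub>m (g * ?gi * (Z * ?gi)) + (fps_X ^ l \<cdot>\<^sub>m (Z * ?gi) - fps_X ^ l \<cdot>\<^sub>m (fps_X ^ l \<cdot>\<^sub>m (Z * (?gi * Z * ?gi))))"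
      unfolding xg y_def using gm gi Z
      by (simp add: add_mult_distrib_mat[of _ n n _ _ n] mult_minus_distrib_mat[of _ n n _ n] smult_swap assoc_mult_mat[of _ n n _ n _ n])
        (intro eq_matI, auto simp: algebra_simps)
    also have "reduce_mat r \<dots> = reduce_mat r (1\<^sub>m n - fps_X ^ l \<cdot>\<^sub>m (1\<^sub>m n * (Z * ?gi)) + (fps_X ^ l \<cdot>\<^sub>m (Z * ?gi) - 0\<^sub>m n n))"
      using gm gi Z G_inv[OF g]
      by (intro reduce_add_cong[of _ _ _ _ _ n n] small reduce_mult_cong[of _ _ _ _ _ n n n] sq refl) auto
    also have "1\<^sub>m n - fps_X ^ l \<cdot>\<^sub>m (1\<^sub>m n * (Z * ?gi)) + (fps_X ^ l \<cdot>\<^sub>m (Z * ?gi) - 0\<^sub>m n n) = 1\<^sub>m n"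
      using gi Z by (intro eq_matI) auto
    finally show ?thesis .
  qed
  moreover have "reduce_mat r (y * x) = reduce_mat r (1\<^sub>m n)"
  proof -
    have "y * x = ?gi * g - fps_X ^ l \<cdot>\<^sub>m (?gi * Z * (?gi * g)) + (fps_X ^ l \<cdot>\<^sub>m (?gi * Z) - fps_X ^ l \<cdot>\<^sub>m (fps_X ^ l \<cdot>\<^sub>m (?gi * Z * ?gi * Z)))"
      unfolding xg y_def using gm gi Z
      by (simp add: mult_add_distrib_mat[of _ n n _ n] minus_mult_distrib_mat[of _ n n _ _ n] smult_swap assoc_mult_mat[of _ n n _ n _ n])
        (intro eq_matI, auto simp: algebra_simps)
    also have "reduce_mat r \<dots> = reduce_mat r (1\<^sub>m n - fps_X ^ l \<cdot>\<^sub>m (?gi * Z * 1\<^sub>m n) + (fps_X ^ l \<cdot>\<^sub>m (?gi * Z) - 0\<^sub>m n n))"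
      using gm gi Z G_inv[OF g]
      by (intro reduce_add_cong[of _ _ _ _ _ n n] small reduce_mult_cong[of _ _ _ _ _ n n n] sq refl) auto
    also have "1\<^sub>m n - fps_X ^ l \<cdot>\<^sub>m (?gi * Z * 1\<^sub>m n) + (fps_X ^ l \<cdot>\<^sub>m (?gi * Z) - 0\<^sub>m n n) = 1\<^sub>m n"
      using gi Z by (intro eq_matI) auto
    finally show ?thesis .
  qed
  ultimately show xG: "reduce_mat r x \<in> carrier G"
    unfolding G_iff using x y xc by (auto intro!: mk bexI[of _ y] simp: reduce_mult_reduce[of _ n n _ n])
  let ?xi = "inv\<^bsub>G\<^esub> (reduce_mat r x)"
  note xi = G_mats[OF G.inv_closed[OF xG]]
  have "reduce_mat l (reduce_mat r (?xi * g)) = reduce_mat l (?xi * reduce_mat r x)"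
    using eq xi gm xc r by (auto intro!: reduce_mult_cong[of _ _ _ _ _ n n n])
  also have "\<dots> = reduce_mat l (1\<^sub>m n)"
    using reduce_mono[OF G_inv(2)[OF xG]] r by simp
  finally show "?xi \<otimes>\<^bsub>G\<^esub> g \<in> T"
    using G.m_closed[OF G.inv_closed[OF xG] g] by (simp add: cong_subgroup_def)
qed

lemma cong_elt_T: "V \<in> mats k n \<Longrightarrow> cong_elt V \<in> T"
proof -
  assume V: "V \<in> mats k n"
  have 1: "reduce_mat l (1\<^sub>m n + fps_X ^ l \<cdot>\<^sub>m V) = reduce_mat l (1\<^sub>m n)"
    using dims[OF V] by (auto simp: mat_eq_iff fps_eq_iff fps_X_power_mult_nth)
  have "cong_elt V \<in> carrier G" unfolding cong_elt_def
    by (rule unit_lift(1)[OF G.one_closed]) (use V 1 r in \<open>auto intro!: mk fk\<close>)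
  thus "cong_elt V \<in> T" using 1 lr unfolding cong_elt_def by (simp add: cong_subgroup_def)
qed

lemma T_carrier: "T \<subseteq> carrier G" by (auto simp: cong_subgroup_def)

lemma cong_part_elt:
  assumes "V \<in> mats k n"
  shows "cong_part l (cong_elt V) = reduce_mat l V"
  using dims[OF assms] r l unfolding cong_elt_def
  by (auto simp: mat_eq_iff fps_eq_iff cong_part_def fps_X_power_mult_nth)

lemma elt_cong_part:
  assumes "t \<in> T"
  shows "cong_part l t \<in> mats k n" "cong_elt (cong_part l t) = t"
proof -
  have t: "t \<in> carrier G" "reduce_mat l t = reduce_mat l (1\<^sub>m n)" using assms by (auto simp: cong_subgroup_def)
  note tm = G_mats[OF t(1)]
  show cp: "cong_part l t \<in> mats k n" unfolding cong_part_def using tm by (auto intro!: mk)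
  have "1\<^sub>m n + fps_X ^ l \<cdot>\<^sub>m cong_part l t = t"
  proof (rule eq_matI)
    fix i j assume "i < dim_row t" "j < dim_col t"
    hence ij: "i < n" "j < n" using tm by auto
    have "fps_cutoff l (t $$ (i, j) - 1\<^sub>m n $$ (i, j)) = 0"
      using t(2) ij tm by (simp add: reduce_eq_iff[of _ n n] fps_cutoff_diff)
    hence "fps_X ^ l * fps_shift l (t $$ (i, j) - 1\<^sub>m n $$ (i, j)) = t $$ (i, j) - 1\<^sub>m n $$ (i, j)"
      using fps_shift_cutoff'[of l "t $$ (i, j) - 1\<^sub>m n $$ (i, j)"] by simp
    thus "(1\<^sub>m n + fps_X ^ l \<cdot>\<^sub>m cong_part l t) $$ (i, j) = t $$ (i, j)" using ij tm cp dims[OF cp] by (simp add: cong_part_def)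
  qed (use tm dims[OF cp] in auto)
  thus "cong_elt (cong_part l t) = t" unfolding cong_elt_def using tm by simp
qed

lemma cong_elt_cong: "reduce_mat l V = reduce_mat l Y \<Longrightarrow> V \<in> mats k n \<Longrightarrow> Y \<in> mats k n \<Longrightarrow> cong_elt V = cong_elt Y"
  unfolding cong_elt_def using r dims
  by (intro reduce_add_cong[of _ _ _ _ _ n n] reduce_X_power_smult[of r l l _ _ n n]) auto

text \<open>The cross term carries \<open>\<pi>^(2 l)\<close> and disappears, so \<open>T\<close> is
  a quotient of the additive group of matrices and in particular abelian.\<close>

lemma cong_elt_mult:
  assumes "V \<in> mats k n" "Y \<in> mats k n"
  shows "cong_elt V \<otimes>\<^bsub>G\<^esub> cong_elt Y = cong_elt (V + Y)"
proof -
  note c = dims[OF assms(1)] dims[OF assms(2)]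
  have "(1\<^sub>m n + fps_X ^ l \<cdot>\<^sub>m V) * (1\<^sub>m n + fps_X ^ l \<cdot>\<^sub>m Y) = 1\<^sub>m n + fps_X ^ l \<cdot>\<^sub>m (V + Y) + fps_X ^ r \<cdot>\<^sub>m (V * Y)"
  proof -
    have "(1\<^sub>m n + fps_X ^ l \<cdot>\<^sub>m V) * (1\<^sub>m n + fps_X ^ l \<cdot>\<^sub>m Y) = 1\<^sub>m n * (1\<^sub>m n + fps_X ^ l \<cdot>\<^sub>m Y) + (fps_X ^ l \<cdot>\<^sub>m V) * (1\<^sub>m n + fps_X ^ l \<cdot>\<^sub>m Y)"
      using c by (intro add_mult_distrib_mat[of _ n n _ _ n]) auto
    also have "(fps_X ^ l \<cdot>\<^sub>m V) * (1\<^sub>m n + fps_X ^ l \<cdot>\<^sub>m Y) = fps_X ^ l \<cdot>\<^sub>m V + fps_X ^ r \<cdot>\<^sub>m (V * Y)"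
      using c by (simp add: mult_add_distrib_mat[of _ n n _ n] smult_mat_mult_smult_mat[of _ n n _ n] r power_add mult_2)
    finally show ?thesis using c by (intro eq_matI) (auto simp: algebra_simps)
  qed
  also have "reduce_mat r \<dots> = reduce_mat r (1\<^sub>m n + fps_X ^ l \<cdot>\<^sub>m (V + Y))"
    using c by (auto simp: mat_eq_iff fps_eq_iff fps_X_power_mult_nth)
  finally show ?thesis using c by (simp add: cong_elt_def reduce_mult_reduce[of _ n n _ n])
qed

lemma cong_elt_conj:
  assumes g: "g \<in> carrier G" and V: "V \<in> mats k n"
  shows "inv\<^bsub>G\<^esub> g \<otimes>\<^bsub>G\<^esub> cong_elt V \<otimes>\<^bsub>G\<^esub> g = cong_elt (inv\<^bsub>G\<^esub> g * V * g)"
proof -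
  let ?gi = "inv\<^bsub>G\<^esub> g"
  note gm = G_mats[OF g] and gi = G_mats[OF G.inv_closed[OF g]] and c = dims[OF V]
  have "?gi \<otimes>\<^bsub>G\<^esub> cong_elt V \<otimes>\<^bsub>G\<^esub> g = reduce_mat r (?gi * (1\<^sub>m n + fps_X ^ l \<cdot>\<^sub>m V) * g)"
    using gm gi c by (simp add: cong_elt_def reduce_mult_reduce[of _ n n _ n])
  also have "?gi * (1\<^sub>m n + fps_X ^ l \<cdot>\<^sub>m V) * g = ?gi * g + fps_X ^ l \<cdot>\<^sub>m (?gi * V * g)"
    using gm gi c by (simp add: mult_add_distrib_mat[of _ n n _ n] add_mult_distrib_mat[of _ n n _ _ n]
        mult_smult_distrib[of _ n n _ n] mult_smult_assoc_mat[of _ n n _ n])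
  also have "reduce_mat r \<dots> = cong_elt (?gi * V * g)"
    unfolding cong_elt_def using gm gi c G_inv[OF g] by (intro reduce_add_cong[of _ _ _ _ _ n n]) auto
  finally show ?thesis .
qed

lemma T_normal:
  assumes "g \<in> carrier G" "t \<in> T"
  shows "inv\<^bsub>G\<^esub> g \<otimes>\<^bsub>G\<^esub> t \<otimes>\<^bsub>G\<^esub> g \<in> T"
  using cong_elt_conj[OF assms(1) elt_cong_part(1)[OF assms(2)]] elt_cong_part[OF assms(2)] G_mats(1)[OF assms(1)]
    G_mats(1)[OF G.inv_closed[OF assms(1)]] by (auto intro!: cong_elt_T mk)

lemma T_subgroup: "subgroup T G"
proof (rule G.subgroupI)
  show "T \<subseteq> carrier G" by (rule T_carrier)
  have "cong_elt (0\<^sub>m n n) \<in> T" by (rule cong_elt_T) (rule mk)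
  thus "T \<noteq> {}" by blast
  fix t assume t: "t \<in> T"
  define V where "V = cong_part l t"
  have V: "V \<in> mats k n" "t = cong_elt V" using elt_cong_part[OF t] by (auto simp: V_def)
  have mX: "- V \<in> mats k n" using V(1) fk by (auto simp: mats_def)
  have "cong_elt (- V) \<otimes>\<^bsub>G\<^esub> cong_elt V = cong_elt (0\<^sub>m n n)"
    using cong_elt_mult[OF mX V(1)] dims[OF V(1)] by (simp add: uminus_l_inv_mat)
  also have "\<dots> = \<one>\<^bsub>G\<^esub>" by (simp add: cong_elt_def)
  finally have "inv\<^bsub>G\<^esub> t = cong_elt (- V)" using V cong_elt_T T_carrier mX by (intro G.inv_equality) auto
  thus "inv\<^bsub>G\<^esub> t \<in> T" using cong_elt_T[OF mX] by simp
  fix s assume s: "s \<in> T"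
  show "t \<otimes>\<^bsub>G\<^esub> s \<in> T"
    using cong_elt_mult[OF V(1) elt_cong_part(1)[OF s]] elt_cong_part[OF s] V by (auto intro!: cong_elt_T mk)
qed

lemma wt_elt: "B \<in> mats k n \<Longrightarrow> V \<in> mats k n \<Longrightarrow> wt B (cong_elt V) = \<chi> (mat_trace (B * V))"
  unfolding wt_def cong_part_elt using dims
  by (intro \<chi>_cong trace_over mk cutoff_mat_trace_cong[of _ _ _ n] reduce_mult_cong[of _ _ _ _ _ n n n]) auto

lemma wt_mult:
  assumes B: "B \<in> mats k n" and t: "t \<in> T" "s \<in> T"
  shows "wt B (t \<otimes>\<^bsub>G\<^esub> s) = wt B t * wt B s"
proof -
  define V Y where "V = cong_part l t" and "Y = cong_part l s"
  have V: "V \<in> mats k n" "t = cong_elt V" and Y: "Y \<in> mats k n" "s = cong_elt Y"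
    using elt_cong_part[OF t(1)] elt_cong_part[OF t(2)] by (auto simp: V_def Y_def)
  have "mat_trace (B * (V + Y)) = mat_trace (B * V) + mat_trace (B * Y)"
    using dims B V Y by (simp add: mult_add_distrib_mat[of _ n n _ n] mat_trace_add[of _ n])
  thus ?thesis unfolding V(2) Y(2) cong_elt_mult[OF V(1) Y(1)] using B V Y
    by (simp add: wt_elt mk \<chi>_add trace_over)
qed

lemma wt_nz: "B \<in> mats k n \<Longrightarrow> t \<in> T \<Longrightarrow> wt B t \<noteq> 0"
  unfolding wt_def by (intro \<chi>_nz trace_over mk elt_cong_part)

lemma wt_cong:
  assumes "reduce_mat l B = reduce_mat l B'" "B \<in> mats k n" "B' \<in> mats k n" "t \<in> T"
  shows "wt B t = wt B' t"
  unfolding wt_def using dims assms elt_cong_part[OF assms(4)]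
  by (intro \<chi>_cong trace_over mk cutoff_mat_trace_cong[of _ _ _ n] reduce_mult_cong[of _ _ _ _ _ n n n]) auto

text \<open>By cyclicity of the trace, conjugation moves from the group element to \<open>B\<close>:
  the action on characters of \<open>T\<close> is conjugation of matrices modulo
  \<open>\<pi>^l\<close>.\<close>

lemma wt_conj:
  assumes B: "B \<in> mats k n" and g: "g \<in> carrier G" and t: "t \<in> T"
  shows "wt B (inv\<^bsub>G\<^esub> g \<otimes>\<^bsub>G\<^esub> t \<otimes>\<^bsub>G\<^esub> g) = wt (g * B * inv\<^bsub>G\<^esub> g) t"
proof -
  let ?gi = "inv\<^bsub>G\<^esub> g"
  define V where "V = cong_part l t"
  have V: "V \<in> mats k n" "t = cong_elt V" using elt_cong_part[OF t] by (auto simp: V_def)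
  note gm = G_mats[OF g] and gi = G_mats[OF G.inv_closed[OF g]] and c = dims[OF V(1)] dims[OF B]
  have "mat_trace (B * (?gi * V * g)) = mat_trace (g * B * ?gi * V)"
  proof -
    have "B * (?gi * V * g) = B * (?gi * V) * g" using gm gi c by (simp add: assoc_mult_mat[of _ n n _ n _ n])
    hence "mat_trace (B * (?gi * V * g)) = mat_trace (g * (B * (?gi * V)))"
      using gm gi c by (simp add: mat_trace_mult_comm[of _ n n])
    thus ?thesis using gm gi c by (simp add: assoc_mult_mat[of _ n n _ n _ n])
  qed
  thus ?thesis unfolding V(2) cong_elt_conj[OF g V(1)] using B V gm gi by (simp add: wt_elt mk)
qed

text \<open>Nondegeneracy of the trace pairing, applied to the difference \<open>B - B'\<close>;
  together with \<open>wt_cong\<close> it identifies characters of this form with matrices modulo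
  \<open>\<pi>^l\<close>.\<close>

lemma wt_eqD:
  assumes B: "B \<in> mats k n" "B' \<in> mats k n" and eq: "\<And>t. t \<in> T \<Longrightarrow> wt B t = wt B' t"
  shows "reduce_mat l B = reduce_mat l B'"
proof -
  have "reduce_mat l (B - B') = 0\<^sub>m n n"
  proof (rule \<chi>_trace_nondegenerate)
    fix V assume V: "V \<in> mats k n"
    have "mat_trace ((B - B') * V) + mat_trace (B' * V) = mat_trace (B * V)"
      using B V dims by (simp add: minus_mult_distrib_mat[of _ n n _ _ n] mat_trace_diff[of _ n])
    hence "\<chi> (mat_trace ((B - B') * V)) * \<chi> (mat_trace (B' * V)) = \<chi> (mat_trace (B * V))"
      using B V by (subst \<chi>_add[symmetric]) (auto intro!: trace_over mk)
    also have "\<dots> = \<chi> (mat_trace (B' * V))" using eq[OF cong_elt_T[OF V]] B V by (simp add: wt_elt)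
    finally show "\<chi> (mat_trace ((B - B') * V)) = 1"
      using \<chi>_nz[of "mat_trace (B' * V)"] B V by (auto simp: trace_over mk)
  qed (use B in \<open>auto intro!: mk\<close>)
  hence "fps_cutoff l (B $$ (i, j) - B' $$ (i, j)) = 0" if "i < n" "j < n" for i j
    using that B dims by (auto simp: mat_eq_iff)
  thus ?thesis using B dims by (auto simp: reduce_eq_iff[of _ n n] fps_cutoff_diff)
qed

end

subsection \<open>The representation attached to a nilpotent matrix\<close>

text \<open>A constant factor does not mix degrees, so truncation passes through the product.
  Commuting with a constant matrix can therefore be tested without truncating.\<close>

lemma reduce_mult_const:
  fixes A :: "'a::comm_ring_1 fps mat"
  assumes "A \<in> carrier_mat n n" "M \<in> carrier_mat n n"
  shows "reduce_mat m (A * const_mat M) = reduce_mat m A * const_mat M"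
    "reduce_mat m (const_mat M * A) = const_mat M * reduce_mat m A"
proof -
  have 1: "fps_cutoff m (x * fps_const c) = fps_cutoff m x * fps_const c" for x :: "'a fps" and c
    by (auto simp: fps_eq_iff)
  have 2: "fps_cutoff m (fps_const c * x) = fps_const c * fps_cutoff m x" for x :: "'a fps" and c
    by (auto simp: fps_eq_iff)
  show "reduce_mat m (A * const_mat M) = reduce_mat m A * const_mat M"
    using assms by (intro eq_matI) (auto simp: scalar_prod_def fps_cutoff_sum 1)
  show "reduce_mat m (const_mat M * A) = const_mat M * reduce_mat m A"
    using assms by (intro eq_matI) (auto simp: scalar_prod_def fps_cutoff_sum 2)
qed

locale nilpotent_character = truncated_gl k n l r \<chi>
  for k :: "'a::field set" and n l r :: nat and \<chi> :: "'a fps \<Rightarrow> 'c::field" +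
  fixes M :: "'a mat"
  assumes M: "M \<in> carrier_mat n n" and Mk: "i < n \<Longrightarrow> j < n \<Longrightarrow> M $$ (i, j) \<in> k" and nil: "nilpotent_mat M"
begin

abbreviation "C \<equiv> GL_centraliser k n r (const_mat M)"
abbreviation "H \<equiv> C <#>\<^bsub>G\<^esub> T"
abbreviation "cM \<equiv> const_mat M"

lemma cM: "cM \<in> mats k n" "cM \<in> carrier_mat n n"
  using M Mk fk by (auto simp: mats_def)

lemma C_iff: "x \<in> C \<longleftrightarrow> x \<in> carrier G \<and> x * cM = cM * x"
proof -
  have "reduce_mat r (x * cM) = x * cM \<and> reduce_mat r (cM * x) = cM * x" if "x \<in> carrier G"
    using reduce_mult_const[OF G_mats(2)[OF that] M, of r] G_mats(3)[OF that] by simp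
  thus ?thesis unfolding GL_centraliser_def by auto
qed

text \<open>Below degree \<open>l\<close> every coefficient matrix \<open>W\<close> of
  \<open>V\<close> commutes with the nilpotent \<open>M\<close>, so \<open>M * W\<close> is
  nilpotent and has trace zero. This is the reason why the character extends trivially over the
  centraliser of \<open>M\<close>.\<close>

lemma trace_centraliser:
  assumes V: "V \<in> mats k n" and comm: "reduce_mat l (V * cM) = reduce_mat l (cM * V)"
  shows "\<chi> (mat_trace (cM * V)) = 1"
proof -
  note c = dims[OF V]
  have "fps_cutoff l (mat_trace (cM * V)) = fps_cutoff l 0"
  proof (rule fps_ext)
    fix a
    define W where "W = map_mat (\<lambda>x. fps_nth x a) V"
    have W: "W \<in> carrier_mat n n" using c by (simp add: W_def)
    have MW: "(M * W) $$ (i, j) = fps_nth ((cM * V) $$ (i, j)) a" and WM: "(W * M) $$ (i, j) = fps_nth ((V * cM) $$ (i, j)) a"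
      if "i < n" "j < n" for i j
      using that c M by (simp_all add: W_def scalar_prod_def fps_sum_nth)
    show "fps_nth (fps_cutoff l (mat_trace (cM * V))) a = fps_nth (fps_cutoff l 0) a"
    proof (cases "a < l")
      case True
      have comm': "M * W = W * M"
      proof (rule eq_matI)
        fix i j assume "i < dim_row (W * M)" "j < dim_col (W * M)"
        hence ij: "i < n" "j < n" using W M by auto
        have "fps_cutoff l ((V * cM) $$ (i, j)) = fps_cutoff l ((cM * V) $$ (i, j))"
          using comm reduce_eq_iff[of "V * cM" n n "cM * V" l] c cM ij by auto
        from arg_cong[OF this, of "\<lambda>x. fps_nth x a"] show "(M * W) $$ (i, j) = (W * M) $$ (i, j)"
          using True MW[OF ij] WM[OF ij] by simp
      qed (use W M in auto)
      obtain e where e: "M ^\<^sub>m e = 0\<^sub>m n n" using nil M by (auto simp: nilpotent_mat_def)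
      have "(M * W) ^\<^sub>m e = 0\<^sub>m n n"
        using pow_mat_mult_commute(2)[OF M W comm', of e] left_mult_zero_mat[OF pow_carrier_mat[OF W, of e]] unfolding e by simp
      hence "mat_trace (M * W) = 0" using M W by (intro mat_trace_nilpotent[of _ n e]) auto
      moreover have "mat_trace (M * W) = fps_nth (mat_trace (cM * V)) a"
        using M by (simp add: mat_trace_def fps_sum_nth MW)
      ultimately show ?thesis by simp
    qed simp
  qed
  hence "\<chi> (mat_trace (cM * V)) = \<chi> 0" using V cM fk by (intro \<chi>_cong trace_over mk) auto
  thus ?thesis by (simp add: \<chi>_0)
qed

lemma C_subgroup: "subgroup C G"
proof (rule G.subgroupI)
  show "C \<subseteq> carrier G" by (auto simp: C_iff)
  have "\<one>\<^bsub>G\<^esub> \<in> C" unfolding GL_centraliser_def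
    using cM(2) G.one_closed by (simp add: reduce_mult_reduce[of _ n n _ n])
  thus "C \<noteq> {}" by blast
  fix x assume x: "x \<in> C"
  hence xG: "x \<in> carrier G" and xc: "x * cM = cM * x" by (auto simp: C_iff)
  let ?xi = "inv\<^bsub>G\<^esub> x"
  note xm = G_mats[OF xG] and xi = G_mats[OF G.inv_closed[OF xG]]
  have "reduce_mat r (?xi * cM) = reduce_mat r (?xi * cM * (x * ?xi))"
    using reduce_mult_cong[of r "?xi * cM" "?xi * cM" "x * ?xi" "1\<^sub>m n" n n n] G_inv[OF xG] xm xi cM by simp
  also have "?xi * cM * (x * ?xi) = ?xi * (cM * x) * ?xi"
    using xm xi cM by (simp add: assoc_mult_mat[of _ n n _ n _ n])
  also have "\<dots> = ?xi * x * (cM * ?xi)" unfolding xc[symmetric]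
    using xm xi cM by (simp add: assoc_mult_mat[of _ n n _ n _ n])
  also have "reduce_mat r \<dots> = reduce_mat r (cM * ?xi)"
  proof -
    have "reduce_mat r (?xi * x * (cM * ?xi)) = reduce_mat r (1\<^sub>m n * (cM * ?xi))"
      using G_inv[OF xG] xm xi cM by (intro reduce_mult_cong[of _ _ _ _ _ n n n]) auto
    thus ?thesis using xi cM by simp
  qed
  finally show "?xi \<in> C" using xG by (simp add: GL_centraliser_def)
  fix y assume y: "y \<in> C"
  hence yG: "y \<in> carrier G" and yc: "y * cM = cM * y" by (auto simp: C_iff)
  note ym = G_mats[OF yG]
  have "x * y * cM = cM * (x * y)"
  proof -
    have "x * y * cM = x * cM * y" using xm ym cM yc by (simp add: assoc_mult_mat[of _ n n _ n _ n])
    thus ?thesis unfolding xc using xm ym cM by (simp add: assoc_mult_mat[of _ n n _ n _ n])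
  qed
  hence "reduce_mat r (reduce_mat r (x * y) * cM) = reduce_mat r (cM * reduce_mat r (x * y))"
    using xm ym cM by (simp add: reduce_mult_reduce[of _ n n _ n])
  thus "x \<otimes>\<^bsub>G\<^esub> y \<in> C" using G.m_closed[OF xG yG] by (simp add: GL_centraliser_def)
qed

lemma H_subgroup: "subgroup H G"
  by (rule subgroup_set_mult[OF G.is_group C_subgroup T_subgroup T_normal])

lemma wt_C_conj:
  assumes x: "x \<in> C" and t: "t \<in> T"
  shows "wt cM (inv\<^bsub>G\<^esub> x \<otimes>\<^bsub>G\<^esub> t \<otimes>\<^bsub>G\<^esub> x) = wt cM t"
proof -
  have xG: "x \<in> carrier G" and xc: "x * cM = cM * x" using x by (auto simp: C_iff)
  note xm = G_mats[OF xG] and xi = G_mats[OF G.inv_closed[OF xG]]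
  have "reduce_mat r (x * cM * inv\<^bsub>G\<^esub> x) = reduce_mat r (cM * (x * inv\<^bsub>G\<^esub> x))"
    unfolding xc using xm xi cM by (simp add: assoc_mult_mat[of _ n n _ n _ n])
  also have "\<dots> = reduce_mat r cM"
    using reduce_mult_cong[of r cM cM "x * inv\<^bsub>G\<^esub> x" "1\<^sub>m n" n n n] G_inv[OF xG] xm xi cM by simp
  finally have "reduce_mat l (x * cM * inv\<^bsub>G\<^esub> x) = reduce_mat l cM" using lr by (rule reduce_mono)
  thus ?thesis unfolding wt_conj[OF cM(1) xG t] using xm xi cM t by (intro wt_cong mk) auto
qed

text \<open>Commutation of \<open>1 + \<pi>^l V\<close> with \<open>M\<close> modulo
  \<open>\<pi>^(2 l)\<close> says that \<open>V\<close> commutes with \<open>M\<close> modulo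
  \<open>\<pi>^l\<close>, exactly the precision that \<open>trace_centraliser\<close> asks
  for.\<close>

lemma wt_C_inter_T:
  assumes "t \<in> C" "t \<in> T"
  shows "wt cM t = 1"
proof -
  define V where "V = cong_part l t"
  have V: "V \<in> mats k n" "t = cong_elt V" using elt_cong_part[OF assms(2)] by (auto simp: V_def)
  note c = dims[OF V(1)]
  have "reduce_mat r (cong_elt V * cM) = reduce_mat r (cM * cong_elt V)"
    using assms(1) V by (simp add: C_iff)
  hence "reduce_mat r ((1\<^sub>m n + fps_X ^ l \<cdot>\<^sub>m V) * cM) = reduce_mat r (cM * (1\<^sub>m n + fps_X ^ l \<cdot>\<^sub>m V))"
    using c cM by (simp add: cong_elt_def reduce_mult_reduce[of _ n n _ n])
  moreover have "(1\<^sub>m n + fps_X ^ l \<cdot>\<^sub>m V) * cM = cM + fps_X ^ l \<cdot>\<^sub>m (V * cM)"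
    "cM * (1\<^sub>m n + fps_X ^ l \<cdot>\<^sub>m V) = cM + fps_X ^ l \<cdot>\<^sub>m (cM * V)"
    using c cM by (simp_all add: mult_add_distrib_mat[of _ n n _ n] add_mult_distrib_mat[of _ n n _ _ n]
        mult_smult_distrib[of _ n n _ n] mult_smult_assoc_mat[of _ n n _ n])
  ultimately have "reduce_mat r (cM + fps_X ^ l \<cdot>\<^sub>m (V * cM) - cM) = reduce_mat r (cM + fps_X ^ l \<cdot>\<^sub>m (cM * V) - cM)"
    using c cM by (intro reduce_add_cong(2)[of _ _ _ _ _ n n]) auto
  moreover have "cM + Z - cM = Z" if "Z \<in> carrier_mat n n" for Z
    using that cM by (intro eq_matI) auto
  ultimately have "reduce_mat (l + l) (fps_X ^ l \<cdot>\<^sub>m (V * cM)) = reduce_mat (l + l) (fps_X ^ l \<cdot>\<^sub>m (cM * V))"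
    using c cM r by (simp add: mult_2)
  hence "reduce_mat l (V * cM) = reduce_mat l (cM * V)"
    using c cM by (intro reduce_X_power_smult_cancel[of l l _ _ n n]) auto
  thus ?thesis unfolding V(2) using V(1) cM by (simp add: wt_elt trace_centraliser)
qed

definition "ext y = (THE c. \<exists>x\<in>C. \<exists>t\<in>T. y = x \<otimes>\<^bsub>G\<^esub> t \<and> c = wt cM t)"

text \<open>Two factorisations of one element differ by an element of both \<open>C\<close> and
  \<open>T\<close>, where the character is trivial; so the \<open>THE\<close> in
  \<open>ext_def\<close> has a single candidate.\<close>

lemma ext:
  assumes x: "x \<in> C" and t: "t \<in> T"
  shows "ext (x \<otimes>\<^bsub>G\<^esub> t) = wt cM t"
  unfolding ext_def
proof (rule the_equality)
  show "\<exists>x'\<in>C. \<exists>t'\<in>T. x \<otimes>\<^bsub>G\<^esub> t = x' \<otimes>\<^bsub>G\<^esub> t' \<and> wt cM t = wt cM t'" using x t by blast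
  fix c assume "\<exists>x'\<in>C. \<exists>t'\<in>T. x \<otimes>\<^bsub>G\<^esub> t = x' \<otimes>\<^bsub>G\<^esub> t' \<and> c = wt cM t'"
  then obtain x' t' where x': "x' \<in> C" "t' \<in> T" "x \<otimes>\<^bsub>G\<^esub> t = x' \<otimes>\<^bsub>G\<^esub> t'" "c = wt cM t'" by blast
  interpret C: subgroup C G by (rule C_subgroup)
  interpret T: subgroup T G by (rule T_subgroup)
  define y where "y = inv\<^bsub>G\<^esub> x' \<otimes>\<^bsub>G\<^esub> x"
  have yC: "y \<in> C" using x x' C.m_closed C.m_inv_closed by (simp add: y_def del: GL_trunc_mult)
  have yt: "y \<otimes>\<^bsub>G\<^esub> t = t'"
  proof -
    have "y \<otimes>\<^bsub>G\<^esub> t = inv\<^bsub>G\<^esub> x' \<otimes>\<^bsub>G\<^esub> (x \<otimes>\<^bsub>G\<^esub> t)" unfolding y_def using x x' t by (intro G.m_assoc) auto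
    also have "\<dots> = t'" unfolding x'(3)
      by (intro G.inv_solve_left'[THEN iffD2]) (use x' in \<open>auto simp del: GL_trunc_mult intro!: G.m_closed\<close>)
    finally show ?thesis .
  qed
  have "y = t' \<otimes>\<^bsub>G\<^esub> inv\<^bsub>G\<^esub> t"
    by (rule G.inv_solve_right[THEN iffD2]) (use yC t x' yt in \<open>auto simp del: GL_trunc_mult\<close>)
  hence "y \<in> T" using T.m_closed[OF x'(2) T.m_inv_closed[OF t]] by simp
  hence "wt cM t' = wt cM y * wt cM t" using wt_mult[OF cM(1) _ t, of y] yt by simp
  thus "c = wt cM t" using wt_C_inter_T[OF yC \<open>y \<in> T\<close>] x' by simp
qed

lemma ext_T: "t \<in> T \<Longrightarrow> ext t = wt cM t"
proof -
  assume t: "t \<in> T"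
  interpret C: subgroup C G by (rule C_subgroup)
  have "\<one>\<^bsub>G\<^esub> \<otimes>\<^bsub>G\<^esub> t = t" using t T_carrier by (intro G.l_one) auto
  thus ?thesis using ext[OF C.one_closed t] by (simp only:)
qed

lemma H_cases:
  assumes "y \<in> H"
  obtains x t where "x \<in> C" "t \<in> T" "y = x \<otimes>\<^bsub>G\<^esub> t"
  using assms unfolding set_mult_def by blast

lemma ext_nz: "y \<in> H \<Longrightarrow> ext y \<noteq> 0"
  by (erule H_cases) (simp only: ext wt_nz[OF cM(1)] not_False_eq_True)

text \<open>Moving \<open>x'\<close> to the left past \<open>t\<close> replaces \<open>t\<close> by
  a conjugate, and conjugation by an element of \<open>C\<close> does not change the
  character.\<close>

lemma ext_mult:
  assumes "y \<in> H" "z \<in> H"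
  shows "ext (y \<otimes>\<^bsub>G\<^esub> z) = ext y * ext z"
proof -
  interpret C: subgroup C G by (rule C_subgroup)
  interpret T: subgroup T G by (rule T_subgroup)
  obtain x t where y: "x \<in> C" "t \<in> T" "y = x \<otimes>\<^bsub>G\<^esub> t" using assms(1) by (rule H_cases)
  obtain x' t' where z: "x' \<in> C" "t' \<in> T" "z = x' \<otimes>\<^bsub>G\<^esub> t'" using assms(2) by (rule H_cases)
  have "y \<otimes>\<^bsub>G\<^esub> z = (x \<otimes>\<^bsub>G\<^esub> x') \<otimes>\<^bsub>G\<^esub> ((inv\<^bsub>G\<^esub> x' \<otimes>\<^bsub>G\<^esub> t \<otimes>\<^bsub>G\<^esub> x') \<otimes>\<^bsub>G\<^esub> t')"
  proof -
    have "(x \<otimes>\<^bsub>G\<^esub> x') \<otimes>\<^bsub>G\<^esub> ((inv\<^bsub>G\<^esub> x' \<otimes>\<^bsub>G\<^esub> t \<otimes>\<^bsub>G\<^esub> x') \<otimes>\<^bsub>G\<^esub> t') =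
        x \<otimes>\<^bsub>G\<^esub> (x' \<otimes>\<^bsub>G\<^esub> inv\<^bsub>G\<^esub> x') \<otimes>\<^bsub>G\<^esub> t \<otimes>\<^bsub>G\<^esub> x' \<otimes>\<^bsub>G\<^esub> t'"
      using y z by (simp only: G.m_assoc C.mem_carrier T.mem_carrier G.inv_closed G.m_closed)
    also have "\<dots> = y \<otimes>\<^bsub>G\<^esub> z"
      using y z by (simp only: G.m_assoc C.mem_carrier T.mem_carrier G.inv_closed G.m_closed G.r_inv G.r_one)
    finally show ?thesis by (rule sym)
  qed
  moreover have "x \<otimes>\<^bsub>G\<^esub> x' \<in> C" by (rule C.m_closed[OF y(1) z(1)])
  moreover have c: "inv\<^bsub>G\<^esub> x' \<otimes>\<^bsub>G\<^esub> t \<otimes>\<^bsub>G\<^esub> x' \<in> T" by (rule T_normal[OF C.mem_carrier[OF z(1)] y(2)])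
  moreover have "(inv\<^bsub>G\<^esub> x' \<otimes>\<^bsub>G\<^esub> t \<otimes>\<^bsub>G\<^esub> x') \<otimes>\<^bsub>G\<^esub> t' \<in> T" by (rule T.m_closed[OF c z(2)])
  ultimately have "ext (y \<otimes>\<^bsub>G\<^esub> z) = wt cM ((inv\<^bsub>G\<^esub> x' \<otimes>\<^bsub>G\<^esub> t \<otimes>\<^bsub>G\<^esub> x') \<otimes>\<^bsub>G\<^esub> t')" by (simp only: ext)
  also have "\<dots> = wt cM t * wt cM t'" by (simp only: wt_mult[OF cM(1) c z(2)] wt_C_conj[OF z(1) y(2)])
  finally show ?thesis using y z by (simp only: ext)
qed

text \<open>If no \<open>t\<close> separates, then \<open>g\<close> commutes with \<open>M\<close>
  modulo \<open>\<pi>^l\<close>. Since \<open>M\<close> is constant, the truncation of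
  \<open>g\<close> at \<open>l\<close> commutes with \<open>M\<close> exactly, and it is again
  invertible; so \<open>g\<close> is an element of \<open>C\<close> times an element of
  \<open>T\<close>.\<close>

lemma not_H_separated:
  assumes g: "g \<in> carrier G" "g \<notin> H"
  shows "\<exists>t\<in>T. wt cM (inv\<^bsub>G\<^esub> g \<otimes>\<^bsub>G\<^esub> t \<otimes>\<^bsub>G\<^esub> g) \<noteq> wt cM t"
proof (rule ccontr)
  assume *: "\<not> ?thesis"
  let ?gi = "inv\<^bsub>G\<^esub> g"
  note gm = G_mats[OF g(1)] and gi = G_mats[OF G.inv_closed[OF g(1)]]
  have "reduce_mat l (g * cM * ?gi) = reduce_mat l cM"
    using * wt_conj[OF cM(1) g(1)] cM gm gi by (intro wt_eqD mk) auto
  hence "reduce_mat l (g * cM * ?gi * g) = reduce_mat l (cM * g)"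
    using gm gi cM by (intro reduce_mult_cong[of _ _ _ _ _ n n n]) auto
  moreover have "reduce_mat l (g * cM * (?gi * g)) = reduce_mat l (g * cM * 1\<^sub>m n)"
    using gm gi cM reduce_mono[OF G_inv(2)[OF g(1)] lr] by (intro reduce_mult_cong[of _ _ _ _ _ n n n]) auto
  ultimately have comm: "reduce_mat l (g * cM) = reduce_mat l (cM * g)"
    using gm gi cM by (simp add: assoc_mult_mat[of _ n n _ n _ n])
  \<comment> \<open>This lift of \<open>g\<close> modulo \<open>\<pi>^l\<close> has no terms of
    degree \<open>l\<close> or higher, so its commutator with the constant matrix \<open>M\<close>
    vanishes entirely and not just modulo \<open>\<pi>^l\<close>.\<close>
  define x where "x = reduce_mat l g"
  have x: "x \<in> mats k n" "reduce_mat l x = reduce_mat l g" unfolding x_def using gm by (auto intro!: mk)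
  have rx: "reduce_mat r x = x" by (auto simp: x_def mat_eq_iff fps_eq_iff r)
  have "x * cM = cM * x" using comm reduce_mult_const[OF gm(2) M, of l] by (simp add: x_def)
  hence xC: "x \<in> C" using unit_lift(1)[OF g(1) x] rx by (simp add: C_iff)
  have xG: "x \<in> carrier G" using xC by (simp add: C_iff)
  have t: "inv\<^bsub>G\<^esub> x \<otimes>\<^bsub>G\<^esub> g \<in> T" using unit_lift(2)[OF g(1) x] rx by simp
  have "g = x \<otimes>\<^bsub>G\<^esub> (inv\<^bsub>G\<^esub> x \<otimes>\<^bsub>G\<^esub> g)"
    using xG g(1) by (simp only: G.m_assoc[symmetric] G.inv_closed G.r_inv G.l_one)
  hence "g \<in> H" using xC t unfolding set_mult_def by blast
  thus False using g(2) by simp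
qed

lemma T_sub_H: "T \<subseteq> H"
proof
  fix t assume t: "t \<in> T"
  interpret C: subgroup C G by (rule C_subgroup)
  have "t = \<one>\<^bsub>G\<^esub> \<otimes>\<^bsub>G\<^esub> t" by (rule G.l_one[symmetric]) (use t T_carrier in blast)
  thus "t \<in> H" using C.one_closed t unfolding set_mult_def by blast
qed

definition "nu = induced_rep G H (\<lambda>y. mat 1 1 (\<lambda>_. ext y))"

text \<open>For a one-dimensional representation separation inside a block is vacuous, and Mackey's
  condition says that no element outside \<open>H\<close> stabilises the character of
  \<open>T\<close>.\<close>

sublocale ind: induction_data G H T 1 "\<lambda>y. mat 1 1 (\<lambda>_. ext y)"
proof (rule induction_data.intro)
  show "subgroup H G" by (rule H_subgroup)
  show "finite (carrier G)" by (rule GL_trunc_finite[OF kfin])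
  show "T \<subseteq> H" by (rule T_sub_H)
  show "inv\<^bsub>G\<^esub> g \<otimes>\<^bsub>G\<^esub> t \<otimes>\<^bsub>G\<^esub> g \<in> T" if "g \<in> carrier G" "t \<in> T" for g t by (rule T_normal) fact+
  have HG: "group (G\<lparr>carrier := H\<rparr>)" by (rule G.subgroup_imp_group[OF H_subgroup])
  have one: "ext \<one>\<^bsub>G\<^esub> = 1"
  proof -
    have oH: "\<one>\<^bsub>G\<^esub> \<in> H" by (rule subgroup.one_closed[OF H_subgroup])
    have "ext \<one>\<^bsub>G\<^esub> * ext \<one>\<^bsub>G\<^esub> = ext (\<one>\<^bsub>G\<^esub> \<otimes>\<^bsub>G\<^esub> \<one>\<^bsub>G\<^esub>)" by (rule ext_mult[OF oH oH, symmetric])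
    also have "\<dots> = ext \<one>\<^bsub>G\<^esub>" by (simp only: G.r_one G.one_closed)
    finally show ?thesis using ext_nz[OF oH] by (simp del: GL_trunc_one)
  qed
  show "weight_rep (G\<lparr>carrier := H\<rparr>) T 1 (\<lambda>y. mat 1 1 (\<lambda>_. ext y))"
    unfolding weight_rep_def
  proof (intro conjI allI impI ballI)
    show "representation (G\<lparr>carrier := H\<rparr>) 1 (\<lambda>y. mat 1 1 (\<lambda>_. ext y))"
    proof (rule representationI[OF HG])
      fix y z assume "y \<in> carrier (G\<lparr>carrier := H\<rparr>)" "z \<in> carrier (G\<lparr>carrier := H\<rparr>)"
      hence "ext (y \<otimes>\<^bsub>G\<^esub> z) = ext y * ext z" by (intro ext_mult) auto
      thus "mat 1 1 (\<lambda>_. ext (y \<otimes>\<^bsub>G\<lparr>carrier := H\<rparr>\<^esub> z)) = mat 1 1 (\<lambda>_. ext y) * mat 1 1 (\<lambda>_. ext z)"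
        by (auto simp: mat_eq_iff scalar_prod_def)
    qed (use one in \<open>auto simp: mat_eq_iff\<close>)
    fix i j :: nat assume "i < 1" "j < 1"
    thus "\<exists>g\<in>carrier (G\<lparr>carrier := H\<rparr>). moves_basis 1 (mat 1 1 (\<lambda>_. ext g)) j i"
      using one H_subgroup[THEN subgroup.one_closed]
      by (intro bexI[of _ "\<one>\<^bsub>G\<^esub>"]) (auto simp: moves_basis_def simp del: GL_trunc_one)
  qed (auto simp: diagonal_mat_def)
  fix g and a b :: nat assume g: "g \<in> carrier G" "g \<notin> H" and ab: "a < 1" "b < 1"
  obtain t where t: "t \<in> T" "wt cM (inv\<^bsub>G\<^esub> g \<otimes>\<^bsub>G\<^esub> t \<otimes>\<^bsub>G\<^esub> g) \<noteq> wt cM t"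
    using not_H_separated[OF g] by blast
  show "\<exists>t\<in>T. mat 1 1 (\<lambda>_. ext (inv\<^bsub>G\<^esub> g \<otimes>\<^bsub>G\<^esub> t \<otimes>\<^bsub>G\<^esub> g)) $$ (a, a) \<noteq> mat 1 1 (\<lambda>_. ext t) $$ (b, b)"
    using t ab by (intro bexI[of _ t]) (simp_all add: ext_T T_normal[OF g(1)] del: GL_trunc_mult)
qed (simp_all add: G.is_group)

text \<open>The weight at the trivial coset is known only up to conjugation by some
  \<open>c \<in> H\<close>; as \<open>ext\<close> is a one-dimensional character of
  \<open>H\<close>, this conjugation has no effect, and the weight of \<open>M\<close> itself
  occurs.\<close>

lemma nu_weight_rep: "\<exists>D>0. weight_rep G T D nu \<and> (\<exists>u<D. \<forall>t\<in>T. nu t $$ (u, u) = wt cM t)"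
proof -
  let ?D = "length ind.ts * 1"
  obtain u c where u: "u < ?D" "c \<in> H"
    "\<forall>t\<in>T. nu t $$ (u, u) = mat 1 1 (\<lambda>_. ext (inv\<^bsub>G\<^esub> c \<otimes>\<^bsub>G\<^esub> t \<otimes>\<^bsub>G\<^esub> c)) $$ (0, 0)"
    using ind.I_weight_H[of 0] unfolding nu_def by auto
  have "nu t $$ (u, u) = wt cM t" if t: "t \<in> T" for t
  proof -
    have tH: "t \<in> H" using T_sub_H t by blast
    have ci: "inv\<^bsub>G\<^esub> c \<in> H" by (rule ind.H.m_inv_closed[OF u(2)])
    have "nu t $$ (u, u) = ext (inv\<^bsub>G\<^esub> c \<otimes>\<^bsub>G\<^esub> t \<otimes>\<^bsub>G\<^esub> c)" using u(3) t by simp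
    also have "\<dots> = ext (inv\<^bsub>G\<^esub> c) * ext t * ext c"
      by (simp only: ext_mult[OF ind.H.m_closed[OF ci tH] u(2)] ext_mult[OF ci tH])
    also have "\<dots> = ext t * ext (inv\<^bsub>G\<^esub> c \<otimes>\<^bsub>G\<^esub> c)"
      by (simp only: ext_mult[OF ci u(2)] mult_ac)
    also have "inv\<^bsub>G\<^esub> c \<otimes>\<^bsub>G\<^esub> c = \<one>\<^bsub>G\<^esub>" by (rule G.l_inv[OF ind.H.mem_carrier[OF u(2)]])
    also have "ext t * ext \<one>\<^bsub>G\<^esub> = ext t"
    proof -
      have "ext t = ext (t \<otimes>\<^bsub>G\<^esub> \<one>\<^bsub>G\<^esub>)" by (simp only: G.r_one[OF ind.H.mem_carrier[OF tH]])
      thus ?thesis by (simp only: ext_mult[OF tH ind.H.one_closed])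
    qed
    finally show ?thesis by (simp only: ext_T[OF t])
  qed
  thus ?thesis using ind.I_weight_rep ind.dim_pos u(1) unfolding nu_def by blast
qed

end

section \<open>Finite fields and the Frobenius\<close>

lemma card_gt_1: "1 < CARD('q::finite_field)"
proof -
  have "card {0, 1 :: 'q} \<le> CARD('q)" by (intro card_mono) auto
  thus ?thesis by simp
qed

interpretation to_ac: inj_comm_ring_hom to_ac
  by standard (auto)

lemma map_poly_pCons_zero:
  assumes "f 0 = 0"
  shows "map_poly f (pCons a p) = pCons (f a) (map_poly f p)"
  by (rule poly_eqI) (simp add: coeff_map_poly assms coeff_pCons split: nat.split)

lemma map_poly_to_ac_mult:
  fixes p q :: "'q::field poly"
  shows "map_poly to_ac (p * q) = map_poly to_ac p * map_poly to_ac q"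
  by (rule poly_eqI) (simp add: coeff_map_poly coeff_mult to_ac_sum)

lemma map_poly_to_ac_add:
  fixes p q :: "'q::field poly"
  shows "map_poly to_ac (p + q) = map_poly to_ac p + map_poly to_ac q"
  by (rule poly_eqI) (simp add: coeff_map_poly)

lemma poly_eqI_points:
  fixes p q :: "'a::idom poly"
  assumes "\<And>j. j < d \<Longrightarrow> poly p (x j) = poly q (x j)" "inj_on x {..<d}"
    "p = 0 \<or> Polynomial.degree p < d" "q = 0 \<or> Polynomial.degree q < d" "0 < d"
  shows "p = q"
proof (rule poly_eqI_degree[of "x ` {..<d}"])
  have "card (x ` {..<d}) = d" using assms(2) by (simp add: card_image)
  thus "Polynomial.degree p < card (x ` {..<d})" "Polynomial.degree q < card (x ` {..<d})"
    using assms(3-5) by auto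
qed (use assms(1) in auto)

text \<open>Additivity of Frobenius by counting roots: the difference of the two sides, as a
  polynomial, has degree below \<open>q\<close> since the leading terms cancel, and it vanishes at
  all \<open>q\<close> elements of the base field.\<close>

lemma one_add_power_card:
  fixes x :: "'q::finite_field alg_closure"
  shows "(x + 1) ^ CARD('q) = x ^ CARD('q) + 1"
proof -
  let ?q = "CARD('q)"
  define p where "p = [:1, 1:] ^ ?q - (monom (1 :: 'q alg_closure) ?q + 1)"
  have q: "1 < ?q" by (rule card_gt_1)
  have dp: "Polynomial.degree ([:1, 1:] ^ ?q :: 'q alg_closure poly) = ?q"
    by (subst degree_power_eq) auto
  have lc: "Polynomial.coeff ([:1, 1:] ^ ?q :: 'q alg_closure poly) ?q = 1"
    using lead_coeff_power[of "[:1, 1:] :: 'q alg_closure poly" ?q] dp by simp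
  have "Polynomial.degree p \<le> ?q" unfolding p_def
    by (intro degree_diff_le degree_add_le) (simp_all add: dp degree_monom_le)
  moreover have "Polynomial.coeff p ?q = 0" unfolding p_def using lc q by (simp add: coeff_1)
  ultimately have "p = 0 \<or> Polynomial.degree p < ?q"
    by (metis leading_coeff_0_iff le_neq_implies_less)
  moreover have "poly p (to_ac a) = 0" for a :: 'q
  proof -
    have fxd: "to_ac b ^ ?q = to_ac b" for b :: 'q
      by (metis finite_field_power_card_eq_same to_ac_power)
    have "(to_ac a + 1) ^ ?q = to_ac a + 1" using fxd[of "a + 1"] by simp
    thus ?thesis by (simp add: p_def poly_monom fxd add.commute)
  qed
  moreover obtain e where e: "bij_betw e {..<?q} (UNIV :: 'q set)"
    using ex_bij_betw_nat_finite[of "UNIV :: 'q set"] by (auto simp: lessThan_atLeast0)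
  ultimately have "p = 0"
    by (intro poly_eqI_points[of ?q p "\<lambda>i. to_ac (e i)" 0])
      (use q in \<open>auto simp: inj_on_def bij_betw_def\<close>)
  hence "poly p x = 0" by simp
  thus ?thesis by (simp add: p_def poly_monom add.commute)
qed

lemma power_card_add:
  fixes x y :: "'q::finite_field alg_closure"
  shows "(x + y) ^ CARD('q) = x ^ CARD('q) + y ^ CARD('q)"
proof (cases "y = 0")
  case True
  thus ?thesis using finite_UNIV_card_ge_0[where 'a = 'q] by simp
next
  case False
  have "x + y = y * (x / y + 1)" using False by (simp add: field_simps)
  hence "(x + y) ^ CARD('q) = y ^ CARD('q) * ((x / y) ^ CARD('q) + 1)"
    by (simp add: power_mult_distrib one_add_power_card)
  thus ?thesis using False by (simp add: field_simps)
qed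

lemma power_card_power_add:
  fixes x y :: "'q::finite_field alg_closure"
  shows "(x + y) ^ (CARD('q) ^ j) = x ^ (CARD('q) ^ j) + y ^ (CARD('q) ^ j)"
proof (induction j)
  case (Suc j)
  have "(x + y) ^ (CARD('q) ^ Suc j) = ((x + y) ^ (CARD('q) ^ j)) ^ CARD('q)"
    by (simp add: power_mult[symmetric] mult.commute)
  thus ?case unfolding Suc power_card_add by (simp add: power_mult[symmetric] mult.commute)
qed simp

lemma power_card_power_sum:
  fixes f :: "'i \<Rightarrow> 'q::finite_field alg_closure"
  shows "(\<Sum>i\<in>I. f i) ^ (CARD('q) ^ j) = (\<Sum>i\<in>I. f i ^ (CARD('q) ^ j))"
  by (induction I rule: infinite_finite_induct) (auto simp: power_card_power_add zero_power)

lemma power_card_power_minus: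
  fixes x y :: "'q::finite_field alg_closure"
  shows "(x - y) ^ (CARD('q) ^ j) = x ^ (CARD('q) ^ j) - y ^ (CARD('q) ^ j)"
  using power_card_power_add[of "x - y" y j] by (simp add: algebra_simps)

lemma power_card_power_inj:
  fixes x y :: "'q::finite_field alg_closure"
  assumes "x ^ (CARD('q) ^ j) = y ^ (CARD('q) ^ j)"
  shows "x = y"
  using power_card_power_minus[of x y j] assms by simp

text \<open>The polynomial \<open>X^q - X\<close> has at most \<open>q\<close> roots, and the image
  of the base field already supplies \<open>q\<close> of them.\<close>

lemma power_card_eq_imp_range:
  fixes x :: "'q::finite_field alg_closure"
  assumes "x ^ CARD('q) = x"
  shows "x \<in> range to_ac"
proof (rule ccontr)
  assume x: "x \<notin> range to_ac"
  let ?q = "CARD('q)"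
  have q: "1 < ?q" by (rule card_gt_1)
  define p where "p = monom (1 :: 'q alg_closure) ?q - [:0, 1:]"
  have "Polynomial.coeff [:0, 1 :: 'q alg_closure:] ?q = 0" using q by (intro coeff_eq_0) simp
  hence c: "Polynomial.coeff p ?q = 1" by (simp add: p_def)
  hence p0: "p \<noteq> 0" by auto
  have deg: "Polynomial.degree p \<le> ?q" unfolding p_def using q
    by (intro degree_diff_le) (simp_all add: degree_monom_le)
  have "to_ac a ^ ?q = to_ac a" for a :: 'q
    by (metis finite_field_power_card_eq_same to_ac_power)
  hence "insert x (range to_ac) \<subseteq> {x. poly p x = 0}" using assms by (auto simp: p_def poly_monom)
  hence "card (insert x (range to_ac)) \<le> card {x. poly p x = 0}"
    by (intro card_mono poly_roots_finite p0)
  also have "\<dots> \<le> ?q" using card_poly_roots_bound[OF p0] deg by simp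
  finally show False using x by (simp add: card_image inj_to_ac)
qed

lemma coeff_ring_finite_subfield: "coeff_ring (finite_subfield d)"
  by (auto simp: coeff_ring_def finite_subfield_def power_card_power_minus power_mult_distrib)

lemma finite_subfield_inverse: "x \<in> finite_subfield d \<Longrightarrow> inverse x \<in> finite_subfield d"
  by (simp add: finite_subfield_def power_inverse)

text \<open>Positivity matters here: for \<open>d = 0\<close> the defining equation reads
  \<open>x ^ 1 = x\<close> and holds in the whole algebraic closure.\<close>

lemma finite_finite_subfield:
  assumes "0 < d"
  shows "finite (finite_subfield d :: 'q::finite_field alg_closure set)"
proof -
  let ?Q = "CARD('q) ^ d"
  have Q: "1 < ?Q" by (rule one_less_power[OF card_gt_1 assms])
  define p where "p = monom (1 :: 'q alg_closure) ?Q - [:0, 1:]"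
  have "Polynomial.coeff [:0, 1 :: 'q alg_closure:] ?Q = 0" using Q by (intro coeff_eq_0) simp
  hence "Polynomial.coeff p ?Q = 1" by (simp add: p_def)
  hence p0: "p \<noteq> 0" by auto
  have "finite_subfield d \<subseteq> {x. poly p x = 0}" by (auto simp: finite_subfield_def p_def poly_monom)
  thus ?thesis using poly_roots_finite[OF p0] by (rule finite_subset)
qed

subsection \<open>The Frobenius on power series\<close>

lemma frobenius_nth: "fps_nth (frobenius x) i = fps_nth x i ^ CARD('q)" for x :: "'q::finite_field alg_closure fps"
  by (simp add: frobenius_def)

lemma frobenius_funpow_nth:
  fixes x :: "'q::finite_field alg_closure fps"
  shows "fps_nth ((frobenius ^^ j) x) i = fps_nth x i ^ (CARD('q) ^ j)"
  by (induction j) (simp_all add: frobenius_nth power_mult[symmetric] mult.commute)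

interpretation frob: comm_ring_hom "frobenius :: 'q::finite_field alg_closure fps \<Rightarrow> _"
proof
  fix x y :: "'q alg_closure fps"
  have add: "(a + b) ^ CARD('q) = a ^ CARD('q) + b ^ CARD('q)" for a b :: "'q alg_closure" by (rule power_card_add)
  show "frobenius (x + y) = frobenius x + frobenius y" by (rule fps_ext) (simp add: frobenius_nth add)
  have sum: "sum f I ^ CARD('q) = (\<Sum>i\<in>I. f i ^ CARD('q))" for f :: "nat \<Rightarrow> 'q alg_closure" and I
    using power_card_power_sum[of f I 1] by simp
  show "frobenius (x * y) = frobenius x * frobenius y"
    by (rule fps_ext) (simp add: frobenius_nth fps_mult_nth sum power_mult_distrib)
  show "frobenius (1 :: 'q alg_closure fps) = 1" by (rule fps_ext) (simp add: frobenius_nth)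
  show "frobenius (0 :: 'q alg_closure fps) = 0" by (rule fps_ext) (simp add: frobenius_nth)
qed

interpretation emb: comm_ring_hom "O_embed :: 'q::finite_field fps \<Rightarrow> _"
proof
  fix x y :: "'q fps"
  show "O_embed (x + y) = O_embed x + O_embed y" by (rule fps_ext) (simp add: O_embed_def)
  show "O_embed (x * y) = O_embed x * O_embed y" by (rule fps_ext) (simp add: O_embed_def fps_mult_nth to_ac_sum)
  show "O_embed (1 :: 'q fps) = 1" by (rule fps_ext) (simp add: O_embed_def)
  show "O_embed (0 :: 'q fps) = 0" by (rule fps_ext) (simp add: O_embed_def)
qed

lemma O_embed_nth: "fps_nth (O_embed x) i = to_ac (fps_nth x i)"
  by (simp add: O_embed_def)

lemma O_embed_eq_iff [simp]: "O_embed x = O_embed y \<longleftrightarrow> x = y"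
  by (auto simp: fps_eq_iff O_embed_nth)

lemma O_embed_cutoff: "O_embed (fps_cutoff m x) = fps_cutoff m (O_embed x)"
  by (auto simp: fps_eq_iff O_embed_nth)

lemma O_embed_X_power: "O_embed (fps_X ^ m) = fps_X ^ m"
  by (auto simp: fps_eq_iff O_embed_nth)

lemma frobenius_O_embed [simp]: "frobenius (O_embed x) = O_embed x"
  by (rule fps_ext) (metis O_embed_nth finite_field_power_card_eq_same frobenius_nth to_ac_power)

lemma frobenius_fixed_imp_O_embed:
  assumes "frobenius x = x"
  shows "\<exists>z. x = O_embed z"
proof -
  have "fps_nth x i \<in> range to_ac" for i
    by (rule power_card_eq_imp_range) (metis assms frobenius_nth)
  hence "x = O_embed (Abs_fps (\<lambda>i. of_ac (fps_nth x i)))"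
    by (intro fps_ext) (simp add: O_embed_nth to_ac_of_ac)
  thus ?thesis by blast
qed

lemma O_ext_eq_fps_over: "O_ext d = fps_over (finite_subfield d)"
  by (simp add: O_ext_def fps_over_def)

lemma O_ext_iff: "x \<in> O_ext d \<longleftrightarrow> (frobenius ^^ d) x = x"
  by (simp add: O_ext_def fps_eq_iff frobenius_funpow_nth finite_subfield_def)

lemma frobenius_funpow_hom:
  fixes x y :: "'q::finite_field alg_closure fps"
  shows "(frobenius ^^ j) (x + y) = (frobenius ^^ j) x + (frobenius ^^ j) y"
    "(frobenius ^^ j) (x * y) = (frobenius ^^ j) x * (frobenius ^^ j) y"
    "(frobenius ^^ j) (O_embed z) = O_embed z"
  by (induction j) (simp_all add: hom_distribs)

text \<open>Frobenius permutes the summands cyclically because its \<open>d\<close>-th iterate fixes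
  \<open>x\<close>. So the sum has coefficients in the base field, and the passage through
  \<open>of_ac\<close> in \<open>unram_trace\<close> loses nothing.\<close>

lemma unram_trace_embed:
  assumes "x \<in> O_ext d"
  shows "O_embed (unram_trace d x) = (\<Sum>j<d. (frobenius ^^ j) x)"
proof -
  define t where "t = (\<Sum>j<d. (frobenius ^^ j) x)"
  have "frobenius t = (\<Sum>j<d. (frobenius ^^ Suc j) x)" by (simp add: t_def hom_distribs)
  also have "\<dots> = (\<Sum>j<d. (frobenius ^^ j) x) + (frobenius ^^ d) x - (frobenius ^^ 0) x"
    using sum.lessThan_Suc[of "\<lambda>j. (frobenius ^^ j) x" d] sum.lessThan_Suc_shift[of "\<lambda>j. (frobenius ^^ j) x" d]
    by (simp add: algebra_simps)
  also have "\<dots> = t" using assms by (simp add: O_ext_iff t_def)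
  finally obtain z where z: "t = O_embed z" using frobenius_fixed_imp_O_embed by blast
  have "unram_trace d x = z" unfolding unram_trace_def t_def[symmetric] z
    by (rule fps_ext) (simp add: O_embed_nth)
  thus ?thesis using z by (simp add: t_def)
qed

lemma unram_trace_add:
  assumes "x \<in> O_ext d" "y \<in> O_ext d"
  shows "unram_trace d (x + y) = unram_trace d x + unram_trace d y"
proof -
  have "x + y \<in> O_ext d" using assms by (simp add: O_ext_iff frobenius_funpow_hom)
  hence "O_embed (unram_trace d (x + y)) = O_embed (unram_trace d x + unram_trace d y)"
    using assms by (simp add: unram_trace_embed frobenius_funpow_hom sum.distrib hom_distribs)
  thus ?thesis by simp
qed

lemma frobenius_funpow_cutoff: "(frobenius ^^ j) (fps_cutoff m x) = fps_cutoff m ((frobenius ^^ j) x)"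
  for x :: "'q::finite_field alg_closure fps"
  using card_gt_1[where 'q = 'q] by (auto simp: fps_eq_iff frobenius_funpow_nth)

lemma unram_trace_cutoff:
  "unram_trace d (fps_cutoff m x) = fps_cutoff m (unram_trace d x)"
  by (rule fps_ext) (simp add: unram_trace_def frobenius_funpow_cutoff fps_sum_nth)

lemma unram_trace_X_power_const:
  "unram_trace d (fps_X ^ m * fps_const e) = fps_X ^ m * unram_trace d (fps_const e)"
  for e :: "'q::finite_field alg_closure"
  using card_gt_1[where 'q = 'q]
  by (intro fps_ext) (auto simp: unram_trace_def frobenius_funpow_nth fps_sum_nth fps_X_power_mult_nth fps_nth_fps_const power_0_left)

subsection \<open>Roots of irreducible polynomials\<close>

text \<open>Division with remainder shows that a polynomial \<open>g\<close> of least degree over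
  the base field with root \<open>s\<close> divides all others. It divides the irreducible
  \<open>f\<close> without being a unit, hence is associated to \<open>f\<close>.\<close>

lemma irreducible_dvd_if_common_root:
  fixes f p :: "'q::finite_field poly"
  assumes f: "irreducible f" "poly (map_poly to_ac f) s = 0" and p: "poly (map_poly to_ac p) s = 0"
  shows "f dvd p"
proof -
  let ?r = "\<lambda>g :: 'q poly. g \<noteq> 0 \<and> poly (map_poly to_ac g) s = 0"
  have "?r f" using f by auto
  then obtain g where g: "?r g" and min: "\<And>h. ?r h \<Longrightarrow> Polynomial.degree g \<le> Polynomial.degree h"
    using ex_has_least_nat[of ?r f Polynomial.degree] by blast
  have dvd: "g dvd h" if h: "poly (map_poly to_ac h) s = 0" for h
  proof (rule ccontr)
    assume nd: "\<not> g dvd h"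
    hence m: "h mod g \<noteq> 0" by (simp add: dvd_eq_mod_eq_0)
    have "map_poly to_ac h = map_poly to_ac (h div g) * map_poly to_ac g + map_poly to_ac (h mod g)"
      by (metis div_mult_mod_eq map_poly_to_ac_add map_poly_to_ac_mult)
    hence "poly (map_poly to_ac (h mod g)) s = 0" using h g by simp
    hence "Polynomial.degree g \<le> Polynomial.degree (h mod g)" using m by (intro min) simp
    thus False using degree_mod_less[of g h] g m by auto
  qed
  obtain h where h: "f = g * h" using dvd[OF f(2)] by (elim dvdE)
  have "\<not> g dvd 1"
  proof
    assume "g dvd 1"
    hence "Polynomial.degree g = 0" by (simp add: poly_dvd_1)
    then obtain c where "g = [:c:]" by (rule degree_eq_zeroE)
    thus False using g by (simp add: map_poly_pCons_zero)
  qed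
  hence "h dvd 1" using irreducibleD[OF f(1) h] by blast
  then obtain h' where "h * h' = 1" by (metis dvdE)
  hence "g = f * h'" using h by (simp add: mult.assoc)
  hence "f dvd g" by simp
  thus ?thesis using dvd[OF p] by (rule dvd_trans)
qed

lemma root_power_card:
  fixes f :: "'q::finite_field poly"
  assumes "poly (map_poly to_ac f) s = 0"
  shows "poly (map_poly to_ac f) (s ^ (CARD('q) ^ j)) = 0"
proof -
  have fix1: "to_ac c ^ (CARD('q) ^ j) = to_ac c" for c :: 'q
    by (metis finite_field_power_card_power_eq_same to_ac_power)
  have "poly (map_poly to_ac f) (s ^ (CARD('q) ^ j)) = poly (map_poly to_ac f) s ^ (CARD('q) ^ j)"
    unfolding poly_altdef power_card_power_sum
    by (simp add: coeff_map_poly power_mult_distrib fix1 power_mult[symmetric] mult.commute)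
  thus ?thesis using assms card_gt_1[where 'q = 'q] by (simp add: zero_power)
qed

lemma irreducible_roots_disjoint:
  fixes f g :: "'q::finite_field poly"
  assumes f: "irreducible f" "monic f" "poly (map_poly to_ac f) s = 0"
    and g: "irreducible g" "monic g" "poly (map_poly to_ac g) t = 0"
    and eq: "s ^ (CARD('q) ^ i) = t ^ (CARD('q) ^ j)"
  shows "f = g"
proof -
  have 1: "poly (map_poly to_ac f) (s ^ (CARD('q) ^ i)) = 0" "poly (map_poly to_ac g) (s ^ (CARD('q) ^ i)) = 0"
    using root_power_card[OF f(3), of i] root_power_card[OF g(3), of j] eq by auto
  have "f dvd g" "g dvd f"
    using irreducible_dvd_if_common_root[OF f(1) 1] irreducible_dvd_if_common_root[OF g(1) 1(2) 1(1)] by auto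
  thus ?thesis using f(2) g(2) by (metis poly_dvd_antisym)
qed

text \<open>If two conjugates coincided, \<open>s\<close> would be fixed by the \<open>e\<close>-th
  Frobenius power for some positive \<open>e\<close> below the degree of \<open>f\<close>. The
  product of the \<open>e\<close> linear factors of the conjugates would then have coefficients in
  the base field and vanish at \<open>s\<close>, although its degree is too small for a multiple of
  \<open>f\<close>.\<close>

lemma irreducible_roots_distinct:
  fixes f :: "'q::finite_field poly"
  assumes f: "irreducible f" "poly (map_poly to_ac f) s = 0" and ij: "i < j" "j < Polynomial.degree f"
  shows "s ^ (CARD('q) ^ i) \<noteq> s ^ (CARD('q) ^ j)"
proof
  let ?q = "CARD('q)"
  assume "s ^ (?q ^ i) = s ^ (?q ^ j)"
  define e where "e = j - i"
  have e: "0 < e" "e < Polynomial.degree f" using ij by (auto simp: e_def)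
  have "(s ^ (?q ^ e)) ^ (?q ^ i) = s ^ (?q ^ i)"
    using ij \<open>s ^ (?q ^ i) = s ^ (?q ^ j)\<close> by (simp add: e_def power_mult[symmetric] power_add[symmetric])
  hence se: "s ^ (?q ^ e) = s" by (rule power_card_power_inj)
  define F where "F = (\<lambda>c :: 'q alg_closure. c ^ ?q)"
  have F0: "F 0 = 0" using card_gt_1[where 'q = 'q] by (simp add: F_def zero_power)
  have Fadd: "F (a + b) = F a + F b" for a b by (simp add: F_def power_card_add)
  have Fsum: "F (sum h I) = (\<Sum>i\<in>I. F (h i))" for h :: "nat \<Rightarrow> _" and I
    using power_card_power_sum[of h I 1] by (simp add: F_def)
  have Fmult: "F (a * b) = F a * F b" for a b by (simp add: F_def power_mult_distrib)
  have Fp: "map_poly F (a * b) = map_poly F a * map_poly F b" for a b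
    by (rule poly_eqI) (simp add: coeff_map_poly F0 coeff_mult Fsum Fmult)
  have Fl: "map_poly F [:- c, 1:] = [:- (F c), 1:]" for c
    using power_card_power_minus[of 0 c 1] F0
    by (intro poly_eqI) (auto simp: coeff_map_poly F0 coeff_pCons F_def split: nat.split)
  define g where "g = (\<Prod>t<e. [:- (s ^ (?q ^ t)), 1:])"
  have Fg: "map_poly F (\<Prod>t<u. [:- (s ^ (?q ^ t)), 1:]) = (\<Prod>t<u. [:- (s ^ (?q ^ Suc t)), 1:])" for u
  proof (induction u)
    case 0
    show ?case by (rule poly_eqI) (simp add: coeff_map_poly F0 coeff_1 F_def)
  next
    case (Suc u)
    have "F (s ^ (?q ^ u)) = s ^ (?q ^ Suc u)" by (simp add: F_def power_mult[symmetric] mult.commute)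
    thus ?case by (simp only: prod.lessThan_Suc Fp Fl Suc)
  qed
  \<comment> \<open>Frobenius on coefficients shifts the linear factors by one, and the factor
    shifted out at the end is \<open>X - s\<close> by \<open>se\<close>. Multiplying by
    \<open>X - s\<close> on both sides avoids reindexing the product; the common factor is cancelled
    afterwards.\<close>
  have "(\<Prod>t<e. [:- (s ^ (?q ^ Suc t)), 1:]) * [:- s, 1:] = g * [:- s, 1:]"
    unfolding g_def
    using prod.lessThan_Suc[of "\<lambda>t. [:- (s ^ (?q ^ t)), 1:]" e] prod.lessThan_Suc_shift[of "\<lambda>t. [:- (s ^ (?q ^ t)), 1:]" e] se
    by (simp add: mult.commute)
  moreover have "[:- s, 1:] \<noteq> 0" by simp
  ultimately have "map_poly F g = g" unfolding Fg[of e, folded g_def] by (simp only: mult_right_cancel simp_thms)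
  hence "F (Polynomial.coeff g t) = Polynomial.coeff g t" for t
    by (metis F0 coeff_map_poly)
  hence "Polynomial.coeff g t \<in> range to_ac" for t by (intro power_card_eq_imp_range) (simp add: F_def)
  hence g0: "g = map_poly to_ac (map_poly of_ac g)"
    by (intro poly_eqI) (simp add: coeff_map_poly to_ac_of_ac)
  have "poly g s = 0" using e by (auto simp: g_def poly_prod intro!: bexI[of _ 0])
  hence "f dvd map_poly of_ac g" using g0 by (intro irreducible_dvd_if_common_root[OF f]) simp
  moreover have "monic g" unfolding g_def by (intro monic_prod) auto
  hence "g \<noteq> 0" by auto
  hence "map_poly of_ac g \<noteq> 0" using g0 by auto
  ultimately have "Polynomial.degree f \<le> Polynomial.degree (map_poly of_ac g)" by (rule dvd_imp_degree_le)
  also have "\<dots> \<le> Polynomial.degree g" by (rule degree_map_poly_le)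
  also have "\<dots> = e" unfolding g_def by (subst degree_prod_eq_sum_degree) auto
  finally show False using e by simp
qed

section \<open>The commutant of an unramified matrix\<close>

text \<open>Interpolation over a ring: it suffices that differences of nodes are units, because the
  only division is by the value of the node polynomial \<open>N\<close> at the new node, a product
  of such differences.\<close>

lemma newton_interpolation:
  fixes x y :: "nat \<Rightarrow> 'a::idom"
  assumes "\<And>i j. i < d \<Longrightarrow> j < d \<Longrightarrow> i \<noteq> j \<Longrightarrow> x i - x j dvd 1"
  shows "\<exists>p. (p = 0 \<or> Polynomial.degree p < d) \<and> (\<forall>j<d. poly p (x j) = y j)"
  using assms
proof (induction d)
  case 0
  show ?case by (intro exI[of _ 0]) simp
next
  case (Suc d)
  note unit = Suc.prems
  from Suc obtain p where p: "p = 0 \<or> Polynomial.degree p < d" "\<And>j. j < d \<Longrightarrow> poly p (x j) = y j"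
    using less_SucI by blast
  define N where "N = (\<Prod>j<d. [:- x j, 1:])"
  have "(\<Prod>j<u. x d - x j) dvd 1" if "u \<le> d" for u
    using that
  proof (induction u)
    case (Suc u)
    have "x d - x u dvd 1" using Suc.prems by (intro unit) auto
    hence "(\<Prod>j<u. x d - x j) * (x d - x u) dvd 1 * 1" using Suc by (intro mult_dvd_mono) auto
    thus ?case by simp
  qed simp
  hence "(\<Prod>j<d. x d - x j) dvd 1" by simp
  then obtain c where c: "1 = (\<Prod>j<d. x d - x j) * c" by (elim dvdE)
  have N: "poly N z = (\<Prod>j<d. z - x j)" for z by (simp add: N_def poly_prod)
  \<comment> \<open>The correction is a multiple of \<open>N\<close>, so it leaves the values at the
    old nodes alone; \<open>c\<close> inverts the value of \<open>N\<close> at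
    \<open>x d\<close>.\<close>
  define q where "q = p + Polynomial.smult (c * (y d - poly p (x d))) N"
  have "poly q (x j) = y j" if "j < Suc d" for j
  proof (cases "j = d")
    case True
    have "poly q (x d) = poly p (x d) + ((\<Prod>j<d. x d - x j) * c) * (y d - poly p (x d))"
      by (simp add: q_def N mult_ac)
    thus ?thesis unfolding c[symmetric] using True by simp
  next
    case False
    hence "poly N (x j) = 0" using that unfolding N by (intro prod_zero) auto
    thus ?thesis using p(2)[of j] False that by (simp add: q_def)
  qed
  moreover have "Polynomial.degree q < Suc d"
  proof -
    have "Polynomial.degree N \<le> d" unfolding N_def
      by (rule order_trans[OF degree_prod_sum_le]) auto
    hence "Polynomial.degree q \<le> d" unfolding q_def using p(1)
      by (intro degree_add_le order_trans[OF degree_smult_le]) auto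
    thus ?thesis by simp
  qed
  ultimately show ?case by blast
qed

text \<open>Horner evaluation at a matrix. The size is an explicit argument so that the zero
  polynomial also has a value of the right dimension.\<close>

definition mat_poly :: "nat \<Rightarrow> 'a::comm_ring_1 mat \<Rightarrow> 'a poly \<Rightarrow> 'a mat" where
  "mat_poly n A p = fold_coeffs (\<lambda>a Z. a \<cdot>\<^sub>m 1\<^sub>m n + A * Z) p (0\<^sub>m n n)"

lemma mat_poly_0 [simp]: "mat_poly n A 0 = 0\<^sub>m n n"
  by (simp add: mat_poly_def)

lemma mat_poly_pCons:
  assumes "A \<in> carrier_mat n n"
  shows "mat_poly n A (pCons a p) = a \<cdot>\<^sub>m 1\<^sub>m n + A * mat_poly n A p"
proof (cases "a = 0 \<and> p = 0")
  case True
  hence "a \<cdot>\<^sub>m 1\<^sub>m n + A * mat_poly n A p = 0\<^sub>m n n" using assms by (auto simp: mat_eq_iff)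
  thus ?thesis using True by simp
next
  case False
  thus ?thesis unfolding mat_poly_def by (cases "p = 0") (auto simp: fold_coeffs_def)
qed

lemma mat_poly_carrier [simp]: "A \<in> carrier_mat n n \<Longrightarrow> mat_poly n A p \<in> carrier_mat n n"
  by (induction p) (auto simp: mat_poly_pCons)

lemma mat_poly_commute:
  assumes A: "A \<in> carrier_mat n n"
  shows "A * mat_poly n A p = mat_poly n A p * A"
proof (induction p)
  case (pCons a p)
  have c: "mat_poly n A p \<in> carrier_mat n n" using A by simp
  have "A * mat_poly n A (pCons a p) = a \<cdot>\<^sub>m A + A * (A * mat_poly n A p)"
    using A c by (simp add: mat_poly_pCons mult_add_distrib_mat[of _ n n _ n] mult_smult_distrib[of _ n n _ n])
  also have "\<dots> = mat_poly n A (pCons a p) * A"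
    using A c unfolding pCons.IH
    by (simp add: mat_poly_pCons add_mult_distrib_mat[of _ n n _ _ n] mult_smult_assoc_mat[of _ n n _ n] assoc_mult_mat[of _ n n _ n _ n])
  finally show ?case .
qed (use A in simp)

lemma mat_diag_mult_eq:
  fixes f g :: "nat \<Rightarrow> 'a::comm_ring_1"
  shows "mat_diag n f * mat_diag n g = mat_diag n (\<lambda>i. f i * g i)"
  by (simp add: mat_diag_diag)

lemma mat_poly_conj:
  fixes A :: "'a::comm_ring_1 mat" and P Q :: "'b::comm_ring_1 mat"
  assumes h: "comm_ring_hom h" and A: "A \<in> carrier_mat n n" and sim: "similar_mat_wit (map_mat h A) (mat_diag n x) P Q"
  shows "map_mat h (mat_poly n A p) = P * mat_diag n (\<lambda>j. poly (map_poly h p) (x j)) * Q"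
proof -
  interpret h: comm_ring_hom h by fact
  have PQ: "P \<in> carrier_mat n n" "Q \<in> carrier_mat n n" "P * Q = 1\<^sub>m n" "Q * P = 1\<^sub>m n" "map_mat h A = P * mat_diag n x * Q"
    using sim A by (auto simp: similar_mat_wit_def Let_def)
  note assoc = assoc_mult_mat[of _ n n _ n _ n]
  show ?thesis
  proof (induction p)
    case 0
    have "mat_diag n (\<lambda>j. 0) = (0\<^sub>m n n :: 'b mat)" by (auto simp: mat_eq_iff mat_diag_def)
    moreover have "map_mat h (0\<^sub>m n n) = 0\<^sub>m n n" by (auto simp: mat_eq_iff h.hom_zero)
    ultimately show ?case using PQ(1,2) by simp
  next
    case (pCons a p)
    define E where "E = mat_diag n (\<lambda>j. poly (map_poly h p) (x j))"
    have E: "E \<in> carrier_mat n n" and D: "mat_diag n x \<in> carrier_mat n n" by (simp_all add: E_def)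
    have c: "mat_poly n A p \<in> carrier_mat n n" using A by simp
    have "map_mat h (mat_poly n A (pCons a p)) = h a \<cdot>\<^sub>m 1\<^sub>m n + map_mat h (A * mat_poly n A p)"
    proof -
      define W where "W = A * mat_poly n A p"
      have "W \<in> carrier_mat n n" using A c by (simp add: W_def)
      thus ?thesis unfolding mat_poly_pCons[OF A] W_def[symmetric]
        by (intro eq_matI) (auto simp: h.hom_add h.hom_mult h.hom_one h.hom_zero)
    qed
    also have "map_mat h (A * mat_poly n A p) = P * mat_diag n x * Q * (P * E * Q)"
      using pCons.IH PQ(5) h.mat_hom_mult[OF A c] by (simp add: E_def)
    also have "\<dots> = P * mat_diag n x * (Q * P) * E * Q" using PQ(1,2) E D by (simp add: assoc)
    also have "\<dots> = P * (mat_diag n x * E) * Q" using PQ E D by (simp add: assoc)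
    also have "h a \<cdot>\<^sub>m 1\<^sub>m n = P * (h a \<cdot>\<^sub>m 1\<^sub>m n) * Q"
      using PQ by (simp add: mult_smult_distrib[of _ n n _ n] mult_smult_assoc_mat[of _ n n _ n])
    also have "P * (h a \<cdot>\<^sub>m 1\<^sub>m n) * Q + P * (mat_diag n x * E) * Q = P * (h a \<cdot>\<^sub>m 1\<^sub>m n + mat_diag n x * E) * Q"
      using PQ(1,2) E D
      by (simp add: mult_add_distrib_mat[of _ n n _ n] add_mult_distrib_mat[of _ n n _ _ n])
    also have "h a \<cdot>\<^sub>m 1\<^sub>m n + mat_diag n x * E = mat_diag n (\<lambda>j. poly (map_poly h (pCons a p)) (x j))"
      unfolding E_def mat_diag_mult_eq
      by (auto simp: mat_eq_iff mat_diag_def map_poly_pCons_zero[of h, OF h.hom_zero])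
    finally show ?case .
  qed
qed

text \<open>
  In bases diagonalising \<open>A\<close> and \<open>A'\<close> the Sylvester operator \<open>Z \<mapsto> A Z - Z A'\<close> is diagonal, with
  eigenvalues the differences of those of \<open>A\<close> and \<open>A'\<close>.
\<close>

lemma sylvester_conj:
  fixes A :: "'a::comm_ring_1 mat" and P Q P' Q' :: "'b::comm_ring_1 mat"
  assumes h: "comm_ring_hom h" and A: "A \<in> carrier_mat n n" "A' \<in> carrier_mat n' n'" and Z: "Z \<in> carrier_mat n n'"
    and sim: "similar_mat_wit (map_mat h A) (mat_diag n x) P Q"
    and sim': "similar_mat_wit (map_mat h A') (mat_diag n' x') P' Q'"
    and ij: "i < n" "j < n'"
  shows "(Q * map_mat h (A * Z - Z * A') * P') $$ (i, j) = (x i - x' j) * (Q * map_mat h Z * P') $$ (i, j)"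
proof -
  interpret h: comm_ring_hom h by fact
  have PQ: "P \<in> carrier_mat n n" "Q \<in> carrier_mat n n" "P * Q = 1\<^sub>m n" "Q * P = 1\<^sub>m n" "map_mat h A = P * mat_diag n x * Q"
    using sim A by (auto simp: similar_mat_wit_def Let_def)
  have PQ': "P' \<in> carrier_mat n' n'" "Q' \<in> carrier_mat n' n'" "P' * Q' = 1\<^sub>m n'" "Q' * P' = 1\<^sub>m n'" "map_mat h A' = P' * mat_diag n' x' * Q'"
    using sim' A by (auto simp: similar_mat_wit_def Let_def)
  define Y where "Y = Q * map_mat h Z * P'"
  let ?D = "mat_diag n x" and ?D' = "mat_diag n' x'" and ?Z = "map_mat h Z" and ?A = "map_mat h A" and ?A' = "map_mat h A'"
  have D: "?D \<in> carrier_mat n n" "?D' \<in> carrier_mat n' n'" by simp_all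
  have c: "?Z \<in> carrier_mat n n'" "?A \<in> carrier_mat n n" "?A' \<in> carrier_mat n' n'" using A Z by auto
  note QZ = mult_carrier_mat[OF PQ(2) c(1)] and AZ = mult_carrier_mat[OF c(2,1)] and ZA = mult_carrier_mat[OF c(1,3)]
  have Y: "Y \<in> carrier_mat n n'" unfolding Y_def by (rule mult_carrier_mat[OF QZ PQ'(1)])
  have QA: "Q * ?A = ?D * Q"
  proof -
    have "Q * (P * ?D * Q) = (Q * P) * ?D * Q"
      using PQ(1,2) D(1) by (simp add: assoc_mult_mat[of _ n n _ n _ n])
    thus ?thesis using PQ D by simp
  qed
  have AP: "?A' * P' = P' * ?D'"
  proof -
    have "P' * ?D' * Q' * P' = P' * ?D' * (Q' * P')"
      using PQ'(1,2) D(2) by (simp add: assoc_mult_mat[of _ n' n' _ n' _ n'])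
    thus ?thesis using PQ' D mult_carrier_mat[OF PQ'(1) D(2)] by simp
  qed
  have "map_mat h (A * Z - Z * A') = map_mat h (A * Z) - map_mat h (Z * A')"
    using A Z by (auto simp: mat_eq_iff h.hom_minus)
  also have "\<dots> = ?A * ?Z - ?Z * ?A'"
    using h.mat_hom_mult[OF A(1) Z] h.mat_hom_mult[OF Z A(2)] by simp
  finally have "Q * map_mat h (A * Z - Z * A') * P' = (Q * (?A * ?Z) - Q * (?Z * ?A')) * P'"
    by (simp only: mult_minus_distrib_mat[OF PQ(2) AZ ZA])
  also have "\<dots> = Q * (?A * ?Z) * P' - Q * (?Z * ?A') * P'"
    by (rule minus_mult_distrib_mat[OF mult_carrier_mat[OF PQ(2) AZ] mult_carrier_mat[OF PQ(2) ZA] PQ'(1)])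
  also have "Q * (?A * ?Z) * P' = ?D * Y"
    unfolding Y_def assoc_mult_mat[OF PQ(2) c(2) c(1), symmetric] QA assoc_mult_mat[OF D(1) PQ(2) c(1)]
    by (rule assoc_mult_mat[OF D(1) QZ PQ'(1)])
  also have "Q * (?Z * ?A') * P' = Y * ?D'"
    unfolding Y_def assoc_mult_mat[OF PQ(2) c(1) c(3), symmetric] assoc_mult_mat[OF QZ c(3) PQ'(1)] AP
    by (rule assoc_mult_mat[OF QZ PQ'(1) D(2), symmetric])
  finally have "Q * map_mat h (A * Z - Z * A') * P' = ?D * Y - Y * ?D'" .
  thus ?thesis using ij Y unfolding Y_def[symmetric]
    by (simp add: mat_diag_mult_left[OF Y] mat_diag_mult_right[OF Y] left_diff_distrib mult.commute)
qed

text \<open>A left inverse of \<open>O_embed\<close>; it is applied to series that have been shown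
  to lie in the range of \<open>O_embed\<close>.\<close>

definition O_restrict :: "'q::finite_field alg_closure fps \<Rightarrow> 'q fps" where
  "O_restrict x = Abs_fps (\<lambda>i. of_ac (fps_nth x i))"

lemma O_restrict_embed: "O_restrict (O_embed z) = z"
  by (rule fps_ext) (simp add: O_restrict_def O_embed_nth)

lemma similar_mat_wit_diagD:
  assumes "similar_mat_wit B (mat_diag n x) P Q"
  shows "P \<in> carrier_mat n n" "Q \<in> carrier_mat n n" "P * Q = 1\<^sub>m n" "Q * P = 1\<^sub>m n" "B \<in> carrier_mat n n"
proof -
  have *: "{B, mat_diag n x, P, Q} \<subseteq> carrier_mat (dim_row B) (dim_row B)"
    "P * Q = 1\<^sub>m (dim_row B)" "Q * P = 1\<^sub>m (dim_row B)"
    using assms unfolding similar_mat_wit_def Let_def by blast+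
  have "mat_diag n x \<in> carrier_mat (dim_row B) (dim_row B)" using * by blast
  hence "dim_row B = n" using carrier_matD(1)[OF mat_diag_dim[of n x]] by (simp only: carrier_matD(1))
  thus "P \<in> carrier_mat n n" "Q \<in> carrier_mat n n" "P * Q = 1\<^sub>m n" "Q * P = 1\<^sub>m n" "B \<in> carrier_mat n n"
    using * by auto
qed

lemma conj_inverse:
  fixes Z :: "'a::comm_ring_1 mat"
  assumes "similar_mat_wit B (mat_diag n x) P Q" "similar_mat_wit B' (mat_diag n' x') P' Q'" "Z \<in> carrier_mat n n'"
  shows "Z = P * (Q * Z * P') * Q'"
proof -
  have PQ: "P \<in> carrier_mat n n" "Q \<in> carrier_mat n n" "P * Q = 1\<^sub>m n"
    "P' \<in> carrier_mat n' n'" "Q' \<in> carrier_mat n' n'" "P' * Q' = 1\<^sub>m n'"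
    using similar_mat_wit_diagD[OF assms(1)] similar_mat_wit_diagD[OF assms(2)] by auto
  note Z = assms(3) and QZ = mult_carrier_mat[OF PQ(2) assms(3)]
  have "P * (Q * Z * P') * Q' = Z * P' * Q'"
    unfolding assoc_mult_mat[OF PQ(1) QZ PQ(4), symmetric] assoc_mult_mat[OF PQ(1,2) Z, symmetric] PQ(3)
      left_mult_one_mat[OF Z] ..
  also have "\<dots> = Z" unfolding assoc_mult_mat[OF Z PQ(4,5)] PQ(6) by (rule right_mult_one_mat[OF Z])
  finally show ?thesis by (rule sym)
qed

lemma reduce_mat_eq_0_iff:
  "Z \<in> carrier_mat a b \<Longrightarrow> reduce_mat m Z = 0\<^sub>m a b \<longleftrightarrow> (\<forall>i<a. \<forall>j<b. fps_cutoff m (Z $$ (i, j)) = 0)"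
  by (auto simp: mat_eq_iff)

lemma reduce_map_O_embed: "reduce_mat m (map_mat O_embed Z) = map_mat O_embed (reduce_mat m Z)"
  by (auto simp: mat_eq_iff O_embed_cutoff)

lemma reduce_O_embed_eq_0_iff:
  "Z \<in> carrier_mat a b \<Longrightarrow> reduce_mat m (map_mat O_embed Z) = 0\<^sub>m a b \<longleftrightarrow> reduce_mat m Z = 0\<^sub>m a b"
proof -
  assume Z: "Z \<in> carrier_mat a b"
  have "fps_cutoff m (O_embed x) = 0 \<longleftrightarrow> fps_cutoff m x = 0" for x :: "'a fps"
    using O_embed_eq_iff[of "fps_cutoff m x" 0] by (simp add: O_embed_cutoff)
  thus ?thesis using Z by (simp add: reduce_mat_eq_0_iff[of _ a b])
qed

lemma reduce_conj_eq_0: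
  fixes Z :: "'a::comm_ring_1 fps mat"
  assumes "reduce_mat m Z = 0\<^sub>m n n'" "Z \<in> carrier_mat n n'" "L \<in> carrier_mat n n" "R \<in> carrier_mat n' n'"
  shows "reduce_mat m (L * Z * R) = 0\<^sub>m n n'"
proof -
  have z: "reduce_mat m (0\<^sub>m n n') = (0\<^sub>m n n' :: 'a fps mat)" by (auto simp: mat_eq_iff)
  have "reduce_mat m (L * Z * R) = reduce_mat m (L * 0\<^sub>m n n' * R)"
    using assms z by (intro reduce_mult_cong[of _ _ _ _ _ n n' n'] reduce_mult_cong[of _ _ _ _ _ n n n']) auto
  also have "L * 0\<^sub>m n n' * R = 0\<^sub>m n n'" using assms by simp
  finally show ?thesis using z by simp
qed

lemma cutoff_unit_mult:
  fixes u y :: "'a::comm_ring_1 fps"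
  assumes "u dvd 1" "fps_cutoff m (u * y) = 0"
  shows "fps_cutoff m y = 0"
proof -
  obtain v where v: "1 = u * v" using assms(1) by (elim dvdE)
  have "fps_cutoff m (v * (u * y)) = fps_cutoff m (v * 0)"
    using assms(2) by (intro fps_cutoff_mult_cong) auto
  moreover have "v * (u * y) = y" using v by (metis mult.commute mult.left_commute mult_1)
  ultimately show ?thesis by simp
qed

lemma fps_dvd_one_iff: "(x :: 'a::field fps) dvd 1 \<longleftrightarrow> fps_nth x 0 \<noteq> 0"
  by (rule fps_is_unit_iff)

lemma all_cutoff_eqD: "(\<And>m. fps_cutoff m x = fps_cutoff m y) \<Longrightarrow> x = y"
  by (rule fps_ext) (metis fps_cutoff_nth lessI)

lemma frobenius_funpow_0 [simp]: "(frobenius ^^ j) 0 = (0 :: 'q::finite_field alg_closure fps)"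
  by (induction j) (simp_all add: frob.hom_zero)

text \<open>The eigenvalues are the conjugates of \<open>s\<close>, and \<open>dist\<close> makes
  them distinct already modulo \<open>\<pi>\<close>. So their differences are units and
  interpolation at them is possible.\<close>

locale unramified_matrix =
  fixes d :: nat and A :: "'q::finite_field fps mat" and s :: "'q alg_closure fps" and P Q :: "'q alg_closure fps mat"
  assumes d: "0 < d" and A: "A \<in> carrier_mat d d" and s: "s \<in> O_ext d"
    and sim: "similar_mat_wit (map_mat O_embed A) (mat_diag d (\<lambda>j. (frobenius ^^ j) s)) P Q"
    and dist: "i < j \<Longrightarrow> j < d \<Longrightarrow> fps_nth s 0 ^ (CARD('q) ^ i) \<noteq> fps_nth s 0 ^ (CARD('q) ^ j)"
begin

definition "node j = (frobenius ^^ j) s"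
definition "cj Z = Q * map_mat O_embed Z * P"
text \<open>For a matrix commuting with \<open>A\<close> this corner entry in the eigenbasis is the
  eigenvalue that corresponds to \<open>s\<close>. It is the explicit form of the identification of
  the commutant with the extension ring.\<close>

definition "y Z = cj Z $$ (0, 0)"

lemma node_unit: "i < d \<Longrightarrow> j < d \<Longrightarrow> i \<noteq> j \<Longrightarrow> node i - node j dvd 1"
  using dist[of i j] dist[of j i] by (auto simp: fps_dvd_one_iff node_def frobenius_funpow_nth nat_neq_iff)

lemma node_inj: "inj_on node {..<d}"
proof (rule inj_onI, rule ccontr)
  fix i j assume "i \<in> {..<d}" "j \<in> {..<d}" "node i = node j" "i \<noteq> j"
  thus False using node_unit[of i j] by simp
qed

lemma PQ: "P \<in> carrier_mat d d" "Q \<in> carrier_mat d d" "P * Q = 1\<^sub>m d" "Q * P = 1\<^sub>m d"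
  using sim A by (auto simp: similar_mat_wit_def Let_def)

lemma sim': "similar_mat_wit (map_mat O_embed A) (mat_diag d node) P Q"
  using sim unfolding node_def .

lemma cj_carrier: "Z \<in> carrier_mat d d \<Longrightarrow> cj Z \<in> carrier_mat d d"
  using PQ by (simp add: cj_def)

lemma cj_mat_poly: "cj (mat_poly d A p) = mat_diag d (\<lambda>j. poly (map_poly O_embed p) (node j))"
proof -
  let ?D = "mat_diag d (\<lambda>j. poly (map_poly O_embed p) (node j))"
  have "cj (mat_poly d A p) = Q * (P * ?D * Q) * P"
    unfolding cj_def mat_poly_conj[OF emb.comm_ring_hom_axioms A sim'] ..
  also have "\<dots> = (Q * P) * ?D * (Q * P)"
    using PQ(1,2) by (simp add: assoc_mult_mat[of _ d d _ d _ d])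
  finally show ?thesis using PQ(4) mat_diag_dim[of d "\<lambda>j. poly (map_poly O_embed p) (node j)"] by simp
qed

lemma frobenius_poly:
  "(frobenius ^^ j) (poly (map_poly O_embed p) x) = poly (map_poly O_embed p) ((frobenius ^^ j) x)"
  by (induction p) (simp_all add: frobenius_funpow_hom map_poly_pCons_zero[of O_embed, OF emb.hom_zero])

lemma y_mat_poly: "y (mat_poly d A p) = poly (map_poly O_embed p) s"
  using d by (simp add: y_def cj_mat_poly mat_diag_def node_def)

lemma interpolate: "\<exists>p. (p = 0 \<or> Polynomial.degree p < d) \<and> (\<forall>j<d. poly p (node j) = f j)"
  using node_unit by (rule newton_interpolation)

text \<open>Uniqueness of interpolation modulo \<open>\<pi>^m\<close>: if all values are divisible
  by \<open>\<pi>^m\<close>, interpolate the quotients by \<open>q\<close> and compare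
  \<open>p\<close> with \<open>\<pi>^m q\<close> at the nodes.\<close>

lemma interpolate_cutoff_unique:
  assumes p: "p = 0 \<or> Polynomial.degree p < d" and van: "\<And>j. j < d \<Longrightarrow> fps_cutoff m (poly p (node j)) = 0"
  shows "fps_cutoff m (Polynomial.coeff p i) = 0"
proof -
  define z where "z = (\<lambda>j. fps_shift m (poly p (node j)))"
  have z: "poly p (node j) = fps_X ^ m * z j" if "j < d" for j
    using van[OF that] fps_shift_cutoff'[of m "poly p (node j)"] by (simp add: z_def)
  obtain q where q: "q = 0 \<or> Polynomial.degree q < d" "\<And>j. j < d \<Longrightarrow> poly q (node j) = z j"
    using interpolate[of z] by blast
  have "p = Polynomial.smult (fps_X ^ m) q"
  proof (rule poly_eqI_points[OF _ node_inj p _ d])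
    show "poly p (node j) = poly (Polynomial.smult (fps_X ^ m) q) (node j)" if "j < d" for j
      using z[OF that] q(2)[OF that] by simp
    show "Polynomial.smult (fps_X ^ m) q = 0 \<or> Polynomial.degree (Polynomial.smult (fps_X ^ m) q) < d"
      using q(1) by auto
  qed
  hence "Polynomial.coeff p i = fps_X ^ m * Polynomial.coeff q i" by simp
  thus ?thesis by (simp add: fps_eq_iff fps_X_power_mult_nth)
qed

lemma frobenius_poly_coeffs:
  "frobenius (poly p x) = poly (map_poly frobenius p) (frobenius x)"
  for p :: "'q alg_closure fps poly"
  by (induction p) (simp_all add: map_poly_pCons_zero[of frobenius, OF frob.hom_zero] frob.hom_add frob.hom_mult)

lemma coeff_frobenius: "Polynomial.coeff (map_poly frobenius p) i = frobenius (Polynomial.coeff p i)"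
  for p :: "'q alg_closure fps poly"
  by (rule coeff_map_poly) (rule frob.hom_zero)

lemma degree_frobenius:
  assumes "p = 0 \<or> Polynomial.degree p < d"
  shows "map_poly frobenius p = 0 \<or> Polynomial.degree (map_poly frobenius p) < d"
  using assms degree_map_poly_le[of frobenius p] by auto

lemma s_fixed: "(frobenius ^^ d) s = s"
  using s by (simp add: O_ext_iff)

lemma node_Suc: "node (Suc j) = frobenius (node j)"
  by (simp add: node_def)

text \<open>
  The interpolation polynomial of a family permuted cyclically by Frobenius, like the nodes, is
  itself invariant under Frobenius by uniqueness.
\<close>

lemma O_ext_poly:
  assumes x: "x \<in> O_ext d"
  shows "\<exists>p. poly (map_poly O_embed p) s = x"
proof -
  obtain p where p: "p = 0 \<or> Polynomial.degree p < d" "\<And>j. j < d \<Longrightarrow> poly p (node j) = (frobenius ^^ j) x"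
    using interpolate[of "\<lambda>j. (frobenius ^^ j) x"] by blast
  have Fp: "poly (map_poly frobenius p) (node (Suc j)) = (frobenius ^^ Suc j) x" if "j < d" for j
    using frobenius_poly_coeffs[of p "node j"] p(2)[OF that] by (simp add: node_Suc)
  have "map_poly frobenius p = p"
  proof (rule poly_eqI_points[OF _ node_inj degree_frobenius[OF p(1)] p(1) d])
    fix j assume j: "j < d"
    show "poly (map_poly frobenius p) (node j) = poly p (node j)"
    proof (cases j)
      case 0
      \<comment> \<open>The cyclic shift closes up: index \<open>d\<close> is index
        \<open>0\<close>, both for the nodes and for the conjugates of \<open>x\<close>.\<close>
      have "node d = s" using s_fixed by (simp add: node_def)
      hence "node (Suc (d - 1)) = node 0" using d by (simp add: node_def)
      moreover have "(frobenius ^^ Suc (d - 1)) x = x" using x d by (simp add: O_ext_iff del: funpow.simps)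
      ultimately show ?thesis using Fp[of "d - 1"] p(2)[OF d] d 0 by simp
    next
      case (Suc i)
      thus ?thesis using Fp[of i] p(2)[OF j] j by simp
    qed
  qed
  hence "\<exists>z. Polynomial.coeff p i = O_embed z" for i
    using coeff_frobenius[of p i] by (intro frobenius_fixed_imp_O_embed) simp
  then obtain c where c: "\<And>i. Polynomial.coeff p i = O_embed (c i)" by metis
  define q where "q = map_poly (\<lambda>x. O_restrict x) p"
  note inv = O_restrict_embed
  have "O_restrict (0 :: 'q alg_closure fps) = (0 :: 'q fps)" by (simp add: O_restrict_def fps_eq_iff)
  hence "map_poly O_embed q = p"
    unfolding q_def by (intro poly_eqI) (simp add: coeff_map_poly emb.hom_zero c inv)
  thus ?thesis using p(2)[OF d] by (intro exI[of _ q]) (simp add: node_def)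
qed

text \<open>In the eigenbasis \<open>Z\<close> is diagonal modulo \<open>\<pi>^m\<close>, and its
  diagonal is interpolated by a polynomial \<open>p\<close> over the large ring. Since
  \<open>Z\<close> and \<open>A\<close> are fixed by Frobenius, \<open>p\<close> and its Frobenius
  image take the same values at the nodes modulo \<open>\<pi>^m\<close>; uniqueness then brings the
  coefficients down to the base ring modulo \<open>\<pi>^m\<close>.\<close>

lemma commute_mod_poly:
  assumes Z: "Z \<in> carrier_mat d d" and comm: "reduce_mat m (A * Z) = reduce_mat m (Z * A)"
  shows "\<exists>p. reduce_mat m Z = reduce_mat m (mat_poly d A p)"
proof -
  define Y where "Y = cj Z"
  have Y: "Y \<in> carrier_mat d d" using Z by (simp add: Y_def cj_carrier)
  \<comment> \<open>The commutator multiplies this entry by a difference of two nodes, which is a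
    unit off the diagonal.\<close>
  have off: "fps_cutoff m (Y $$ (i, j)) = 0" if ij: "i < d" "j < d" "i \<noteq> j" for i j
  proof (rule cutoff_unit_mult[OF node_unit[OF ij]])
    have AZ: "A * Z \<in> carrier_mat d d" "Z * A \<in> carrier_mat d d" using A Z by auto
    have "reduce_mat m (A * Z - Z * A) = reduce_mat m (Z * A - Z * A)"
      using comm AZ by (intro reduce_add_cong(2)[of _ _ _ _ _ d d]) auto
    also have "Z * A - Z * A = 0\<^sub>m d d" using AZ by (auto simp: mat_eq_iff)
    also have "reduce_mat m (0\<^sub>m d d) = (0\<^sub>m d d :: 'q fps mat)" by (auto simp: mat_eq_iff)
    finally have "reduce_mat m (map_mat O_embed (A * Z - Z * A)) = 0\<^sub>m d d"
      using AZ by (simp add: reduce_O_embed_eq_0_iff[of _ d d])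
    hence "reduce_mat m (Q * map_mat O_embed (A * Z - Z * A) * P) = 0\<^sub>m d d"
      using PQ AZ by (intro reduce_conj_eq_0) auto
    moreover have "Q * map_mat O_embed (A * Z - Z * A) * P \<in> carrier_mat d d"
      using PQ AZ by (intro mult_carrier_mat[of _ d d]) auto
    ultimately have "fps_cutoff m ((Q * map_mat O_embed (A * Z - Z * A) * P) $$ (i, j)) = 0"
      using ij by (simp add: reduce_mat_eq_0_iff[of _ d d])
    thus "fps_cutoff m ((node i - node j) * Y $$ (i, j)) = 0"
      unfolding sylvester_conj[OF emb.comm_ring_hom_axioms A A Z sim' sim' ij(1,2)] Y_def cj_def .
  qed
  obtain p where p: "p = 0 \<or> Polynomial.degree p < d" "\<And>j. j < d \<Longrightarrow> poly p (node j) = Y $$ (j, j)"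
    using interpolate[of "\<lambda>j. Y $$ (j, j)"] by blast
  have fY: "map_mat frobenius (map_mat O_embed Z) = map_mat O_embed Z" for Z :: "'q fps mat"
    by (auto simp: mat_eq_iff)
  define B where "B = map_mat O_embed A"
  have B: "B \<in> carrier_mat d d" using A by (simp add: B_def)
  have idhom: "comm_ring_hom (\<lambda>x::'q alg_closure fps. x)" by standard auto
  have mid: "map_mat (\<lambda>x. x) W = W" for W :: "'q alg_closure fps mat" by (auto simp: mat_eq_iff)
  have pid: "map_poly (\<lambda>x. x) p = p" for p :: "'q alg_closure fps poly" by (rule poly_eqI) (simp add: coeff_map_poly)
  have Bp: "mat_poly d B p = P * mat_diag d (\<lambda>j. poly p (node j)) * Q" for p
    using mat_poly_conj[OF idhom B, of node P Q p] sim' by (simp add: mid pid B_def)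
  have Dc: "mat_diag d f \<in> carrier_mat d d" for f :: "nat \<Rightarrow> 'q alg_closure fps" by simp
  have ZB: "reduce_mat m (map_mat O_embed Z) = reduce_mat m (mat_poly d B p)"
  proof -
    have "reduce_mat m Y = reduce_mat m (mat_diag d (\<lambda>j. poly p (node j)))"
      using Y off p(2) by (auto simp: mat_eq_iff mat_diag_def)
    hence "reduce_mat m (P * Y * Q) = reduce_mat m (P * mat_diag d (\<lambda>j. poly p (node j)) * Q)"
      using PQ Y Dc by (intro reduce_mult_cong[of _ _ _ _ _ d d d]) auto
    moreover have "P * Y * Q = map_mat O_embed Z"
      unfolding Y_def cj_def using conj_inverse[OF sim' sim', of "map_mat O_embed Z"] Z by simp
    ultimately show ?thesis by (simp add: Bp)
  qed
  have fmp: "map_mat frobenius (mat_poly d B p) = mat_poly d B (map_poly frobenius p)"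
  proof (induction p)
    case 0
    show ?case by (auto simp: mat_eq_iff frob.hom_zero)
  next
    case (pCons a p)
    define W where "W = mat_poly d B p"
    have W: "W \<in> carrier_mat d d" using B by (simp add: W_def)
    have BW: "B * W \<in> carrier_mat d d" using B W by simp
    have "map_mat frobenius (a \<cdot>\<^sub>m 1\<^sub>m d + B * W) = frobenius a \<cdot>\<^sub>m 1\<^sub>m d + map_mat frobenius (B * W)"
      using BW B W by (intro eq_matI) (auto simp: frob.hom_add frob.hom_mult frob.hom_one frob.hom_zero)
    also have "map_mat frobenius (B * W) = B * map_mat frobenius W"
      using frob.mat_hom_mult[OF B W] fY[of A] by (simp add: B_def)
    finally show ?case using pCons.IH B
      by (simp add: mat_poly_pCons map_poly_pCons_zero[of frobenius, OF frob.hom_zero] W_def)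
  qed
  \<comment> \<open>Both sides agree with \<open>Z\<close> modulo \<open>\<pi>^m\<close>, the left
    one because Frobenius fixes the embedded \<open>A\<close> and \<open>Z\<close>
    entrywise.\<close>
  have "reduce_mat m (mat_poly d B (map_poly frobenius p)) = reduce_mat m (mat_poly d B p)"
  proof -
    have rf: "reduce_mat m (map_mat frobenius W) = map_mat frobenius (reduce_mat m W)" for W :: "'q alg_closure fps mat"
    proof -
      have "fps_cutoff m (frobenius x) = frobenius (fps_cutoff m x)" for x :: "'q alg_closure fps"
        using frobenius_funpow_cutoff[of 1 m x] by simp
      thus ?thesis by (simp add: mat_eq_iff)
    qed
    have "reduce_mat m (mat_poly d B (map_poly frobenius p)) = map_mat frobenius (reduce_mat m (map_mat O_embed Z))"
      unfolding fmp[symmetric] rf ZB ..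
    also have "\<dots> = reduce_mat m (map_mat O_embed Z)" unfolding reduce_map_O_embed fY ..
    finally show ?thesis unfolding ZB .
  qed
  hence eq: "reduce_mat m (P * mat_diag d (\<lambda>j. poly (map_poly frobenius p) (node j)) * Q) =
      reduce_mat m (P * mat_diag d (\<lambda>j. poly p (node j)) * Q)" unfolding Bp .
  have "fps_cutoff m (poly (map_poly frobenius p) (node j)) = fps_cutoff m (poly p (node j))" if j: "j < d" for j
  proof -
    have strip: "Q * (P * mat_diag d f * Q) * P = mat_diag d f" for f
    proof -
      have "Q * (P * mat_diag d f * Q) * P = (Q * P) * mat_diag d f * (Q * P)"
        using PQ(1,2) Dc[of f] by (simp add: assoc_mult_mat[of _ d d _ d _ d])
      thus ?thesis using PQ(4) Dc[of f] by simp
    qed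
    have car: "P * mat_diag d f * Q \<in> carrier_mat d d" for f using PQ Dc by simp
    have "reduce_mat m (Q * (P * mat_diag d (\<lambda>j. poly (map_poly frobenius p) (node j)) * Q) * P) =
        reduce_mat m (Q * (P * mat_diag d (\<lambda>j. poly p (node j)) * Q) * P)"
      by (rule reduce_mult_cong[of _ _ _ _ _ d d d], rule reduce_mult_cong[of _ _ _ _ _ d d d], rule refl, rule eq)
        (use PQ car in auto)
    from arg_cong[OF this[unfolded strip], of "\<lambda>W. W $$ (j, j)"] show ?thesis
      using j by (simp add: mat_diag_def)
  qed
  hence "fps_cutoff m (Polynomial.coeff (map_poly frobenius p - p) i) = 0" for i
    using degree_frobenius[OF p(1)] p(1) degree_diff_less[of "map_poly frobenius p" d p]
    by (intro interpolate_cutoff_unique) (auto simp: fps_cutoff_diff)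
  hence "frobenius (fps_cutoff m (Polynomial.coeff p i)) = fps_cutoff m (Polynomial.coeff p i)" for i
    using frobenius_funpow_cutoff[of 1 m "Polynomial.coeff p i"] by (simp add: coeff_frobenius fps_cutoff_diff)
  hence "\<exists>z. fps_cutoff m (Polynomial.coeff p i) = O_embed z" for i by (intro frobenius_fixed_imp_O_embed)
  then obtain c where c: "\<And>i. fps_cutoff m (Polynomial.coeff p i) = O_embed (c i)" by metis
  \<comment> \<open>Truncating the coefficients of \<open>p\<close> changes its values by multiples
    of \<open>\<pi>^m\<close> only, and the truncated coefficients come from the base ring.\<close>
  define q where "q = map_poly (\<lambda>x. O_restrict (fps_cutoff m x)) p"
  note inv = O_restrict_embed
  have "O_restrict (0 :: 'q alg_closure fps) = (0 :: 'q fps)" by (simp add: O_restrict_def fps_eq_iff)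
  hence q: "O_embed (Polynomial.coeff q i) = fps_cutoff m (Polynomial.coeff p i)" for i
    unfolding q_def by (simp add: coeff_map_poly c inv)
  have "fps_cutoff m (poly (map_poly O_embed q) x) = fps_cutoff m (poly p x)" for x
  proof -
    have "map_poly O_embed q - p = Polynomial.smult (fps_X ^ m) (map_poly (\<lambda>x. - fps_shift m x) p)"
    proof (rule poly_eqI)
      fix i
      show "Polynomial.coeff (map_poly O_embed q - p) i =
          Polynomial.coeff (Polynomial.smult (fps_X ^ m) (map_poly (\<lambda>x. - fps_shift m x) p)) i"
        using fps_shift_cutoff'[of m "Polynomial.coeff p i"]
        by (simp add: coeff_map_poly emb.hom_zero q algebra_simps)
    qed
    hence "poly (map_poly O_embed q) x - poly p x = fps_X ^ m * poly (map_poly (\<lambda>x. - fps_shift m x) p) x"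
      by (metis poly_diff poly_smult)
    thus ?thesis unfolding fps_cutoff_eq_iff_dvd by simp
  qed
  hence "reduce_mat m (mat_diag d (\<lambda>j. poly (map_poly O_embed q) (node j))) = reduce_mat m (mat_diag d (\<lambda>j. poly p (node j)))"
    by (auto simp: mat_eq_iff mat_diag_def)
  hence "reduce_mat m (P * mat_diag d (\<lambda>j. poly (map_poly O_embed q) (node j)) * Q) = reduce_mat m (P * mat_diag d (\<lambda>j. poly p (node j)) * Q)"
    using PQ Dc by (intro reduce_mult_cong[of _ _ _ _ _ d d d]) auto
  hence "reduce_mat m (map_mat O_embed (mat_poly d A q)) = reduce_mat m (map_mat O_embed Z)"
    unfolding mat_poly_conj[OF emb.comm_ring_hom_axioms A sim'] ZB Bp .
  hence "map_mat O_embed (reduce_mat m (mat_poly d A q)) = map_mat O_embed (reduce_mat m Z)"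
    unfolding reduce_map_O_embed .
  hence "reduce_mat m (mat_poly d A q) = reduce_mat m Z" by (auto simp: mat_eq_iff)
  thus ?thesis by metis
qed

end

section \<open>The commutant as ring of integers of the unramified extension\<close>

context unramified_matrix
begin

text \<open>Commutation without truncation. Such matrices form an honest ring on which
  \<open>y\<close> is multiplicative, so truncation enters only at the end.\<close>

definition "exact Z \<longleftrightarrow> Z \<in> carrier_mat d d \<and> A * Z = Z * A"

lemma exact_carrier: "exact Z \<Longrightarrow> Z \<in> carrier_mat d d"
  by (simp add: exact_def)

lemma exact_mat_poly: "exact (mat_poly d A p)"
  using A mat_poly_commute[OF A] by (simp add: exact_def)

lemma y_formula:
  assumes "Z \<in> carrier_mat d d"
  shows "y Z = (\<Sum>u<d. \<Sum>v<d. Q $$ (0, u) * O_embed (Z $$ (u, v)) * P $$ (v, 0))"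
proof -
  have "map_mat O_embed Z \<in> carrier_mat d d" using assms by simp
  hence "cj Z = Q * (map_mat O_embed Z * P)" unfolding cj_def by (rule assoc_mult_mat[OF PQ(2) _ PQ(1)])
  hence "y Z = (\<Sum>u<d. Q $$ (0, u) * (\<Sum>v<d. O_embed (Z $$ (u, v)) * P $$ (v, 0)))"
    unfolding y_def using PQ(1,2) assms d by (auto simp: scalar_prod_def lessThan_atLeast0 intro!: sum.cong)
  thus ?thesis by (simp add: sum_distrib_left mult.assoc)
qed

lemma y_add:
  assumes "Z \<in> carrier_mat d d" "W \<in> carrier_mat d d"
  shows "y (Z + W) = y Z + y W"
proof -
  have "Z + W \<in> carrier_mat d d" using assms by simp
  thus ?thesis using assms by (simp add: y_formula emb.hom_add sum.distrib algebra_simps)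
qed

lemma y_smult:
  assumes "Z \<in> carrier_mat d d"
  shows "y (c \<cdot>\<^sub>m Z) = O_embed c * y Z"
proof -
  have "c \<cdot>\<^sub>m Z \<in> carrier_mat d d" using assms by simp
  thus ?thesis using assms by (simp add: y_formula emb.hom_mult sum_distrib_left mult_ac)
qed

lemma y_one: "y (1\<^sub>m d) = 1"
proof -
  have "map_mat O_embed (1\<^sub>m d) = (1\<^sub>m d :: 'q alg_closure fps mat)"
    by (auto simp: mat_eq_iff emb.hom_one emb.hom_zero)
  thus ?thesis using PQ d by (simp add: y_def cj_def)
qed

lemma y_A: "y A = s"
proof -
  have "mat_poly d A [:0, 1:] = A"
  proof -
    have "0 \<cdot>\<^sub>m 1\<^sub>m d + A * (1 \<cdot>\<^sub>m 1\<^sub>m d + A * 0\<^sub>m d d) = A" using A by (auto simp: mat_eq_iff)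
    thus ?thesis using A by (simp add: mat_poly_pCons)
  qed
  thus ?thesis using y_mat_poly[of "[:0, 1:]"]
    by (simp add: map_poly_pCons_zero[of O_embed, OF emb.hom_zero] emb.hom_one emb.hom_zero)
qed

lemma cj_cong:
  assumes "reduce_mat m Z = reduce_mat m W" "Z \<in> carrier_mat d d" "W \<in> carrier_mat d d"
  shows "reduce_mat m (cj Z) = reduce_mat m (cj W)"
  unfolding cj_def
  by (rule reduce_mult_cong[of _ _ _ _ _ d d d], rule reduce_mult_cong[of _ _ _ _ _ d d d])
    (use assms PQ in \<open>auto simp: reduce_map_O_embed\<close>)

lemma y_cong:
  assumes "reduce_mat m Z = reduce_mat m W" "Z \<in> carrier_mat d d" "W \<in> carrier_mat d d"
  shows "fps_cutoff m (y Z) = fps_cutoff m (y W)"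
  using arg_cong[OF cj_cong[OF assms], of "\<lambda>V. V $$ (0, 0)"] cj_carrier[OF assms(2)] cj_carrier[OF assms(3)] d
  by (simp add: y_def)

text \<open>Modulo each \<open>\<pi>^m\<close> the matrix is a polynomial in \<open>A\<close>, where
  both claims are visible. The polynomials vary with \<open>m\<close>, but series that agree modulo
  all powers are equal, so the polynomials never have to converge.\<close>

lemma exact_diag:
  assumes "exact Z"
  shows "y Z \<in> O_ext d" "cj Z = mat_diag d (\<lambda>j. (frobenius ^^ j) (y Z))"
proof -
  have Z: "Z \<in> carrier_mat d d" "A * Z = Z * A" using assms by (auto simp: exact_def)
  have ex: "\<exists>p. reduce_mat m Z = reduce_mat m (mat_poly d A p)" for m
    using commute_mod_poly[OF Z(1), of m] Z(2) by simp
  have mp: "mat_poly d A p \<in> carrier_mat d d" for p using A by simp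
  have node: "poly (map_poly O_embed p) (node j) = (frobenius ^^ j) (poly (map_poly O_embed p) s)" for p j
    by (simp add: frobenius_poly node_def)
  have "fps_cutoff m ((frobenius ^^ d) (y Z)) = fps_cutoff m (y Z)" for m
  proof -
    obtain p where p: "reduce_mat m Z = reduce_mat m (mat_poly d A p)" using ex by blast
    have "fps_cutoff m (y Z) = fps_cutoff m (poly (map_poly O_embed p) s)"
      using y_cong[OF p Z(1) mp] by (simp add: y_mat_poly)
    thus ?thesis using frobenius_poly[of d p s] s_fixed
      by (simp flip: frobenius_funpow_cutoff) (simp add: frobenius_funpow_cutoff)
  qed
  thus "y Z \<in> O_ext d" unfolding O_ext_iff by (rule all_cutoff_eqD)
  show "cj Z = mat_diag d (\<lambda>j. (frobenius ^^ j) (y Z))"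
  proof (rule eq_matI)
    fix i j assume "i < dim_row (mat_diag d (\<lambda>j. (frobenius ^^ j) (y Z)))" "j < dim_col (mat_diag d (\<lambda>j. (frobenius ^^ j) (y Z)))"
    hence ij: "i < d" "j < d" by (simp_all add: mat_diag_def)
    show "cj Z $$ (i, j) = mat_diag d (\<lambda>j. (frobenius ^^ j) (y Z)) $$ (i, j)"
    proof (rule all_cutoff_eqD)
      fix m
      obtain p where p: "reduce_mat m Z = reduce_mat m (mat_poly d A p)" using ex by blast
      have "fps_cutoff m (y Z) = fps_cutoff m (poly (map_poly O_embed p) s)"
        using y_cong[OF p Z(1) mp] by (simp add: y_mat_poly)
      hence yj: "fps_cutoff m ((frobenius ^^ j) (y Z)) = fps_cutoff m (poly (map_poly O_embed p) (node j))"
        unfolding node by (simp flip: frobenius_funpow_cutoff)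
      have "fps_cutoff m (cj Z $$ (i, j)) = fps_cutoff m (cj (mat_poly d A p) $$ (i, j))"
        using arg_cong[OF cj_cong[OF p Z(1) mp], of "\<lambda>V. V $$ (i, j)"] cj_carrier[OF Z(1)] cj_carrier[OF mp[of p]] ij by simp
      thus "fps_cutoff m (cj Z $$ (i, j)) = fps_cutoff m (mat_diag d (\<lambda>j. (frobenius ^^ j) (y Z)) $$ (i, j))"
        using ij yj by (auto simp: cj_mat_poly mat_diag_def)
    qed
  qed (use cj_carrier[OF Z(1)] in \<open>auto simp: mat_diag_def\<close>)
qed

lemma exact_mult:
  assumes "exact Z" "exact W"
  shows "y (Z * W) = y Z * y W"
proof -
  have Z: "Z \<in> carrier_mat d d" and W: "W \<in> carrier_mat d d" using assms by (auto simp: exact_def)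
  let ?Z = "map_mat O_embed Z" and ?W = "map_mat O_embed W"
  have c: "?Z \<in> carrier_mat d d" "?W \<in> carrier_mat d d" using Z W by auto
  have "cj (Z * W) = Q * (?Z * ?W) * P" unfolding cj_def emb.mat_hom_mult[OF Z W] ..
  also have "\<dots> = Q * ?Z * (P * Q) * ?W * P"
    using PQ(1,2) c unfolding PQ(3) by (simp add: assoc_mult_mat[of _ d d _ d _ d])
  also have "\<dots> = cj Z * cj W"
    unfolding cj_def using PQ(1,2) c by (simp add: assoc_mult_mat[of _ d d _ d _ d])
  finally have "cj (Z * W) = mat_diag d (\<lambda>j. (frobenius ^^ j) (y Z) * (frobenius ^^ j) (y W))"
    unfolding exact_diag(2)[OF assms(1)] exact_diag(2)[OF assms(2)] by simp
  thus ?thesis using d by (simp add: y_def[of "Z * W"] mat_diag_def)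
qed

lemma exact_eq_0:
  assumes "exact Z" "fps_cutoff m (y Z) = 0"
  shows "reduce_mat m Z = 0\<^sub>m d d"
proof -
  have Z: "Z \<in> carrier_mat d d" using assms by (auto simp: exact_def)
  have "fps_cutoff m ((frobenius ^^ j) (y Z)) = 0" for j
    using assms(2) by (simp flip: frobenius_funpow_cutoff)
  hence "reduce_mat m (cj Z) = 0\<^sub>m d d"
    unfolding exact_diag(2)[OF assms(1)] by (auto simp: mat_eq_iff mat_diag_def)
  hence "reduce_mat m (P * cj Z * Q) = 0\<^sub>m d d" using PQ cj_carrier[OF Z] by (intro reduce_conj_eq_0) auto
  moreover have "P * cj Z * Q = map_mat O_embed Z"
    unfolding cj_def using conj_inverse[OF sim' sim', of "map_mat O_embed Z"] Z by simp
  ultimately show ?thesis using Z by (simp add: reduce_O_embed_eq_0_iff[of _ d d])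
qed

lemma exact_surj:
  assumes "x \<in> O_ext d"
  obtains Z where "exact Z" "y Z = x"
  using O_ext_poly[OF assms] exact_mat_poly y_mat_poly by metis

text \<open>The trace survives the diagonalisation, after which the diagonal entries are the
  Frobenius conjugates of \<open>y Z\<close>.\<close>

lemma exact_trace:
  assumes "exact Z"
  shows "mat_trace Z = unram_trace d (y Z)"
proof -
  have Z: "Z \<in> carrier_mat d d" using assms by (auto simp: exact_def)
  have "O_embed (mat_trace Z) = mat_trace (map_mat O_embed Z)"
    using Z by (simp add: mat_trace_def emb.hom_sum)
  also have "map_mat O_embed Z = P * cj Z * Q"
    unfolding cj_def using conj_inverse[OF sim' sim', of "map_mat O_embed Z"] Z by simp
  also have "mat_trace \<dots> = mat_trace (cj Z)" using PQ cj_carrier[OF Z] by (intro mat_trace_similar) auto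
  also have "\<dots> = (\<Sum>j<d. (frobenius ^^ j) (y Z))"
    unfolding exact_diag(2)[OF assms] by (simp add: mat_trace_def mat_diag_def)
  also have "\<dots> = O_embed (unram_trace d (y Z))" by (rule unram_trace_embed[OF exact_diag(1)[OF assms], symmetric])
  finally show ?thesis by simp
qed

text \<open>The polynomial in \<open>A\<close> that approximates \<open>Z\<close> commutes with
  \<open>A\<close> exactly.\<close>

lemma exact_lift:
  assumes "Z \<in> carrier_mat d d" "reduce_mat m (A * Z) = reduce_mat m (Z * A)"
  shows "\<exists>W. exact W \<and> reduce_mat m W = reduce_mat m Z"
  using commute_mod_poly[OF assms] exact_mat_poly by metis

lemma commutant_carrier:
  "Z \<in> carrier (commutant m A) \<longleftrightarrow> Z \<in> carrier_mat d d \<and> reduce_mat m Z = Z \<and> reduce_mat m (A * Z) = reduce_mat m (Z * A)"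
proof -
  have mult: "Z \<otimes>\<^bsub>trunc_mat_ring UNIV d m\<^esub> W = reduce_mat m (Z * W)" for Z W by (simp add: trunc_mat_ring_def)
  have dA: "dim_row A = d" using A by simp
  have upd: "carrier (R\<lparr>carrier := S\<rparr>) = S" for R :: "'q fps mat ring" and S by simp
  have "carrier (commutant m A) = {Z \<in> carrier (trunc_mat_ring UNIV d m).
      Z \<otimes>\<^bsub>trunc_mat_ring UNIV d m\<^esub> reduce_mat m A = reduce_mat m A \<otimes>\<^bsub>trunc_mat_ring UNIV d m\<^esub> Z}"
    unfolding commutant_def Let_def dA by (rule upd)
  hence 1: "Z \<in> carrier (commutant m A) \<longleftrightarrow> Z \<in> carrier_mat d d \<and> reduce_mat m Z = Z \<and>
      reduce_mat m (Z * reduce_mat m A) = reduce_mat m (reduce_mat m A * Z)"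
    unfolding carrier_trunc_mat_ring mult mats_UNIV by (simp only: mem_Collect_eq conj_assoc)
  show ?thesis
  proof (cases "Z \<in> carrier_mat d d")
    case True
    have "reduce_mat m (Z * reduce_mat m A) = reduce_mat m (Z * A)" "reduce_mat m (reduce_mat m A * Z) = reduce_mat m (A * Z)"
      using True A by (simp_all add: reduce_mult_reduce[of _ d d _ d])
    thus ?thesis unfolding 1 by metis
  qed (simp add: 1)
qed

lemma commutant_ops:
  "Z \<otimes>\<^bsub>commutant m A\<^esub> W = reduce_mat m (Z * W)" "Z \<oplus>\<^bsub>commutant m A\<^esub> W = Z + W"
  "\<one>\<^bsub>commutant m A\<^esub> = reduce_mat m (1\<^sub>m d)"
  using A by (simp_all add: commutant_def Let_def trunc_mat_ring_def)

lemma exact_one: "exact (1\<^sub>m d)" using A by (simp add: exact_def)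

lemma exact_add: "exact Z \<Longrightarrow> exact W \<Longrightarrow> exact (Z + W)"
  using A by (simp add: exact_def mult_add_distrib_mat[of _ d d _ d] add_mult_distrib_mat[of _ d d _ _ d])

lemma exact_closed_mult:
  assumes "exact Z" "exact W"
  shows "exact (Z * W)"
proof -
  have c: "Z \<in> carrier_mat d d" "W \<in> carrier_mat d d" "A * Z = Z * A" "A * W = W * A"
    using assms by (auto simp: exact_def)
  have "A * (Z * W) = Z * (A * W)"
    unfolding assoc_mult_mat[OF A c(1,2), symmetric] c(3) by (rule assoc_mult_mat[OF c(1) A c(2)])
  also have "\<dots> = Z * W * A" unfolding c(4) by (rule assoc_mult_mat[OF c(1,2) A, symmetric])
  finally show ?thesis using mult_carrier_mat[OF c(1,2)] by (simp add: exact_def)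
qed

lemma commutant_exact:
  assumes "Z \<in> carrier (commutant m A)"
  obtains W where "exact W" "Z = reduce_mat m W"
  using assms exact_lift[of Z m] unfolding commutant_carrier by metis

lemma reduce_exact_commutant: "exact W \<Longrightarrow> reduce_mat m W \<in> carrier (commutant m A)"
  unfolding commutant_carrier exact_def using A by (auto simp: reduce_mult_reduce[of _ d d _ d])

lemma y_reduce: "exact W \<Longrightarrow> fps_cutoff m (y (reduce_mat m W)) = fps_cutoff m (y W)"
  by (rule y_cong) (auto simp: exact_def)

lemma trunc_ext_carrier:
  "x \<in> carrier (trunc_ring (finite_subfield d) m) \<longleftrightarrow> x \<in> O_ext d \<and> fps_cutoff m x = x"
  by (auto simp: trunc_ring_def O_ext_def)

lemma trunc_ring_ops:
  "x \<otimes>\<^bsub>trunc_ring k m\<^esub> z = fps_cutoff m (x * z)" "x \<oplus>\<^bsub>trunc_ring k m\<^esub> z = x + z"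
  "\<one>\<^bsub>trunc_ring k m\<^esub> = fps_cutoff m 1"
  by (simp_all add: trunc_ring_def)

lemma O_ext_cutoff: "x \<in> O_ext d \<Longrightarrow> fps_cutoff m x \<in> O_ext d"
  unfolding O_ext_eq_fps_over by (rule fps_over_closed(2)[OF coeff_ring_finite_subfield])

lemma y_ring_iso:
  "(\<lambda>Z. fps_cutoff m (y Z)) \<in> ring_iso (commutant m A) (trunc_ring (finite_subfield d) m)"
proof -
  let ?f = "\<lambda>Z. fps_cutoff m (y Z)" and ?R = "commutant m A" and ?S = "trunc_ring (finite_subfield d :: 'q alg_closure set) m"
  have hom: "?f \<in> Ring.ring_hom ?R ?S"
  proof (rule ring_hom_memI)
    fix Z assume Z: "Z \<in> carrier ?R"
    then obtain Z' where Z': "exact Z'" "Z = reduce_mat m Z'" by (rule commutant_exact)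
    show "?f Z \<in> carrier ?S"
      unfolding Z'(2) y_reduce[OF Z'(1)] trunc_ext_carrier using O_ext_cutoff[OF exact_diag(1)[OF Z'(1)]] by simp
    fix W assume W: "W \<in> carrier ?R"
    then obtain W' where W': "exact W'" "W = reduce_mat m W'" by (rule commutant_exact)
    have c: "Z' \<in> carrier_mat d d" "W' \<in> carrier_mat d d" using Z' W' exact_carrier by auto
    have "Z \<otimes>\<^bsub>?R\<^esub> W = reduce_mat m (Z' * W')"
      unfolding commutant_ops Z' W' using c by (simp add: reduce_mult_reduce[of _ d d _ d])
    thus "?f (Z \<otimes>\<^bsub>?R\<^esub> W) = ?f Z \<otimes>\<^bsub>?S\<^esub> ?f W"
      unfolding trunc_ring_ops Z'(2) W'(2) y_reduce[OF Z'(1)] y_reduce[OF W'(1)]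
      by (simp add: y_reduce[OF exact_closed_mult[OF Z'(1) W'(1)]] exact_mult[OF Z'(1) W'(1)] fps_cutoff_mult_cutoff)
    have "Z + W = reduce_mat m (Z' + W')"
      unfolding Z' W' using c by (auto simp: mat_eq_iff fps_cutoff_add)
    thus "?f (Z \<oplus>\<^bsub>?R\<^esub> W) = ?f Z \<oplus>\<^bsub>?S\<^esub> ?f W"
      unfolding trunc_ring_ops commutant_ops Z'(2) W'(2) y_reduce[OF Z'(1)] y_reduce[OF W'(1)]
      by (simp add: y_reduce[OF exact_add[OF Z'(1) W'(1)]] y_add[OF c] fps_cutoff_add)
  next
    show "?f \<one>\<^bsub>?R\<^esub> = \<one>\<^bsub>?S\<^esub>"
      unfolding commutant_ops trunc_ring_ops y_reduce[OF exact_one] y_one ..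
  qed
  have "bij_betw ?f (carrier ?R) (carrier ?S)"
  proof (rule bij_betw_imageI)
    show "inj_on ?f (carrier ?R)"
    proof (rule inj_onI)
      fix Z W assume Z: "Z \<in> carrier ?R" and W: "W \<in> carrier ?R" and eq: "?f Z = ?f W"
      obtain Z' where Z': "exact Z'" "Z = reduce_mat m Z'" using Z by (rule commutant_exact)
      obtain W' where W': "exact W'" "W = reduce_mat m W'" using W by (rule commutant_exact)
      have c: "Z' \<in> carrier_mat d d" "W' \<in> carrier_mat d d" using Z' W' exact_carrier by auto
      have e: "exact (Z' + (- 1) \<cdot>\<^sub>m W')"
        using A c W'(1) by (intro exact_add Z') (auto simp: exact_def mult_smult_distrib[of _ d d _ d] mult_smult_assoc_mat[of _ d d _ d])
      have "y (Z' + (- 1) \<cdot>\<^sub>m W') = y Z' - y W'"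
        using c by (simp add: y_add y_smult emb.hom_uminus emb.hom_one)
      hence "fps_cutoff m (y (Z' + (- 1) \<cdot>\<^sub>m W')) = 0"
        using eq unfolding Z'(2) W'(2) y_reduce[OF Z'(1)] y_reduce[OF W'(1)] by (simp add: fps_cutoff_diff)
      hence "reduce_mat m (Z' + (- 1) \<cdot>\<^sub>m W') = 0\<^sub>m d d" by (rule exact_eq_0[OF e])
      hence "fps_cutoff m (Z' $$ (i, j) - W' $$ (i, j)) = 0" if "i < d" "j < d" for i j
        using that c by (auto simp: mat_eq_iff)
      thus "Z = W" unfolding Z'(2) W'(2) using c by (auto simp: mat_eq_iff fps_cutoff_diff)
    qed
    show "?f ` carrier ?R = carrier ?S"
    proof
      show "?f ` carrier ?R \<subseteq> carrier ?S" by (rule image_subsetI) (rule ring_hom_closed[OF hom])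
      show "carrier ?S \<subseteq> ?f ` carrier ?R"
      proof
        fix x assume "x \<in> carrier ?S"
        hence x: "x \<in> O_ext d" "fps_cutoff m x = x" by (auto simp: trunc_ext_carrier)
        obtain Z where Z: "exact Z" "y Z = x" using exact_surj[OF x(1)] .
        have "x = ?f (reduce_mat m Z)" using y_reduce[OF Z(1), of m] Z x by simp
        thus "x \<in> ?f ` carrier ?R" using reduce_exact_commutant[OF Z(1)] by blast
      qed
    qed
  qed
  thus ?thesis using hom by (simp add: ring_iso_def)
qed

text \<open>The isomorphism is chosen by \<open>SOME\<close>. The explicit map \<open>y\<close>
  shows that the specification is satisfiable, and any map meeting it is determined on polynomials
  in \<open>A\<close>, which exhaust the commutant modulo \<open>\<pi>^m\<close>; so the chosen map
  is given by \<open>y\<close>.\<close>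

lemma commutant_iso_exact:
  assumes Z: "exact Z"
  shows "commutant_iso m A s (reduce_mat m Z) = fps_cutoff m (y Z)"
proof -
  let ?R = "commutant m A" and ?S = "trunc_ring (finite_subfield d :: 'q alg_closure set) m"
  define spec where "spec = (\<lambda>f. f \<in> ring_iso ?R ?S \<and> f (reduce_mat m A) = fps_cutoff m s \<and>
     (\<forall>c \<in> carrier (trunc_ring UNIV m). f (c \<cdot>\<^sub>m reduce_mat m (1\<^sub>m d)) = O_embed c))"
  have one: "fps_cutoff m a \<cdot>\<^sub>m reduce_mat m (1\<^sub>m d) = reduce_mat m (a \<cdot>\<^sub>m 1\<^sub>m d)" for a :: "'q fps"
    by (auto simp: mat_eq_iff fps_cutoff_one)
  have ex: "spec (\<lambda>Z. fps_cutoff m (y Z))"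
    unfolding spec_def
  proof (intro conjI ballI)
    show "fps_cutoff m (y (reduce_mat m A)) = fps_cutoff m s"
      using y_reduce[of A m] A by (simp add: exact_def y_A)
    fix c :: "'q fps" assume "c \<in> carrier (trunc_ring UNIV m)"
    hence c: "fps_cutoff m c = c" by (simp add: trunc_ring_def)
    have "exact (c \<cdot>\<^sub>m 1\<^sub>m d)" using A by (simp add: exact_def mult_smult_distrib[of _ d d _ d] mult_smult_assoc_mat[of _ d d _ d])
    from y_reduce[OF this, of m] show "fps_cutoff m (y (c \<cdot>\<^sub>m reduce_mat m (1\<^sub>m d))) = O_embed c"
      using one[of c] c O_embed_cutoff[of m c] by (simp add: y_smult y_one)
  qed (rule y_ring_iso)
  have "commutant_iso m A s = (SOME f. spec f)"
    unfolding commutant_iso_def spec_def using A by simp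
  hence sp: "spec (commutant_iso m A s)" using someI[of spec, OF ex] by simp
  define f where "f = commutant_iso m A s"
  have f: "f \<in> Ring.ring_hom ?R ?S" "f (reduce_mat m A) = fps_cutoff m s"
    "\<And>c. fps_cutoff m c = c \<Longrightarrow> f (c \<cdot>\<^sub>m reduce_mat m (1\<^sub>m d)) = O_embed c"
    using sp by (auto simp: spec_def f_def ring_iso_def trunc_ring_def)
  have poly: "f (reduce_mat m (mat_poly d A p)) = fps_cutoff m (poly (map_poly O_embed p) s)" for p
  proof (induction p)
    case 0
    have "fps_cutoff m 0 \<cdot>\<^sub>m reduce_mat m (1\<^sub>m d) = reduce_mat m (mat_poly d A (0 :: 'q fps poly))"
      by (auto simp: mat_eq_iff)
    thus ?case using f(3)[of 0] by (simp add: emb.hom_zero)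
  next
    case (pCons a p)
    define W where "W = mat_poly d A p"
    have W: "exact W" "W \<in> carrier_mat d d" using exact_mat_poly exact_carrier by (auto simp: W_def)
    have eA: "exact A" using A by (simp add: exact_def)
    have ea: "exact (a \<cdot>\<^sub>m 1\<^sub>m d)" using A by (simp add: exact_def mult_smult_distrib[of _ d d _ d] mult_smult_assoc_mat[of _ d d _ d])
    have AW: "A * W \<in> carrier_mat d d" using A W by simp
    have "reduce_mat m (mat_poly d A (pCons a p)) = reduce_mat m (a \<cdot>\<^sub>m 1\<^sub>m d) + reduce_mat m (A * W)"
      unfolding mat_poly_pCons[OF A] W_def[symmetric] using A W(2) AW by (auto simp: mat_eq_iff fps_cutoff_add)
    also have "\<dots> = reduce_mat m (a \<cdot>\<^sub>m 1\<^sub>m d) \<oplus>\<^bsub>?R\<^esub> (reduce_mat m A \<otimes>\<^bsub>?R\<^esub> reduce_mat m W)"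
      unfolding commutant_ops using A W by (simp add: reduce_mult_reduce[of _ d d _ d])
    finally have eq: "reduce_mat m (mat_poly d A (pCons a p)) = reduce_mat m (a \<cdot>\<^sub>m 1\<^sub>m d) \<oplus>\<^bsub>?R\<^esub> (reduce_mat m A \<otimes>\<^bsub>?R\<^esub> reduce_mat m W)" .
    have in1: "reduce_mat m (a \<cdot>\<^sub>m 1\<^sub>m d) \<in> carrier ?R" "reduce_mat m A \<in> carrier ?R" "reduce_mat m W \<in> carrier ?R"
      using ea eA W by (auto intro: reduce_exact_commutant)
    have in2: "reduce_mat m A \<otimes>\<^bsub>?R\<^esub> reduce_mat m W \<in> carrier ?R"
      unfolding commutant_ops using reduce_exact_commutant[OF exact_closed_mult[OF eA W(1)], of m] A W(2)
      by (simp add: reduce_mult_reduce[of _ d d _ d])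
    have "f (reduce_mat m (mat_poly d A (pCons a p))) = O_embed (fps_cutoff m a) + fps_cutoff m (fps_cutoff m s * f (reduce_mat m W))"
      unfolding eq using ring_hom_add[OF f(1) in1(1) in2] ring_hom_mult[OF f(1) in1(2,3)] f(2) f(3)[of "fps_cutoff m a"] one[of a]
      by (simp add: trunc_ring_ops)
    thus ?case using pCons.IH
      by (simp add: W_def map_poly_pCons_zero[of O_embed, OF emb.hom_zero] O_embed_cutoff fps_cutoff_add fps_cutoff_mult_cutoff)
  qed
  obtain p where p: "reduce_mat m Z = reduce_mat m (mat_poly d A p)"
    using commute_mod_poly[of Z m] Z by (auto simp: exact_def)
  have "fps_cutoff m (y Z) = fps_cutoff m (poly (map_poly O_embed p) s)"
    using y_cong[OF p exact_carrier[OF Z]] A by (simp add: y_mat_poly)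
  thus ?thesis using poly[of p] p by (simp add: f_def)
qed

end

section \<open>Block matrices\<close>

lemma diag_block_mat_replicate:
  fixes B :: "'a::zero mat"
  assumes B: "B \<in> carrier_mat d d"
  shows "diag_block_mat (replicate k B) \<in> carrier_mat (k * d) (k * d) \<and>
    (\<forall>a<k. \<forall>b<k. \<forall>u<d. \<forall>v<d. diag_block_mat (replicate k B) $$ (a * d + u, b * d + v) = (if a = b then B $$ (u, v) else 0))"
proof (induction k)
  case (Suc k)
  let ?R = "diag_block_mat (replicate k B)"
  have R: "?R \<in> carrier_mat (k * d) (k * d)" using Suc by blast
  have eq: "diag_block_mat (replicate (Suc k) B) = four_block_mat B (0\<^sub>m d (k * d)) (0\<^sub>m (k * d) d) ?R"
    using B R by (simp add: Let_def)
  have car: "diag_block_mat (replicate (Suc k) B) \<in> carrier_mat (Suc k * d) (Suc k * d)"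
    unfolding eq using B R by simp
  have "diag_block_mat (replicate (Suc k) B) $$ (a * d + u, b * d + v) = (if a = b then B $$ (u, v) else 0)"
    if h: "a < Suc k" "b < Suc k" "u < d" "v < d" for a b u v
  proof -
    have lt: "a * d + u < d + k * d" "b * d + v < d + k * d"
      using mult_add_less_mult[OF h(1,3)] mult_add_less_mult[OF h(2,4)] by simp_all
    show ?thesis
    proof (cases a)
      case 0
      show ?thesis
      proof (cases b)
        case 0
        thus ?thesis unfolding eq using \<open>a = 0\<close> lt h B R by simp
      next
        case (Suc b')
        thus ?thesis unfolding eq using \<open>a = 0\<close> lt h B R by simp
      qed
    next
      case a: (Suc a')
      show ?thesis
      proof (cases b)
        case 0
        thus ?thesis unfolding eq using a lt h B R by simp
      next
        case b: (Suc b')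
        have "?R $$ (a' * d + u, b' * d + v) = (if a' = b' then B $$ (u, v) else 0)"
          using Suc.IH a b h by simp
        thus ?thesis unfolding eq using a b lt h B R by simp
      qed
    qed
  qed
  thus ?case using car by blast
qed (simp add: carrier_matI)

text \<open>Written exactly as the offset inside \<open>component\<close>, so that the two unfold to
  the same term.\<close>

definition block_off :: "('q::zero poly \<times> nat) list \<Rightarrow> nat \<Rightarrow> nat" where
  "block_off fs i = (\<Sum>(f', k') \<leftarrow> take i fs. k' * Polynomial.degree f')"

text \<open>Row or column number of coordinate \<open>u\<close> in the \<open>a\<close>-th copy of
  the block belonging to the \<open>i\<close>-th polynomial; all three counters start from
  zero.\<close>

definition block_idx :: "('q::zero poly \<times> nat) list \<Rightarrow> nat \<Rightarrow> nat \<Rightarrow> nat \<Rightarrow> nat" where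
  "block_idx fs i a u = block_off fs i + a * Polynomial.degree (fst (fs ! i)) + u"

lemma block_off_0 [simp]: "block_off fs 0 = 0"
  by (simp add: block_off_def)

lemma block_off_Suc:
  "i < length fs \<Longrightarrow> block_off fs (Suc i) = block_off fs i + snd (fs ! i) * Polynomial.degree (fst (fs ! i))"
  by (simp add: block_off_def take_Suc_conv_app_nth case_prod_beta)

lemma block_off_Cons_Suc: "block_off ((f, k) # fs) (Suc i) = k * Polynomial.degree f + block_off fs i"
  by (simp add: block_off_def)

lemma block_off_mono: "i \<le> j \<Longrightarrow> block_off fs i \<le> block_off fs j"
proof (induction j)
  case (Suc j)
  show ?case
  proof (cases "i = Suc j")
    case False
    hence "block_off fs i \<le> block_off fs j" using Suc by simp
    also have "\<dots> \<le> block_off fs (Suc j)"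
      by (cases "j < length fs") (simp_all add: block_off_Suc, simp add: block_off_def)
    finally show ?thesis .
  qed simp
qed simp

lemma block_idx_less_off:
  assumes "i < length fs" "a < snd (fs ! i)" "u < Polynomial.degree (fst (fs ! i))"
  shows "block_idx fs i a u < block_off fs (Suc i)"
  using mult_add_less_mult[OF assms(2,3)] by (simp add: block_idx_def block_off_Suc[OF assms(1)])

lemma block_idx_less:
  assumes "i < length fs" "a < snd (fs ! i)" "u < Polynomial.degree (fst (fs ! i))"
  shows "block_idx fs i a u < block_off fs (length fs)"
  using block_idx_less_off[OF assms] block_off_mono[of "Suc i" "length fs" fs] assms(1) by simp

lemma block_idx_inj:
  assumes i: "i < length fs" "a < snd (fs ! i)" "u < Polynomial.degree (fst (fs ! i))"
    and j: "j < length fs" "b < snd (fs ! j)" "v < Polynomial.degree (fst (fs ! j))"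
    and eq: "block_idx fs i a u = block_idx fs j b v"
  shows "i = j \<and> a = b \<and> u = v"
proof -
  have lt: "block_idx fs i a u < block_idx fs j b v"
    if "i < length fs" "a < snd (fs ! i)" "u < Polynomial.degree (fst (fs ! i))" "i < j" for i a u j b v
    using block_idx_less_off[OF that(1-3)] block_off_mono[of "Suc i" j fs] that(4) by (simp add: block_idx_def)
  have "i = j" using lt[OF i, of j b v] lt[OF j, of i a u] eq by (cases i j rule: linorder_cases) auto
  thus ?thesis using eq mult_add_eq_iff[OF i(3), of v a b] j(3) by (simp add: block_idx_def)
qed

lemma block_idx_cases:
  assumes "x < block_off fs (length fs)"
  shows "\<exists>i a u. i < length fs \<and> a < snd (fs ! i) \<and> u < Polynomial.degree (fst (fs ! i)) \<and> x = block_idx fs i a u"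
proof -
  have "\<exists>i a u. i < length fs \<and> a < snd (fs ! i) \<and> u < Polynomial.degree (fst (fs ! i)) \<and> x = block_idx fs i a u"
    if "j \<le> length fs" "x < block_off fs j" for j
    using that
  proof (induction j)
    case (Suc j)
    show ?case
    proof (cases "x < block_off fs j")
      case False
      define z where "z = x - block_off fs j"
      have "z < snd (fs ! j) * Polynomial.degree (fst (fs ! j))" using Suc.prems False by (simp add: z_def block_off_Suc)
      then obtain a u where "a < snd (fs ! j)" "u < Polynomial.degree (fst (fs ! j))" "z = a * Polynomial.degree (fst (fs ! j)) + u"
        by (rule index_split)
      thus ?thesis using False Suc.prems
        by (intro exI[of _ j] exI[of _ a] exI[of _ u]) (simp add: block_idx_def z_def)
    qed (use Suc in simp)
  qed simp
  thus ?thesis using assms by blast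
qed

lemma sum_block_idx:
  fixes g :: "nat \<Rightarrow> 'a::comm_monoid_add"
  shows "sum g {0..<block_off fs (length fs)} =
    (\<Sum>i<length fs. \<Sum>a<snd (fs ! i). \<Sum>u<Polynomial.degree (fst (fs ! i)). g (block_idx fs i a u))"
proof -
  have "sum g {0..<block_off fs j} =
    (\<Sum>i<j. \<Sum>a<snd (fs ! i). \<Sum>u<Polynomial.degree (fst (fs ! i)). g (block_idx fs i a u))" if "j \<le> length fs" for j
    using that
  proof (induction j)
    case (Suc j)
    let ?m = "snd (fs ! j) * Polynomial.degree (fst (fs ! j))"
    have "sum g {0..<block_off fs (Suc j)} = sum g {0..<block_off fs j} + sum g {block_off fs j..<block_off fs j + ?m}"
      using Suc.prems by (simp add: block_off_Suc sum.atLeastLessThan_concat)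
    also have "sum g {block_off fs j..<block_off fs j + ?m} = sum (\<lambda>x. g (block_off fs j + x)) {0..<?m}"
      using sum.shift_bounds_nat_ivl[of g 0 "block_off fs j" ?m] by (simp add: add.commute)
    also have "\<dots> = (\<Sum>a<snd (fs ! j). \<Sum>u<Polynomial.degree (fst (fs ! j)). g (block_idx fs j a u))"
      unfolding sum_lessThan_mult_split by (simp add: block_idx_def add.assoc)
    finally show ?case using Suc by simp
  qed simp
  thus ?thesis by blast
qed

lemma block_mat_A_entry:
  fixes A :: "'q::field poly \<Rightarrow> 'q fps mat"
  assumes "\<And>f. f \<in> fst ` set fs \<Longrightarrow> A f \<in> carrier_mat (Polynomial.degree f) (Polynomial.degree f)"
  shows "block_mat_A A fs \<in> carrier_mat (block_off fs (length fs)) (block_off fs (length fs)) \<and>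
    (\<forall>i<length fs. \<forall>j<length fs. \<forall>a<snd (fs ! i). \<forall>b<snd (fs ! j).
     \<forall>u<Polynomial.degree (fst (fs ! i)). \<forall>v<Polynomial.degree (fst (fs ! j)).
      block_mat_A A fs $$ (block_idx fs i a u, block_idx fs j b v) =
        (if i = j \<and> a = b then A (fst (fs ! i)) $$ (u, v) else 0))"
  using assms
proof (induction fs)
  case Nil
  show ?case by (simp add: block_mat_A_def)
next
  case (Cons fk fs)
  obtain f k where fk: "fk = (f, k)" by (cases fk)
  let ?d = "Polynomial.degree f"
  let ?n = "block_off fs (length fs)"
  let ?R = "diag_block_mat (replicate k (A f))"
  let ?B = "block_mat_A A fs"
  have Af: "A f \<in> carrier_mat ?d ?d" using Cons.prems[of f] fk by simp
  note R = diag_block_mat_replicate[OF Af, of k]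
  have pre: "A f \<in> carrier_mat (Polynomial.degree f) (Polynomial.degree f)" if "f \<in> fst ` set fs" for f
    using Cons.prems[of f] that by simp
  note IH0 = Cons.IH[OF pre]
  have IH: "?B \<in> carrier_mat ?n ?n"
    "\<And>i j a b u v. i < length fs \<Longrightarrow> j < length fs \<Longrightarrow> a < snd (fs ! i) \<Longrightarrow> b < snd (fs ! j) \<Longrightarrow>
     u < Polynomial.degree (fst (fs ! i)) \<Longrightarrow> v < Polynomial.degree (fst (fs ! j)) \<Longrightarrow>
      ?B $$ (block_idx fs i a u, block_idx fs j b v) =
        (if i = j \<and> a = b then A (fst (fs ! i)) $$ (u, v) else 0)"
    using IH0 by blast+
  have Rc: "?R \<in> carrier_mat (k * ?d) (k * ?d)" using R by blast
  have eq: "block_mat_A A (fk # fs) = four_block_mat ?R (0\<^sub>m (k * ?d) ?n) (0\<^sub>m ?n (k * ?d)) ?B"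
    using carrier_matD[OF Rc] carrier_matD[OF IH(1)] unfolding fk block_mat_A_def
    by (simp add: diag_block_mat_append Let_def)
  have off: "block_off (fk # fs) (length (fk # fs)) = k * ?d + ?n"
    by (simp add: fk block_off_Cons_Suc)
  have car: "block_mat_A A (fk # fs) \<in> carrier_mat (k * ?d + ?n) (k * ?d + ?n)"
    unfolding eq using R IH(1) by simp
  have idx0: "block_idx (fk # fs) 0 a u = a * ?d + u" for a u by (simp add: block_idx_def fk)
  have idxS: "block_idx (fk # fs) (Suc i) a u = k * ?d + block_idx fs i a u" for i a u
    by (simp add: block_idx_def fk block_off_Cons_Suc)
  have "block_mat_A A (fk # fs) $$ (block_idx (fk # fs) i a u, block_idx (fk # fs) j b v) =
        (if i = j \<and> a = b then A (fst ((fk # fs) ! i)) $$ (u, v) else 0)"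
    if i: "i < length (fk # fs)" "a < snd ((fk # fs) ! i)" "u < Polynomial.degree (fst ((fk # fs) ! i))"
      and j: "j < length (fk # fs)" "b < snd ((fk # fs) ! j)" "v < Polynomial.degree (fst ((fk # fs) ! j))" for i j a b u v
  proof -
    have Rc: "?R \<in> carrier_mat (k * ?d) (k * ?d)" using R by blast
    note lt = block_idx_less[OF i] block_idx_less[OF j]
    have lt': "block_idx (fk # fs) i a u < k * ?d + ?n" "block_idx (fk # fs) j b v < k * ?d + ?n"
      using lt unfolding off by simp_all
    have ent: "block_mat_A A (fk # fs) $$ (x, y) =
        (if x < k * ?d then if y < k * ?d then ?R $$ (x, y) else 0
         else if y < k * ?d then 0 else ?B $$ (x - k * ?d, y - k * ?d))"
      if "x < k * ?d + ?n" "y < k * ?d + ?n" for x y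
      unfolding eq using that Rc IH(1) by auto
    show ?thesis
    proof (cases i)
      case i0: 0
      have a: "a * ?d + u < k * ?d" using i i0 fk by (intro mult_add_less_mult) auto
      show ?thesis
      proof (cases j)
        case j0: 0
        have b: "b * ?d + v < k * ?d" using j j0 fk by (intro mult_add_less_mult) auto
        have "?R $$ (a * ?d + u, b * ?d + v) = (if a = b then A f $$ (u, v) else 0)"
          using R i j i0 j0 fk by simp
        moreover have "block_mat_A A (fk # fs) $$ (a * ?d + u, b * ?d + v) = ?R $$ (a * ?d + u, b * ?d + v)"
          using ent[OF lt'] a b unfolding i0 j0 idx0 by simp
        ultimately show ?thesis unfolding i0 j0 idx0 by (simp add: fk)
      next
        case (Suc j')
        thus ?thesis using ent[OF lt'] a i0 by (simp add: idx0 idxS)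
      qed
    next
      case iS: (Suc i')
      show ?thesis
      proof (cases j)
        case j0: 0
        have b: "b * ?d + v < k * ?d" using j j0 fk by (intro mult_add_less_mult) auto
        thus ?thesis using ent[OF lt'] iS j0 by (simp add: idx0 idxS)
      next
        case jS: (Suc j')
        have "?B $$ (block_idx fs i' a u, block_idx fs j' b v) = (if i' = j' \<and> a = b then A (fst (fs ! i')) $$ (u, v) else 0)"
          using i j iS jS by (intro IH(2)) auto
        thus ?thesis using ent[OF lt'] iS jS by (simp add: idxS)
      qed
    qed
  qed
  thus ?case using car unfolding off by blast
qed

text \<open>In the eigenbases the operator multiplies each entry by a scalar that is zero or a unit
  modulo \<open>\<pi>\<close>. A zero scalar already kills the entry in its image, and a unit can be
  cancelled. If no scalar is zero, the operator itself is injective modulo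
  \<open>\<pi>^m\<close>.\<close>

lemma sylvester_square:
  fixes A :: "'q::finite_field fps mat"
  assumes A: "A \<in> carrier_mat n n" "A' \<in> carrier_mat n' n'" and Z: "Z \<in> carrier_mat n n'"
    and sim: "similar_mat_wit (map_mat O_embed A) (mat_diag n x) P Q"
    and sim': "similar_mat_wit (map_mat O_embed A') (mat_diag n' x') P' Q'"
    and unit: "\<And>i j. i < n \<Longrightarrow> j < n' \<Longrightarrow> x i = x' j \<or> x i - x' j dvd 1"
  shows "reduce_mat m (A * (A * Z - Z * A') - (A * Z - Z * A') * A') = 0\<^sub>m n n' \<Longrightarrow> reduce_mat m (A * Z - Z * A') = 0\<^sub>m n n'"
    "(\<And>i j. i < n \<Longrightarrow> j < n' \<Longrightarrow> x i \<noteq> x' j) \<Longrightarrow> reduce_mat m (A * Z - Z * A') = 0\<^sub>m n n' \<Longrightarrow> reduce_mat m Z = 0\<^sub>m n n'"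
proof -
  note h = emb.comm_ring_hom_axioms
  note PQ = similar_mat_wit_diagD[OF sim] and PQ' = similar_mat_wit_diagD[OF sim']
  define c where "c = (\<lambda>W. Q * map_mat O_embed W * P')"
  have c: "c W \<in> carrier_mat n n'" if "W \<in> carrier_mat n n'" for W
    unfolding c_def using that PQ(2) PQ'(1) by (intro mult_carrier_mat[of _ n n'] mult_carrier_mat[of _ n n]) auto
  have zero_iff: "reduce_mat m W = 0\<^sub>m n n' \<longleftrightarrow> (\<forall>i<n. \<forall>j<n'. fps_cutoff m (c W $$ (i, j)) = 0)"
    if W: "W \<in> carrier_mat n n'" for W
  proof -
    have "reduce_mat m (c W) = 0\<^sub>m n n' \<longleftrightarrow> reduce_mat m (map_mat O_embed W) = 0\<^sub>m n n'"
    proof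
      assume "reduce_mat m (c W) = 0\<^sub>m n n'"
      hence "reduce_mat m (P * c W * Q') = 0\<^sub>m n n'" using PQ PQ' c[OF W] by (intro reduce_conj_eq_0) auto
      moreover have "P * c W * Q' = map_mat O_embed W"
        unfolding c_def using conj_inverse[OF sim sim', of "map_mat O_embed W"] W by simp
      ultimately show "reduce_mat m (map_mat O_embed W) = 0\<^sub>m n n'" by simp
    next
      assume "reduce_mat m (map_mat O_embed W) = 0\<^sub>m n n'"
      thus "reduce_mat m (c W) = 0\<^sub>m n n'" unfolding c_def using W PQ PQ' by (intro reduce_conj_eq_0) auto
    qed
    thus ?thesis using reduce_O_embed_eq_0_iff[OF W, of m] reduce_mat_eq_0_iff[OF c[OF W], of m] by blast
  qed
  define S where "S = (\<lambda>W. A * W - W * A')"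
  have S: "S W \<in> carrier_mat n n'" if "W \<in> carrier_mat n n'" for W
    unfolding S_def using mult_carrier_mat[OF that A(2)] by (rule minus_carrier_mat)
  have cS: "c (S W) $$ (i, j) = (x i - x' j) * c W $$ (i, j)" if "W \<in> carrier_mat n n'" "i < n" "j < n'" for W i j
    unfolding c_def S_def by (rule sylvester_conj[OF h A that(1) sim sim' that(2,3)])
  { assume "reduce_mat m (A * (A * Z - Z * A') - (A * Z - Z * A') * A') = 0\<^sub>m n n'"
    hence 0: "reduce_mat m (S (S Z)) = 0\<^sub>m n n'" by (simp add: S_def)
    have "fps_cutoff m (c (S Z) $$ (i, j)) = 0" if ij: "i < n" "j < n'" for i j
    proof (cases "x i = x' j")
      case True
      thus ?thesis using cS[OF Z ij] by simp
    next
      case False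
      hence u: "x i - x' j dvd 1" using unit[OF ij] by blast
      have "fps_cutoff m ((x i - x' j) * c (S Z) $$ (i, j)) = 0"
        using 0 zero_iff[OF S[OF S[OF Z]]] ij unfolding cS[OF S[OF Z] ij, symmetric] by blast
      thus ?thesis by (rule cutoff_unit_mult[OF u])
    qed
    thus "reduce_mat m (A * Z - Z * A') = 0\<^sub>m n n'" using zero_iff[OF S[OF Z]] by (simp add: S_def) }
  { assume ne: "\<And>i j. i < n \<Longrightarrow> j < n' \<Longrightarrow> x i \<noteq> x' j" and "reduce_mat m (A * Z - Z * A') = 0\<^sub>m n n'"
    hence 0: "reduce_mat m (S Z) = 0\<^sub>m n n'" by (simp add: S_def)
    have "fps_cutoff m (c Z $$ (i, j)) = 0" if ij: "i < n" "j < n'" for i j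
    proof -
      have u: "x i - x' j dvd 1" using unit[OF ij] ne[OF ij] by blast
      have "fps_cutoff m ((x i - x' j) * c Z $$ (i, j)) = 0"
        using 0 zero_iff[OF S[OF Z]] ij unfolding cS[OF Z ij, symmetric] by blast
      thus ?thesis by (rule cutoff_unit_mult[OF u])
    qed
    thus "reduce_mat m Z = 0\<^sub>m n n'" using zero_iff[OF Z] by blast }
qed

section \<open>The centraliser of \<open>A\<^sub>s\<close>\<close>

text \<open>\<open>disj\<close> compares roots of different polynomials together with all their
  conjugates; it makes eigenvalue differences between different blocks units.\<close>

locale block_data =
  fixes fs :: "('q::finite_field poly \<times> nat) list" and A :: "'q poly \<Rightarrow> 'q fps mat" and s :: "'q poly \<Rightarrow> 'q alg_closure fps"
    and P Q :: "'q poly \<Rightarrow> 'q alg_closure fps mat"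
  assumes um: "(f, k) \<in> set fs \<Longrightarrow> unramified_matrix (Polynomial.degree f) (A f) (s f) (P f) (Q f)"
    and disj: "i < length fs \<Longrightarrow> j < length fs \<Longrightarrow> i \<noteq> j \<Longrightarrow>
      fps_nth (s (fst (fs ! i))) 0 ^ (CARD('q) ^ a) \<noteq> fps_nth (s (fst (fs ! j))) 0 ^ (CARD('q) ^ b)"
begin

abbreviation "N \<equiv> length fs"
abbreviation "dg i \<equiv> Polynomial.degree (fst (fs ! i))"
abbreviation "mu i \<equiv> snd (fs ! i)"
abbreviation "idx \<equiv> block_idx fs"
abbreviation "n \<equiv> block_off fs (length fs)"
abbreviation "As \<equiv> block_mat_A A fs"
abbreviation "Ai i \<equiv> A (fst (fs ! i))"
abbreviation "si i \<equiv> s (fst (fs ! i))"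
abbreviation "yi i \<equiv> unramified_matrix.y (P (fst (fs ! i))) (Q (fst (fs ! i)))"
abbreviation "ex i \<equiv> unramified_matrix.exact (dg i) (Ai i)"
abbreviation "ki i \<equiv> (finite_subfield (dg i) :: 'q alg_closure set)"
abbreviation "valid i a u \<equiv> i < N \<and> a < mu i \<and> u < dg i"

lemma umi: "i < N \<Longrightarrow> unramified_matrix (dg i) (Ai i) (si i) (P (fst (fs ! i))) (Q (fst (fs ! i)))"
  using um[of "fst (fs ! i)" "snd (fs ! i)"] by simp

lemma Ai: "i < N \<Longrightarrow> Ai i \<in> carrier_mat (dg i) (dg i)"
  using unramified_matrix.A[OF umi] .

lemma A_carrier: "f \<in> fst ` set fs \<Longrightarrow> A f \<in> carrier_mat (Polynomial.degree f) (Polynomial.degree f)"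
  using unramified_matrix.A[OF um] by auto

lemma As: "As \<in> carrier_mat n n"
  using block_mat_A_entry[of fs A] A_carrier by blast

lemma As_entry: "valid i a u \<Longrightarrow> valid j b v \<Longrightarrow>
    As $$ (idx i a u, idx j b v) = (if i = j \<and> a = b then Ai i $$ (u, v) else 0)"
  using block_mat_A_entry[of fs A] A_carrier by blast

lemma idx_less: "valid i a u \<Longrightarrow> idx i a u < n"
  using block_idx_less by blast

lemma idx_eq_iff: "valid i a u \<Longrightarrow> valid j b v \<Longrightarrow> idx i a u = idx j b v \<longleftrightarrow> i = j \<and> a = b \<and> u = v"
  using block_idx_inj by blast

lemma idx_cases:
  assumes "x < n"
  obtains i a u where "valid i a u" "x = idx i a u"
  using block_idx_cases[OF assms] by blast

definition "blk Z i a j b = mat (dg i) (dg j) (\<lambda>(u, v). Z $$ (idx i a u, idx j b v))"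

lemma blk_carrier [simp]: "blk Z i a j b \<in> carrier_mat (dg i) (dg j)"
  by (simp add: blk_def)

lemma blk_dims [simp]: "dim_row (blk Z i a j b) = dg i" "dim_col (blk Z i a j b) = dg j"
  by (simp_all add: blk_def)

lemma blk_index [simp]: "u < dg i \<Longrightarrow> v < dg j \<Longrightarrow> blk Z i a j b $$ (u, v) = Z $$ (idx i a u, idx j b v)"
  by (simp add: blk_def)

lemma eq_by_blocks:
  assumes "Z \<in> carrier_mat n n" "W \<in> carrier_mat n n"
    "\<And>i a j b. i < N \<Longrightarrow> j < N \<Longrightarrow> a < mu i \<Longrightarrow> b < mu j \<Longrightarrow> blk Z i a j b = blk W i a j b"
  shows "Z = W"
proof (rule eq_matI)
  fix x y assume "x < dim_row W" "y < dim_col W"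
  hence xy: "x < n" "y < n" using assms(2) by auto
  obtain i a u where x: "valid i a u" "x = idx i a u" using xy(1) by (rule idx_cases)
  obtain j b v where y: "valid j b v" "y = idx j b v" using xy(2) by (rule idx_cases)
  have "blk Z i a j b $$ (u, v) = blk W i a j b $$ (u, v)" using assms(3)[of i j a b] x y by simp
  thus "Z $$ (x, y) = W $$ (x, y)" using x y by simp
qed (use assms in auto)

lemma reduce_blk: "Z \<in> carrier_mat n n \<Longrightarrow> i < N \<Longrightarrow> j < N \<Longrightarrow> a < mu i \<Longrightarrow> b < mu j \<Longrightarrow>
    blk (reduce_mat m Z) i a j b = reduce_mat m (blk Z i a j b)"
  by (rule eq_matI) (auto simp: idx_less)

lemma mult_entry:
  fixes Z W :: "'b::semiring_0 mat"
  assumes "Z \<in> carrier_mat n n" "W \<in> carrier_mat n n" "x < n" "y < n"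
  shows "(Z * W) $$ (x, y) = (\<Sum>i<N. \<Sum>a<mu i. \<Sum>u<dg i. Z $$ (x, idx i a u) * W $$ (idx i a u, y))"
proof -
  have "(Z * W) $$ (x, y) = (\<Sum>z = 0..<n. Z $$ (x, z) * W $$ (z, y))"
    using assms by (auto simp: scalar_prod_def)
  thus ?thesis unfolding sum_block_idx .
qed

lemma sum_delta2:
  fixes g :: "nat \<Rightarrow> nat \<Rightarrow> 'b::comm_monoid_add"
  assumes "j < N" "b < mu j"
  shows "(\<Sum>i<N. \<Sum>a<mu i. if i = j \<and> a = b then g i a else 0) = g j b"
proof -
  have "(\<Sum>i<N. \<Sum>a<mu i. if i = j \<and> a = b then g i a else 0) = (\<Sum>i<N. if i = j then g j b else 0)"
    using assms by (intro sum.cong refl) (auto simp: sum.delta)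
  thus ?thesis using assms by simp
qed

lemma blk_mult_As:
  assumes Z: "Z \<in> carrier_mat n n" and ij: "i < N" "j < N" "a < mu i" "b < mu j"
  shows "blk (Z * As) i a j b = blk Z i a j b * Ai j" "blk (As * Z) i a j b = Ai i * blk Z i a j b"
proof -
  show "blk (Z * As) i a j b = blk Z i a j b * Ai j"
  proof (rule eq_matI)
    fix u v assume "u < dim_row (blk Z i a j b * Ai j)" "v < dim_col (blk Z i a j b * Ai j)"
    hence uv: "u < dg i" "v < dg j" using Ai[OF ij(2)] by (auto simp: blk_def)
    have "(Z * As) $$ (idx i a u, idx j b v) = (\<Sum>i'<N. \<Sum>a'<mu i'. \<Sum>w<dg i'. Z $$ (idx i a u, idx i' a' w) * As $$ (idx i' a' w, idx j b v))"
      using uv ij by (intro mult_entry Z As idx_less) auto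
    also have "\<dots> = (\<Sum>i'<N. \<Sum>a'<mu i'. if i' = j \<and> a' = b then \<Sum>w<dg i'. Z $$ (idx i a u, idx i' a' w) * Ai j $$ (w, v) else 0)"
      using uv ij by (intro sum.cong refl) (auto simp: As_entry)
    also have "\<dots> = (\<Sum>w<dg j. Z $$ (idx i a u, idx j b w) * Ai j $$ (w, v))"
      using ij by (intro sum_delta2)
    finally show "blk (Z * As) i a j b $$ (u, v) = (blk Z i a j b * Ai j) $$ (u, v)"
      using uv Ai[OF ij(2)] by (auto simp: scalar_prod_def lessThan_atLeast0 blk_def)
  qed (use Ai[OF ij(2)] in \<open>auto simp: blk_def\<close>)
  show "blk (As * Z) i a j b = Ai i * blk Z i a j b"
  proof (rule eq_matI)
    fix u v assume "u < dim_row (Ai i * blk Z i a j b)" "v < dim_col (Ai i * blk Z i a j b)"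
    hence uv: "u < dg i" "v < dg j" using Ai[OF ij(1)] by (auto simp: blk_def)
    have "(As * Z) $$ (idx i a u, idx j b v) = (\<Sum>i'<N. \<Sum>a'<mu i'. \<Sum>w<dg i'. As $$ (idx i a u, idx i' a' w) * Z $$ (idx i' a' w, idx j b v))"
      using uv ij by (intro mult_entry Z As idx_less) auto
    also have "\<dots> = (\<Sum>i'<N. \<Sum>a'<mu i'. if i' = i \<and> a' = a then \<Sum>w<dg i'. Ai i $$ (u, w) * Z $$ (idx i' a' w, idx j b v) else 0)"
      using uv ij by (intro sum.cong refl) (auto simp: As_entry)
    also have "\<dots> = (\<Sum>w<dg i. Ai i $$ (u, w) * Z $$ (idx i a w, idx j b v))"
      using ij by (intro sum_delta2)
    finally show "blk (As * Z) i a j b $$ (u, v) = (Ai i * blk Z i a j b) $$ (u, v)"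
      using uv Ai[OF ij(1)] by (auto simp: scalar_prod_def lessThan_atLeast0 blk_def)
  qed (use Ai[OF ij(1)] in \<open>auto simp: blk_def\<close>)
qed

definition "D Z = As * Z - Z * As"

lemma D_carrier [simp]: "Z \<in> carrier_mat n n \<Longrightarrow> D Z \<in> carrier_mat n n"
  using As by (simp add: D_def)

lemma blk_D:
  assumes Z: "Z \<in> carrier_mat n n" and ij: "i < N" "j < N" "a < mu i" "b < mu j"
  shows "blk (D Z) i a j b = Ai i * blk Z i a j b - blk Z i a j b * Ai j"
proof -
  have "blk (D Z) i a j b = blk (As * Z) i a j b - blk (Z * As) i a j b"
    using As Z ij by (intro eq_matI) (auto simp: D_def idx_less simp del: index_mult_mat(1))
  thus ?thesis unfolding blk_mult_As[OF assms] .
qed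

text \<open>Within one block distinct conjugates differ by a unit by \<open>node_unit\<close>;
  across blocks the same follows from \<open>disj\<close>.\<close>

lemma nodes_eq_or_unit:
  assumes "i < N" "j < N" "u < dg i" "v < dg j"
  shows "(frobenius ^^ u) (si i) = (frobenius ^^ v) (si j) \<or> (frobenius ^^ u) (si i) - (frobenius ^^ v) (si j) dvd 1"
    "i \<noteq> j \<Longrightarrow> (frobenius ^^ u) (si i) \<noteq> (frobenius ^^ v) (si j)"
proof -
  have ne: "(frobenius ^^ u) (si i) - (frobenius ^^ v) (si j) dvd 1" if "i \<noteq> j"
    using disj[OF assms(1,2) that, of u v] by (simp add: fps_dvd_one_iff frobenius_funpow_nth)
  show "i \<noteq> j \<Longrightarrow> (frobenius ^^ u) (si i) \<noteq> (frobenius ^^ v) (si j)" using ne by auto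
  show "(frobenius ^^ u) (si i) = (frobenius ^^ v) (si j) \<or> (frobenius ^^ u) (si i) - (frobenius ^^ v) (si j) dvd 1"
  proof (cases "i = j")
    case True
    show ?thesis
    proof (cases "u = v")
      case False
      have v: "v < dg i" using assms(4) True by simp
      have "(frobenius ^^ u) (si i) - (frobenius ^^ v) (si i) dvd 1"
        using unramified_matrix.node_unit[OF umi[OF assms(1)] assms(3) v False]
        unfolding unramified_matrix.node_def[OF umi[OF assms(1)]] .
      thus ?thesis using True by metis
    qed (use True in simp)
  qed (use ne in blast)
qed

lemma reduce_eq_0_by_blocks:
  assumes "Z \<in> carrier_mat n n"
  shows "reduce_mat m Z = 0\<^sub>m n n \<longleftrightarrow>
    (\<forall>i<N. \<forall>j<N. \<forall>a<mu i. \<forall>b<mu j. reduce_mat m (blk Z i a j b) = 0\<^sub>m (dg i) (dg j))"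
proof
  assume 0: "reduce_mat m Z = 0\<^sub>m n n"
  show "\<forall>i<N. \<forall>j<N. \<forall>a<mu i. \<forall>b<mu j. reduce_mat m (blk Z i a j b) = 0\<^sub>m (dg i) (dg j)"
  proof (intro allI impI)
    fix i j a b assume h: "i < N" "j < N" "a < mu i" "b < mu j"
    show "reduce_mat m (blk Z i a j b) = 0\<^sub>m (dg i) (dg j)"
      unfolding reduce_blk[OF assms h, symmetric] 0 using h by (intro eq_matI) (auto simp: blk_def idx_less)
  qed
next
  assume h: "\<forall>i<N. \<forall>j<N. \<forall>a<mu i. \<forall>b<mu j. reduce_mat m (blk Z i a j b) = 0\<^sub>m (dg i) (dg j)"
  show "reduce_mat m Z = 0\<^sub>m n n"
  proof (rule eq_by_blocks)
    fix i a j b assume ij: "i < N" "j < N" "a < mu i" "b < mu j"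
    show "blk (reduce_mat m Z) i a j b = blk (0\<^sub>m n n) i a j b"
      unfolding reduce_blk[OF assms ij] using h ij by (intro eq_matI) (auto simp: blk_def idx_less)
  qed (use assms in auto)
qed

text \<open>Since the eigenvalues of \<open>D\<close> are zero or units, \<open>D\<close> is semisimple modulo every power of \<open>\<pi>\<close>.\<close>

lemma D_square:
  assumes Z: "Z \<in> carrier_mat n n" and 0: "reduce_mat m (D (D Z)) = 0\<^sub>m n n"
  shows "reduce_mat m (D Z) = 0\<^sub>m n n"
  unfolding reduce_eq_0_by_blocks[OF D_carrier[OF Z]]
proof (intro allI impI)
  fix i j a b assume h: "i < N" "j < N" "a < mu i" "b < mu j"
  have 1: "reduce_mat m (blk (D (D Z)) i a j b) = 0\<^sub>m (dg i) (dg j)"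
    using 0 h unfolding reduce_eq_0_by_blocks[OF D_carrier[OF D_carrier[OF Z]]] by blast
  show "reduce_mat m (blk (D Z) i a j b) = 0\<^sub>m (dg i) (dg j)"
    unfolding blk_D[OF Z h]
  proof (rule sylvester_square(1)[OF Ai[OF h(1)] Ai[OF h(2)] blk_carrier
          unramified_matrix.sim[OF umi[OF h(1)]] unramified_matrix.sim[OF umi[OF h(2)]]])
    show "reduce_mat m (Ai i * (Ai i * blk Z i a j b - blk Z i a j b * Ai j) -
        (Ai i * blk Z i a j b - blk Z i a j b * Ai j) * Ai j) = 0\<^sub>m (dg i) (dg j)"
      using 1 unfolding blk_D[OF D_carrier[OF Z] h] blk_D[OF Z h] .
  qed (rule nodes_eq_or_unit(1)[OF h(1,2)])
qed

lemma off_diagonal_blocks: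
  assumes Z: "Z \<in> carrier_mat n n" and 0: "reduce_mat m (D Z) = 0\<^sub>m n n"
    and h: "i < N" "j < N" "a < mu i" "b < mu j" "i \<noteq> j"
  shows "reduce_mat m (blk Z i a j b) = 0\<^sub>m (dg i) (dg j)"
proof -
  have 1: "reduce_mat m (blk (D Z) i a j b) = 0\<^sub>m (dg i) (dg j)"
    using 0 h unfolding reduce_eq_0_by_blocks[OF D_carrier[OF Z]] by blast
  show ?thesis
  proof (rule sylvester_square(2)[OF Ai[OF h(1)] Ai[OF h(2)] blk_carrier
          unramified_matrix.sim[OF umi[OF h(1)]] unramified_matrix.sim[OF umi[OF h(2)]]])
    show "reduce_mat m (Ai i * blk Z i a j b - blk Z i a j b * Ai j) = 0\<^sub>m (dg i) (dg j)"
      using 1 unfolding blk_D[OF Z h(1-4)] .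
    show "(frobenius ^^ u) (si i) \<noteq> (frobenius ^^ v) (si j)" if "u < dg i" "v < dg j" for u v
      by (rule nodes_eq_or_unit(2)[OF h(1,2) that h(5)])
  qed (rule nodes_eq_or_unit(1)[OF h(1,2)])
qed

text \<open>The exact centraliser of \<open>As\<close> over the untruncated ring, source of all
  representatives for elements of the truncated centraliser.\<close>

definition "E Z \<longleftrightarrow> Z \<in> carrier_mat n n \<and> As * Z = Z * As"

lemma E_carrier: "E Z \<Longrightarrow> Z \<in> carrier_mat n n"
  by (simp add: E_def)

lemma E_D: "E Z \<Longrightarrow> D Z = 0\<^sub>m n n"
  using As by (auto simp: E_def D_def)

lemma all_reduce_0:
  fixes Z :: "'a::zero fps mat"
  assumes "Z \<in> carrier_mat a b" "\<And>m. reduce_mat m Z = 0\<^sub>m a b"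
  shows "Z = 0\<^sub>m a b"
proof (rule eq_matI)
  fix i j assume ij: "i < dim_row (0\<^sub>m a b)" "j < dim_col (0\<^sub>m a b)"
  have "fps_cutoff m (Z $$ (i, j)) = fps_cutoff m 0" for m
    using arg_cong[OF assms(2)[of m], of "\<lambda>Y. Y $$ (i, j)"] ij assms(1) by simp
  hence "Z $$ (i, j) = 0" by (rule all_cutoff_eqD)
  thus "Z $$ (i, j) = 0\<^sub>m a b $$ (i, j)" using ij by simp
qed (use assms in auto)

text \<open>An off-diagonal block of a commuting matrix vanishes modulo every power of
  \<open>\<pi>\<close>, hence vanishes. The diagonal blocks need only commute with the corresponding
  \<open>A f\<close>.\<close>

lemma E_blocks:
  assumes Z: "Z \<in> carrier_mat n n"
  shows "E Z \<longleftrightarrow> (\<forall>i<N. \<forall>j<N. \<forall>a<mu i. \<forall>b<mu j. if i = j then ex i (blk Z i a j b) else blk Z i a j b = 0\<^sub>m (dg i) (dg j))"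
    (is "_ \<longleftrightarrow> ?r")
proof
  assume EZ: "E Z"
  show ?r
  proof (intro allI impI)
    fix i j a b assume h: "i < N" "j < N" "a < mu i" "b < mu j"
    show "if i = j then ex i (blk Z i a j b) else blk Z i a j b = 0\<^sub>m (dg i) (dg j)"
    proof (cases "i = j")
      case True
      have "Ai i * blk Z i a j b = blk Z i a j b * Ai j"
        unfolding blk_mult_As[OF Z h, symmetric] using EZ by (simp add: E_def)
      thus ?thesis using True unfolding unramified_matrix.exact_def[OF umi[OF h(1)]] by simp
    next
      case False
      have "reduce_mat m (D Z) = 0\<^sub>m n n" for m unfolding E_D[OF EZ] by (auto simp: mat_eq_iff)
      hence "reduce_mat m (blk Z i a j b) = 0\<^sub>m (dg i) (dg j)" for m
        using off_diagonal_blocks[OF Z _ h False] by blast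
      hence "blk Z i a j b = 0\<^sub>m (dg i) (dg j)" by (rule all_reduce_0[OF blk_carrier])
      thus ?thesis using False by simp
    qed
  qed
next
  assume r: ?r
  have "As * Z = Z * As"
  proof (rule eq_by_blocks)
    fix i a j b assume h: "i < N" "j < N" "a < mu i" "b < mu j"
    show "blk (As * Z) i a j b = blk (Z * As) i a j b"
    proof (cases "i = j")
      case True
      have "ex i (blk Z i a j b)" using r h True by auto
      thus ?thesis unfolding blk_mult_As[OF Z h] using True
        unfolding unramified_matrix.exact_def[OF umi[OF h(1)]] by simp
    next
      case False
      have "blk Z i a j b = 0\<^sub>m (dg i) (dg j)" using r h False by auto
      thus ?thesis unfolding blk_mult_As[OF Z h] using Ai[OF h(1)] Ai[OF h(2)] by simp
    qed
  qed (use As Z in auto)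
  thus "E Z" using Z by (simp add: E_def)
qed

lemma E_block: "E Z \<Longrightarrow> i < N \<Longrightarrow> a < mu i \<Longrightarrow> b < mu i \<Longrightarrow> ex i (blk Z i a i b)"
  using E_blocks[OF E_carrier] by (metis (no_types, lifting))

definition "decode x = (SOME t. case t of (i, a, u) \<Rightarrow> valid i a u \<and> x = idx i a u)"

lemma decode:
  assumes "valid i a u"
  shows "decode (idx i a u) = (i, a, u)"
proof -
  have "case decode (idx i a u) of (i', a', u') \<Rightarrow> valid i' a' u' \<and> idx i a u = idx i' a' u'"
    unfolding decode_def by (rule someI[of _ "(i, a, u)"]) (use assms in simp)
  moreover obtain i' a' u' where "decode (idx i a u) = (i', a', u')" by (metis prod_cases3)
  ultimately show ?thesis using idx_eq_iff[OF assms, of i' a' u'] by simp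
qed

text \<open>The inverse of cutting into blocks: \<open>decode\<close> recovers factor, copy and
  coordinate from an index, and blocks between different factors are set to zero.\<close>

definition "assemble W = mat n n (\<lambda>(x, y). case decode x of (i, a, u) \<Rightarrow> case decode y of (j, b, v) \<Rightarrow>
  if i = j then W i a b $$ (u, v) else 0)"

lemma assemble_carrier [simp]: "assemble W \<in> carrier_mat n n"
  by (simp add: assemble_def)

lemma blk_assemble:
  assumes "i < N" "j < N" "a < mu i" "b < mu j" "W i a b \<in> carrier_mat (dg i) (dg i)"
  shows "blk (assemble W) i a j b = (if i = j then W i a b else 0\<^sub>m (dg i) (dg j))"
  using assms by (intro eq_matI) (auto simp: assemble_def idx_less decode)

lemma assemble_E:
  assumes "\<And>i a b. i < N \<Longrightarrow> a < mu i \<Longrightarrow> b < mu i \<Longrightarrow> ex i (W i a b)"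
  shows "E (assemble W)"
  unfolding E_blocks[OF assemble_carrier]
proof (intro allI impI)
  fix i j a b assume h: "i < N" "j < N" "a < mu i" "b < mu j"
  show "if i = j then ex i (blk (assemble W) i a j b) else blk (assemble W) i a j b = 0\<^sub>m (dg i) (dg j)"
  proof (cases "i = j")
    case True
    have e: "ex i (W i a b)" using assms[of i a b] h True by simp
    hence "W i a b \<in> carrier_mat (dg i) (dg i)" by (rule unramified_matrix.exact_carrier[OF umi[OF h(1)]])
    thus ?thesis using blk_assemble[OF h, of W] True e by simp
  next
    case False
    thus ?thesis using h by (auto intro!: eq_matI simp: assemble_def idx_less decode)
  qed
qed

text \<open>Diagonal blocks are lifted one at a time by \<open>exact_lift\<close>; off-diagonal
  blocks vanish modulo \<open>\<pi>^m\<close> and are lifted by zero.\<close>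

lemma E_lift:
  assumes Z: "Z \<in> carrier_mat n n" and 0: "reduce_mat m (D Z) = 0\<^sub>m n n"
  shows "\<exists>W. E W \<and> reduce_mat m W = reduce_mat m Z"
proof -
  have "\<exists>W. i < N \<longrightarrow> a < mu i \<longrightarrow> b < mu i \<longrightarrow> ex i W \<and> reduce_mat m W = reduce_mat m (blk Z i a i b)" for i a b
  proof (cases "i < N \<and> a < mu i \<and> b < mu i")
    case True
    let ?B = "blk Z i a i b"
    have "reduce_mat m (blk (D Z) i a i b) = 0\<^sub>m (dg i) (dg i)"
      using 0 True unfolding reduce_eq_0_by_blocks[OF D_carrier[OF Z]] by blast
    hence "reduce_mat m (Ai i * ?B - ?B * Ai i) = 0\<^sub>m (dg i) (dg i)" using blk_D[OF Z, of i i a b] True by simp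
    moreover have c: "Ai i * ?B \<in> carrier_mat (dg i) (dg i)" "?B * Ai i \<in> carrier_mat (dg i) (dg i)"
      using Ai[of i] True by auto
    ultimately have "fps_cutoff m ((Ai i * ?B) $$ (u, v) - (?B * Ai i) $$ (u, v)) = 0" if "u < dg i" "v < dg i" for u v
      using that c by (auto simp: reduce_mat_eq_0_iff[of _ "dg i" "dg i"] simp del: index_mult_mat)
    hence "reduce_mat m (Ai i * ?B) = reduce_mat m (?B * Ai i)"
      using c by (auto simp: reduce_eq_iff[of _ "dg i" "dg i"] fps_cutoff_diff simp del: index_mult_mat)
    thus ?thesis using unramified_matrix.exact_lift[OF umi[of i] blk_carrier[of Z i a i b], of m] True by blast
  qed blast
  then obtain W where W: "\<And>i a b. i < N \<Longrightarrow> a < mu i \<Longrightarrow> b < mu i \<Longrightarrow> ex i (W i a b)"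
    "\<And>i a b. i < N \<Longrightarrow> a < mu i \<Longrightarrow> b < mu i \<Longrightarrow> reduce_mat m (W i a b) = reduce_mat m (blk Z i a i b)" by metis
  have "reduce_mat m (assemble W) = reduce_mat m Z"
  proof (rule eq_by_blocks)
    fix i a j b assume h: "i < N" "j < N" "a < mu i" "b < mu j"
    show "blk (reduce_mat m (assemble W)) i a j b = blk (reduce_mat m Z) i a j b"
    proof (cases "i = j")
      case True
      have "W i a b \<in> carrier_mat (dg i) (dg i)"
        using W(1)[of i a b] h True unramified_matrix.exact_carrier[OF umi[OF h(1)]] by simp
      thus ?thesis unfolding reduce_blk[OF assemble_carrier h] reduce_blk[OF Z h]
        using blk_assemble[OF h, of W] W(2)[of i a b] h True by simp
    next
      case False
      have "blk (assemble W) i a j b = 0\<^sub>m (dg i) (dg j)"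
        using h False by (auto intro!: eq_matI simp: assemble_def idx_less decode)
      thus ?thesis unfolding reduce_blk[OF assemble_carrier h] reduce_blk[OF Z h] off_diagonal_blocks[OF Z 0 h False]
        by (auto simp: mat_eq_iff)
    qed
  qed (use Z in auto)
  moreover have "E (assemble W)" by (rule assemble_E) (rule W(1))
  ultimately show ?thesis by blast
qed

text \<open>The untruncated counterpart of \<open>component\<close>, with \<open>y\<close> in place
  of the isomorphism chosen by \<open>SOME\<close>. On \<open>E\<close> it is the projection to the
  \<open>i\<close>-th matrix ring.\<close>

definition "cmp i Z = mat (mu i) (mu i) (\<lambda>(a, b). yi i (blk Z i a i b))"

lemma cmp_dims [simp]: "dim_row (cmp i Z) = mu i" "dim_col (cmp i Z) = mu i"
  by (simp_all add: cmp_def)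

lemma cmp_carrier [simp]: "cmp i Z \<in> carrier_mat (mu i) (mu i)"
  by (simp add: cmp_def)

lemma cmp_mats: "E Z \<Longrightarrow> i < N \<Longrightarrow> cmp i Z \<in> mats (ki i) (mu i)"
  unfolding mats_def O_ext_eq_fps_over[symmetric]
  using unramified_matrix.exact_diag(1)[OF umi[of i] E_block[of Z i]] by (auto simp: cmp_def)

lemma blk_add: "Z \<in> carrier_mat n n \<Longrightarrow> W \<in> carrier_mat n n \<Longrightarrow> i < N \<Longrightarrow> a < mu i \<Longrightarrow> b < mu i \<Longrightarrow>
    blk (Z + W) i a i b = blk Z i a i b + blk W i a i b"
  by (intro eq_matI) (auto simp: blk_def idx_less)

lemma blk_smult: "Z \<in> carrier_mat n n \<Longrightarrow> i < N \<Longrightarrow> a < mu i \<Longrightarrow> b < mu i \<Longrightarrow>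
    blk (c \<cdot>\<^sub>m Z) i a i b = c \<cdot>\<^sub>m blk Z i a i b"
  by (intro eq_matI) (auto simp: blk_def idx_less)

lemma cmp_add: "Z \<in> carrier_mat n n \<Longrightarrow> W \<in> carrier_mat n n \<Longrightarrow> i < N \<Longrightarrow> cmp i (Z + W) = cmp i Z + cmp i W"
  by (intro eq_matI) (auto simp: cmp_def blk_add unramified_matrix.y_add[OF umi blk_carrier blk_carrier])

lemma cmp_smult: "Z \<in> carrier_mat n n \<Longrightarrow> i < N \<Longrightarrow> cmp i (c \<cdot>\<^sub>m Z) = O_embed c \<cdot>\<^sub>m cmp i Z"
  by (intro eq_matI) (auto simp: cmp_def blk_smult unramified_matrix.y_smult[OF umi blk_carrier])

lemma cmp_one:
  assumes "i < N"
  shows "cmp i (1\<^sub>m n) = (1\<^sub>m (mu i) :: 'q alg_closure fps mat)"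
proof (rule eq_matI)
  fix a b assume "a < dim_row (1\<^sub>m (mu i) :: 'q alg_closure fps mat)" "b < dim_col (1\<^sub>m (mu i) :: 'q alg_closure fps mat)"
  hence ab: "a < mu i" "b < mu i" by auto
  have "blk (1\<^sub>m n :: 'q fps mat) i a i b = (if a = b then 1\<^sub>m (dg i) else 0 \<cdot>\<^sub>m 1\<^sub>m (dg i))"
    using ab assms by (intro eq_matI) (auto simp: blk_def idx_less idx_eq_iff)
  thus "cmp i (1\<^sub>m n) $$ (a, b) = 1\<^sub>m (mu i) $$ (a, b)"
    using ab unramified_matrix.y_one[OF umi[OF assms]] unramified_matrix.y_smult[OF umi[OF assms], of "1\<^sub>m (dg i)" 0]
    by (simp add: cmp_def emb.hom_zero)
qed auto

lemma cmp_cong: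
  assumes "reduce_mat m Z = reduce_mat m W" "Z \<in> carrier_mat n n" "W \<in> carrier_mat n n" "i < N"
  shows "reduce_mat m (cmp i Z) = reduce_mat m (cmp i W)"
proof -
  have "fps_cutoff m (yi i (blk Z i a i b)) = fps_cutoff m (yi i (blk W i a i b))" if ab: "a < mu i" "b < mu i" for a b
    using assms(4) ab by (intro unramified_matrix.y_cong[OF umi])
      (auto simp: reduce_blk[OF assms(2), symmetric] reduce_blk[OF assms(3), symmetric] assms(1))
  thus ?thesis by (intro eq_matI) (auto simp: cmp_def)
qed

text \<open>The off-diagonal blocks of \<open>Z\<close> vanish, so the sum over all blocks stays
  within factor \<open>i\<close>, where \<open>y\<close> is additive and multiplicative.\<close>

lemma cmp_mult:
  assumes Z: "E Z" and W: "E W" and i: "i < N"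
  shows "cmp i (Z * W) = cmp i Z * cmp i W"
proof (rule eq_matI)
  interpret u: unramified_matrix "dg i" "Ai i" "si i" "P (fst (fs ! i))" "Q (fst (fs ! i))" by (rule umi[OF i])
  note Zc = E_carrier[OF Z] and Wc = E_carrier[OF W]
  fix a b assume "a < dim_row (cmp i Z * cmp i W)" "b < dim_col (cmp i Z * cmp i W)"
  hence ab: "a < mu i" "b < mu i" by (auto simp: cmp_def)
  let ?Q = "Q (fst (fs ! i))" and ?P = "P (fst (fs ! i))"
  have ent: "(Z * W) $$ (idx i a u, idx i b v) = (\<Sum>c<mu i. (blk Z i a i c * blk W i c i b) $$ (u, v))"
    if uv: "u < dg i" "v < dg i" for u v
  proof -
    have z: "Z $$ (idx i a u, idx j c w) = 0" if "j < N" "c < mu j" "w < dg j" "j \<noteq> i" for j c w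
    proof -
      have "blk Z i a j c = 0\<^sub>m (dg i) (dg j)" using E_blocks[OF Zc] Z i ab that by (metis (no_types, lifting))
      from arg_cong[OF this, of "\<lambda>Y. Y $$ (u, w)"] show ?thesis using uv that by simp
    qed
    have "(Z * W) $$ (idx i a u, idx i b v) = (\<Sum>j<N. \<Sum>c<mu j. \<Sum>w<dg j. Z $$ (idx i a u, idx j c w) * W $$ (idx j c w, idx i b v))"
      using uv ab i by (intro mult_entry Zc Wc idx_less) auto
    also have "\<dots> = (\<Sum>j<N. if j = i then \<Sum>c<mu i. \<Sum>w<dg i. Z $$ (idx i a u, idx i c w) * W $$ (idx i c w, idx i b v) else 0)"
      by (intro sum.cong refl) (auto simp: z)
    also have "\<dots> = (\<Sum>c<mu i. \<Sum>w<dg i. Z $$ (idx i a u, idx i c w) * W $$ (idx i c w, idx i b v))" using i by simp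
    also have "\<dots> = (\<Sum>c<mu i. (blk Z i a i c * blk W i c i b) $$ (u, v))"
      using uv by (intro sum.cong refl) (auto simp: scalar_prod_def blk_def lessThan_atLeast0)
    finally show ?thesis .
  qed
  have "cmp i (Z * W) $$ (a, b) = u.y (blk (Z * W) i a i b)" using ab by (simp add: cmp_def)
  also have "\<dots> = (\<Sum>u<dg i. \<Sum>v<dg i. \<Sum>c<mu i. ?Q $$ (0, u) * O_embed ((blk Z i a i c * blk W i c i b) $$ (u, v)) * ?P $$ (v, 0))"
    unfolding u.y_formula[OF blk_carrier]
    by (intro sum.cong refl) (simp add: ent emb.hom_sum sum_distrib_left sum_distrib_right del: index_mult_mat)
  also have "\<dots> = (\<Sum>u<dg i. \<Sum>c<mu i. \<Sum>v<dg i. ?Q $$ (0, u) * O_embed ((blk Z i a i c * blk W i c i b) $$ (u, v)) * ?P $$ (v, 0))"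
    by (intro sum.cong refl sum.swap)
  also have "\<dots> = (\<Sum>c<mu i. \<Sum>u<dg i. \<Sum>v<dg i. ?Q $$ (0, u) * O_embed ((blk Z i a i c * blk W i c i b) $$ (u, v)) * ?P $$ (v, 0))"
    by (rule sum.swap)
  also have "\<dots> = (\<Sum>c<mu i. u.y (blk Z i a i c * blk W i c i b))"
  proof (intro sum.cong refl)
    fix c
    have "blk Z i a i c * blk W i c i b \<in> carrier_mat (dg i) (dg i)" by (rule mult_carrier_mat[OF blk_carrier blk_carrier])
    thus "(\<Sum>u<dg i. \<Sum>v<dg i. ?Q $$ (0, u) * O_embed ((blk Z i a i c * blk W i c i b) $$ (u, v)) * ?P $$ (v, 0)) =
      u.y (blk Z i a i c * blk W i c i b)" by (rule u.y_formula[symmetric])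
  qed
  also have "\<dots> = (\<Sum>c<mu i. u.y (blk Z i a i c) * u.y (blk W i c i b))"
    by (intro sum.cong refl u.exact_mult E_block Z W i ab) auto
  also have "\<dots> = (cmp i Z * cmp i W) $$ (a, b)"
    using ab by (simp add: cmp_def scalar_prod_def lessThan_atLeast0)
  finally show "cmp i (Z * W) $$ (a, b) = (cmp i Z * cmp i W) $$ (a, b)" .
qed (auto simp: cmp_def)

text \<open>In the \<open>i\<close>-th component \<open>As\<close> is the scalar
  \<open>si i\<close>; this is how the lifted root in the condition on \<open>\<phi>\<close> turns
  into multiplication by \<open>As\<close>.\<close>

lemma cmp_As_mult:
  assumes Z: "E Z" and i: "i < N"
  shows "cmp i (As * Z) = si i \<cdot>\<^sub>m cmp i Z"
proof (rule eq_matI)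
  interpret u: unramified_matrix "dg i" "Ai i" "si i" "P (fst (fs ! i))" "Q (fst (fs ! i))" by (rule umi[OF i])
  fix a b assume "a < dim_row (si i \<cdot>\<^sub>m cmp i Z)" "b < dim_col (si i \<cdot>\<^sub>m cmp i Z)"
  hence ab: "a < mu i" "b < mu i" by (auto simp: cmp_def)
  have eA: "u.exact (Ai i)" using u.A by (simp add: u.exact_def)
  show "cmp i (As * Z) $$ (a, b) = (si i \<cdot>\<^sub>m cmp i Z) $$ (a, b)"
    using ab blk_mult_As(2)[OF E_carrier[OF Z] i i ab] u.exact_mult[OF eA E_block[OF Z i ab]]
    by (simp add: cmp_def u.y_A)
qed (auto simp: cmp_def)

lemma cmp_eq_0:
  assumes Z: "E Z" and 0: "\<And>i. i < N \<Longrightarrow> reduce_mat m (cmp i Z) = 0\<^sub>m (mu i) (mu i)"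
  shows "reduce_mat m Z = 0\<^sub>m n n"
  unfolding reduce_eq_0_by_blocks[OF E_carrier[OF Z]]
proof (intro allI impI)
  fix i j a b assume h: "i < N" "j < N" "a < mu i" "b < mu j"
  show "reduce_mat m (blk Z i a j b) = 0\<^sub>m (dg i) (dg j)"
  proof (cases "i = j")
    case True
    have "fps_cutoff m (yi i (blk Z i a i b)) = 0"
      using arg_cong[OF 0[OF h(1)], of "\<lambda>Y. Y $$ (a, b)"] h True by (simp add: cmp_def)
    thus ?thesis using unramified_matrix.exact_eq_0[OF umi[OF h(1)] E_block[OF Z h(1), of a b]] h True by simp
  next
    case False
    have "blk Z i a j b = 0\<^sub>m (dg i) (dg j)" using E_blocks[OF E_carrier[OF Z]] Z h False by (metis (no_types, lifting))
    thus ?thesis by (auto simp: mat_eq_iff)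
  qed
qed

lemma cmp_surj:
  assumes Y: "\<And>i. i < N \<Longrightarrow> Y i \<in> mats (ki i) (mu i)"
  shows "\<exists>Z. E Z \<and> (\<forall>i<N. cmp i Z = Y i)"
proof -
  have "\<exists>W. i < N \<longrightarrow> a < mu i \<longrightarrow> b < mu i \<longrightarrow> ex i W \<and> yi i W = Y i $$ (a, b)" for i a b
  proof (cases "i < N \<and> a < mu i \<and> b < mu i")
    case True
    hence "Y i $$ (a, b) \<in> O_ext (dg i)" using Y[of i] by (auto simp: mats_def O_ext_eq_fps_over)
    thus ?thesis using unramified_matrix.exact_surj[OF umi] True by metis
  qed blast
  then obtain W where W: "\<And>i a b. i < N \<Longrightarrow> a < mu i \<Longrightarrow> b < mu i \<Longrightarrow> ex i (W i a b)"
    "\<And>i a b. i < N \<Longrightarrow> a < mu i \<Longrightarrow> b < mu i \<Longrightarrow> yi i (W i a b) = Y i $$ (a, b)" by metis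
  have "cmp i (assemble W) = Y i" if i: "i < N" for i
  proof (rule eq_matI)
    fix a b assume "a < dim_row (Y i)" "b < dim_col (Y i)"
    hence ab: "a < mu i" "b < mu i" using Y[OF i] by (auto simp: mats_def)
    have "blk (assemble W) i a i b = W i a b"
      using blk_assemble[OF i i ab] unramified_matrix.exact_carrier[OF umi[OF i] W(1)[OF i ab]] by simp
    thus "cmp i (assemble W) $$ (a, b) = Y i $$ (a, b)" using ab W(2)[OF i ab] by (simp add: cmp_def)
  qed (use Y[OF i] in \<open>auto simp: cmp_def mats_def\<close>)
  moreover have "E (assemble W)" by (rule assemble_E) (rule W(1))
  ultimately show ?thesis by blast
qed

lemma unram_trace_sum:
  assumes "\<And>a. a \<in> I \<Longrightarrow> x a \<in> O_ext d" "finite I"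
  shows "unram_trace d (sum x I) = (\<Sum>a\<in>I. unram_trace d (x a))"
  using assms(2,1)
proof (induction I rule: finite_induct)
  case empty
  show ?case by (simp add: unram_trace_def fps_eq_iff)
next
  case (insert a I)
  have "sum x I \<in> O_ext d" unfolding O_ext_eq_fps_over
    by (intro coeff_ring_sum[OF coeff_ring_fps_over[OF coeff_ring_finite_subfield]])
      (use insert in \<open>auto simp: O_ext_eq_fps_over[symmetric]\<close>)
  thus ?case using insert by (simp add: unram_trace_add)
qed

text \<open>Transitivity of the trace. It makes the characters built from field traces on the
  factors fit together to the single character given by the trace on the whole matrix ring.\<close>

lemma cmp_trace:
  assumes Z: "E Z"
  shows "mat_trace Z = (\<Sum>i<N. unram_trace (dg i) (mat_trace (cmp i Z)))"
proof -
  have "mat_trace Z = (\<Sum>x = 0..<n. Z $$ (x, x))" using E_carrier[OF Z] by (simp add: mat_trace_def lessThan_atLeast0)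
  also have "\<dots> = (\<Sum>i<N. \<Sum>a<mu i. \<Sum>u<dg i. Z $$ (idx i a u, idx i a u))" by (rule sum_block_idx)
  also have "\<dots> = (\<Sum>i<N. \<Sum>a<mu i. mat_trace (blk Z i a i a))"
    by (intro sum.cong refl) (simp add: mat_trace_def blk_def)
  also have "\<dots> = (\<Sum>i<N. \<Sum>a<mu i. unram_trace (dg i) (yi i (blk Z i a i a)))"
    by (intro sum.cong refl unramified_matrix.exact_trace[OF umi] E_block[OF Z]) auto
  also have "\<dots> = (\<Sum>i<N. unram_trace (dg i) (\<Sum>a<mu i. yi i (blk Z i a i a)))"
    by (intro sum.cong refl unram_trace_sum[symmetric] unramified_matrix.exact_diag(1)[OF umi] E_block[OF Z]) auto
  also have "\<dots> = (\<Sum>i<N. unram_trace (dg i) (mat_trace (cmp i Z)))"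
    by (intro sum.cong refl) (simp add: mat_trace_def cmp_def)
  finally show ?thesis .
qed

text \<open>The bridge from the definitions to the explicit components; beyond this point the choice
  of isomorphism does not appear in the computations.\<close>

lemma component_cmp:
  assumes Z: "E Z" and i: "i < N"
  shows "component m A s fs i (reduce_mat m Z) = reduce_mat m (cmp i Z)"
proof -
  obtain f k where fk: "fs ! i = (f, k)" by (cases "fs ! i")
  interpret u: unramified_matrix "dg i" "Ai i" "si i" "P (fst (fs ! i))" "Q (fst (fs ! i))" by (rule umi[OF i])
  have "commutant_iso m (A f) (s f) (mat (Polynomial.degree f) (Polynomial.degree f)
      (\<lambda>(u, v). reduce_mat m Z $$ (block_off fs i + a * Polynomial.degree f + u, block_off fs i + b * Polynomial.degree f + v))) =
      fps_cutoff m (yi i (blk Z i a i b))" if ab: "a < k" "b < k" for a b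
  proof -
    have "mat (Polynomial.degree f) (Polynomial.degree f)
      (\<lambda>(u, v). reduce_mat m Z $$ (block_off fs i + a * Polynomial.degree f + u, block_off fs i + b * Polynomial.degree f + v)) =
      blk (reduce_mat m Z) i a i b" by (simp add: blk_def fk block_idx_def)
    also have "\<dots> = reduce_mat m (blk Z i a i b)" using E_carrier[OF Z] i ab fk by (intro reduce_blk) auto
    finally show ?thesis using u.commutant_iso_exact[OF E_block[OF Z i, of a b], of m] ab fk by simp
  qed
  thus ?thesis unfolding component_def block_off_def[symmetric] fk Let_def cmp_def prod.case
    by (intro eq_matI) (auto simp: fk)
qed

end

section \<open>Truncated determinants, the trace form and weights\<close>

lemma fps_cutoff_prod_cong:
  fixes f g :: "'i \<Rightarrow> 'a::comm_ring_1 fps"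
  assumes "\<And>i. i \<in> I \<Longrightarrow> fps_cutoff m (f i) = fps_cutoff m (g i)"
  shows "fps_cutoff m (prod f I) = fps_cutoff m (prod g I)"
  using assms by (induction I rule: infinite_finite_induct) (auto intro!: fps_cutoff_mult_cong)

lemma fps_cutoff_det_cong:
  fixes Z :: "'a::comm_ring_1 fps mat"
  assumes "reduce_mat m Z = reduce_mat m W" "Z \<in> carrier_mat n n" "W \<in> carrier_mat n n"
  shows "fps_cutoff m (det Z) = fps_cutoff m (det W)"
  unfolding det_def'[OF assms(2)] det_def'[OF assms(3)] fps_cutoff_sum
proof (intro sum.cong refl fps_cutoff_mult_cong fps_cutoff_prod_cong)
  fix p i assume p: "p \<in> {p. p permutes {0..<n}}" and i: "i \<in> {0..<n}"
  have "p i < n" using p i permutes_in_image[of p "{0..<n}" i] by auto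
  thus "fps_cutoff m (Z $$ (i, p i)) = fps_cutoff m (W $$ (i, p i))"
    using assms i by (auto simp: reduce_eq_iff)
qed

lemma det_over:
  assumes "coeff_ring k" "Z \<in> mats k n"
  shows "det Z \<in> fps_over k"
proof -
  note fk = coeff_ring_closed[OF coeff_ring_fps_over[OF assms(1)]]
  have Z: "Z \<in> carrier_mat n n" using assms(2) by (rule matsD)
  show ?thesis unfolding det_def'[OF Z]
  proof (intro coeff_ring_sum[OF coeff_ring_fps_over[OF assms(1)]] fk(4) coeff_ring_prod[OF coeff_ring_fps_over[OF assms(1)]])
    fix p assume p: "p \<in> {p. p permutes {0..<n}}"
    have "signof p = (1 :: 'a fps) \<or> signof p = (- 1 :: 'a fps)" by (cases p rule: sign_cases) auto
    thus "signof p \<in> fps_over k" using fk by auto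
    fix i assume i: "i \<in> {0..<n}"
    have "p i < n" using p i permutes_in_image[of p "{0..<n}" i] by auto
    thus "Z $$ (i, p i) \<in> fps_over k" using assms(2) i by (auto simp: mats_def)
  qed
qed

text \<open>Were the trace zero on the residue field, all power sums of the nodes would vanish
  modulo \<open>\<pi>\<close>. The polynomial with value one at the first node and zero at the
  others has values summing to one, yet that sum is a linear combination of the power sums.\<close>

lemma (in unramified_matrix) trace_nontrivial:
  "\<exists>e :: 'q alg_closure. e \<in> finite_subfield d \<and> fps_nth (unram_trace d (fps_const e)) 0 \<noteq> 0"
proof (rule ccontr)
  assume *: "\<not> ?thesis"
  have s_pow: "s ^ i \<in> O_ext d" for i
    unfolding O_ext_iff by (induction i) (use s_fixed frobenius_funpow_hom(3)[of d 1] in \<open>simp_all add: frobenius_funpow_hom emb.hom_one\<close>)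
  have node_pow: "node j ^ i = (frobenius ^^ j) (s ^ i)" for i j
    by (induction i) (use frobenius_funpow_hom(3)[of j 1] in \<open>simp_all add: frobenius_funpow_hom emb.hom_one node_def\<close>)
  have tr0: "fps_nth (\<Sum>j<d. node j ^ i) 0 = 0" for i
  proof -
    have e: "fps_nth (s ^ i) 0 \<in> finite_subfield d" using s_pow[of i] by (simp add: O_ext_def)
    have "fps_nth (unram_trace d (fps_const (fps_nth (s ^ i) 0))) 0 = fps_nth (unram_trace d (s ^ i)) 0"
      by (simp add: unram_trace_def fps_sum_nth frobenius_funpow_nth)
    moreover have "fps_nth (unram_trace d (fps_const (fps_nth (s ^ i) 0))) 0 = 0" using * e by blast
    ultimately have "fps_nth (unram_trace d (s ^ i)) 0 = 0" by simp
    moreover have "(\<Sum>j<d. node j ^ i) = O_embed (unram_trace d (s ^ i))"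
      unfolding unram_trace_embed[OF s_pow] node_pow ..
    ultimately show ?thesis by (simp add: O_embed_nth)
  qed
  obtain p where p: "\<And>j. j < d \<Longrightarrow> poly p (node j) = (if j = 0 then 1 else 0)"
    using interpolate[of "\<lambda>j. if j = 0 then 1 else 0"] by blast
  have "(\<Sum>j<d. poly p (node j)) = (\<Sum>j<d. if j = 0 then 1 else 0)" using p by (intro sum.cong) auto
  also have "\<dots> = 1" using d by simp
  finally have "1 = (\<Sum>j<d. \<Sum>i\<le>Polynomial.degree p. Polynomial.coeff p i * node j ^ i)" by (simp add: poly_altdef)
  also have "\<dots> = (\<Sum>i\<le>Polynomial.degree p. Polynomial.coeff p i * (\<Sum>j<d. node j ^ i))"
    by (subst sum.swap) (simp add: sum_distrib_left)
  finally have "fps_nth 1 0 = fps_nth (\<Sum>i\<le>Polynomial.degree p. Polynomial.coeff p i * (\<Sum>j<d. node j ^ i)) 0" by simp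
  also have "\<dots> = (\<Sum>i\<le>Polynomial.degree p. fps_nth (Polynomial.coeff p i) 0 * fps_nth (\<Sum>j<d. node j ^ i) 0)"
    by (simp only: fps_sum_nth fps_mult_nth_0)
  also have "\<dots> = 0" by (simp only: tr0 mult_zero_right sum.neutral_const)
  finally show False by simp
qed

lemma unram_trace_mult_embed:
  assumes "x \<in> O_ext d"
  shows "unram_trace d (O_embed z * x) = z * unram_trace d x"
proof -
  have "O_embed z * x \<in> O_ext d" using assms by (simp add: O_ext_iff frobenius_funpow_hom)
  hence "O_embed (unram_trace d (O_embed z * x)) = O_embed (z * unram_trace d x)"
    using assms by (simp add: unram_trace_embed frobenius_funpow_hom emb.hom_mult sum_distrib_left)
  thus ?thesis by simp
qed

text \<open>Compare the \<open>(i, j)\<close> entries in the identity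
  \<open>t \<otimes> g = g \<otimes> (inv g \<otimes> t \<otimes> g)\<close> after applying
  \<open>\<rho>\<close>; each side is one diagonal entry times the same nonzero constant.\<close>

lemma moves_basis_weight:
  fixes G (structure) and \<rho> :: "'g \<Rightarrow> 'c::field mat"
  assumes G: "group G" and \<rho>: "weight_rep G T d \<rho>" and T: "T \<subseteq> carrier G"
    and n: "inv g \<otimes> t \<otimes> g \<in> T" and g: "g \<in> carrier G" and t: "t \<in> T"
    and mv: "moves_basis d (\<rho> g) j i" and ij: "i < d" "j < d"
  shows "\<rho> t $$ (i, i) = \<rho> (inv g \<otimes> t \<otimes> g) $$ (j, j)"
proof -
  interpret group G by fact
  note rep = weight_repD(1)[OF \<rho>]
  let ?t = "inv g \<otimes> t \<otimes> g"
  have tG: "t \<in> carrier G" "?t \<in> carrier G" using t n T by auto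
  have "t \<otimes> g = g \<otimes> ?t" using tG g by (simp add: m_assoc[symmetric])
  hence eq: "\<rho> t * \<rho> g = \<rho> g * \<rho> ?t"
    using representation_mult[OF rep tG(1) g] representation_mult[OF rep g tG(2)] by simp
  obtain c where c: "c \<noteq> 0" "\<And>a. a < d \<Longrightarrow> \<rho> g $$ (a, j) = (if a = i then c else 0)"
    using mv unfolding moves_basis_def by blast
  note car = representation_carrier[OF rep tG(1)] representation_carrier[OF rep tG(2)] representation_carrier[OF rep g]
  have "(\<rho> t * \<rho> g) $$ (i, j) = (\<Sum>k = 0..<d. \<rho> t $$ (i, k) * \<rho> g $$ (k, j))"
    using car ij by (auto simp: scalar_prod_def)
  also have "\<dots> = (\<Sum>k = 0..<d. if k = i then \<rho> t $$ (i, i) * c else 0)"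
    by (intro sum.cong refl) (simp add: c(2))
  finally have 1: "(\<rho> t * \<rho> g) $$ (i, j) = \<rho> t $$ (i, i) * c" using ij by simp
  have dg: "diagonal_mat (\<rho> ?t)" by (rule weight_repD(2)[OF \<rho> n])
  have "(\<rho> g * \<rho> ?t) $$ (i, j) = (\<Sum>k = 0..<d. \<rho> g $$ (i, k) * \<rho> ?t $$ (k, j))"
    using car ij by (auto simp: scalar_prod_def)
  also have "\<dots> = (\<Sum>k = 0..<d. if k = j then c * \<rho> ?t $$ (j, j) else 0)"
    using dg car ij by (intro sum.cong refl) (auto simp: diagonal_mat_def c(2))
  finally have 2: "(\<rho> g * \<rho> ?t) $$ (i, j) = c * \<rho> ?t $$ (j, j)" using ij by simp
  show ?thesis using 1 2 eq c(1) by simp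
qed

section \<open>Projection of a semidirect product\<close>

locale semidirect =
  fixes G (structure) and L K :: "'g set"
  assumes G: "group G" and L: "subgroup L G" and K: "subgroup K G"
    and LK: "x \<in> L \<Longrightarrow> x \<in> K \<Longrightarrow> x = \<one>" and conj: "x \<in> L \<Longrightarrow> y \<in> K \<Longrightarrow> inv x \<otimes> y \<otimes> x \<in> K"
begin

sublocale group G by (rule G)
sublocale L: subgroup L G by (rule L)
sublocale K: subgroup K G by (rule K)

text \<open>The same description as in \<open>L_projection\<close>, for an abstract complement, so
  that the projection of the definitions becomes an instance.\<close>

definition "proj g = (THE x. x \<in> L \<and> inv x \<otimes> g \<in> K)"

lemma proj: 
  assumes "x \<in> L" "y \<in> K"
  shows "proj (x \<otimes> y) = x"
  unfolding proj_def
proof (rule the_equality)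
  have "inv x \<otimes> (x \<otimes> y) = y" using assms by (simp add: m_assoc[symmetric])
  thus "x \<in> L \<and> inv x \<otimes> (x \<otimes> y) \<in> K" using assms by simp
  fix z assume z: "z \<in> L \<and> inv z \<otimes> (x \<otimes> y) \<in> K"
  have "inv z \<otimes> x = (inv z \<otimes> (x \<otimes> y)) \<otimes> inv y" using assms z by (simp add: m_assoc)
  hence "inv z \<otimes> x \<in> K" using z assms by auto
  moreover have "inv z \<otimes> x \<in> L" using z assms by auto
  ultimately have "inv z \<otimes> x = \<one>" by (intro LK)
  thus "z = x" using z assms by (metis L.mem_carrier inv_closed inv_equality inv_inv)
qed

lemma mult_form:
  assumes "x \<in> L" "y \<in> K" "x' \<in> L" "y' \<in> K"
  shows "(x \<otimes> y) \<otimes> (x' \<otimes> y') = (x \<otimes> x') \<otimes> ((inv x' \<otimes> y \<otimes> x') \<otimes> y')"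
proof -
  have "(x \<otimes> x') \<otimes> ((inv x' \<otimes> y \<otimes> x') \<otimes> y') = x \<otimes> (x' \<otimes> inv x') \<otimes> y \<otimes> x' \<otimes> y'"
    using assms by (simp only: m_assoc L.mem_carrier K.mem_carrier inv_closed m_closed)
  thus ?thesis using assms by (simp add: m_assoc)
qed

lemma proj_mult:
  assumes "x \<in> L" "y \<in> K" "x' \<in> L" "y' \<in> K"
  shows "proj ((x \<otimes> y) \<otimes> (x' \<otimes> y')) = proj (x \<otimes> y) \<otimes> proj (x' \<otimes> y')"
  unfolding mult_form[OF assms] using assms conj[OF assms(3,2)] by (simp add: proj)

end

section \<open>Image of the commutator and separation of the nilpotent part\<close>

context block_data
begin

lemma D_add: "Z \<in> carrier_mat n n \<Longrightarrow> W \<in> carrier_mat n n \<Longrightarrow> D (Z + W) = D Z + D W"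
  using As mult_carrier_mat[OF As, of Z n] mult_carrier_mat[OF As, of W n] mult_carrier_mat[of Z n n As n] mult_carrier_mat[of W n n As n]
  by (simp add: D_def mult_add_distrib_mat[of _ n n _ n] add_mult_distrib_mat[of _ n n _ _ n]) (intro eq_matI, auto)

lemma D_smult: "Z \<in> carrier_mat n n \<Longrightarrow> D (c \<cdot>\<^sub>m Z) = c \<cdot>\<^sub>m D Z"
  using As mult_carrier_mat[OF As, of Z n] mult_carrier_mat[of Z n n As n]
  by (simp add: D_def mult_smult_distrib[of _ n n _ n] mult_smult_assoc_mat[of _ n n _ n])
    (intro eq_matI, auto simp: algebra_simps simp del: index_mult_mat(1))

lemma D_diff: "Z \<in> carrier_mat n n \<Longrightarrow> W \<in> carrier_mat n n \<Longrightarrow> D (Z - W) = D Z - D W"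
proof -
  assume c: "Z \<in> carrier_mat n n" "W \<in> carrier_mat n n"
  have "Z - W = Z + (- 1) \<cdot>\<^sub>m W" using c by (intro eq_matI) auto
  thus "D (Z - W) = D Z - D W" using c D_carrier[OF c(1)] D_carrier[OF c(2)]
    by (simp add: D_add D_smult) (intro eq_matI, auto)
qed

lemma D_cong: "reduce_mat m Z = reduce_mat m W \<Longrightarrow> Z \<in> carrier_mat n n \<Longrightarrow> W \<in> carrier_mat n n \<Longrightarrow>
    reduce_mat m (D Z) = reduce_mat m (D W)"
  unfolding D_def
  by (rule reduce_add_cong(2)[OF reduce_mult_cong[OF refl _ As As] reduce_mult_cong[OF _ refl _ _ As As]
        square_carrier_closed(1)[OF As] square_carrier_closed(1)[OF As] square_carrier_closed(1)[OF _ As] square_carrier_closed(1)[OF _ As]])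

lemma reduce_diff_0_iff:
  fixes Z W :: "'q fps mat"
  assumes "Z \<in> carrier_mat n n" "W \<in> carrier_mat n n"
  shows "reduce_mat m (Z - W) = 0\<^sub>m n n \<longleftrightarrow> reduce_mat m Z = reduce_mat m W"
proof -
  have "fps_cutoff m (x - y) = 0 \<longleftrightarrow> fps_cutoff m x = fps_cutoff m y" for x y :: "'q fps"
    by (simp add: fps_cutoff_diff)
  thus ?thesis using assms by (auto simp: mat_eq_iff)
qed

text \<open>\<open>D\<close> is injective on its own image modulo \<open>\<pi>\<^sup>m\<close>, which is finite; hence it is onto it.\<close>

lemma decomposition:
  assumes Z: "Z \<in> carrier_mat n n"
  shows "\<exists>W Y. E W \<and> Y \<in> carrier_mat n n \<and> reduce_mat m Z = reduce_mat m (W + D Y)"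
proof -
  define R where "R = {Z \<in> carrier_mat n n. reduce_mat m Z = (Z :: 'q fps mat)}"
  define f where "f = (\<lambda>Z. reduce_mat m (D Z))"
  have R: "R = carrier (trunc_mat_ring UNIV n m)" by (simp add: R_def carrier_trunc_mat_ring)
  have "finite R" unfolding R trunc_mat_ring_def
    using finite_mats[OF finite_trunc_ring[of "UNIV :: 'q set" m], of n] by simp
  have fR: "f Z \<in> R" if "Z \<in> R" for Z using that by (auto simp: R_def f_def)
  have fin: "finite (f ` R)" using \<open>finite R\<close> by simp
  have inj: "inj_on f (f ` R)"
  proof (rule inj_onI)
    fix x y assume "x \<in> f ` R" "y \<in> f ` R" "f x = f y"
    then obtain a b where a: "a \<in> R" "x = f a" and b: "b \<in> R" "y = f b" by blast
    have c: "a \<in> carrier_mat n n" "b \<in> carrier_mat n n" using a b by (auto simp: R_def)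
    have "reduce_mat m (D (D a)) = reduce_mat m (D (f a))" "reduce_mat m (D (D b)) = reduce_mat m (D (f b))"
      unfolding f_def by (rule D_cong; use c in simp)+
    hence "reduce_mat m (D (D a)) = reduce_mat m (D (D b))" using \<open>f x = f y\<close> a b by (simp add: f_def)
    moreover have "D (D (a - b)) = D (D a) - D (D b)"
      unfolding D_diff[OF c] by (rule D_diff[OF D_carrier[OF c(1)] D_carrier[OF c(2)]])
    ultimately have "reduce_mat m (D (D (a - b))) = 0\<^sub>m n n"
      using reduce_diff_0_iff[OF D_carrier[OF D_carrier[OF c(1)]] D_carrier[OF D_carrier[OF c(2)]]] by metis
    hence "reduce_mat m (D a - D b) = 0\<^sub>m n n"
      using D_square[OF square_carrier_closed(2)[OF c]] unfolding D_diff[OF c] by blast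
    hence "reduce_mat m (D a) = reduce_mat m (D b)"
      unfolding reduce_diff_0_iff[OF D_carrier[OF c(1)] D_carrier[OF c(2)]] .
    thus "x = y" unfolding a(2) b(2) f_def .
  qed
  have "f ` f ` R \<subseteq> f ` R" using fR by blast
  hence surj: "f ` f ` R = f ` R" using endo_inj_surj[OF fin _ inj] by blast
  have "reduce_mat m Z \<in> R" using Z by (auto simp: R_def)
  hence "f (reduce_mat m Z) \<in> f ` f ` R" unfolding surj by blast
  \<comment> \<open>Now \<open>D Z\<close> and \<open>D (D Y)\<close> agree modulo
    \<open>\<pi>^m\<close>, so \<open>Z - D Y\<close> is killed by \<open>D\<close> and lifts to the
    exact centraliser.\<close>
  then obtain Y where Y: "Y \<in> R" "f (reduce_mat m Z) = f (f Y)" by blast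
  have Yc: "Y \<in> carrier_mat n n" using Y by (auto simp: R_def)
  have "reduce_mat m (D Z) = f (reduce_mat m Z)" unfolding f_def by (rule D_cong) (use Z in auto)
  also have "\<dots> = reduce_mat m (D (D Y))" unfolding Y(2) unfolding f_def by (rule D_cong) (use Yc in auto)
  finally have "reduce_mat m (D (Z - D Y)) = 0\<^sub>m n n"
    unfolding D_diff[OF Z D_carrier[OF Yc]] reduce_diff_0_iff[OF D_carrier[OF Z] D_carrier[OF D_carrier[OF Yc]]] .
  then obtain W where W: "E W" "reduce_mat m W = reduce_mat m (Z - D Y)" using E_lift[of "Z - D Y" m] Z Yc by auto
  have "reduce_mat m (W + D Y) = reduce_mat m (Z - D Y + D Y)"
    using W E_carrier[OF W(1)] Z Yc D_carrier[OF Yc] by (intro reduce_add_cong(1)[of _ _ _ _ _ n n]) auto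
  also have "Z - D Y + D Y = Z" using Z D_carrier[OF Yc] by (intro eq_matI) auto
  finally show ?thesis using W(1) Yc by metis
qed

text \<open>By cyclicity this is the trace of \<open>[B, As] * Y\<close>. Consequently the character
  of \<open>T\<close> given by \<open>B\<close> is trivial on the kernel of the projection to
  \<open>L\<close>.\<close>

lemma trace_mult_D:
  assumes B: "E B" and Y: "Y \<in> carrier_mat n n"
  shows "mat_trace (B * D Y) = 0"
proof -
  have Bc: "B \<in> carrier_mat n n" and BA: "As * B = B * As" using B by (auto simp: E_def)
  have c: "As * Y \<in> carrier_mat n n" "Y * As \<in> carrier_mat n n" "B * Y \<in> carrier_mat n n" "B * As \<in> carrier_mat n n"
    using Bc As Y by auto
  have "B * D Y = B * (As * Y) - B * (Y * As)" unfolding D_def by (rule mult_minus_distrib_mat[OF Bc c(1,2)])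
  hence "mat_trace (B * D Y) = mat_trace (B * (As * Y)) - mat_trace (B * (Y * As))"
    using mat_trace_diff[OF mult_carrier_mat[OF Bc c(1)] mult_carrier_mat[OF Bc c(2)]] by simp
  also have "mat_trace (B * (Y * As)) = mat_trace (B * Y * As)"
    by (simp only: assoc_mult_mat[OF Bc Y As])
  also have "\<dots> = mat_trace (As * (B * Y))" by (rule mat_trace_mult_comm[OF c(3) As])
  also have "As * (B * Y) = B * (As * Y)"
    unfolding assoc_mult_mat[OF As Bc Y, symmetric] BA by (rule assoc_mult_mat[OF Bc As Y])
  finally show ?thesis by simp
qed

text \<open>The uniqueness of the Jordan decomposition in truncated form. The hypothesis
  \<open>eq\<close> turns \<open>D g\<close> into \<open>g * Na - Nb * g\<close>, so applying
  \<open>D\<close> raises the exponents in products of a power of \<open>Nb\<close>, then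
  \<open>g\<close>, then a power of \<open>Na\<close>. High exponents vanish, hence an iterate of
  \<open>D\<close> kills \<open>g\<close>, and \<open>D_square\<close> brings the iterate down to
  one application.\<close>

lemma nilpotent_separation:
  assumes g: "g \<in> carrier_mat n n" and N: "Na \<in> carrier_mat n n" "Nb \<in> carrier_mat n n"
    and comm: "reduce_mat m (D Na) = 0\<^sub>m n n" "reduce_mat m (D Nb) = 0\<^sub>m n n"
    and nil: "reduce_mat m (Na ^\<^sub>m e) = 0\<^sub>m n n" "reduce_mat m (Nb ^\<^sub>m e) = 0\<^sub>m n n"
    and eq: "reduce_mat m (g * (As + Na)) = reduce_mat m ((As + Nb) * g)"
  shows "reduce_mat m (D g) = 0\<^sub>m n n"
proof -
  note mc = mult_carrier_mat[of _ n n _ n] and as = assoc_mult_mat[of _ n n _ n _ n]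
  have zero: "reduce_mat m (Z * W) = 0\<^sub>m n n" if "reduce_mat m Z = 0\<^sub>m n n \<or> reduce_mat m W = 0\<^sub>m n n"
    "Z \<in> carrier_mat n n" "W \<in> carrier_mat n n" for Z W :: "'q fps mat"
  proof -
    have z: "reduce_mat m (0\<^sub>m n n) = (0\<^sub>m n n :: 'q fps mat)" by (auto simp: mat_eq_iff)
    from that(1) show ?thesis
    proof
      assume "reduce_mat m Z = 0\<^sub>m n n"
      hence "reduce_mat m (Z * W) = reduce_mat m (0\<^sub>m n n * W)" using that z by (intro reduce_mult_cong[of _ _ _ _ _ n n n]) auto
      thus ?thesis using that z by simp
    next
      assume "reduce_mat m W = 0\<^sub>m n n"
      hence "reduce_mat m (Z * W) = reduce_mat m (Z * 0\<^sub>m n n)" using that z by (intro reduce_mult_cong[of _ _ _ _ _ n n n]) auto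
      thus ?thesis using that z by simp
    qed
  qed
  \<comment> \<open>\<open>D\<close> is a derivation; as it kills \<open>Na\<close> and
    \<open>Nb\<close> modulo \<open>\<pi>^m\<close>, it passes through their powers to
    \<open>g\<close>.\<close>
  have Dprod: "D (Z * W) = D Z * W + Z * D W" if ZW: "Z \<in> carrier_mat n n" "W \<in> carrier_mat n n" for Z W
  proof -
    have c: "As * Z \<in> carrier_mat n n" "Z * As \<in> carrier_mat n n" "As * W \<in> carrier_mat n n" "W * As \<in> carrier_mat n n"
      using ZW As by auto
    have id: "U - V + (V - V') = U - V'"
      if "U \<in> carrier_mat n n" "V \<in> carrier_mat n n" "V' \<in> carrier_mat n n" for U V V' :: "'q fps mat"
      using that by (auto intro!: eq_matI)
    have "D Z * W + Z * D W = (As * Z * W - Z * As * W) + (Z * (As * W) - Z * (W * As))"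
      unfolding D_def minus_mult_distrib_mat[OF c(1,2) ZW(2)] mult_minus_distrib_mat[OF ZW(1) c(3,4)] ..
    also have "Z * As * W = Z * (As * W)" by (rule as[OF ZW(1) As ZW(2)])
    also have "As * Z * W = As * (Z * W)" by (rule as[OF As ZW])
    also have "Z * (W * As) = Z * W * As" by (rule as[OF ZW As, symmetric])
    also have "As * (Z * W) - Z * (As * W) + (Z * (As * W) - Z * W * As) = As * (Z * W) - Z * W * As"
      by (rule id[OF mc[OF As mc[OF ZW]] mc[OF ZW(1) c(3)] mc[OF mc[OF ZW] As]])
    finally show ?thesis by (simp add: D_def)
  qed
  have Dpow: "reduce_mat m (D (M ^\<^sub>m i)) = 0\<^sub>m n n" if M: "M \<in> carrier_mat n n" "reduce_mat m (D M) = 0\<^sub>m n n" for M i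
  proof (induction i)
    case 0
    have "D (1\<^sub>m n) = 0\<^sub>m n n" using As by (simp add: D_def)
    thus ?case using M by (auto simp: mat_eq_iff)
  next
    case (Suc i)
    have p: "M ^\<^sub>m i \<in> carrier_mat n n" using M by simp
    note c = mc[OF D_carrier[OF p] M(1)] mc[OF p D_carrier[OF M(1)]]
    have z: "reduce_mat m (0\<^sub>m n n) = (0\<^sub>m n n :: 'q fps mat)" by (rule eq_matI) auto
    have "reduce_mat m (D (M ^\<^sub>m i) * M) = reduce_mat m (0\<^sub>m n n)" "reduce_mat m (M ^\<^sub>m i * D M) = reduce_mat m (0\<^sub>m n n)"
      unfolding z by (rule zero[OF disjI1[OF Suc] D_carrier[OF p] M(1)], rule zero[OF disjI2[OF M(2)] p D_carrier[OF M(1)]])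
    hence "reduce_mat m (D (M ^\<^sub>m i * M)) = reduce_mat m (0\<^sub>m n n + 0\<^sub>m n n)"
      unfolding Dprod[OF p M(1)] by (rule reduce_add_cong(1)[OF _ _ c(1) zero_carrier_mat c(2) zero_carrier_mat])
    thus ?case unfolding pow_mat.simps left_add_zero_mat[OF zero_carrier_mat] z .
  qed
  define F where "F = (\<lambda>i j. Nb ^\<^sub>m i * g * Na ^\<^sub>m j)"
  have p: "Na ^\<^sub>m j \<in> carrier_mat n n" "Nb ^\<^sub>m j \<in> carrier_mat n n" for j using N by auto
  have F: "F i j \<in> carrier_mat n n" for i j unfolding F_def by (intro mc p g)
  have Dg: "reduce_mat m (D g) = reduce_mat m (g * Na - Nb * g)"
  proof -
    have c: "g * As \<in> carrier_mat n n" "g * Na \<in> carrier_mat n n" "As * g \<in> carrier_mat n n" "Nb * g \<in> carrier_mat n n"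
      using g N As by auto
    have id: "U - V = U + W - W - V" "V + U - W - V = U - W"
      if "U \<in> carrier_mat n n" "V \<in> carrier_mat n n" "W \<in> carrier_mat n n" for U V W :: "'q fps mat"
      using that by (auto intro!: eq_matI)
    have "D g = (As + Nb) * g - Nb * g - g * As"
      unfolding add_mult_distrib_mat[OF As N(2) g] D_def by (rule id(1)[OF c(3,1,4)])
    also have "reduce_mat m \<dots> = reduce_mat m (g * (As + Na) - Nb * g - g * As)"
    proof -
      have s: "As + Nb \<in> carrier_mat n n" "As + Na \<in> carrier_mat n n" using N by auto
      note s' = mc[OF s(1) g] mc[OF g s(2)]
      have "reduce_mat m ((As + Nb) * g - Nb * g) = reduce_mat m (g * (As + Na) - Nb * g)"
        by (rule reduce_add_cong(2)[OF eq[symmetric] refl s' c(4) c(4)])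
      thus ?thesis
        by (rule reduce_add_cong(2)[OF _ refl square_carrier_closed(2)[OF s'(1) c(4)] square_carrier_closed(2)[OF s'(2) c(4)] c(1) c(1)])
    qed
    also have "g * (As + Na) - Nb * g - g * As = g * Na - Nb * g"
      unfolding mult_add_distrib_mat[OF g As N(1)] by (rule id(2)[OF c(2,1,4)])
    finally show ?thesis .
  qed
  \<comment> \<open>On the family \<open>F\<close> the operator \<open>D\<close> acts as right
    multiplication by \<open>Na\<close> minus left multiplication by \<open>Nb\<close>, two
    commuting nilpotent operators.\<close>
  have DF: "reduce_mat m (D (F i j)) = reduce_mat m (F i (Suc j) - F (Suc i) j)" for i j
  proof -
    let ?b = "Nb ^\<^sub>m i" and ?a = "Na ^\<^sub>m j"
    have bg: "?b * g \<in> carrier_mat n n" by (intro mc p g)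
    have "D (F i j) = (D ?b * g + ?b * D g) * ?a + ?b * g * D ?a"
      unfolding F_def Dprod[OF bg p(1)] Dprod[OF p(2) g] ..
    also have "reduce_mat m \<dots> = reduce_mat m ((0\<^sub>m n n * g + ?b * (g * Na - Nb * g)) * ?a + ?b * g * 0\<^sub>m n n)"
    proof -
      have z: "reduce_mat m (0\<^sub>m n n) = (0\<^sub>m n n :: 'q fps mat)" by (auto simp: mat_eq_iff)
      have 1: "reduce_mat m (D ?b) = reduce_mat m (0\<^sub>m n n)" "reduce_mat m (D ?a) = reduce_mat m (0\<^sub>m n n)"
        using Dpow[OF N(2) comm(2), of i] Dpow[OF N(1) comm(1), of j] z by simp_all
      have c: "g * Na - Nb * g \<in> carrier_mat n n" using g N by auto
      note c' = mc[OF D_carrier[OF p(2)] g] mc[OF p(2) D_carrier[OF g]] mc[OF bg D_carrier[OF p(1)]] mc[OF p(2) c]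
        mc[OF zero_carrier_mat[of n n] g] mc[OF bg zero_carrier_mat[of n n]]
      show ?thesis
      proof -
        let ?z = "0\<^sub>m n n" and ?x = "g * Na - Nb * g"
        have a1: "reduce_mat m (D ?b * g) = reduce_mat m (?z * g)"
          by (rule reduce_mult_cong[OF 1(1) refl D_carrier[OF p(2)] zero_carrier_mat g g])
        have a2: "reduce_mat m (?b * D g) = reduce_mat m (?b * ?x)"
          by (rule reduce_mult_cong[OF refl Dg p(2) p(2) D_carrier[OF g] c])
        have a3: "reduce_mat m (D ?b * g + ?b * D g) = reduce_mat m (?z * g + ?b * ?x)"
          by (rule reduce_add_cong(1)[OF a1 a2 c'(1) c'(5) c'(2) c'(4)])
        have s1: "D ?b * g + ?b * D g \<in> carrier_mat n n" "?z * g + ?b * ?x \<in> carrier_mat n n"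
          by (rule add_carrier_mat[OF c'(2)], rule add_carrier_mat[OF c'(4)])
        have a4: "reduce_mat m ((D ?b * g + ?b * D g) * ?a) = reduce_mat m ((?z * g + ?b * ?x) * ?a)"
          by (rule reduce_mult_cong[OF a3 refl s1 p(1) p(1)])
        have a5: "reduce_mat m (?b * g * D ?a) = reduce_mat m (?b * g * ?z)"
          by (rule reduce_mult_cong[OF refl 1(2) bg bg D_carrier[OF p(1)] zero_carrier_mat])
        show ?thesis
          by (rule reduce_add_cong(1)[OF a4 a5 mc[OF s1(1) p(1)] mc[OF s1(2) p(1)] c'(3) c'(6)])
      qed
    qed
    also have "(0\<^sub>m n n * g + ?b * (g * Na - Nb * g)) * ?a + ?b * g * 0\<^sub>m n n = F i (Suc j) - F (Suc i) j"
    proof -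
      have c: "g * Na \<in> carrier_mat n n" "Nb * g \<in> carrier_mat n n" using g N by auto
      have c2: "?b * (g * Na) \<in> carrier_mat n n" "?b * (Nb * g) \<in> carrier_mat n n" "?b * (g * Na - Nb * g) \<in> carrier_mat n n"
        using c p by auto
      have "(0\<^sub>m n n * g + ?b * (g * Na - Nb * g)) * ?a + ?b * g * 0\<^sub>m n n = ?b * (g * Na - Nb * g) * ?a"
        unfolding left_mult_zero_mat[OF g] right_mult_zero_mat[OF bg] left_add_zero_mat[OF c2(3)]
        by (rule right_add_zero_mat[OF mc[OF c2(3) p(1)]])
      also have "\<dots> = ?b * (g * Na) * ?a - ?b * (Nb * g) * ?a"
        unfolding mult_minus_distrib_mat[OF p(2) c] by (rule minus_mult_distrib_mat[OF c2(1,2) p(1)])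
      also have "?b * (g * Na) * ?a = F i (Suc j)"
      proof -
        have "Na * ?a = Na ^\<^sub>m Suc j" using pow_mat_mult_commute(1)[OF N(1) N(1) refl, of j] by simp
        thus ?thesis unfolding F_def as[OF p(2) g N(1), symmetric] as[OF bg N(1) p(1)] by simp
      qed
      also have "?b * (Nb * g) * ?a = F (Suc i) j"
        unfolding F_def as[OF p(2) N(2) g, symmetric] by simp
      finally show ?thesis .
    qed
    finally show ?thesis .
  qed
  have vanish: "reduce_mat m (F i j) = 0\<^sub>m n n" if "e \<le> i \<or> e \<le> j" for i j
  proof -
    have pw: "reduce_mat m (M ^\<^sub>m i) = 0\<^sub>m n n"
      if M: "M \<in> carrier_mat n n" "reduce_mat m (M ^\<^sub>m e) = 0\<^sub>m n n" "e \<le> i" for M :: "'q fps mat" and i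
      using M(3)
    proof (induction i rule: dec_induct)
      case (step i)
      thus ?case using zero[of "M ^\<^sub>m i" M] M by simp
    qed (rule M(2))
    have c: "Nb ^\<^sub>m i * g \<in> carrier_mat n n" by (rule mc[OF p(2) g])
    show ?thesis unfolding F_def using that
    proof
      assume "e \<le> i"
      from pw[OF N(2) nil(2) this] have "reduce_mat m (Nb ^\<^sub>m i * g) = 0\<^sub>m n n" by (intro zero[OF disjI1 p(2) g])
      thus "reduce_mat m (Nb ^\<^sub>m i * g * Na ^\<^sub>m j) = 0\<^sub>m n n" by (intro zero[OF disjI1 c p(1)])
    next
      assume "e \<le> j"
      from pw[OF N(1) nil(1) this] show "reduce_mat m (Nb ^\<^sub>m i * g * Na ^\<^sub>m j) = 0\<^sub>m n n" by (intro zero[OF disjI2 c p(1)])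
    qed
  qed
  \<comment> \<open>Descending induction on \<open>i + j\<close>: if \<open>D\<close> kills both
    terms on the right of \<open>DF\<close>, then it kills \<open>D (F i j)\<close>, and
    \<open>D_square\<close> removes one application.\<close>
  have "reduce_mat m (D (F i j)) = 0\<^sub>m n n" for i j
  proof (induction "2 * e - (i + j)" arbitrary: i j rule: less_induct)
    case less
    show ?case
    proof (cases "e \<le> i \<or> e \<le> j")
      case True
      have z: "reduce_mat m (0\<^sub>m n n) = (0\<^sub>m n n :: 'q fps mat)" by (rule eq_matI) auto
      have "reduce_mat m (F i j) = reduce_mat m (0\<^sub>m n n)" unfolding z by (rule vanish[OF True])
      hence "reduce_mat m (D (F i j)) = reduce_mat m (D (0\<^sub>m n n))" by (rule D_cong[OF _ F zero_carrier_mat])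
      also have "D (0\<^sub>m n n) = 0\<^sub>m n n" using As by (simp add: D_def)
      finally show ?thesis unfolding z .
    next
      case False
      have "reduce_mat m (D (D (F i j))) = reduce_mat m (D (F i (Suc j) - F (Suc i) j))"
        by (rule D_cong[OF DF D_carrier[OF F] square_carrier_closed(2)[OF F F]])
      also have "\<dots> = 0\<^sub>m n n"
        unfolding D_diff[OF F F] reduce_diff_0_iff[OF D_carrier[OF F] D_carrier[OF F]]
      proof -
        have "2 * e - (i + Suc j) < 2 * e - (i + j)" "2 * e - (Suc i + j) < 2 * e - (i + j)" using False by auto
        from less[OF this(1)] less[OF this(2)]
        show "reduce_mat m (D (F i (Suc j))) = reduce_mat m (D (F (Suc i) j))" by (rule trans[OF _ sym])
      qed
      finally show ?thesis by (rule D_square[OF F])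
    qed
  qed
  from this[of 0 0] show ?thesis using g N by (simp add: F_def)
qed

end

section \<open>The representations of the centraliser\<close>

lemma GL_reduce_carrier:
  assumes k: "coeff_ring k" and Z: "Z \<in> mats k n" and Y: "Y \<in> mats k n"
    and eq: "reduce_mat m (Z * Y) = reduce_mat m (1\<^sub>m n)" "reduce_mat m (Y * Z) = reduce_mat m (1\<^sub>m n)"
  shows "reduce_mat m Z \<in> carrier (GL_trunc k n m)"
  unfolding GL_trunc_carrier_iff[OF k]
proof (intro conjI bexI[of _ Y])
  show "reduce_mat m Z \<in> mats k n" by (rule mats_closed(7)[OF k Z])
  show "reduce_mat m (reduce_mat m Z * Y) = reduce_mat m (1\<^sub>m n)" "reduce_mat m (Y * reduce_mat m Z) = reduce_mat m (1\<^sub>m n)"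
    using reduce_mult_reduce(1)[OF matsD(1)[OF Z] matsD(1)[OF Y], of m] reduce_mult_reduce(2)[OF matsD(1)[OF Y] matsD(1)[OF Z], of m] eq
    by metis+
qed (use Y in auto)

lemma GL_reduce_mult:
  fixes Z Y :: "'a::comm_ring_1 fps mat"
  assumes "Z \<in> carrier_mat n n" "Y \<in> carrier_mat n n"
  shows "reduce_mat m Z \<otimes>\<^bsub>GL_trunc k n m\<^esub> reduce_mat m Y = reduce_mat m (Z * Y)"
  unfolding GL_trunc_mult using assms
  by (simp only: reduce_mult_reduce(1)[of Z n n "reduce_mat m Y" n] reduce_mult_reduce(2)[of Z n n Y n] map_carrier_mat)

context block_data
begin

lemma E_add: "E Z \<Longrightarrow> E W \<Longrightarrow> E (Z + W)"
  using As by (auto simp: E_def mult_add_distrib_mat[of _ n n _ n] add_mult_distrib_mat[of _ n n _ _ n])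

lemma E_one: "E (1\<^sub>m n)"
  using As by (simp add: E_def)

lemma E_As: "E As"
  using As by (simp add: E_def)

lemma E_smult: "E Z \<Longrightarrow> E (c \<cdot>\<^sub>m Z)"
  using As by (auto simp: E_def mult_smult_distrib[of _ n n _ n] mult_smult_assoc_mat[of _ n n _ n])

lemma E_mult:
  assumes "E Z" "E W"
  shows "E (Z * W)"
proof -
  have c: "Z \<in> carrier_mat n n" "W \<in> carrier_mat n n" and e: "As * Z = Z * As" "As * W = W * As"
    using assms by (auto simp: E_def)
  have "As * (Z * W) = Z * As * W" unfolding assoc_mult_mat[OF As c, symmetric] e(1) ..
  also have "\<dots> = Z * W * As" unfolding assoc_mult_mat[OF c(1) As c(2)] e(2) assoc_mult_mat[OF c As] ..
  finally show ?thesis using c by (simp add: E_def)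
qed

lemma E_reduce_D:
  assumes "E W" "reduce_mat m W = reduce_mat m Z" "Z \<in> carrier_mat n n"
  shows "reduce_mat m (D Z) = 0\<^sub>m n n"
proof -
  have "reduce_mat m (D Z) = reduce_mat m (D W)" using D_cong[OF assms(2) E_carrier[OF assms(1)] assms(3)] by simp
  thus ?thesis unfolding E_D[OF assms(1)] by (auto simp: mat_eq_iff)
qed

text \<open>\<open>D\<close> is linear over the centraliser on both sides, so conjugation by
  \<open>L\<close> preserves the image of \<open>D\<close>; this gives the normality needed for the
  projection.\<close>

lemma E_D_mult:
  assumes W: "E W" "E W'" and Y: "Y \<in> carrier_mat n n"
  shows "W * D Y * W' = D (W * Y * W')"
proof -
  note mc = mult_carrier_mat[of _ n n _ n] and as = assoc_mult_mat[of _ n n _ n _ n]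
  have c: "W \<in> carrier_mat n n" "W' \<in> carrier_mat n n" and e: "As * W = W * As" "As * W' = W' * As"
    using W by (auto simp: E_def)
  have d: "As * Y \<in> carrier_mat n n" "Y * As \<in> carrier_mat n n" by (rule mc[OF As Y], rule mc[OF Y As])
  have "W * D Y * W' = W * (As * Y) * W' - W * (Y * As) * W'"
    unfolding D_def mult_minus_distrib_mat[OF c(1) d] by (rule minus_mult_distrib_mat[OF mc[OF c(1) d(1)] mc[OF c(1) d(2)] c(2)])
  also have "W * (As * Y) * W' = As * (W * Y * W')"
    unfolding as[OF c(1) As Y, symmetric] e(1)[symmetric] as[OF As c(1) Y] by (rule as[OF As mc[OF c(1) Y] c(2)])
  also have "W * (Y * As) * W' = W * Y * W' * As"
    unfolding as[OF c(1) Y As, symmetric] as[OF mc[OF c(1) Y] As c(2)] e(2) by (rule as[OF mc[OF c(1) Y] c(2) As, symmetric])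
  finally show ?thesis by (simp add: D_def)
qed

lemma cmp_mod_inj:
  assumes "E Z" "E W" "\<And>i. i < N \<Longrightarrow> reduce_mat m (cmp i Z) = reduce_mat m (cmp i W)"
  shows "reduce_mat m Z = reduce_mat m W"
proof -
  note c = E_carrier[OF assms(1)] E_carrier[OF assms(2)]
  define V where "V = Z + (- 1) \<cdot>\<^sub>m W"
  have V: "E V" unfolding V_def by (intro E_add E_smult assms)
  have "Z = W + V" unfolding V_def using c by (intro eq_matI) auto
  hence Z: "cmp i Z = cmp i W + cmp i V" if "i < N" for i using cmp_add[OF c(2) E_carrier[OF V] that] by simp
  have "reduce_mat m (cmp i V) = 0\<^sub>m (mu i) (mu i)" if i: "i < N" for i
  proof -
    have id: "cmp i V = cmp i Z - cmp i W" unfolding Z[OF i] by (intro eq_matI) auto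
    have "reduce_mat m (cmp i Z - cmp i W) = reduce_mat m (cmp i W - cmp i W)"
      by (rule reduce_add_cong(2)[OF assms(3)[OF i] refl cmp_carrier cmp_carrier cmp_carrier cmp_carrier])
    thus ?thesis unfolding id by (auto simp: mat_eq_iff)
  qed
  hence "reduce_mat m V = 0\<^sub>m n n" by (rule cmp_eq_0[OF V])
  hence "reduce_mat m (Z - W) = 0\<^sub>m n n" unfolding V_def using c by (auto simp: mat_eq_iff)
  thus ?thesis using reduce_diff_0_iff[OF c] by simp
qed

end

text \<open>\<open>Nt\<close> commutes with \<open>As\<close> over the untruncated ring, is exactly
  nilpotent, and has the constant matrices \<open>Ns i\<close> as its components. That such a lift
  of the nilpotent part exists is the content of \<open>nilpotent_lift\<close>.\<close>

locale jordan_data = block_data fs A s P Q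
  for fs :: "('q::finite_field poly \<times> nat) list" and A :: "'q poly \<Rightarrow> 'q fps mat" and s :: "'q poly \<Rightarrow> 'q alg_closure fps"
    and P Q :: "'q poly \<Rightarrow> 'q alg_closure fps mat" +
  fixes l r :: nat and \<psi> :: "'q fps \<Rightarrow> 'c::field" and \<phi> :: "'q poly \<Rightarrow> 'q alg_closure fps \<Rightarrow> 'c"
    and Nt :: "'q fps mat" and Ns :: "nat \<Rightarrow> 'q alg_closure mat" and e :: nat
  assumes l: "0 < l" and r: "r = 2 * l" and psi: "additive_character l \<psi>"
    and phi: "i < N \<Longrightarrow> \<phi> (fst (fs ! i)) \<in> hom (units_of (trunc_ring (ki i) r)) (units_of class_ring)"
    and phi_cong: "i < N \<Longrightarrow> x \<in> O_ext (dg i) \<Longrightarrow>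
      \<phi> (fst (fs ! i)) (fps_cutoff r (1 + fps_X ^ l * x)) = \<psi> (fps_cutoff l (unram_trace (dg i) (si i * x)))"
    and Nt: "E Nt" and Nt_nil: "Nt ^\<^sub>m e = 0\<^sub>m n n"
    and Ns: "i < N \<Longrightarrow> cmp i Nt = const_mat (Ns i)" and Ns_nil: "i < N \<Longrightarrow> nilpotent_mat (Ns i)"
begin

text \<open>\<open>\<psi>\<close> extended to all series by truncating first, so that traces can be
  computed with untruncated representatives.\<close>

definition "\<chi> x = \<psi> (fps_cutoff l x)"

lemma \<chi>: "\<chi> (x + y) = \<chi> x * \<chi> y" "\<chi> x \<noteq> 0" "\<chi> (fps_cutoff l x) = \<chi> x"
proof -
  have "\<psi> \<in> hom (add_monoid (trunc_ring UNIV l)) (units_of class_ring)" using psi by (simp add: additive_character_def)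
  moreover have "fps_cutoff l x \<in> carrier (add_monoid (trunc_ring UNIV l))" for x :: "'q fps" by (simp add: trunc_ring_def)
  moreover have "a \<otimes>\<^bsub>add_monoid (trunc_ring UNIV l)\<^esub> b = a + b" for a b :: "'q fps" by (simp add: trunc_ring_def)
  ultimately have "\<psi> (fps_cutoff l x + fps_cutoff l y) = \<psi> (fps_cutoff l x) * \<psi> (fps_cutoff l y)" "\<psi> (fps_cutoff l x) \<noteq> 0"
    unfolding class_ring_character by metis+
  thus "\<chi> (x + y) = \<chi> x * \<chi> y" "\<chi> x \<noteq> 0" by (simp_all add: \<chi>_def fps_cutoff_add)
  show "\<chi> (fps_cutoff l x) = \<chi> x" by (simp add: \<chi>_def)
qed

lemma \<chi>_X_power: "\<chi> (fps_X ^ (l - 1) * x) = \<chi> (fps_X ^ (l - 1) * fps_const (fps_nth x 0))"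
proof -
  have "fps_cutoff l (fps_X ^ (l - 1) * x) = fps_cutoff l (fps_X ^ (l - 1) * fps_const (fps_nth x 0))"
    using l by (intro fps_cutoff_X_power_mult[where j = 1]) (auto simp: fps_eq_iff)
  thus ?thesis by (simp add: \<chi>_def)
qed

lemma \<chi>_nontrivial: "\<exists>a. \<chi> (fps_X ^ (l - 1) * fps_const a) \<noteq> 1"
proof -
  obtain x where "\<psi> (fps_cutoff l (fps_X ^ (l - 1) * x)) \<noteq> 1" using psi by (auto simp: additive_character_def)
  hence "\<chi> (fps_X ^ (l - 1) * x) \<noteq> 1" by (simp add: \<chi>_def)
  thus ?thesis unfolding \<chi>_X_power[of x] by blast
qed

lemma coeff_ring_UNIV: "coeff_ring UNIV"
  by (simp add: coeff_ring_def)

sublocale gl: truncated_gl "UNIV :: 'q set" n l r \<chi>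
proof unfold_locales
  show "\<exists>a\<in>UNIV. \<chi> (fps_X ^ (l - 1) * fps_const a) \<noteq> 1" using \<chi>_nontrivial by simp
qed (use l r \<chi> in \<open>auto simp: coeff_ring_UNIV\<close>)

definition "\<chi>i i x = \<chi> (unram_trace (dg i) x)"

lemma nilpotent_character_i:
  assumes i: "i < N"
  shows "nilpotent_character (ki i) (mu i) l r (\<chi>i i) (Ns i)"
proof -
  interpret u: unramified_matrix "dg i" "Ai i" "si i" "P (fst (fs ! i))" "Q (fst (fs ! i))" by (rule umi[OF i])
  have cm: "const_mat (Ns i) \<in> mats (ki i) (mu i)" unfolding Ns[OF i, symmetric] by (rule cmp_mats[OF Nt i])
  show ?thesis
  proof unfold_locales
    show "coeff_ring (ki i)" by (rule coeff_ring_finite_subfield)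
    show "x \<in> ki i \<Longrightarrow> inverse x \<in> ki i" for x by (rule finite_subfield_inverse)
    show "finite (ki i)" by (rule finite_finite_subfield[OF u.d])
    show "y \<in> fps_over (ki i) \<Longrightarrow> z \<in> fps_over (ki i) \<Longrightarrow> \<chi>i i (y + z) = \<chi>i i y * \<chi>i i z" for y z
      by (simp add: \<chi>i_def O_ext_eq_fps_over[symmetric] unram_trace_add \<chi>)
    show "\<chi>i i (fps_cutoff l y) = \<chi>i i y" for y by (simp add: \<chi>i_def unram_trace_cutoff \<chi>)
    show "\<chi>i i y \<noteq> 0" for y by (simp add: \<chi>i_def \<chi>)
    show "\<exists>a\<in>ki i. \<chi>i i (fps_X ^ (l - 1) * fps_const a) \<noteq> 1"
    proof -
      obtain a where a: "\<chi> (fps_X ^ (l - 1) * fps_const a) \<noteq> 1" using \<chi>_nontrivial by blast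
      obtain b :: "'q alg_closure" where b: "b \<in> ki i" "fps_nth (unram_trace (dg i) (fps_const b)) 0 \<noteq> 0"
        using u.trace_nontrivial by blast
      \<comment> \<open>Scaling \<open>b\<close> by \<open>a / c\<close> makes the residue of its
        trace equal to \<open>a\<close>, for which \<open>\<chi>\<close> is nontrivial on the
        socle.\<close>
      define c where "c = fps_nth (unram_trace (dg i) (fps_const b)) 0"
      have cb: "fps_const b \<in> O_ext (dg i)" using b(1) unfolding O_ext_eq_fps_over by (rule fps_over_closed(1)[OF coeff_ring_finite_subfield])
      have eq: "fps_const (to_ac (a / c) * b) = O_embed (fps_const (a / c)) * fps_const b"
        by (rule fps_ext) (simp add: O_embed_nth fps_nth_fps_const)
      have "O_embed (fps_const (a / c)) * fps_const b \<in> O_ext (dg i)" using cb by (simp add: O_ext_iff frobenius_funpow_hom)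
      hence "fps_nth (fps_const (to_ac (a / c) * b)) 0 \<in> ki i" unfolding eq by (simp add: O_ext_def)
      hence mem: "to_ac (a / c) * b \<in> ki i" by simp
      have "\<chi>i i (fps_X ^ (l - 1) * fps_const (to_ac (a / c) * b)) =
          \<chi> (fps_X ^ (l - 1) * (fps_const (a / c) * unram_trace (dg i) (fps_const b)))"
        unfolding \<chi>i_def unram_trace_X_power_const unfolding eq unram_trace_mult_embed[OF cb] ..
      also have "\<dots> = \<chi> (fps_X ^ (l - 1) * fps_const a)"
        unfolding \<chi>_X_power[of "fps_const (a / c) * unram_trace (dg i) (fps_const b)"] using b(2) by (simp add: c_def)
      finally show ?thesis using a mem by (intro bexI[of _ "to_ac (a / c) * b"]) auto
    qed
    show "Ns i \<in> carrier_mat (mu i) (mu i)" using matsD(1)[OF cm] by simp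
    show "Ns i $$ (a, b) \<in> ki i" if "a < mu i" "b < mu i" for a b
      using fps_overD[OF matsD(2)[OF cm that], of 0] matsD(1)[OF cm] that by simp
    show "nilpotent_mat (Ns i)" by (rule Ns_nil[OF i])
  qed (use l r in auto)
qed

abbreviation "Gi i \<equiv> GL_trunc (ki i) (mu i) r"
abbreviation "nui i \<equiv> nu_rep l r (dg i) (mu i) \<psi> (Ns i)"
definition "cei i V = reduce_mat r (1\<^sub>m (mu i) + fps_X ^ l \<cdot>\<^sub>m V)" for V :: "'q alg_closure fps mat"

text \<open>The given \<open>nu_rep\<close> and the representation of the locale differ only in
  where truncations are placed; \<open>\<psi>\<close> sees series modulo \<open>\<pi>^l\<close>, so
  both use the same character and the same induced representation.\<close>

lemma nu_weights:
  assumes i: "i < N"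
  shows "\<exists>d>0. weight_rep (Gi i) (cong_subgroup (ki i) (mu i) r l) d (nui i) \<and>
    (\<exists>u<d. \<forall>V \<in> mats (ki i) (mu i). nui i (cei i V) $$ (u, u) = \<chi>i i (mat_trace (const_mat (Ns i) * V)))"
proof -
  interpret c: nilpotent_character "ki i" "mu i" l r "\<chi>i i" "Ns i" by (rule nilpotent_character_i[OF i])
  have wt: "psi_nilp l (dg i) \<psi> (Ns i) g = c.wt (const_mat (Ns i)) g" if g: "g \<in> c.T" for g
  proof -
    note V = c.elt_cong_part(1)[OF g] and Vc = matsD(1)[OF c.elt_cong_part(1)[OF g]]
    have "reduce_mat l (const_mat (Ns i) * reduce_mat l (cong_part l g)) = reduce_mat l (const_mat (Ns i) * cong_part l g)"
      by (rule reduce_mult_reduce(2)[OF c.cM(2) Vc])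
    hence "fps_cutoff l (mat_trace (const_mat (Ns i) * reduce_mat l (cong_part l g))) = fps_cutoff l (mat_trace (const_mat (Ns i) * cong_part l g))"
      by (rule cutoff_mat_trace_cong[where n = "mu i"]) (use c.cM(2) Vc in auto)
    thus ?thesis by (simp add: psi_nilp_def c.wt_def \<chi>i_def \<chi>_def unram_trace_cutoff)
  qed
  have "psi_nilp_ext l r (dg i) (mu i) \<psi> (Ns i) y = c.ext y" for y
  proof -
    have "(\<exists>x\<in>c.C. \<exists>g\<in>c.T. y = x \<otimes>\<^bsub>c.G\<^esub> g \<and> d = psi_nilp l (dg i) \<psi> (Ns i) g) \<longleftrightarrow>
        (\<exists>x\<in>c.C. \<exists>g\<in>c.T. y = x \<otimes>\<^bsub>c.G\<^esub> g \<and> d = c.wt (const_mat (Ns i)) g)" for d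
      using wt by (metis (no_types, lifting))
    thus ?thesis unfolding psi_nilp_ext_def Let_def c.ext_def by presburger
  qed
  hence nu: "nui i = c.nu" unfolding nu_rep_def Let_def c.nu_def by presburger
  obtain d u where d: "0 < d" "weight_rep c.G c.T d c.nu" "u < d" "\<And>t. t \<in> c.T \<Longrightarrow> c.nu t $$ (u, u) = c.wt (const_mat (Ns i)) t"
    using c.nu_weight_rep by blast
  have "nui i (cei i V) $$ (u, u) = \<chi>i i (mat_trace (const_mat (Ns i) * V))" if V: "V \<in> mats (ki i) (mu i)" for V
  proof -
    have "cei i V = c.cong_elt V" by (simp add: cei_def c.cong_elt_def)
    thus ?thesis unfolding nu using d(4)[OF c.cong_elt_T[OF V]] c.wt_elt[OF c.cM(1) V] by simp
  qed
  thus ?thesis using d nu by metis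
qed

lemma cei:
  assumes i: "i < N"
  shows "V \<in> mats (ki i) (mu i) \<Longrightarrow> cei i V \<in> cong_subgroup (ki i) (mu i) r l"
    "t \<in> cong_subgroup (ki i) (mu i) r l \<Longrightarrow> \<exists>V \<in> mats (ki i) (mu i). t = cei i V"
    "cong_subgroup (ki i) (mu i) r l \<subseteq> carrier (Gi i)" "group (Gi i)"
proof -
  interpret c: nilpotent_character "ki i" "mu i" l r "\<chi>i i" "Ns i" by (rule nilpotent_character_i[OF i])
  have eq: "cei i V = c.cong_elt V" for V by (simp add: cei_def c.cong_elt_def)
  show "V \<in> mats (ki i) (mu i) \<Longrightarrow> cei i V \<in> cong_subgroup (ki i) (mu i) r l" unfolding eq by (rule c.cong_elt_T)
  show "t \<in> cong_subgroup (ki i) (mu i) r l \<Longrightarrow> \<exists>V \<in> mats (ki i) (mu i). t = cei i V"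
    unfolding eq using c.elt_cong_part by metis
  show "cong_subgroup (ki i) (mu i) r l \<subseteq> carrier (Gi i)" by (rule c.T_carrier)
  show "group (Gi i)" by (rule c.G.is_group)
qed

definition "L = L_group n r A fs"
abbreviation "GL \<equiv> gl.G\<lparr>carrier := L\<rparr>"
definition "pr i g = component r A s fs i g"
text \<open>Plays the role of the congruence subgroup of \<open>L\<close>, parametrised by exactly
  commuting matrices so that components can be read off.\<close>

definition "TL = gl.cong_elt ` {V. E V}"

lemma L_iff: "g \<in> L \<longleftrightarrow> g \<in> carrier gl.G \<and> reduce_mat r (D g) = 0\<^sub>m n n"
proof -
  have "reduce_mat r (g * reduce_mat r As) = reduce_mat r (reduce_mat r As * g) \<longleftrightarrow> reduce_mat r (D g) = 0\<^sub>m n n"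
    if "g \<in> carrier gl.G" for g
  proof -
    note c = gl.G_mats(2)[OF that]
    show ?thesis
      unfolding reduce_mult_reduce(1)[OF As c] reduce_mult_reduce(2)[OF c As] D_def
        reduce_diff_0_iff[OF square_carrier_closed(1)[OF As c] square_carrier_closed(1)[OF c As]]
      by (rule eq_commute)
  qed
  thus ?thesis unfolding L_def L_group_def GL_centraliser_def by blast
qed

text \<open>Every element of \<open>L\<close> has a representative in \<open>E\<close>, where
  \<open>cmp\<close> respects sums and products; all statements about \<open>pr\<close> are obtained
  this way.\<close>

lemma L_rep:
  assumes "g \<in> L"
  obtains W where "E W" "g = reduce_mat r W"
proof -
  have g: "g \<in> carrier gl.G" "reduce_mat r (D g) = 0\<^sub>m n n" using assms by (simp_all add: L_iff)
  obtain W where "E W" "reduce_mat r W = reduce_mat r g" using E_lift[OF gl.G_mats(2)[OF g(1)] g(2)] by blast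
  thus ?thesis using gl.G_mats(3)[OF g(1)] that by simp
qed

lemma E_L: "E W \<Longrightarrow> reduce_mat r W \<in> carrier gl.G \<Longrightarrow> reduce_mat r W \<in> L"
  unfolding L_iff by (intro conjI E_reduce_D[of W]) (auto simp: E_carrier)

lemma E_L_mult: "E W \<Longrightarrow> E W' \<Longrightarrow> reduce_mat r W \<otimes>\<^bsub>gl.G\<^esub> reduce_mat r W' = reduce_mat r (W * W')"
  by (rule GL_reduce_mult[OF E_carrier E_carrier])

lemma L_subgroup: "subgroup L gl.G"
proof (rule gl.G.subgroupI)
  show "L \<subseteq> carrier gl.G" by (auto simp: L_iff)
  have "reduce_mat r (1\<^sub>m n) \<in> L" by (rule E_L[OF E_one]) (use gl.G.one_closed in simp)
  thus "L \<noteq> {}" by blast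
  fix x assume x: "x \<in> L"
  hence xG: "x \<in> carrier gl.G" by (simp add: L_iff)
  let ?xi = "inv\<^bsub>gl.G\<^esub> x"
  note xm = gl.G_mats(2)[OF xG] and xi = gl.G_mats(2)[OF gl.G.inv_closed[OF xG]]
  note mc = mult_carrier_mat[of _ n n _ n] and as = assoc_mult_mat[of _ n n _ n _ n]
  have xc: "reduce_mat r (As * x) = reduce_mat r (x * As)"
    using x unfolding L_iff D_def reduce_diff_0_iff[OF mc[OF As xm] mc[OF xm As]] by blast
  have "reduce_mat r (?xi * As * (x * ?xi)) = reduce_mat r (?xi * As * 1\<^sub>m n)"
    by (rule reduce_mult_cong[OF refl gl.G_inv(1)[OF xG] mc[OF xi As] mc[OF xi As] mc[OF xm xi] one_carrier_mat])
  hence "reduce_mat r (?xi * As) = reduce_mat r (?xi * As * (x * ?xi))"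
    unfolding right_mult_one_mat[OF mc[OF xi As]] by (rule sym)
  also have "?xi * As * (x * ?xi) = ?xi * (As * x * ?xi)"
    unfolding as[OF xi As mc[OF xm xi]] as[OF As xm xi] ..
  also have "reduce_mat r \<dots> = reduce_mat r (?xi * (x * As * ?xi))"
    by (rule reduce_mult_cong[OF refl reduce_mult_cong[OF xc refl mc[OF As xm] mc[OF xm As] xi xi] xi xi mc[OF mc[OF As xm] xi] mc[OF mc[OF xm As] xi]])
  also have "?xi * (x * As * ?xi) = ?xi * x * (As * ?xi)"
    unfolding as[OF xm As xi] by (rule as[OF xi xm mc[OF As xi], symmetric])
  also have "reduce_mat r \<dots> = reduce_mat r (1\<^sub>m n * (As * ?xi))"
    by (rule reduce_mult_cong[OF gl.G_inv(2)[OF xG] refl mc[OF xi xm] one_carrier_mat mc[OF As xi] mc[OF As xi]])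
  also have "1\<^sub>m n * (As * ?xi) = As * ?xi" by (rule left_mult_one_mat[OF mc[OF As xi]])
  finally have "reduce_mat r (As * ?xi) = reduce_mat r (?xi * As)" by (rule sym)
  thus "?xi \<in> L" unfolding L_iff D_def reduce_diff_0_iff[OF mc[OF As xi] mc[OF xi As]] using gl.G.inv_closed[OF xG] by blast
  fix y assume y: "y \<in> L"
  have yG: "y \<in> carrier gl.G" using y by (simp add: L_iff)
  obtain W W' where W: "E W" "x = reduce_mat r W" "E W'" "y = reduce_mat r W'" using L_rep[OF x] L_rep[OF y] by metis
  have "x \<otimes>\<^bsub>gl.G\<^esub> y = reduce_mat r (W * W')" unfolding W(2,4) by (rule E_L_mult[OF W(1,3)])
  thus "x \<otimes>\<^bsub>gl.G\<^esub> y \<in> L" using E_L[OF E_mult[OF W(1,3)]] gl.G.m_closed[OF xG yG] by (simp del: GL_trunc_mult)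
qed

sublocale L: subgroup L gl.G by (rule L_subgroup)

lemma GL_group: "group GL"
  by (rule gl.G.subgroup_imp_group[OF L_subgroup])

lemma pr_reduce: "E W \<Longrightarrow> i < N \<Longrightarrow> pr i (reduce_mat r W) = reduce_mat r (cmp i W)"
  unfolding pr_def by (rule component_cmp)

lemma pr_mult:
  assumes "x \<in> L" "y \<in> L" "i < N"
  shows "pr i (x \<otimes>\<^bsub>gl.G\<^esub> y) = pr i x \<otimes>\<^bsub>Gi i\<^esub> pr i y"
proof -
  obtain W W' where W: "E W" "x = reduce_mat r W" "E W'" "y = reduce_mat r W'" using L_rep[OF assms(1)] L_rep[OF assms(2)] by metis
  show ?thesis unfolding W(2,4) E_L_mult[OF W(1,3)] pr_reduce[OF E_mult[OF W(1,3)] assms(3)] cmp_mult[OF W(1,3) assms(3)]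
      pr_reduce[OF W(1) assms(3)] pr_reduce[OF W(3) assms(3)] by (rule GL_reduce_mult[OF cmp_carrier cmp_carrier, symmetric])
qed

lemma pr_closed:
  assumes "x \<in> L" "i < N"
  shows "pr i x \<in> carrier (Gi i)"
proof -
  have xi: "inv\<^bsub>gl.G\<^esub> x \<in> L" using assms(1) by (rule L.m_inv_closed)
  obtain W W' where W: "E W" "x = reduce_mat r W" "E W'" "inv\<^bsub>gl.G\<^esub> x = reduce_mat r W'" using L_rep[OF assms(1)] L_rep[OF xi] by metis
  have "reduce_mat r (W * W') = \<one>\<^bsub>gl.G\<^esub>" unfolding E_L_mult[OF W(1,3), symmetric] W(2)[symmetric] W(4)[symmetric]
    by (rule gl.G.r_inv[OF L.mem_carrier[OF assms(1)]])
  hence 1: "reduce_mat r (W * W') = reduce_mat r (1\<^sub>m n)" by simp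
  have "reduce_mat r (W' * W) = \<one>\<^bsub>gl.G\<^esub>" unfolding E_L_mult[OF W(3,1), symmetric] W(2)[symmetric] W(4)[symmetric]
    by (rule gl.G.l_inv[OF L.mem_carrier[OF assms(1)]])
  hence 2: "reduce_mat r (W' * W) = reduce_mat r (1\<^sub>m n)" by simp
  show ?thesis unfolding W(2) pr_reduce[OF W(1) assms(2)]
  proof (rule GL_reduce_carrier[OF coeff_ring_finite_subfield cmp_mats[OF W(1) assms(2)] cmp_mats[OF W(3) assms(2)]])
    show "reduce_mat r (cmp i W * cmp i W') = reduce_mat r (1\<^sub>m (mu i))"
      unfolding cmp_mult[OF W(1,3) assms(2), symmetric] cmp_one[OF assms(2), symmetric]
      by (rule cmp_cong[OF 1 E_carrier[OF E_mult[OF W(1,3)]] one_carrier_mat assms(2)])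
    show "reduce_mat r (cmp i W' * cmp i W) = reduce_mat r (1\<^sub>m (mu i))"
      unfolding cmp_mult[OF W(3,1) assms(2), symmetric] cmp_one[OF assms(2), symmetric]
      by (rule cmp_cong[OF 2 E_carrier[OF E_mult[OF W(3,1)]] one_carrier_mat assms(2)])
  qed
qed

text \<open>Assemble the given components and, separately, their inverses. The two products are
  congruent to the identity in each component, hence as matrices, by
  \<open>cmp_mod_inj\<close>.\<close>

lemma pr_surj:
  assumes "\<And>i. i < N \<Longrightarrow> x i \<in> carrier (Gi i)"
  shows "\<exists>g \<in> L. \<forall>i<N. pr i g = x i"
proof -
  have xm: "x i \<in> mats (ki i) (mu i)" "reduce_mat r (x i) = x i"
    "\<exists>y \<in> mats (ki i) (mu i). reduce_mat r (x i * y) = reduce_mat r (1\<^sub>m (mu i)) \<and> reduce_mat r (y * x i) = reduce_mat r (1\<^sub>m (mu i))"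
    if "i < N" for i
    using assms[OF that] unfolding GL_trunc_carrier_iff[OF coeff_ring_finite_subfield] by blast+
  from xm(3) obtain y where y: "\<And>i. i < N \<Longrightarrow> y i \<in> mats (ki i) (mu i)"
    "\<And>i. i < N \<Longrightarrow> reduce_mat r (x i * y i) = reduce_mat r (1\<^sub>m (mu i))"
    "\<And>i. i < N \<Longrightarrow> reduce_mat r (y i * x i) = reduce_mat r (1\<^sub>m (mu i))" by metis
  obtain W where W: "E W" "\<And>i. i < N \<Longrightarrow> cmp i W = x i" using cmp_surj[of x] xm(1) by blast
  obtain W' where W': "E W'" "\<And>i. i < N \<Longrightarrow> cmp i W' = y i" using cmp_surj[of y] y(1) by blast
  have "reduce_mat r (W * W') = reduce_mat r (1\<^sub>m n)"
    by (rule cmp_mod_inj[OF E_mult[OF W(1) W'(1)] E_one]) (simp only: cmp_mult[OF W(1) W'(1)] W(2) W'(2) y(2) cmp_one)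
  moreover have "reduce_mat r (W' * W) = reduce_mat r (1\<^sub>m n)"
    by (rule cmp_mod_inj[OF E_mult[OF W'(1) W(1)] E_one]) (simp only: cmp_mult[OF W'(1) W(1)] W(2) W'(2) y(3) cmp_one)
  ultimately have "reduce_mat r W \<in> carrier gl.G"
    using E_carrier[OF W(1)] E_carrier[OF W'(1)] by (intro GL_reduce_carrier[OF coeff_ring_UNIV, of _ _ W']) auto
  hence "reduce_mat r W \<in> L" by (rule E_L[OF W(1)])
  moreover have "pr i (reduce_mat r W) = x i" if "i < N" for i using pr_reduce[OF W(1) that] W(2)[OF that] xm(2)[OF that] by simp
  ultimately show ?thesis by blast
qed

lemma E_cong_elt: "E V \<Longrightarrow> E (1\<^sub>m n + fps_X ^ l \<cdot>\<^sub>m V)"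
  by (intro E_add E_one E_smult)

lemma TL_L: "TL \<subseteq> L"
proof
  fix t assume "t \<in> TL"
  then obtain V where V: "E V" "t = gl.cong_elt V" by (auto simp: TL_def)
  have "gl.cong_elt V \<in> carrier gl.G" using gl.cong_elt_T[of V] E_carrier[OF V(1)] gl.T_carrier by auto
  thus "t \<in> L" unfolding V(2) gl.cong_elt_def by (rule E_L[OF E_cong_elt[OF V(1)]])
qed

lemma pr_cong_elt:
  assumes V: "E V" and i: "i < N"
  shows "pr i (gl.cong_elt V) = cei i (cmp i V)"
proof -
  have "cmp i (1\<^sub>m n + fps_X ^ l \<cdot>\<^sub>m V) = 1\<^sub>m (mu i) + fps_X ^ l \<cdot>\<^sub>m cmp i V"
    using cmp_add[OF one_carrier_mat smult_carrier_mat[OF E_carrier[OF V]] i, of "fps_X ^ l"]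
    by (simp only: cmp_one[OF i] cmp_smult[OF E_carrier[OF V] i] O_embed_X_power)
  thus ?thesis unfolding gl.cong_elt_def pr_reduce[OF E_cong_elt[OF V] i] cei_def by simp
qed

lemma pr_TL: "t \<in> TL \<Longrightarrow> i < N \<Longrightarrow> pr i t \<in> cong_subgroup (ki i) (mu i) r l"
  unfolding TL_def using pr_cong_elt cei(1) cmp_mats by auto

lemma \<chi>_sum: "(\<Prod>i<M. \<chi> (f i)) = \<chi> (\<Sum>i<M. f i)" for M :: nat
  by (induction M) (simp_all add: gl.\<chi>_0 \<chi>(1) mult.commute)

text \<open>Independence of the factors of \<open>L\<close> supplies the hypotheses of
  \<open>kronecker_weight_rep\<close>. The last clause records one weight, that of
  \<open>Nt\<close>; the other weights are reached from it by conjugation.\<close>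

lemma nu_box_weight_rep:
  "\<exists>d u. weight_rep GL TL d (nu_box l r \<psi> A s fs Ns) \<and> u < d \<and>
    (\<forall>V. E V \<longrightarrow> nu_box l r \<psi> A s fs Ns (gl.cong_elt V) $$ (u, u) = \<chi> (mat_trace (Nt * V)))"
proof -
  obtain d u where d: "\<And>i. i < N \<Longrightarrow> weight_rep (Gi i) (cong_subgroup (ki i) (mu i) r l) (d i) (nui i)"
    and u: "\<And>i. i < N \<Longrightarrow> u i < d i"
      "\<And>i V. i < N \<Longrightarrow> V \<in> mats (ki i) (mu i) \<Longrightarrow> nui i (cei i V) $$ (u i, u i) = \<chi>i i (mat_trace (const_mat (Ns i) * V))"
    using nu_weights by metis
  define ds where "ds = map d [0..<N]"
  define \<rho>s where "\<rho>s = map (\<lambda>i g. nui i (pr i g)) [0..<N]"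
  have len: "length ds = N" "length \<rho>s = N" by (simp_all add: ds_def \<rho>s_def)
  have nth: "ds ! i = d i" "\<rho>s ! i = (\<lambda>g. nui i (pr i g))" if "i < N" for i using that by (simp_all add: ds_def \<rho>s_def)
  have box: "nu_box l r \<psi> A s fs Ns = (\<lambda>g. kronecker_list (map (\<lambda>\<rho>. \<rho> g) \<rho>s))"
    by (rule ext) (simp add: nu_box_def \<rho>s_def pr_def comp_def)
  have one: "pr i \<one>\<^bsub>gl.G\<^esub> = \<one>\<^bsub>Gi i\<^esub>" if "i < N" for i
  proof -
    have "pr i \<one>\<^bsub>gl.G\<^esub> = reduce_mat r (1\<^sub>m (mu i))" unfolding GL_trunc_one pr_reduce[OF E_one that] cmp_one[OF that] ..
    thus ?thesis by simp
  qed
  have rep: "representation GL (d i) (\<lambda>g. nui i (pr i g))" if i: "i < N" for i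
  proof (rule representationI[OF GL_group])
    note ri = weight_repD(1)[OF d[OF i]]
    fix g assume g: "g \<in> carrier GL"
    hence gL: "g \<in> L" by simp
    show "nui i (pr i g) \<in> carrier_mat (d i) (d i)" by (rule representation_carrier[OF ri pr_closed[OF gL i]])
    fix g' assume "g' \<in> carrier GL"
    hence g'L: "g' \<in> L" by simp
    have "nui i (pr i (g \<otimes>\<^bsub>gl.G\<^esub> g')) = nui i (pr i g) * nui i (pr i g')"
      unfolding pr_mult[OF gL g'L i] by (rule representation_mult[OF ri pr_closed[OF gL i] pr_closed[OF g'L i]])
    thus "nui i (pr i (g \<otimes>\<^bsub>GL\<^esub> g')) = nui i (pr i g) * nui i (pr i g')" by simp
  next
    have "nui i (pr i \<one>\<^bsub>gl.G\<^esub>) = 1\<^sub>m (d i)" unfolding one[OF i] by (rule representation_one[OF weight_repD(1)[OF d[OF i]] cei(4)[OF i]])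
    thus "nui i (pr i \<one>\<^bsub>GL\<^esub>) = 1\<^sub>m (d i)" by simp
  qed
  have wr: "weight_rep GL TL (prod_list ds) (\<lambda>g. kronecker_list (map (\<lambda>\<rho>. \<rho> g) \<rho>s))"
  proof (rule kronecker_weight_rep[OF GL_group])
    show "length \<rho>s = length ds" by (simp add: len)
    show "TL \<subseteq> carrier GL" using TL_L by simp
    show "representation GL (ds ! k) (\<rho>s ! k)" if "k < length ds" for k using rep[of k] nth[of k] that len by simp
    show "diagonal_mat ((\<rho>s ! k) t)" if k: "k < length ds" and t: "t \<in> TL" for k t
    proof -
      have kN: "k < N" using k len by simp
      show ?thesis unfolding nth[OF kN] by (rule weight_repD(2)[OF d[OF kN] pr_TL[OF t kN]])
    qed
    show "\<exists>t \<in> TL. (\<rho>s ! k) t $$ (i, i) \<noteq> (\<rho>s ! k) t $$ (j, j) \<and> (\<forall>k' < length ds. k' \<noteq> k \<longrightarrow> (\<rho>s ! k') t = 1\<^sub>m (ds ! k'))"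
      if k: "k < length ds" and ij: "i < ds ! k" "j < ds ! k" "i \<noteq> j" for k i j
    proof -
      have kN: "k < N" using k len by simp
      have ij': "i < d k" "j < d k" using ij nth[OF kN] by simp_all
      obtain t where t: "t \<in> cong_subgroup (ki k) (mu k) r l" "nui k t $$ (i, i) \<noteq> nui k t $$ (j, j)"
        using weight_repD(3)[OF d[OF kN] ij' ij(3)] by blast
      obtain V where V: "V \<in> mats (ki k) (mu k)" "t = cei k V" using cei(2)[OF kN t(1)] by blast
      \<comment> \<open>A matrix with component \<open>V\<close> in factor \<open>k\<close> and zero
        elsewhere gives an element of \<open>TL\<close> that acts as the identity in all other
        factors.\<close>
      have m: "(if i = k then V else 0\<^sub>m (mu i) (mu i)) \<in> mats (ki i) (mu i)" for i
        using V(1) mats_closed(2)[OF coeff_ring_finite_subfield] by (cases "i = k") simp_all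
      obtain Z where Z: "E Z" "\<And>i. i < N \<Longrightarrow> cmp i Z = (if i = k then V else 0\<^sub>m (mu i) (mu i))"
        using cmp_surj[OF m] by blast
      have "pr k (gl.cong_elt Z) = t" unfolding pr_cong_elt[OF Z(1) kN] V(2) using Z(2)[OF kN] by simp
      moreover have "nui k' (pr k' (gl.cong_elt Z)) = 1\<^sub>m (d k')" if k': "k' < N" "k' \<noteq> k" for k'
      proof -
        have "cmp k' Z = 0\<^sub>m (mu k') (mu k')" using Z(2)[OF k'(1)] k'(2) by simp
        hence "pr k' (gl.cong_elt Z) = \<one>\<^bsub>Gi k'\<^esub>" unfolding pr_cong_elt[OF Z(1) k'(1)] cei_def by simp
        thus ?thesis using representation_one[OF weight_repD(1)[OF d[OF k'(1)]] cei(4)[OF k'(1)]] by (simp del: GL_trunc_one)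
      qed
      moreover have "gl.cong_elt Z \<in> TL" using Z(1) by (simp add: TL_def)
      ultimately show ?thesis using t(2) nth[OF kN] nth len by (intro bexI[of _ "gl.cong_elt Z"]) auto
    qed
    fix us vs assume uv: "list_all2 (<) us ds" "list_all2 (<) vs ds"
    have "\<exists>x. i < N \<longrightarrow> x \<in> carrier (Gi i) \<and> moves_basis (d i) (nui i x) (vs ! i) (us ! i)" for i
    proof (cases "i < N")
      case True
      have "us ! i < d i" "vs ! i < d i" using uv True len nth[OF True] by (auto simp: list_all2_conv_all_nth)
      thus ?thesis using weight_repD(4)[OF d[OF True]] by blast
    qed simp
    then obtain x where x: "\<And>i. i < N \<Longrightarrow> x i \<in> carrier (Gi i)" "\<And>i. i < N \<Longrightarrow> moves_basis (d i) (nui i (x i)) (vs ! i) (us ! i)" by metis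
    obtain g where g: "g \<in> L" "\<And>i. i < N \<Longrightarrow> pr i g = x i" using pr_surj[of x] x(1) by blast
    show "\<exists>g \<in> carrier GL. \<forall>k < length ds. moves_basis (ds ! k) ((\<rho>s ! k) g) (vs ! k) (us ! k)"
      using g x(2) len nth by (intro bexI[of _ g]) auto
  qed
  \<comment> \<open>The basis vector whose digits are the \<open>u i\<close> has as weight the
    product of the weights of the \<open>Ns i\<close>; by the trace formula this is the weight of
    \<open>Nt\<close>.\<close>
  have "list_all2 (<) (map u [0..<N]) ds" using u(1) by (simp add: ds_def list_all2_conv_all_nth)
  then obtain v where v: "v < prod_list ds" "digits ds v = map u [0..<N]" using digits_surj by blast
  have "nu_box l r \<psi> A s fs Ns (gl.cong_elt V) $$ (v, v) = \<chi> (mat_trace (Nt * V))" if V: "E V" for V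
  proof -
    have t: "gl.cong_elt V \<in> L" using TL_L V by (auto simp: TL_def)
    have car: "list_all2 (\<lambda>Z d. Z \<in> carrier_mat d d) (map (\<lambda>\<rho>. \<rho> (gl.cong_elt V)) \<rho>s) ds"
      using representation_carrier[OF rep, of _ "gl.cong_elt V"] t by (auto simp: list_all2_conv_all_nth len nth)
    have "nu_box l r \<psi> A s fs Ns (gl.cong_elt V) $$ (v, v) = (\<Prod>i<N. nui i (pr i (gl.cong_elt V)) $$ (u i, u i))"
      unfolding box kronecker_list_index[OF car v(1) v(1)] using v(2) by (auto simp: len nth intro!: prod.cong)
    also have "\<dots> = (\<Prod>i<N. \<chi> (unram_trace (dg i) (mat_trace (cmp i (Nt * V)))))"
      by (intro prod.cong refl) (simp add: pr_cong_elt[OF V] u(2) cmp_mats[OF V] Ns[symmetric] cmp_mult[OF Nt V] \<chi>i_def)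
    also have "\<dots> = \<chi> (\<Sum>i<N. unram_trace (dg i) (mat_trace (cmp i (Nt * V))))"
      by (rule \<chi>_sum)
    also have "\<dots> = \<chi> (mat_trace (Nt * V))" by (simp only: cmp_trace[OF E_mult[OF Nt V]])
    finally show ?thesis .
  qed
  thus ?thesis using wr v(1) unfolding box by blast
qed

end

section \<open>Jordan induction\<close>

lemma fps_cutoff_det_reduce:
  fixes Z :: "'a::comm_ring_1 fps mat"
  assumes "Z \<in> carrier_mat n n"
  shows "fps_cutoff m (det (reduce_mat m Z)) = fps_cutoff m (det Z)"
  by (rule fps_cutoff_det_cong[of _ _ _ n]) (use assms in auto)

lemma trunc_det_unit:
  assumes k: "coeff_ring k" and x: "x \<in> carrier (GL_trunc k n m)"
  shows "fps_cutoff m (det x) \<in> carrier (units_of (trunc_ring k m))"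
proof -
  obtain y where xy: "x \<in> mats k n" "y \<in> mats k n" "reduce_mat m (x * y) = reduce_mat m (1\<^sub>m n)"
    using x unfolding GL_trunc_carrier_iff[OF k] by blast
  note c = matsD(1)[OF xy(1)] matsD(1)[OF xy(2)]
  have "fps_cutoff m (det x * det y) = fps_cutoff m 1"
    using fps_cutoff_det_cong[OF xy(3) mult_carrier_mat[OF c] one_carrier_mat] by (simp add: det_mult[OF c])
  hence 1: "fps_cutoff m (fps_cutoff m (det x) * fps_cutoff m (det y)) = fps_cutoff m 1"
    by (simp add: fps_cutoff_mult_cutoff)
  have car: "fps_cutoff m (det z) \<in> carrier (trunc_ring k m)" if "z \<in> mats k n" for z
    using fps_over_closed(2)[OF k det_over[OF k that], of m] by (simp add: trunc_ring_def fps_over_def)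
  have ops: "a \<otimes>\<^bsub>trunc_ring k m\<^esub> b = fps_cutoff m (a * b)" "\<one>\<^bsub>trunc_ring k m\<^esub> = fps_cutoff m 1" for a b
    by (simp_all add: trunc_ring_def)
  have "fps_cutoff m (det x) \<in> Units (trunc_ring k m)" unfolding Units_def
  proof (intro CollectI conjI bexI)
    show "fps_cutoff m (det y) \<otimes>\<^bsub>trunc_ring k m\<^esub> fps_cutoff m (det x) = \<one>\<^bsub>trunc_ring k m\<^esub>"
      "fps_cutoff m (det x) \<otimes>\<^bsub>trunc_ring k m\<^esub> fps_cutoff m (det y) = \<one>\<^bsub>trunc_ring k m\<^esub>"
      unfolding ops using 1 by (simp_all only: mult.commute)
  qed (use car xy in auto)
  thus ?thesis by (simp add: units_of_def)
qed

lemma trunc_det_mult: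
  assumes k: "coeff_ring k" and x: "x \<in> carrier (GL_trunc k n m)" "y \<in> carrier (GL_trunc k n m)"
  shows "fps_cutoff m (det (x \<otimes>\<^bsub>GL_trunc k n m\<^esub> y)) =
    fps_cutoff m (det x) \<otimes>\<^bsub>units_of (trunc_ring k m)\<^esub> fps_cutoff m (det y)"
proof -
  have "x \<in> mats k n" "y \<in> mats k n" using x unfolding GL_trunc_carrier_iff[OF k] by blast+
  hence c: "x \<in> carrier_mat n n" "y \<in> carrier_mat n n" by (auto dest: matsD)
  show ?thesis using fps_cutoff_det_reduce[OF mult_carrier_mat[OF c], of m]
    by (simp add: units_of_def trunc_ring_def fps_cutoff_mult_cutoff det_mult[OF c])
qed

context jordan_data
begin

abbreviation "phis \<equiv> phi_s r A s \<phi> fs"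
abbreviation "nub \<equiv> nu_box l r \<psi> A s fs Ns"

lemma phis_hom: "phis \<in> hom GL (units_of class_ring)"
  unfolding class_ring_character
proof (intro conjI ballI)
  have u: "fps_cutoff r (det (pr i g)) \<in> carrier (units_of (trunc_ring (ki i) r))" if "g \<in> L" "i < N" for g i
    by (rule trunc_det_unit[OF coeff_ring_finite_subfield pr_closed[OF that]])
  show "phis x \<noteq> 0" if "x \<in> carrier GL" for x
  proof -
    have xL: "x \<in> L" using that by simp
    have "\<phi> (fst (fs ! i)) (fps_cutoff r (det (pr i x))) \<noteq> 0" if "i < N" for i
      using phi[OF that] u[OF xL that] unfolding class_ring_character by blast
    thus ?thesis by (simp add: phi_s_def pr_def)
  qed
  fix x y assume "x \<in> carrier GL" "y \<in> carrier GL"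
  hence xy: "x \<in> L" "y \<in> L" by simp_all
  have "\<phi> (fst (fs ! i)) (fps_cutoff r (det (pr i (x \<otimes>\<^bsub>gl.G\<^esub> y)))) =
      \<phi> (fst (fs ! i)) (fps_cutoff r (det (pr i x))) * \<phi> (fst (fs ! i)) (fps_cutoff r (det (pr i y)))" if i: "i < N" for i
    unfolding pr_mult[OF xy i] trunc_det_mult[OF coeff_ring_finite_subfield pr_closed[OF xy(1) i] pr_closed[OF xy(2) i]]
    using phi[OF i] u[OF xy(1) i] u[OF xy(2) i] unfolding class_ring_character by blast
  hence "phis (x \<otimes>\<^bsub>gl.G\<^esub> y) = phis x * phis y"
    unfolding phi_s_def pr_def[symmetric] prod.distrib[symmetric] by (intro prod.cong refl) (simp del: GL_trunc_mult)
  thus "phis (x \<otimes>\<^bsub>GL\<^esub> y) = phis x * phis y" by simp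
qed

text \<open>To first order the determinant of \<open>1 + \<pi>^l V\<close> is
  \<open>1 + \<pi>^l\<close> times the trace, and the error is divisible by \<open>\<pi>^r\<close>.
  The prescribed values of \<open>\<phi>\<close> then insert the scalar \<open>si i\<close>, which
  is the action of \<open>As\<close>.\<close>

lemma phis_cong_elt:
  assumes V: "E V"
  shows "phis (gl.cong_elt V) = \<chi> (mat_trace (As * V))"
proof -
  have "\<phi> (fst (fs ! i)) (fps_cutoff r (det (pr i (gl.cong_elt V)))) = \<chi> (unram_trace (dg i) (mat_trace (cmp i (As * V))))"
    if i: "i < N" for i
  proof -
    let ?Z = "1\<^sub>m (mu i) + fps_X ^ l \<cdot>\<^sub>m cmp i V"
    have "mat_trace (cmp i V) \<in> fps_over (ki i)" unfolding mat_trace_def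
      using cmp_mats[OF V i] by (intro coeff_ring_sum[OF coeff_ring_fps_over[OF coeff_ring_finite_subfield]]) (auto simp: mats_def)
    hence t: "mat_trace (cmp i V) \<in> O_ext (dg i)" by (simp add: O_ext_eq_fps_over)
    have "fps_X ^ r dvd det ?Z - (1 + fps_X ^ l * mat_trace (cmp i V))"
      using det_one_plus_smult[OF cmp_carrier, of "fps_X ^ l" i V] by (simp add: r mult_2 power_add diff_diff_eq)
    hence "fps_cutoff r (det ?Z) = fps_cutoff r (1 + fps_X ^ l * mat_trace (cmp i V))"
      by (simp only: fps_cutoff_eq_iff_dvd)
    moreover have "fps_cutoff r (det (reduce_mat r ?Z)) = fps_cutoff r (det ?Z)"
      by (rule fps_cutoff_det_reduce[of _ "mu i"]) simp
    ultimately have "\<phi> (fst (fs ! i)) (fps_cutoff r (det (pr i (gl.cong_elt V)))) =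
        \<psi> (fps_cutoff l (unram_trace (dg i) (si i * mat_trace (cmp i V))))"
      unfolding pr_cong_elt[OF V i] cei_def using phi_cong[OF i t] by simp
    thus ?thesis unfolding cmp_As_mult[OF V i] mat_trace_smult[OF cmp_carrier] \<chi>_def .
  qed
  hence "phis (gl.cong_elt V) = (\<Prod>i<N. \<chi> (unram_trace (dg i) (mat_trace (cmp i (As * V)))))"
    unfolding phi_s_def pr_def[symmetric] by (intro prod.cong) auto
  also have "\<dots> = \<chi> (mat_trace (As * V))" by (simp only: \<chi>_sum cmp_trace[OF E_mult[OF E_As V]])
  finally show ?thesis .
qed

definition "B = As + Nt"

lemma B: "E B" "B \<in> carrier_mat n n"
  unfolding B_def using E_add[OF E_As Nt] E_carrier by blast+

definition "KD = (\<lambda>Y. gl.cong_elt (D Y)) ` carrier_mat n n"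

text \<open>The kernel in the definitions uses truncated \<open>As\<close> and \<open>Y\<close>;
  after multiplication by \<open>\<pi>^l\<close> only residues modulo \<open>\<pi>^l\<close> matter,
  so the untruncated description gives the same set.\<close>

lemma L_kernel_eq: "L_kernel n l r A fs = KD"
proof -
  let ?A = "reduce_mat r As"
  have eq: "reduce_mat r (1\<^sub>m n + fps_X ^ l \<cdot>\<^sub>m (?A * Y - Y * ?A)) = gl.cong_elt (D Y)" if Y: "Y \<in> carrier_mat n n" for Y
  proof -
    have Ac: "?A \<in> carrier_mat n n" using As by simp
    have "reduce_mat r (?A * Y - Y * ?A) = reduce_mat r (D Y)" unfolding D_def
      by (rule reduce_add_cong(2)[OF reduce_mult_reduce(1)[OF As Y] reduce_mult_reduce(2)[OF Y As]
            mult_carrier_mat[OF Ac Y] mult_carrier_mat[OF As Y] mult_carrier_mat[OF Y Ac] mult_carrier_mat[OF Y As]])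
    hence 1: "reduce_mat l (?A * Y - Y * ?A) = reduce_mat l (D Y)" by (rule reduce_mono[OF _ gl.lr])
    have "?A * Y - Y * ?A \<in> carrier_mat n n" by (rule square_carrier_closed(2)[OF mult_carrier_mat[OF Ac Y] mult_carrier_mat[OF Y Ac]])
    thus ?thesis unfolding gl.cong_elt_def[symmetric] using gl.cong_elt_cong[OF 1] D_carrier[OF Y] by simp
  qed
  have c: "Y \<in> carrier_mat n n" if "Y \<in> carrier (trunc_mat_ring UNIV n r)" for Y :: "'q fps mat"
    using that by (simp add: carrier_trunc_mat_ring)
  have "\<exists>Y' \<in> carrier (trunc_mat_ring UNIV n r). gl.cong_elt (D Y) = gl.cong_elt (D Y')" if Y: "Y \<in> carrier_mat n n" for Y
  proof (intro bexI)
    have rY: "reduce_mat r Y \<in> carrier_mat n n" using Y by simp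
    have "reduce_mat l (D Y) = reduce_mat l (D (reduce_mat r Y))"
      by (rule D_cong[OF _ Y rY]) (simp add: gl.lr)
    thus "gl.cong_elt (D Y) = gl.cong_elt (D (reduce_mat r Y))"
      by (rule gl.cong_elt_cong) (simp_all only: mats_UNIV D_carrier[OF Y] D_carrier[OF rY])
    show "reduce_mat r Y \<in> carrier (trunc_mat_ring UNIV n r)" using Y by (simp add: carrier_trunc_mat_ring)
  qed
  hence "\<exists>Y' \<in> carrier (trunc_mat_ring UNIV n r). gl.cong_elt (D Y) = reduce_mat r (1\<^sub>m n + fps_X ^ l \<cdot>\<^sub>m (?A * Y' - Y' * ?A))"
    if "Y \<in> carrier_mat n n" for Y using that eq[OF c] by metis
  moreover have "reduce_mat r (1\<^sub>m n + fps_X ^ l \<cdot>\<^sub>m (?A * Y - Y * ?A)) \<in> KD"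
    if "Y \<in> carrier (trunc_mat_ring UNIV n r)" for Y unfolding eq[OF c[OF that]] KD_def using c[OF that] by blast
  ultimately show ?thesis unfolding L_kernel_def Let_def
  proof (intro equalityI subsetI, goal_cases)
    case (1 x)
    then obtain Y where "x = reduce_mat r (1\<^sub>m n + fps_X ^ l \<cdot>\<^sub>m (?A * Y - Y * ?A))" "Y \<in> carrier (trunc_mat_ring UNIV n r)"
      unfolding mem_Collect_eq by (elim exE conjE)
    thus ?case using 1(2) by simp
  next
    case (2 x)
    obtain Y where "x = gl.cong_elt (D Y)" "Y \<in> carrier_mat n n" using 2(3) unfolding KD_def by (rule imageE)
    thus ?case using 2(1)[of Y] unfolding mem_Collect_eq by metis
  qed
qed

lemma KD_T: "KD \<subseteq> gl.T"
  unfolding KD_def using gl.cong_elt_T by auto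

sublocale sd: semidirect gl.G L KD
proof (rule semidirect.intro)
  show "group gl.G" by (rule gl.G.is_group)
  show "subgroup L gl.G" by (rule L_subgroup)
  show KDs: "subgroup KD gl.G"
  proof (rule gl.G.subgroupI)
    show "KD \<subseteq> carrier gl.G" using KD_T gl.T_carrier by blast
    show "KD \<noteq> {}" unfolding KD_def using zero_carrier_mat by blast
    fix a assume "a \<in> KD"
    then obtain Y where Y: "Y \<in> carrier_mat n n" "a = gl.cong_elt (D Y)" by (auto simp: KD_def)
    have mult: "gl.cong_elt (D Y) \<otimes>\<^bsub>gl.G\<^esub> gl.cong_elt (D Y') = gl.cong_elt (D (Y + Y'))" if "Y \<in> carrier_mat n n" "Y' \<in> carrier_mat n n" for Y Y'
      using gl.cong_elt_mult[of "D Y" "D Y'"] that by (simp add: D_add del: GL_trunc_mult)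
    have m: "(- 1) \<cdot>\<^sub>m Y \<in> carrier_mat n n" using Y by simp
    have "(- 1) \<cdot>\<^sub>m Y + Y = 0\<^sub>m n n" using Y by (intro eq_matI) auto
    hence "gl.cong_elt (D ((- 1) \<cdot>\<^sub>m Y)) \<otimes>\<^bsub>gl.G\<^esub> a = gl.cong_elt (D (0\<^sub>m n n))" unfolding Y(2) mult[OF m Y(1)] by simp
    also have "D (0\<^sub>m n n) = 0\<^sub>m n n" using As by (simp add: D_def)
    also have "gl.cong_elt (0\<^sub>m n n) = \<one>\<^bsub>gl.G\<^esub>" by (simp add: gl.cong_elt_def)
    finally have "inv\<^bsub>gl.G\<^esub> a = gl.cong_elt (D ((- 1) \<cdot>\<^sub>m Y))"
      using Y(2) m gl.cong_elt_T[of "D Y"] gl.cong_elt_T[of "D ((- 1) \<cdot>\<^sub>m Y)"] gl.T_carrier Y(1) D_carrier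
      by (intro gl.G.inv_equality) auto
    thus "inv\<^bsub>gl.G\<^esub> a \<in> KD" unfolding KD_def using m by blast
    fix b assume "b \<in> KD"
    then obtain Y' where Y': "Y' \<in> carrier_mat n n" "b = gl.cong_elt (D Y')" by (auto simp: KD_def)
    have "a \<otimes>\<^bsub>gl.G\<^esub> b = gl.cong_elt (D (Y + Y'))" unfolding Y(2) Y'(2) by (rule mult[OF Y(1) Y'(1)])
    thus "a \<otimes>\<^bsub>gl.G\<^esub> b \<in> KD" unfolding KD_def using add_carrier_mat[OF Y'(1)] by blast
  qed
  fix x assume x: "x \<in> L"
  obtain W where W: "E W" "x = reduce_mat r W" using L_rep[OF x] by blast
  note xG = L.mem_carrier[OF x]
  \<comment> \<open>For \<open>x = 1 + \<pi>^l D Y\<close> in \<open>L\<close> the commutator gives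
    \<open>D (D Y) = 0\<close> modulo \<open>\<pi>^l\<close>. By \<open>D_square\<close> already
    \<open>D Y\<close> vanishes there.\<close>
  show "x = \<one>\<^bsub>gl.G\<^esub>" if xK: "x \<in> KD"
  proof -
    obtain Y where Y: "Y \<in> carrier_mat n n" "x = gl.cong_elt (D Y)"
      using xK by (auto simp: KD_def)
    note DY = D_carrier[OF Y(1)] D_carrier[OF D_carrier[OF Y(1)]]
    let ?Z = "1\<^sub>m n + fps_X ^ l \<cdot>\<^sub>m D Y"
    have Zc: "?Z \<in> carrier_mat n n" using DY by simp
    have "reduce_mat r W = reduce_mat r ?Z" using W(2) Y(2) by (simp add: gl.cong_elt_def)
    hence "reduce_mat r (D ?Z) = 0\<^sub>m n n" by (rule E_reduce_D[OF W(1) _ Zc])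
    also have "D ?Z = fps_X ^ l \<cdot>\<^sub>m D (D Y)"
    proof -
      have "D ?Z = D (1\<^sub>m n) + D (fps_X ^ l \<cdot>\<^sub>m D Y)" by (rule D_add[OF one_carrier_mat smult_carrier_mat[OF DY(1)]])
      also have "D (1\<^sub>m n) = 0\<^sub>m n n" by (rule E_D[OF E_one])
      also have "D (fps_X ^ l \<cdot>\<^sub>m D Y) = fps_X ^ l \<cdot>\<^sub>m D (D Y)" by (rule D_smult[OF DY(1)])
      finally show ?thesis using DY(2) by simp
    qed
    finally have "reduce_mat (l + l) (fps_X ^ l \<cdot>\<^sub>m D (D Y)) = reduce_mat (l + l) (fps_X ^ l \<cdot>\<^sub>m 0\<^sub>m n n)"
      using r by (auto simp: mat_eq_iff mult_2)
    hence "reduce_mat l (D (D Y)) = reduce_mat l (0\<^sub>m n n)" by (rule reduce_X_power_smult_cancel[OF _ DY(2) zero_carrier_mat])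
    hence "reduce_mat l (D (D Y)) = 0\<^sub>m n n" by (auto simp: mat_eq_iff)
    hence "reduce_mat l (D Y) = 0\<^sub>m n n" by (rule D_square[OF Y(1)])
    hence "reduce_mat l (D Y) = reduce_mat l (0\<^sub>m n n)" by (auto simp: mat_eq_iff)
    hence "x = gl.cong_elt (0\<^sub>m n n)" unfolding Y(2) using DY by (intro gl.cong_elt_cong) auto
    thus ?thesis by (simp add: gl.cong_elt_def)
  qed
  show "inv\<^bsub>gl.G\<^esub> x \<otimes>\<^bsub>gl.G\<^esub> y \<otimes>\<^bsub>gl.G\<^esub> x \<in> KD" if y: "y \<in> KD" for y
  proof -
    obtain Y where Y: "Y \<in> carrier_mat n n" "y = gl.cong_elt (D Y)" using y by (auto simp: KD_def)
    obtain W' where W': "E W'" "inv\<^bsub>gl.G\<^esub> x = reduce_mat r W'" using L_rep[OF L.m_inv_closed[OF x]] by blast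
    note c = E_carrier[OF W(1)] E_carrier[OF W'(1)] D_carrier[OF Y(1)]
    note mc = mult_carrier_mat[of _ n n _ n]
    have c': "reduce_mat r W \<in> carrier_mat n n" "reduce_mat r W' \<in> carrier_mat n n" using c by auto
    have l: "reduce_mat l (reduce_mat r W) = reduce_mat l W" "reduce_mat l (reduce_mat r W') = reduce_mat l W'"
      by (simp_all add: gl.lr)
    have "reduce_mat l (reduce_mat r W' * D Y * reduce_mat r W) = reduce_mat l (W' * D Y * W)"
      by (rule reduce_mult_cong[OF reduce_mult_cong[OF l(2) refl c'(2) c(2,3,3)] l(1) mc[OF c'(2) c(3)] mc[OF c(2,3)] c'(1) c(1)])
    also have "W' * D Y * W = D (W' * Y * W)" by (rule E_D_mult[OF W'(1) W(1) Y(1)])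
    finally have "gl.cong_elt (reduce_mat r W' * D Y * reduce_mat r W) = gl.cong_elt (D (W' * Y * W))"
      using mc[OF mc[OF c'(2) c(3)] c'(1)] D_carrier[OF mc[OF mc[OF c(2) Y(1)] c(1)]] by (intro gl.cong_elt_cong) auto
    moreover have "inv\<^bsub>gl.G\<^esub> x \<otimes>\<^bsub>gl.G\<^esub> y \<otimes>\<^bsub>gl.G\<^esub> x = gl.cong_elt (inv\<^bsub>gl.G\<^esub> x * D Y * x)"
      unfolding Y(2) using c(3) by (intro gl.cong_elt_conj xG) auto
    ultimately have "inv\<^bsub>gl.G\<^esub> x \<otimes>\<^bsub>gl.G\<^esub> y \<otimes>\<^bsub>gl.G\<^esub> x = gl.cong_elt (D (W' * Y * W))"
      unfolding W'(2) W(2)[symmetric] by (simp only: W(2))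
    thus ?thesis unfolding KD_def using mc[OF mc[OF c(2) Y(1)] c(1)] by blast
  qed
qed

lemma L_projection_eq: "L_projection n l r A fs = sd.proj"
  unfolding L_projection_def sd.proj_def Let_def L_def[symmetric] L_kernel_eq by (rule refl)

definition "H = L <#>\<^bsub>gl.G\<^esub> gl.T"

text \<open>The additive splitting of a matrix modulo \<open>\<pi>^l\<close> becomes a factorisation
  because \<open>T\<close> is abelian.\<close>

lemma T_split:
  assumes Z: "Z \<in> carrier_mat n n"
  obtains W Y where "E W" "Y \<in> carrier_mat n n" "gl.cong_elt Z = gl.cong_elt W \<otimes>\<^bsub>gl.G\<^esub> gl.cong_elt (D Y)"
    "reduce_mat l Z = reduce_mat l (W + D Y)"
proof -
  obtain W Y where W: "E W" "Y \<in> carrier_mat n n" "reduce_mat l Z = reduce_mat l (W + D Y)" using decomposition[OF Z] by blast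
  note c = E_carrier[OF W(1)] D_carrier[OF W(2)]
  have "gl.cong_elt Z = gl.cong_elt (W + D Y)" using W(3) Z add_carrier_mat[OF c(2)] by (intro gl.cong_elt_cong) auto
  also have "\<dots> = gl.cong_elt W \<otimes>\<^bsub>gl.G\<^esub> gl.cong_elt (D Y)" using c by (intro gl.cong_elt_mult[symmetric]) auto
  finally show ?thesis using W that by blast
qed

lemma H_subgroup: "subgroup H gl.G"
  unfolding H_def by (rule subgroup_set_mult[OF gl.G.is_group L_subgroup gl.T_subgroup gl.T_normal])

sublocale H: subgroup H gl.G by (rule H_subgroup)

lemma T_elt: "t \<in> gl.T \<Longrightarrow> \<exists>Z \<in> carrier_mat n n. t = gl.cong_elt Z"
  using gl.elt_cong_part by (metis mats_UNIV)

text \<open>The part of an element of \<open>T\<close> that commutes with \<open>As\<close> is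
  absorbed into \<open>L\<close>, so the product with \<open>T\<close> is a semidirect product with
  the smaller group \<open>KD\<close>.\<close>

lemma H_cases:
  assumes "g \<in> H"
  obtains x y where "x \<in> L" "y \<in> KD" "g = x \<otimes>\<^bsub>gl.G\<^esub> y"
proof -
  obtain x t where xt: "x \<in> L" "t \<in> gl.T" "g = x \<otimes>\<^bsub>gl.G\<^esub> t" using assms unfolding H_def set_mult_def by blast
  obtain Z where Z: "Z \<in> carrier_mat n n" "t = gl.cong_elt Z" using T_elt[OF xt(2)] by blast
  obtain W Y where W: "E W" "Y \<in> carrier_mat n n" "t = gl.cong_elt W \<otimes>\<^bsub>gl.G\<^esub> gl.cong_elt (D Y)" using T_split[OF Z(1)] Z(2) by metis
  have WL: "gl.cong_elt W \<in> L" using TL_L W(1) by (auto simp: TL_def)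
  have yK: "gl.cong_elt (D Y) \<in> KD" using W(2) by (auto simp: KD_def)
  have "g = (x \<otimes>\<^bsub>gl.G\<^esub> gl.cong_elt W) \<otimes>\<^bsub>gl.G\<^esub> gl.cong_elt (D Y)"
    unfolding xt(3) W(3) by (rule gl.G.m_assoc[symmetric, OF L.mem_carrier[OF xt(1)] L.mem_carrier[OF WL] sd.K.mem_carrier[OF yK]])
  thus ?thesis using that[OF L.m_closed[OF xt(1) WL] yK] by blast
qed

lemma LK_H: "x \<in> L \<Longrightarrow> y \<in> KD \<Longrightarrow> x \<otimes>\<^bsub>gl.G\<^esub> y \<in> H"
  unfolding H_def set_mult_def using KD_T by blast

lemma L_H: "x \<in> L \<Longrightarrow> x \<in> H" and proj_L: "x \<in> L \<Longrightarrow> sd.proj x = x"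
proof -
  assume x: "x \<in> L"
  have "x \<otimes>\<^bsub>gl.G\<^esub> \<one>\<^bsub>gl.G\<^esub> = x" by (rule gl.G.r_one[OF L.mem_carrier[OF x]])
  thus "x \<in> H" "sd.proj x = x" using LK_H[OF x sd.K.one_closed] sd.proj[OF x sd.K.one_closed] by metis+
qed

lemma T_sub_H: "gl.T \<subseteq> H"
proof
  fix t assume t: "t \<in> gl.T"
  have "t = \<one>\<^bsub>gl.G\<^esub> \<otimes>\<^bsub>gl.G\<^esub> t" by (rule gl.G.l_one[symmetric]) (use t gl.T_carrier in blast)
  thus "t \<in> H" unfolding H_def set_mult_def using L.one_closed t by blast
qed

lemma TL_T: "TL \<subseteq> gl.T"
  unfolding TL_def using gl.cong_elt_T E_carrier by auto

abbreviation "GH \<equiv> gl.G\<lparr>carrier := H\<rparr>"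
definition "\<sigma> g = phis (sd.proj g) \<cdot>\<^sub>m nub (sd.proj g)"

lemma proj_hom: "sd.proj \<in> hom GH GL"
proof (rule homI)
  fix g g' assume "g \<in> carrier GH" "g' \<in> carrier GH"
  hence g: "g \<in> H" "g' \<in> H" by simp_all
  obtain x y x' y' where xy: "x \<in> L" "y \<in> KD" "g = x \<otimes>\<^bsub>gl.G\<^esub> y" "x' \<in> L" "y' \<in> KD" "g' = x' \<otimes>\<^bsub>gl.G\<^esub> y'"
    using H_cases[OF g(1)] H_cases[OF g(2)] by metis
  show "sd.proj (g \<otimes>\<^bsub>GH\<^esub> g') = sd.proj g \<otimes>\<^bsub>GL\<^esub> sd.proj g'"
    using sd.proj_mult[OF xy(1,2,4,5)] unfolding xy(3,6) by (simp del: GL_trunc_mult)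
  show "sd.proj g \<in> carrier GL" unfolding xy(3) sd.proj[OF xy(1,2)] using xy(1) by simp
qed

text \<open>The twist contributes the weight of \<open>As\<close> and the tensor product that of
  \<open>Nt\<close>; together they give the weight of \<open>B\<close>.\<close>

lemma \<sigma>_weights:
  "\<exists>d u. weight_rep GH gl.T d \<sigma> \<and> u < d \<and> (\<forall>t \<in> gl.T. \<sigma> t $$ (u, u) = gl.wt B t)"
proof -
  obtain d u where d: "weight_rep GL TL d nub" "u < d" "\<And>V. E V \<Longrightarrow> nub (gl.cong_elt V) $$ (u, u) = \<chi> (mat_trace (Nt * V))"
    using nu_box_weight_rep by blast
  have split: "\<exists>W Y. E W \<and> Y \<in> carrier_mat n n \<and> sd.proj (gl.cong_elt Z) = gl.cong_elt W \<and> reduce_mat l Z = reduce_mat l (W + D Y)"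
    if "Z \<in> carrier_mat n n" for Z
  proof -
    obtain W Y where W: "E W" "Y \<in> carrier_mat n n" "gl.cong_elt Z = gl.cong_elt W \<otimes>\<^bsub>gl.G\<^esub> gl.cong_elt (D Y)"
      "reduce_mat l Z = reduce_mat l (W + D Y)" using T_split[OF \<open>Z \<in> carrier_mat n n\<close>] .
    have "gl.cong_elt W \<in> L" using TL_L W(1) by (auto simp: TL_def)
    hence "sd.proj (gl.cong_elt Z) = gl.cong_elt W" unfolding W(3) by (rule sd.proj) (use W(2) in \<open>auto simp: KD_def\<close>)
    thus ?thesis using W by blast
  qed
  have "weight_rep GH gl.T d (\<lambda>g. phis (sd.proj g) \<cdot>\<^sub>m nub (sd.proj g))"
  proof (rule weight_rep_inflate[OF _ GL_group _ d(1) proj_hom _ _ _ phis_hom])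
    show "group GH" by (rule gl.G.subgroup_imp_group[OF H_subgroup])
    show "gl.T \<subseteq> carrier GH" using T_sub_H by simp
    show "\<exists>h\<in>carrier GH. sd.proj h = x" if "x \<in> carrier GL" for x using L_H[of x] proj_L[of x] that by auto
    show "sd.proj t \<in> TL" if "t \<in> gl.T" for t using T_elt[OF that] split unfolding TL_def by blast
    show "\<exists>y\<in>gl.T. sd.proj y = t" if "t \<in> TL" for t using TL_T TL_L proj_L[of t] that by blast
  qed
  hence wr: "weight_rep GH gl.T d \<sigma>" unfolding \<sigma>_def .
  have "\<sigma> t $$ (u, u) = gl.wt B t" if t: "t \<in> gl.T" for t
  proof -
    obtain Z where Z: "Z \<in> carrier_mat n n" "t = gl.cong_elt Z" using T_elt[OF t] by blast
    obtain W Y where W: "E W" "Y \<in> carrier_mat n n" "sd.proj t = gl.cong_elt W" "reduce_mat l Z = reduce_mat l (W + D Y)"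
      using split[OF Z(1)] Z(2) by blast
    note c = E_carrier[OF W(1)] D_carrier[OF W(2)]
    note mc = mult_carrier_mat[of _ n n _ n]
    have "gl.cong_elt W \<in> L" using TL_L W(1) by (auto simp: TL_def)
    hence nc: "nub (gl.cong_elt W) \<in> carrier_mat d d" by (intro representation_carrier[OF weight_repD(1)[OF d(1)]]) simp
    have "\<sigma> t $$ (u, u) = \<chi> (mat_trace (As * W)) * \<chi> (mat_trace (Nt * W))"
      unfolding \<sigma>_def W(3) using nc d(2) by (simp add: phis_cong_elt[OF W(1)] d(3)[OF W(1)])
    also have "\<dots> = \<chi> (mat_trace (As * W) + mat_trace (Nt * W))" by (simp only: \<chi>(1))
    also have "mat_trace (As * W) + mat_trace (Nt * W) = mat_trace (B * W)"
      unfolding B_def add_mult_distrib_mat[OF As E_carrier[OF Nt] c(1)]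
      by (rule mat_trace_add[OF mc[OF As c(1)] mc[OF E_carrier[OF Nt] c(1)], symmetric])
    \<comment> \<open>The added trace is zero; it restores the part of \<open>Z\<close> that the
      projection to \<open>L\<close> has dropped.\<close>
    also have "\<dots> = mat_trace (B * W) + mat_trace (B * D Y)" unfolding trace_mult_D[OF B(1) W(2)] by simp
    also have "\<dots> = mat_trace (B * (W + D Y))"
      unfolding mult_add_distrib_mat[OF B(2) c] by (rule mat_trace_add[OF mc[OF B(2) c(1)] mc[OF B(2) c(2)], symmetric])
    also have "\<chi> \<dots> = gl.wt B (gl.cong_elt (W + D Y))" using B(2) add_carrier_mat[OF c(2)] by (intro gl.wt_elt[symmetric]) auto
    also have "gl.cong_elt (W + D Y) = t" unfolding Z(2) using W(4) Z(1) add_carrier_mat[OF c(2)] by (intro gl.cong_elt_cong) auto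
    finally show ?thesis .
  qed
  thus ?thesis using wr d(2) by blast
qed

end

lemma (in group) conj_conj:
  assumes "g \<in> carrier G" "h \<in> carrier G" "t \<in> carrier G"
  shows "inv h \<otimes> (inv g \<otimes> t \<otimes> g) \<otimes> h = inv (g \<otimes> h) \<otimes> t \<otimes> (g \<otimes> h)"
  using assms by (simp add: inv_mult_group m_assoc)

interpretation residue: semiring_hom "\<lambda>x :: 'a::comm_ring_1 fps. fps_nth x 0"
  by unfold_locales (simp_all add: fps_mult_nth_0)

interpretation fps_const: semiring_hom "fps_const :: 'a::comm_ring_1 \<Rightarrow> 'a fps"
  by unfold_locales simp_all

lemma reduce_1_eq: "reduce_mat 1 Z = const_mat (residue_mat Z)"
  by (rule eq_matI) (auto simp: fps_eq_iff)

lemma residue_const_mat [simp]: "residue_mat (const_mat Z) = Z"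
  by (rule eq_matI) auto

lemma residue_mat_reduce: "0 < m \<Longrightarrow> residue_mat (reduce_mat m Z) = residue_mat Z"
  by (rule eq_matI) auto

lemma residue_mat_trace:
  "Z \<in> carrier_mat n n \<Longrightarrow> mat_trace (residue_mat Z) = fps_nth (mat_trace Z) 0"
  by (simp add: mat_trace_def fps_sum_nth)

section \<open>Mackey's criterion and the orbit of the induced representation\<close>

context jordan_data
begin

lemma stabiliser:
  assumes x: "x \<in> carrier gl.G"
    and st: "\<And>t. t \<in> gl.T \<Longrightarrow> gl.wt B (inv\<^bsub>gl.G\<^esub> x \<otimes>\<^bsub>gl.G\<^esub> t \<otimes>\<^bsub>gl.G\<^esub> x) = gl.wt B t"
  shows "x \<in> H"
proof -
  let ?xi = "inv\<^bsub>gl.G\<^esub> x"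
  note xm = gl.G_mats(2)[OF x] and xi = gl.G_mats(2)[OF gl.G.inv_closed[OF x]]
  note mc = mult_carrier_mat[of _ n n _ n] and as = assoc_mult_mat[of _ n n _ n _ n]
  have Bm: "B \<in> mats UNIV n" using B(2) by simp
  have "reduce_mat l (x * B * ?xi) = reduce_mat l B"
  proof (rule gl.wt_eqD)
    show "x * B * ?xi \<in> mats UNIV n" using mc[OF mc[OF xm B(2)] xi] by simp
    fix t assume t: "t \<in> gl.T"
    show "gl.wt (x * B * ?xi) t = gl.wt B t" using gl.wt_conj[OF Bm x t] st[OF t] by simp
  qed (rule Bm)
  hence "reduce_mat l (x * B * ?xi * x) = reduce_mat l (B * x)"
    by (rule reduce_mult_cong[OF _ refl mc[OF mc[OF xm B(2)] xi] B(2) xm xm])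
  moreover have "reduce_mat l (x * B * (?xi * x)) = reduce_mat l (x * B * 1\<^sub>m n)"
    by (rule reduce_mult_cong[OF refl reduce_mono[OF gl.G_inv(2)[OF x] gl.lr] mc[OF xm B(2)] mc[OF xm B(2)] mc[OF xi xm] one_carrier_mat])
  ultimately have eq: "reduce_mat l (x * (As + Nt)) = reduce_mat l ((As + Nt) * x)"
    unfolding as[OF mc[OF xm B(2)] xi xm, symmetric] right_mult_one_mat[OF mc[OF xm B(2)]] B_def[symmetric] by simp
  have z: "reduce_mat l (0\<^sub>m n n) = (0\<^sub>m n n :: 'q fps mat)" by (rule eq_matI) auto
  have comm: "reduce_mat l (D Nt) = 0\<^sub>m n n" unfolding E_D[OF Nt] by (rule z)
  have nil: "reduce_mat l (Nt ^\<^sub>m e) = 0\<^sub>m n n" unfolding Nt_nil by (rule z)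
  have "reduce_mat l (D x) = 0\<^sub>m n n"
    by (rule nilpotent_separation[OF xm E_carrier[OF Nt] E_carrier[OF Nt] comm comm nil nil eq])
  \<comment> \<open>Commutation modulo \<open>\<pi>^l\<close> is enough: an exact \<open>W\<close>
    congruent to \<open>x\<close> is invertible modulo \<open>\<pi>^r\<close> and lies in
    \<open>L\<close>, and \<open>x\<close> differs from it by an element of
    \<open>T\<close>.\<close>
  then obtain W where W: "E W" "reduce_mat l W = reduce_mat l x" using E_lift[OF xm] by blast
  have Wm: "W \<in> mats UNIV n" using E_carrier[OF W(1)] by simp
  note ul = gl.unit_lift[OF x Wm W(2)]
  have "x = reduce_mat r W \<otimes>\<^bsub>gl.G\<^esub> (inv\<^bsub>gl.G\<^esub> (reduce_mat r W) \<otimes>\<^bsub>gl.G\<^esub> x)"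
    using ul(1) x by (simp only: gl.G.m_assoc[symmetric] gl.G.inv_closed gl.G.r_inv gl.G.l_one)
  thus ?thesis using E_L[OF W(1) ul(1)] ul(2) unfolding H_def set_mult_def by blast
qed

lemma GH_group: "group GH"
  by (rule gl.G.subgroup_imp_group[OF H_subgroup])

text \<open>Transitivity on basis lines turns every weight of \<open>\<sigma>\<close> into a
  conjugate, by an element of \<open>H\<close>, of the single known weight.\<close>

lemma \<sigma>_all_weights:
  assumes wr: "weight_rep GH gl.T d \<sigma>" and u: "u < d" "\<And>t. t \<in> gl.T \<Longrightarrow> \<sigma> t $$ (u, u) = gl.wt B t" and a: "a < d"
  shows "\<exists>h \<in> H. \<forall>t \<in> gl.T. \<sigma> t $$ (a, a) = gl.wt B (inv\<^bsub>gl.G\<^esub> h \<otimes>\<^bsub>gl.G\<^esub> t \<otimes>\<^bsub>gl.G\<^esub> h)"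
proof -
  obtain h where h: "h \<in> carrier GH" "moves_basis d (\<sigma> h) u a" using weight_repD(4)[OF wr a u(1)] by blast
  have hH: "h \<in> H" using h(1) by simp
  have T: "gl.T \<subseteq> carrier GH" using T_sub_H by simp
  have "\<sigma> t $$ (a, a) = gl.wt B (inv\<^bsub>gl.G\<^esub> h \<otimes>\<^bsub>gl.G\<^esub> t \<otimes>\<^bsub>gl.G\<^esub> h)" if t: "t \<in> gl.T" for t
  proof -
    have c: "inv\<^bsub>gl.G\<^esub> h \<otimes>\<^bsub>gl.G\<^esub> t \<otimes>\<^bsub>gl.G\<^esub> h \<in> gl.T" by (rule gl.T_normal[OF H.mem_carrier[OF hH] t])
    have eq: "inv\<^bsub>GH\<^esub> h \<otimes>\<^bsub>GH\<^esub> t \<otimes>\<^bsub>GH\<^esub> h = inv\<^bsub>gl.G\<^esub> h \<otimes>\<^bsub>gl.G\<^esub> t \<otimes>\<^bsub>gl.G\<^esub> h"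
      using gl.G.m_inv_consistent[OF H_subgroup hH] by simp
    have "inv\<^bsub>GH\<^esub> h \<otimes>\<^bsub>GH\<^esub> t \<otimes>\<^bsub>GH\<^esub> h \<in> gl.T" unfolding eq by (rule c)
    hence "\<sigma> t $$ (a, a) = \<sigma> (inv\<^bsub>GH\<^esub> h \<otimes>\<^bsub>GH\<^esub> t \<otimes>\<^bsub>GH\<^esub> h) $$ (u, u)"
      by (rule moves_basis_weight[OF GH_group wr T _ h(1) t h(2) a u(1)])
    thus ?thesis unfolding eq u(2)[OF c] .
  qed
  thus ?thesis using hH by blast
qed

lemma \<sigma>_cross:
  assumes wr: "weight_rep GH gl.T d \<sigma>" and u: "u < d" "\<And>t. t \<in> gl.T \<Longrightarrow> \<sigma> t $$ (u, u) = gl.wt B t"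
    and g: "g \<in> carrier gl.G" "g \<notin> H" and ab: "a < d" "b < d"
  shows "\<exists>t \<in> gl.T. \<sigma> (inv\<^bsub>gl.G\<^esub> g \<otimes>\<^bsub>gl.G\<^esub> t \<otimes>\<^bsub>gl.G\<^esub> g) $$ (a, a) \<noteq> \<sigma> t $$ (b, b)"
proof (rule ccontr)
  assume *: "\<not> ?thesis"
  note Tc = subsetD[OF gl.T_carrier]
  obtain h where h: "h \<in> H" "\<And>t. t \<in> gl.T \<Longrightarrow> \<sigma> t $$ (a, a) = gl.wt B (inv\<^bsub>gl.G\<^esub> h \<otimes>\<^bsub>gl.G\<^esub> t \<otimes>\<^bsub>gl.G\<^esub> h)"
    using \<sigma>_all_weights[OF wr u ab(1)] by blast
  obtain k where k: "k \<in> H" "\<And>t. t \<in> gl.T \<Longrightarrow> \<sigma> t $$ (b, b) = gl.wt B (inv\<^bsub>gl.G\<^esub> k \<otimes>\<^bsub>gl.G\<^esub> t \<otimes>\<^bsub>gl.G\<^esub> k)"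
    using \<sigma>_all_weights[OF wr u ab(2)] by blast
  note hG = H.mem_carrier[OF h(1)] and kG = H.mem_carrier[OF k(1)]
  note kiG = gl.G.inv_closed[OF kG] and ghG = gl.G.m_closed[OF g(1) hG]
  \<comment> \<open>The weights at \<open>a\<close> and \<open>b\<close> are conjugates of the
    weight of \<open>B\<close> by \<open>h\<close> and \<open>k\<close>. If \<open>g\<close> matched
    them, this \<open>x\<close> would stabilise the weight of \<open>B\<close>, lie in
    \<open>H\<close>, and force \<open>g \<in> H\<close>.\<close>
  define x where "x = inv\<^bsub>gl.G\<^esub> k \<otimes>\<^bsub>gl.G\<^esub> (g \<otimes>\<^bsub>gl.G\<^esub> h)"
  have xG: "x \<in> carrier gl.G" unfolding x_def by (rule gl.G.m_closed[OF kiG ghG])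
  have "x \<in> H"
  proof (rule stabiliser[OF xG])
    fix t assume t: "t \<in> gl.T"
    define y where "y = inv\<^bsub>gl.G\<^esub> (inv\<^bsub>gl.G\<^esub> k) \<otimes>\<^bsub>gl.G\<^esub> t \<otimes>\<^bsub>gl.G\<^esub> inv\<^bsub>gl.G\<^esub> k"
    have y: "y \<in> gl.T" unfolding y_def by (rule gl.T_normal[OF kiG t])
    have gy: "inv\<^bsub>gl.G\<^esub> g \<otimes>\<^bsub>gl.G\<^esub> y \<otimes>\<^bsub>gl.G\<^esub> g \<in> gl.T" by (rule gl.T_normal[OF g(1) y])
    have "inv\<^bsub>gl.G\<^esub> x \<otimes>\<^bsub>gl.G\<^esub> t \<otimes>\<^bsub>gl.G\<^esub> x = inv\<^bsub>gl.G\<^esub> (g \<otimes>\<^bsub>gl.G\<^esub> h) \<otimes>\<^bsub>gl.G\<^esub> y \<otimes>\<^bsub>gl.G\<^esub> (g \<otimes>\<^bsub>gl.G\<^esub> h)"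
      unfolding x_def y_def by (rule gl.G.conj_conj[OF kiG ghG Tc[OF t], symmetric])
    also have "\<dots> = inv\<^bsub>gl.G\<^esub> h \<otimes>\<^bsub>gl.G\<^esub> (inv\<^bsub>gl.G\<^esub> g \<otimes>\<^bsub>gl.G\<^esub> y \<otimes>\<^bsub>gl.G\<^esub> g) \<otimes>\<^bsub>gl.G\<^esub> h"
      by (rule gl.G.conj_conj[OF g(1) hG Tc[OF y], symmetric])
    finally have "gl.wt B (inv\<^bsub>gl.G\<^esub> x \<otimes>\<^bsub>gl.G\<^esub> t \<otimes>\<^bsub>gl.G\<^esub> x) = \<sigma> (inv\<^bsub>gl.G\<^esub> g \<otimes>\<^bsub>gl.G\<^esub> y \<otimes>\<^bsub>gl.G\<^esub> g) $$ (a, a)"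
      unfolding h(2)[OF gy] by (rule arg_cong)
    also have "\<dots> = \<sigma> y $$ (b, b)" using * y by blast
    also have "\<dots> = gl.wt B (inv\<^bsub>gl.G\<^esub> k \<otimes>\<^bsub>gl.G\<^esub> y \<otimes>\<^bsub>gl.G\<^esub> k)" by (rule k(2)[OF y])
    also have "inv\<^bsub>gl.G\<^esub> k \<otimes>\<^bsub>gl.G\<^esub> y \<otimes>\<^bsub>gl.G\<^esub> k = t"
      unfolding y_def gl.G.conj_conj[OF kiG kG Tc[OF t]] gl.G.l_inv[OF kG]
      by (simp only: gl.G.inv_one gl.G.l_one[OF Tc[OF t]] gl.G.r_one[OF Tc[OF t]])
    finally show "gl.wt B (inv\<^bsub>gl.G\<^esub> x \<otimes>\<^bsub>gl.G\<^esub> t \<otimes>\<^bsub>gl.G\<^esub> x) = gl.wt B t" .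
  qed
  hence "k \<otimes>\<^bsub>gl.G\<^esub> x \<otimes>\<^bsub>gl.G\<^esub> inv\<^bsub>gl.G\<^esub> h \<in> H" by (rule H.m_closed[OF H.m_closed[OF k(1)] H.m_inv_closed[OF h(1)]])
  also have "k \<otimes>\<^bsub>gl.G\<^esub> x = g \<otimes>\<^bsub>gl.G\<^esub> h"
    unfolding x_def gl.G.m_assoc[OF kG kiG ghG, symmetric] gl.G.r_inv[OF kG] by (rule gl.G.l_one[OF ghG])
  also have "g \<otimes>\<^bsub>gl.G\<^esub> h \<otimes>\<^bsub>gl.G\<^esub> inv\<^bsub>gl.G\<^esub> h = g"
    unfolding gl.G.m_assoc[OF g(1) hG gl.G.inv_closed[OF hG]] gl.G.r_inv[OF hG] by (rule gl.G.r_one[OF g(1)])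
  finally show False using g(2) by blast
qed

definition "J = jordan_induction n l r A s \<phi> fs nub"

lemma J_eq: "J = induced_rep gl.G H \<sigma>"
  unfolding J_def jordan_induction_def Let_def L_projection_eq H_def L_def \<sigma>_def[abs_def] by (rule refl)

text \<open>The second claim provides eigenvectors for all conjugates of the weight of
  \<open>B\<close>, so that a conjugating matrix can later be chosen to hit \<open>\<omega>\<close>
  itself.\<close>

lemma J_irreducible_weight:
  "irreducible_rep gl.G J" "q \<in> carrier gl.G \<Longrightarrow> \<exists>v \<in> carrier_vec (rep_dim gl.G J). v \<noteq> 0\<^sub>v (rep_dim gl.G J) \<and>
    (\<forall>t \<in> gl.T. J t *\<^sub>v v = gl.wt B (inv\<^bsub>gl.G\<^esub> q \<otimes>\<^bsub>gl.G\<^esub> t \<otimes>\<^bsub>gl.G\<^esub> q) \<cdot>\<^sub>v v)"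
proof -
  obtain d u where d: "weight_rep GH gl.T d \<sigma>" "u < d" "\<And>t. t \<in> gl.T \<Longrightarrow> \<sigma> t $$ (u, u) = gl.wt B t"
    using \<sigma>_weights by blast
  interpret ind: induction_data gl.G H gl.T d \<sigma>
  proof (rule induction_data.intro)
    show "finite (carrier gl.G)" by (rule GL_trunc_finite) simp
    show "inv\<^bsub>gl.G\<^esub> g \<otimes>\<^bsub>gl.G\<^esub> t \<otimes>\<^bsub>gl.G\<^esub> g \<in> gl.T" if "g \<in> carrier gl.G" "t \<in> gl.T" for g t by (rule gl.T_normal[OF that])
    show "\<exists>t \<in> gl.T. \<sigma> (inv\<^bsub>gl.G\<^esub> g \<otimes>\<^bsub>gl.G\<^esub> t \<otimes>\<^bsub>gl.G\<^esub> g) $$ (a, a) \<noteq> \<sigma> t $$ (b, b)"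
      if "g \<in> carrier gl.G" "g \<notin> H" "a < d" "b < d" for g a b by (rule \<sigma>_cross[OF d that])
  qed (use d(1,2) H_subgroup T_sub_H gl.G.is_group in auto)
  let ?D = "length ind.ts * d"
  have wr: "weight_rep gl.G gl.T ?D J" unfolding J_eq by (rule ind.I_weight_rep)
  note rep = weight_repD(1)[OF wr]
  note Tc = subsetD[OF gl.T_carrier]
  show "irreducible_rep gl.G J" by (rule weight_rep_irreducible[OF gl.G.is_group wr ind.dim_pos gl.T_carrier])
  have dim: "rep_dim gl.G J = ?D" by (rule rep_dim_eq[OF rep gl.G.is_group])
  assume q: "q \<in> carrier gl.G"
  obtain w c where w: "w < ?D" "c \<in> H" "\<And>t. t \<in> gl.T \<Longrightarrow> J t $$ (w, w) = \<sigma> (inv\<^bsub>gl.G\<^esub> c \<otimes>\<^bsub>gl.G\<^esub> t \<otimes>\<^bsub>gl.G\<^esub> c) $$ (u, u)"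
    using ind.I_weight_H[OF d(2)] unfolding J_eq by blast
  note cG = H.mem_carrier[OF w(2)]
  \<comment> \<open>The basis vector \<open>w\<close> carries the weight conjugated by
    \<open>c\<close>; translating it by \<open>q \<otimes> inv c\<close> produces a vector whose
    weight is conjugated by \<open>q\<close>.\<close>
  define p where "p = q \<otimes>\<^bsub>gl.G\<^esub> inv\<^bsub>gl.G\<^esub> c"
  have pG: "p \<in> carrier gl.G" unfolding p_def by (rule gl.G.m_closed[OF q gl.G.inv_closed[OF cG]])
  note Jp = representation_carrier[OF rep pG] and Jpi = representation_carrier[OF rep gl.G.inv_closed[OF pG]]
  define v where "v = J p *\<^sub>v unit_vec ?D w"
  have uc: "unit_vec ?D w \<in> carrier_vec ?D" by simp
  have vc: "v \<in> carrier_vec ?D" unfolding v_def by (rule mult_mat_vec_carrier[OF Jp uc])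
  show "\<exists>v \<in> carrier_vec (rep_dim gl.G J). v \<noteq> 0\<^sub>v (rep_dim gl.G J) \<and>
    (\<forall>t \<in> gl.T. J t *\<^sub>v v = gl.wt B (inv\<^bsub>gl.G\<^esub> q \<otimes>\<^bsub>gl.G\<^esub> t \<otimes>\<^bsub>gl.G\<^esub> q) \<cdot>\<^sub>v v)"
    unfolding dim
  proof (intro bexI[OF _ vc] conjI ballI)
    show "v \<noteq> 0\<^sub>v ?D"
    proof
      assume "v = 0\<^sub>v ?D"
      hence "J (inv\<^bsub>gl.G\<^esub> p) *\<^sub>v v = 0\<^sub>v ?D" using Jpi by auto
      moreover have "J (inv\<^bsub>gl.G\<^esub> p) *\<^sub>v v = unit_vec ?D w"
        unfolding v_def assoc_mult_mat_vec[OF Jpi Jp uc, symmetric] representation_mult[OF rep gl.G.inv_closed[OF pG] pG, symmetric]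
          gl.G.l_inv[OF pG] representation_one[OF rep gl.G.is_group] by simp
      ultimately have "unit_vec ?D w $ w = (0\<^sub>v ?D :: 'c vec) $ w" by simp
      thus False using w(1) by simp
    qed
    fix t assume t: "t \<in> gl.T"
    let ?t = "inv\<^bsub>gl.G\<^esub> p \<otimes>\<^bsub>gl.G\<^esub> t \<otimes>\<^bsub>gl.G\<^esub> p"
    have tT: "?t \<in> gl.T" by (rule gl.T_normal[OF pG t])
    note Jt = representation_carrier[OF rep Tc[OF tT]]
    have "t \<otimes>\<^bsub>gl.G\<^esub> p = p \<otimes>\<^bsub>gl.G\<^esub> ?t"
      using pG Tc[OF t] by (simp only: gl.G.m_assoc[symmetric] gl.G.m_closed gl.G.inv_closed gl.G.r_inv gl.G.l_one)
    hence eq: "J t * J p = J p * J ?t"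
      unfolding representation_mult[OF rep Tc[OF t] pG, symmetric] representation_mult[OF rep pG Tc[OF tT], symmetric] by (rule arg_cong)
    have ew: "J ?t *\<^sub>v unit_vec ?D w = J ?t $$ (w, w) \<cdot>\<^sub>v unit_vec ?D w"
    proof (rule eq_vecI)
      fix i assume "i < dim_vec (J ?t $$ (w, w) \<cdot>\<^sub>v unit_vec ?D w)"
      hence i: "i < ?D" by simp
      show "(J ?t *\<^sub>v unit_vec ?D w) $ i = (J ?t $$ (w, w) \<cdot>\<^sub>v unit_vec ?D w) $ i"
        unfolding diagonal_mult_vec_index[OF weight_repD(2)[OF wr tT] Jt uc i] using i w(1) by auto
    qed (use Jt in auto)
    have "J t *\<^sub>v v = (J t * J p) *\<^sub>v unit_vec ?D w"
      unfolding v_def by (rule assoc_mult_mat_vec[OF representation_carrier[OF rep Tc[OF t]] Jp uc, symmetric])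
    also have "\<dots> = J p *\<^sub>v (J ?t *\<^sub>v unit_vec ?D w)" unfolding eq by (rule assoc_mult_mat_vec[OF Jp Jt uc])
    also have "\<dots> = J ?t $$ (w, w) \<cdot>\<^sub>v v" unfolding ew v_def by (rule mult_mat_vec[OF Jp uc])
    also have "J ?t $$ (w, w) = gl.wt B (inv\<^bsub>gl.G\<^esub> c \<otimes>\<^bsub>gl.G\<^esub> ?t \<otimes>\<^bsub>gl.G\<^esub> c)"
      unfolding w(3)[OF tT] by (rule d(3)[OF gl.T_normal[OF cG tT]])
    also have "inv\<^bsub>gl.G\<^esub> c \<otimes>\<^bsub>gl.G\<^esub> ?t \<otimes>\<^bsub>gl.G\<^esub> c = inv\<^bsub>gl.G\<^esub> (p \<otimes>\<^bsub>gl.G\<^esub> c) \<otimes>\<^bsub>gl.G\<^esub> t \<otimes>\<^bsub>gl.G\<^esub> (p \<otimes>\<^bsub>gl.G\<^esub> c)"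
      by (rule gl.G.conj_conj[OF pG cG Tc[OF t]])
    also have "p \<otimes>\<^bsub>gl.G\<^esub> c = q"
      unfolding p_def gl.G.m_assoc[OF q gl.G.inv_closed[OF cG] cG] gl.G.l_inv[OF cG] by (rule gl.G.r_one[OF q])
    finally show "J t *\<^sub>v v = gl.wt B (inv\<^bsub>gl.G\<^esub> q \<otimes>\<^bsub>gl.G\<^esub> t \<otimes>\<^bsub>gl.G\<^esub> q) \<cdot>\<^sub>v v" .
  qed
qed

text \<open>An element \<open>1 + \<pi>^(r - 1) V\<close> equals
  \<open>1 + \<pi>^l (\<pi>^(l - 1) V)\<close> since \<open>r - 1 = l + (l - 1)\<close>. So the
  trace enters with the factor \<open>\<pi>^(l - 1)\<close>, and modulo \<open>\<pi>^l\<close> only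
  the residues of both matrices count.\<close>

lemma wt_psi_orbit:
  assumes C: "C \<in> carrier_mat n n" and t: "t \<in> cong_subgroup UNIV n r (r - 1)"
  shows "t \<in> gl.T" "gl.wt C t = psi_orbit l r \<psi> (residue_mat C) t"
proof -
  have tG: "t \<in> carrier gl.G" and tr: "reduce_mat (r - 1) t = reduce_mat (r - 1) (1\<^sub>m n)" using t by (auto simp: cong_subgroup_def)
  note tm = gl.G_mats(2)[OF tG]
  have lr: "l \<le> r - 1" using l r by simp
  show "t \<in> gl.T" using tG reduce_mono[OF tr lr] by (simp add: cong_subgroup_def)
  define V where "V = cong_part (r - 1) t"
  have V: "V \<in> carrier_mat n n" using tm by (simp add: V_def cong_part_def)
  have "cong_part l t = fps_X ^ (l - 1) \<cdot>\<^sub>m V"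
  proof (rule eq_matI)
    fix i j assume "i < dim_row (fps_X ^ (l - 1) \<cdot>\<^sub>m V)" "j < dim_col (fps_X ^ (l - 1) \<cdot>\<^sub>m V)"
    hence ij: "i < n" "j < n" using V by auto
    define y where "y = t $$ (i, j) - 1\<^sub>m n $$ (i, j)"
    have "fps_cutoff (r - 1) (t $$ (i, j)) = fps_cutoff (r - 1) (1\<^sub>m n $$ (i, j))"
      using tr ij tm by (auto simp: reduce_eq_iff[OF tm one_carrier_mat])
    hence "fps_cutoff (r - 1) y = 0" by (simp add: y_def fps_cutoff_diff)
    hence y0: "fps_nth y a = 0" if "a < r - 1" for a using that by (metis fps_cutoff_nth fps_zero_nth)
    have "fps_shift l y = fps_X ^ (l - 1) * fps_shift (r - 1) y"
    proof (rule fps_ext)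
      fix a
      have "r - 1 + (a - (l - 1)) = l + a" if "\<not> a < l - 1" using that l r by simp
      thus "fps_nth (fps_shift l y) a = fps_nth (fps_X ^ (l - 1) * fps_shift (r - 1) y) a"
        using y0[of "l + a"] l r by (auto simp: fps_X_power_mult_nth add.commute)
    qed
    thus "cong_part l t $$ (i, j) = (fps_X ^ (l - 1) \<cdot>\<^sub>m V) $$ (i, j)"
      using ij tm by (simp add: V_def cong_part_def y_def)
  qed (use tm V in \<open>auto simp: cong_part_def\<close>)
  hence "mat_trace (C * cong_part l t) = fps_X ^ (l - 1) * mat_trace (C * V)"
    using mat_trace_smult[OF mult_carrier_mat[OF C V], of "fps_X ^ (l - 1)"] by (simp add: mult_smult_distrib[OF C V])
  hence "gl.wt C t = \<chi> (fps_X ^ (l - 1) * fps_const (fps_nth (mat_trace (C * V)) 0))"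
    unfolding gl.wt_def by (simp only: \<chi>_X_power[of "mat_trace (C * V)"])
  also have "fps_nth (mat_trace (C * V)) 0 = mat_trace (residue_mat C * residue_mat V)"
    unfolding residue.mat_hom_mult[OF C V, symmetric] by (rule residue_mat_trace[OF mult_carrier_mat[OF C V], symmetric])
  also have "\<chi> (fps_X ^ (l - 1) * fps_const x) = \<psi> (fps_X ^ (l - 1) * fps_const x)" for x
  proof -
    have "fps_cutoff l (fps_X ^ (l - 1) * fps_const x) = fps_X ^ (l - 1) * fps_const x"
      using l by (auto simp: fps_eq_iff fps_X_power_mult_nth)
    thus ?thesis by (simp add: \<chi>_def)
  qed
  finally show "gl.wt C t = psi_orbit l r \<psi> (residue_mat C) t" by (simp add: psi_orbit_def V_def)
qed

text \<open>A constant invertible matrix is an element of the group; the eigenvector whose weight is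
  conjugated by it realises the residue of the conjugate of \<open>B\<close> on the last congruence
  subgroup.\<close>

lemma orbit_J:
  assumes h: "h \<in> carrier_mat n n" "h' \<in> carrier_mat n n" "h * h' = 1\<^sub>m n" "h' * h = 1\<^sub>m n"
  shows "h' * residue_mat B * h \<in> orbit n l r \<psi> J"
proof -
  let ?q = "reduce_mat r (const_mat h')" and ?p = "reduce_mat r (const_mat h)"
  have c: "const_mat h \<in> carrier_mat n n" "const_mat h' \<in> carrier_mat n n" using h by auto
  have m: "const_mat h * const_mat h' = 1\<^sub>m n" "const_mat h' * const_mat h = 1\<^sub>m n"
    unfolding fps_const.mat_hom_mult[OF h(1,2), symmetric] fps_const.mat_hom_mult[OF h(2,1), symmetric] h(3,4)
    by (rule fps_const.mat_hom_one)+
  have G: "?q \<in> carrier gl.G" "?p \<in> carrier gl.G"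
    by (rule GL_reduce_carrier[OF coeff_ring_UNIV, of _ n "const_mat h"]; simp only: mats_UNIV c m)
      (rule GL_reduce_carrier[OF coeff_ring_UNIV, of _ n "const_mat h'"]; simp only: mats_UNIV c m)
  have "?p \<otimes>\<^bsub>gl.G\<^esub> ?q = \<one>\<^bsub>gl.G\<^esub>" unfolding GL_reduce_mult[OF c] m by simp
  hence qi: "inv\<^bsub>gl.G\<^esub> ?q = ?p" by (rule gl.G.inv_equality[OF _ G])
  define C where "C = ?q * B * ?p"
  have c': "?q \<in> carrier_mat n n" "?p \<in> carrier_mat n n" using c by auto
  have C: "C \<in> carrier_mat n n" unfolding C_def by (rule mult_carrier_mat[OF mult_carrier_mat[OF c'(1) B(2)] c'(2)])
  have r0: "0 < r" using l r by simp
  have res: "residue_mat C = h' * residue_mat B * h"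
    unfolding C_def residue.mat_hom_mult[OF mult_carrier_mat[OF c'(1) B(2)] c'(2)] residue.mat_hom_mult[OF c'(1) B(2)]
    by (simp add: residue_mat_reduce[OF r0])
  obtain v where v: "v \<in> carrier_vec (rep_dim gl.G J)" "v \<noteq> 0\<^sub>v (rep_dim gl.G J)"
    "\<And>t. t \<in> gl.T \<Longrightarrow> J t *\<^sub>v v = gl.wt B (inv\<^bsub>gl.G\<^esub> ?q \<otimes>\<^bsub>gl.G\<^esub> t \<otimes>\<^bsub>gl.G\<^esub> ?q) \<cdot>\<^sub>v v"
    using J_irreducible_weight(2)[OF G(1)] by blast
  have Bm: "B \<in> mats UNIV n" using B(2) by simp
  have "J t *\<^sub>v v = psi_orbit l r \<psi> (residue_mat C) t \<cdot>\<^sub>v v" if t: "t \<in> cong_subgroup UNIV n r (r - 1)" for t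
  proof -
    note tT = wt_psi_orbit(1)[OF C t]
    have "gl.wt B (inv\<^bsub>gl.G\<^esub> ?q \<otimes>\<^bsub>gl.G\<^esub> t \<otimes>\<^bsub>gl.G\<^esub> ?q) = gl.wt C t"
      using gl.wt_conj[OF Bm G(1) tT] unfolding qi C_def .
    thus ?thesis unfolding v(3)[OF tT] wt_psi_orbit(2)[OF C t] by simp
  qed
  moreover have "residue_mat C \<in> carrier_mat n n" using C by simp
  ultimately show ?thesis unfolding orbit_def occurs_in_def res[symmetric] using v(1,2) by blast
qed

end

section \<open>Exact nilpotent lift of the nilpotent part\<close>

context block_data
begin

lemma E_pow: "E Z \<Longrightarrow> E (Z ^\<^sub>m k)"
proof (induction k)
  case 0
  thus ?case using E_carrier[OF 0] E_one by simp
qed (simp add: E_mult)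

lemma cmp_pow:
  assumes "E Z" "i < N"
  shows "cmp i (Z ^\<^sub>m k) = cmp i Z ^\<^sub>m k"
proof (induction k)
  case 0
  show ?case using E_carrier[OF assms(1)] cmp_one[OF assms(2)] by simp
next
  case (Suc k)
  show ?case unfolding pow_mat.simps cmp_mult[OF E_pow[OF assms(1)] assms] Suc ..
qed

lemma cmp_zero: "i < N \<Longrightarrow> cmp i (0\<^sub>m n n) = 0\<^sub>m (mu i) (mu i)"
proof -
  assume i: "i < N"
  have "(0 \<cdot>\<^sub>m 1\<^sub>m n :: 'q fps mat) = 0\<^sub>m n n" by (rule eq_matI) auto
  hence "cmp i (0\<^sub>m n n) = O_embed 0 \<cdot>\<^sub>m cmp i (1\<^sub>m n)" using cmp_smult[OF one_carrier_mat i, of 0] by simp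
  also have "\<dots> = 0\<^sub>m (mu i) (mu i)" by (rule eq_matI) (auto simp: emb.hom_zero)
  finally show ?thesis .
qed

text \<open>A first lift \<open>N1\<close> into the exact centraliser is nilpotent only modulo
  \<open>\<pi>\<close>. Replacing its components by their residues, as constant matrices, keeps the
  reduction \<open>M\<close> and makes the power \<open>e\<close> vanish exactly.\<close>

lemma nilpotent_lift:
  assumes M: "M \<in> carrier_mat n n" and comm: "residue_mat As * M = M * residue_mat As" and nil: "M ^\<^sub>m e = 0\<^sub>m n n"
  defines "Ns \<equiv> \<lambda>i. nilpotent_component A s fs i M"
  shows "\<exists>Nt. E Nt \<and> Nt ^\<^sub>m e = 0\<^sub>m n n \<and> residue_mat Nt = M \<and> (\<forall>i<N. cmp i Nt = const_mat (Ns i) \<and> nilpotent_mat (Ns i))"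
proof -
  let ?M = "const_mat M"
  have c: "?M \<in> carrier_mat n n" using M by simp
  note mc = mult_carrier_mat[of _ n n _ n]
  have "reduce_mat 1 (As * ?M) = reduce_mat 1 (?M * As)"
    unfolding reduce_1_eq residue.mat_hom_mult[OF As c] residue.mat_hom_mult[OF c As] residue_const_mat comm ..
  hence "reduce_mat 1 (D ?M) = 0\<^sub>m n n" unfolding D_def reduce_diff_0_iff[OF mc[OF As c] mc[OF c As]] .
  then obtain N1 where N1: "E N1" "reduce_mat 1 N1 = reduce_mat 1 ?M" using E_lift[OF c] by blast
  have rM: "reduce_mat 1 ?M = ?M" unfolding reduce_1_eq by simp
  have res1: "residue_mat N1 = M"
    using arg_cong[OF N1(2)[unfolded rM reduce_1_eq], of residue_mat] by simp
  note N1c = E_carrier[OF N1(1)]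
  have Ns: "Ns i = residue_mat (cmp i N1)" if "i < N" for i
  proof -
    have "component 1 A s fs i ?M = reduce_mat 1 (cmp i N1)"
      using component_cmp[OF N1(1) that, of 1] unfolding N1(2) rM .
    thus ?thesis unfolding Ns_def nilpotent_component_def by (simp add: residue_mat_reduce)
  qed
  have Nsc: "Ns i \<in> carrier_mat (mu i) (mu i)" if "i < N" for i unfolding Ns[OF that] by simp
  have cNs: "const_mat (Ns i) \<in> mats (ki i) (mu i)" if "i < N" for i
    using mats_closed(7)[OF coeff_ring_finite_subfield cmp_mats[OF N1(1) that], of 1] unfolding reduce_1_eq Ns[OF that] .
  have Nse: "Ns i ^\<^sub>m e = 0\<^sub>m (mu i) (mu i)" if i: "i < N" for i
  proof -
    have z: "reduce_mat 1 (0\<^sub>m n n) = (0\<^sub>m n n :: 'q fps mat)" by (rule eq_matI) auto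
    have "residue_mat (N1 ^\<^sub>m e) = M ^\<^sub>m e" unfolding residue.mat_hom_pow[OF N1c] res1 ..
    hence "reduce_mat 1 (N1 ^\<^sub>m e) = const_mat (0\<^sub>m n n)" unfolding reduce_1_eq nil by simp
    also have "const_mat (0\<^sub>m n n) = reduce_mat 1 (0\<^sub>m n n)" by (rule eq_matI) auto
    finally have "reduce_mat 1 (cmp i (N1 ^\<^sub>m e)) = reduce_mat 1 (cmp i (0\<^sub>m n n))"
      by (rule cmp_cong[OF _ E_carrier[OF E_pow[OF N1(1)]] zero_carrier_mat i])
    hence "residue_mat (reduce_mat 1 (cmp i N1 ^\<^sub>m e)) = residue_mat (reduce_mat 1 (0\<^sub>m (mu i) (mu i)))"
      unfolding cmp_zero[OF i] cmp_pow[OF N1(1) i] by simp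
    hence "residue_mat (cmp i N1 ^\<^sub>m e) = residue_mat (0\<^sub>m (mu i) (mu i) :: 'q alg_closure fps mat)"
      by (simp add: residue_mat_reduce)
    thus ?thesis unfolding residue.mat_hom_pow[OF cmp_carrier] Ns[OF i] by (auto simp: mat_eq_iff)
  qed
  \<comment> \<open>Surjectivity of the components rebuilds a commuting matrix from the constants;
    its powers are computed componentwise and vanish modulo every power of
    \<open>\<pi>\<close>.\<close>
  obtain Nt where Nt: "E Nt" "\<And>i. i < N \<Longrightarrow> cmp i Nt = const_mat (Ns i)"
    using cmp_surj[of "\<lambda>i. const_mat (Ns i)"] cNs by blast
  have "Nt ^\<^sub>m e = 0\<^sub>m n n"
  proof (rule all_reduce_0[OF E_carrier[OF E_pow[OF Nt(1)]]])
    fix m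
    show "reduce_mat m (Nt ^\<^sub>m e) = 0\<^sub>m n n"
    proof (rule cmp_eq_0[OF E_pow[OF Nt(1)]])
      fix i assume i: "i < N"
      have "cmp i (Nt ^\<^sub>m e) = const_mat (0\<^sub>m (mu i) (mu i))"
        unfolding cmp_pow[OF Nt(1) i] Nt(2)[OF i] fps_const.mat_hom_pow[OF Nsc[OF i], symmetric] Nse[OF i] ..
      thus "reduce_mat m (cmp i (Nt ^\<^sub>m e)) = 0\<^sub>m (mu i) (mu i)" by (auto simp: mat_eq_iff)
    qed
  qed
  moreover have "residue_mat Nt = M"
  proof -
    have "reduce_mat 1 Nt = reduce_mat 1 N1"
      by (rule cmp_mod_inj[OF Nt(1) N1(1)]) (simp only: Nt(2) Ns reduce_1_eq residue_const_mat)
    from arg_cong[OF this, of residue_mat] show ?thesis by (simp add: residue_mat_reduce res1)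
  qed
  moreover have "nilpotent_mat (Ns i)" if "i < N" for i
    unfolding nilpotent_mat_def using Nse[OF that] Nsc[OF that] by (intro exI[of _ e]) auto
  ultimately show ?thesis using Nt by blast
qed

end

theorem corollary3p4:
  fixes \<psi> :: "'q::finite_field fps \<Rightarrow> 'l::prime_card padic_closure"
    and root :: "'q poly \<Rightarrow> 'q alg_closure"
    and s_hat :: "'q poly \<Rightarrow> 'q alg_closure fps"
    and A :: "'q poly \<Rightarrow> 'q fps mat"
    and \<phi> :: "'q poly \<Rightarrow> 'q alg_closure fps \<Rightarrow> 'l padic_closure"
    and \<omega> s N h h_inv :: "'q mat"
    and fs :: "('q poly \<times> nat) list"
    and n l r :: nat
  assumes ell: "CARD('l) \<noteq> CHAR('q)"
    and r: "0 < l" "r = 2 * l"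
    and n: "0 < n"
    and psi: "additive_character l \<psi>"
    and data: "\<And>f. monic f \<Longrightarrow> irreducible f \<Longrightarrow>
                 jordan_datum l r \<psi> f (root f) (s_hat f) (A f) (\<phi> f)"
    and omega: "\<omega> \<in> carrier_mat n n" "additive_jordan_decomposition n \<omega> s N"
    and fs: "char_poly_factorisation s fs"
    and h: "similar_mat_wit (residue_mat (block_mat_A A fs)) s h h_inv"
  shows "let Ns = (\<lambda>i. nilpotent_component A s_hat fs i (h * N * h_inv));
             J = jordan_induction n l r A s_hat \<phi> fs (nu_box l r \<psi> A s_hat fs Ns)
         in irreducible_rep (GL_trunc UNIV n r) J \<and> \<omega> \<in> orbit n l r \<psi> J"
proof -
  have fs': "distinct (map fst fs)" "\<And>f k. (f, k) \<in> set fs \<Longrightarrow> monic f \<and> irreducible f"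
    using fs by (auto simp: char_poly_factorisation_def)
  define good where "good f P Q \<longleftrightarrow>
    similar_mat_wit (map_mat O_embed (A f)) (mat_diag (Polynomial.degree f) (\<lambda>j. (frobenius ^^ j) (s_hat f))) P Q" for f P Q
  have datum: "root f \<in> finite_subfield (Polynomial.degree f)" "poly (map_poly to_ac f) (root f) = 0"
    "s_hat f \<in> O_ext (Polynomial.degree f)" "fps_nth (s_hat f) 0 = root f" "A f \<in> carrier_mat (Polynomial.degree f) (Polynomial.degree f)"
    "\<exists>P Q. good f P Q"
    "\<phi> f \<in> hom (units_of (trunc_ring (finite_subfield (Polynomial.degree f)) r)) (units_of class_ring)"
    "\<And>x. x \<in> O_ext (Polynomial.degree f) \<Longrightarrow> \<phi> f (fps_cutoff r (1 + fps_X ^ l * x)) =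
        \<psi> (fps_cutoff l (unram_trace (Polynomial.degree f) (s_hat f * x)))"
    if "monic f" "irreducible f" for f
    using data[OF that] unfolding jordan_datum_def Let_def good_def by blast+
  obtain P Q where PQ: "\<And>f. monic f \<Longrightarrow> irreducible f \<Longrightarrow> good f (P f) (Q f)" using datum(6) by metis
  interpret bd: block_data fs A s_hat P Q
  proof (rule block_data.intro)
    fix f k assume "(f, k) \<in> set fs"
    hence f: "monic f" "irreducible f" using fs'(2) by auto
    show "unramified_matrix (Polynomial.degree f) (A f) (s_hat f) (P f) (Q f)"
    proof (rule unramified_matrix.intro)
      show "0 < Polynomial.degree f"
      proof (rule ccontr)
        assume "\<not> 0 < Polynomial.degree f"
        then obtain c where c: "f = [:c:]" by (metis degree_eq_zeroE neq0_conv)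
        hence "map_poly to_ac f = [:to_ac c:]" by (simp add: map_poly_pCons_zero)
        hence "c = 0" using datum(2)[OF f] by simp
        thus False using f(1) c by simp
      qed
      show "fps_nth (s_hat f) 0 ^ (CARD('q) ^ i) \<noteq> fps_nth (s_hat f) 0 ^ (CARD('q) ^ j)"
        if "i < j" "j < Polynomial.degree f" for i j
        unfolding datum(4)[OF f] by (rule irreducible_roots_distinct[OF f(2) datum(2)[OF f] that])
    qed (use datum[OF f] PQ[OF f] in \<open>auto simp: good_def\<close>)
  next
    fix i j a b assume ij: "i < length fs" "j < length fs" "i \<noteq> j"
    have m: "monic (fst (fs ! i))" "irreducible (fst (fs ! i))" "monic (fst (fs ! j))" "irreducible (fst (fs ! j))"
      using fs'(2)[of "fst (fs ! i)" "snd (fs ! i)"] fs'(2)[of "fst (fs ! j)" "snd (fs ! j)"] ij by auto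
    have "fst (fs ! i) \<noteq> fst (fs ! j)" using nth_eq_iff_index_eq[OF fs'(1), of i j] ij by auto
    thus "fps_nth (s_hat (fst (fs ! i))) 0 ^ (CARD('q) ^ a) \<noteq> fps_nth (s_hat (fst (fs ! j))) 0 ^ (CARD('q) ^ b)"
      unfolding datum(4)[OF m(1,2)] datum(4)[OF m(3,4)]
      using irreducible_roots_disjoint[OF m(2,1) datum(2)[OF m(1,2)] m(4,3) datum(2)[OF m(3,4)]] by blast
  qed
  have jd: "s \<in> carrier_mat n n" "N \<in> carrier_mat n n" "\<omega> = s + N" "s * N = N * s" "nilpotent_mat N"
    using omega(2) by (auto simp: additive_jordan_decomposition_def)
  let ?R = "residue_mat (block_mat_A A fs)"
  define m where "m = dim_row ?R"
  have hm: "?R \<in> carrier_mat m m" "s \<in> carrier_mat m m" "h \<in> carrier_mat m m" "h_inv \<in> carrier_mat m m"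
    "h * h_inv = 1\<^sub>m m" "h_inv * h = 1\<^sub>m m" "?R = h * s * h_inv"
    using h unfolding similar_mat_wit_def Let_def m_def[symmetric] by blast+
  have mn: "m = n" using carrier_matD(1)[OF hm(2)] carrier_matD(1)[OF jd(1)] by simp
  have hc: "h \<in> carrier_mat n n" "h_inv \<in> carrier_mat n n" and hh: "h * h_inv = 1\<^sub>m n" "h_inv * h = 1\<^sub>m n"
    and Rs: "?R = h * s * h_inv" using hm unfolding mn by blast+
  \<comment> \<open>The total size of the blocks is read off from the similarity of
    \<open>?R\<close> with \<open>s\<close>.\<close>
  have bn: "block_off fs (length fs) = n"
    using carrier_matD(1)[OF hm(1)] carrier_matD(1)[OF bd.As] mn by (simp only: index_map_mat(2))
  note as = assoc_mult_mat[of _ n n _ n _ n] and mc = mult_carrier_mat[of _ n n _ n]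
  define M where "M = h * N * h_inv"
  have conj_mult: "h * U * h_inv * (h * V * h_inv) = h * (U * V) * h_inv"
    if "U \<in> carrier_mat n n" "V \<in> carrier_mat n n" for U V
  proof -
    have "h_inv * (h * V * h_inv) = V * h_inv"
      unfolding as[OF hc(1) that(2) hc(2)] as[OF hc(2,1) mc[OF that(2) hc(2)], symmetric] hh(2)
      by (rule left_mult_one_mat[OF mc[OF that(2) hc(2)]])
    thus ?thesis
      unfolding as[OF mc[OF hc(1) that(1)] hc(2) mc[OF mc[OF hc(1) that(2)] hc(2)]]
        as[OF hc(1) mc[OF that] hc(2)] as[OF that hc(2)]
      using as[OF hc(1) that(1) mc[OF that(2) hc(2)]] by simp
  qed
  have conj_cancel: "h_inv * (h * U * h_inv) * h = U" if U: "U \<in> carrier_mat n n" for U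
  proof -
    have "h_inv * (h * U * h_inv) = U * h_inv"
      unfolding as[OF hc(1) U hc(2)] as[OF hc(2,1) mc[OF U hc(2)], symmetric] hh(2)
      by (rule left_mult_one_mat[OF mc[OF U hc(2)]])
    thus ?thesis unfolding as[OF U hc(2,1)] hh(2) using right_mult_one_mat[OF U]
      by (simp only: as[OF U hc(2,1)] hh(2))
  qed
  have M: "M \<in> carrier_mat n n" unfolding M_def by (rule mc[OF mc[OF hc(1) jd(2)] hc(2)])
  have comm: "?R * M = M * ?R"
    unfolding Rs M_def conj_mult[OF jd(1,2)] conj_mult[OF jd(2,1)] jd(4) ..
  obtain e where e: "N ^\<^sub>m e = 0\<^sub>m n n" using jd(2,5) by (auto simp: nilpotent_mat_def)
  have pow: "M ^\<^sub>m k = h * N ^\<^sub>m k * h_inv" for k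
  proof (induction k)
    case 0
    show ?case using hc hh M jd(2) by simp
  next
    case (Suc k)
    show ?case unfolding pow_mat.simps Suc unfolding M_def by (rule conj_mult[OF pow_carrier_mat[OF jd(2)] jd(2)])
  qed
  have nil: "M ^\<^sub>m e = 0\<^sub>m n n" unfolding pow e using hc by simp
  define Ns where "Ns = (\<lambda>i. nilpotent_component A s_hat fs i M)"
  obtain Nt where Nt: "bd.E Nt" "Nt ^\<^sub>m e = 0\<^sub>m n n" "residue_mat Nt = M"
    "\<And>i. i < length fs \<Longrightarrow> bd.cmp i Nt = const_mat (Ns i)" "\<And>i. i < length fs \<Longrightarrow> nilpotent_mat (Ns i)"
    using bd.nilpotent_lift[unfolded bn, OF M comm nil] unfolding Ns_def by blast
  interpret j: jordan_data fs A s_hat P Q l r \<psi> \<phi> Nt Ns e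
  proof
    fix i assume i: "i < length fs"
    have f: "monic (fst (fs ! i))" "irreducible (fst (fs ! i))" using fs'(2)[of "fst (fs ! i)" "snd (fs ! i)"] i by auto
    show "\<phi> (fst (fs ! i)) \<in> hom (units_of (trunc_ring (finite_subfield (Polynomial.degree (fst (fs ! i)))) r)) (units_of class_ring)"
      by (rule datum(7)[OF f])
    show "\<phi> (fst (fs ! i)) (fps_cutoff r (1 + fps_X ^ l * x)) =
        \<psi> (fps_cutoff l (unram_trace (Polynomial.degree (fst (fs ! i))) (s_hat (fst (fs ! i)) * x)))"
      if "x \<in> O_ext (Polynomial.degree (fst (fs ! i)))" for x by (rule datum(8)[OF f that])
  qed (use r psi Nt bn in auto)
  have NtC: "Nt \<in> carrier_mat n n" using bd.E_carrier[OF Nt(1)] unfolding bn .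
  have As: "block_mat_A A fs \<in> carrier_mat n n" using bd.As unfolding bn .
  \<comment> \<open>Modulo \<open>\<pi>\<close> the matrix \<open>B\<close> is the conjugate of
    \<open>\<omega>\<close> by \<open>h\<close>, and \<open>orbit_J\<close>, used with
    \<open>h\<close> and its inverse, undoes this conjugation.\<close>
  have "residue_mat j.B = ?R + M"
    unfolding j.B_def Nt(3)[symmetric] by (rule eq_matI) (use carrier_matD[OF As] carrier_matD[OF NtC] in simp_all)
  hence "h_inv * residue_mat j.B * h = h_inv * (h * s * h_inv + h * N * h_inv) * h" unfolding Rs M_def by simp
  also have "h * s * h_inv + h * N * h_inv = h * (s + N) * h_inv"
    using hc jd(1,2) by (simp add: mult_add_distrib_mat[of _ n n _ n] add_mult_distrib_mat[of _ n n _ _ n])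
  also have "h_inv * (h * (s + N) * h_inv) * h = \<omega>"
    unfolding jd(3) by (rule conj_cancel[OF add_carrier_mat[OF jd(2)]])
  finally have om: "h_inv * residue_mat j.B * h = \<omega>" .
  have "irreducible_rep (GL_trunc UNIV n r) j.J" using j.J_irreducible_weight(1) unfolding bn .
  moreover have "\<omega> \<in> orbit n l r \<psi> j.J" using j.orbit_J[unfolded bn, OF hc hh] unfolding om .
  moreover have "j.J = jordan_induction n l r A s_hat \<phi> fs (nu_box l r \<psi> A s_hat fs Ns)"
    using j.J_def unfolding bn .
  moreover have "Ns = (\<lambda>i. nilpotent_component A s_hat fs i (h * N * h_inv))" by (simp only: Ns_def M_def)
  ultimately show ?thesis unfolding Let_def by simp
qed

end
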